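(* Let $N\ge3$, let $m,n\ge2$ be integers with $m+n=N+1$, $G=O(m)\times O(n)$ and $s\in(0,1)$. Let $f:\mathbb S^N\to[-1,1]$, $f(x,y)=|x|^2-|y|^2$ for $(x,y)\in\mathbb S^N\subset\mathbb R^m\times\mathbb R^n$. Every $G$-invariant function $u$ on $\mathbb S^N$ can be written as $u=w\circ f$ a.e. for some $w:[-1,1]\to\mathbb R$; put $j(u)=j(w\circ f):=w$. Then $j:H^s_g(\mathbb S^N)^G\to H^s_h([-1,1])$ and $j:L^2_g(\mathbb S^N)^G\to L^2_h([-1,1])$ are isometric isomorphisms.
   Context: $G=O(m)\times O(n)\subset O(N+1)$ acts on the unit sphere $\mathbb S^N\subset\mathbb R^m\times\mathbb R^n$ (round metric $g$, volume $dV_g$); superscript $G$ denotes $G$-invariant functions. With $c_{N,s}=4^s\pi^{-N/2}\frac{\Gamma(\frac N2+s)}{\Gamma(2-s)}s(1-s)$ and $A_{N,s}=\frac{\Gamma(\frac N2+s)}{\Gamma(\frac N2-s)}$, $H^s_g(\mathbb S^N)$ is the closure of $C^\infty(\mathbb S^N)$ in $L^2_g(\mathbb S^N)$ for the norm $\Big(\frac{c_{N,s}}2\iint_{\mathbb S^N\times\mathbb S^N}\frac{|u(z)-u(\zeta)|^2}{|z-\zeta|^{N+2s}}dV_g(z)dV_g(\zeta)+A_{N,s}\int_{\mathbb S^N}u^2dV_g\Big)^{1/2}$. Let $\alpha:=\frac n2-1$, $\beta:=\frac m2-1$ and $h:[-1,1]\to\mathbb R$, $h(t):=C(\alpha,\beta)(1-t)^\alpha(1+t)^\beta$,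 $C(\alpha,\beta):=\frac{|\mathbb S^{m-1}||\mathbb S^{n-1}|}{2^{(m+n)/2}}$, where $|\mathbb S^{k-1}|=2\pi^{k/2}/\Gamma(k/2)$. $L^2_h([-1,1])$ is the weighted space with inner product $\langle w,\tilde w\rangle_h=\int_{-1}^1w\tilde w\,h\,dt$ and norm $\|\cdot\|_h$. $P_i^{(\alpha,\beta)}$ is the $i$-th Jacobi polynomial, i.e. the unique monic polynomial (of degree $i$) solving $(1-t^2)x''+[\beta-\alpha-(\alpha+\beta+2)t]x'+i(i+\alpha+\beta+1)x=0$, and $p_i:=P_i^{(\alpha,\beta)}/\|P_i^{(\alpha,\beta)}\|_h$. $\varphi_{N,s}$ is the symbol of the conformal fractional Laplacian $\mathscr P_g^su(z)=c_{N,s}\,\mathrm{p.v.}\int_{\mathbb S^N}\frac{u(z)-u(\zeta)}{|z-\zeta|^{N+2s}}dV_g(\zeta)+A_{N,s}u(z)$: every eigenfunction of $-\Delta_g$ on $\mathbb S^N$ with eigenvalue $\lambda$ is an eigenfunction of $\mathscr P^s_g$ with eigenvalue $\varphi_{N,s}(\lambda)>0$. Explicitly, $\varphi_{N,s}(\lambda)=\Gamma\big(\tfrac12+s+\sqrt{\lambda+(\tfrac{N-1}2)^2}\big)\big/\Gamma\big(\tfrac12-s+\sqrt{\lambda+(\tfrac{N-1}2)^2}\big)$. With $\lambda_i=2i(N-1+2i)$, $H_h^s([-1,1])$ is the closure of $C^\infty([-1,1])$ (in $L^2_h([-1,1])$) under the norm $\|w\|_{H_h^s}=\big(\sum_{i=0}^\infty\langle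 w,p_i\rangle_h^2\,\varphi_{N,s}(\lambda_i)\big)^{1/2}$. *)

theory Defs
  imports "HOL-Analysis.Analysis" "HOL-Computational_Algebra.Polynomial"
begin

section \<open>Function spaces modulo null sets\<close>

text \<open>Elements of the function spaces are represented by measurable functions; equality of elements
  is equality almost everywhere. Norms take values in \<open>[0,\<infinity>]\<close>, so that a norm of
  the paper can be evaluated at every \<open>L\<^sup>2\<close> function.\<close>

definition ennreal_sqrt :: "ennreal \<Rightarrow> ennreal" where
  "ennreal_sqrt a = (if a = top then top else ennreal (sqrt (enn2real a)))"

definition L2_norm :: "'a measure \<Rightarrow> ('a \<Rightarrow> real) \<Rightarrow> ennreal" where
  "L2_norm M u = ennreal_sqrt (\<integral>\<^sup>+ x. ennreal ((u x)\<^sup>2) \<partial>M)"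

definition L2_space :: "'a measure \<Rightarrow> ('a \<Rightarrow> real) set" where
  "L2_space M = {u \<in> borel_measurable M. L2_norm M u < \<infinity>}"

definition L2_inner :: "'a measure \<Rightarrow> ('a \<Rightarrow> real) \<Rightarrow> ('a \<Rightarrow> real) \<Rightarrow> real" where
  "L2_inner M u v = (LINT x|M. u x * v x)"

definition closure_in_L2 ::
  "'a measure \<Rightarrow> (('a \<Rightarrow> real) \<Rightarrow> ennreal) \<Rightarrow> ('a \<Rightarrow> real) set \<Rightarrow> ('a \<Rightarrow> real) set" where
  "closure_in_L2 M nrm D =
     {u \<in> L2_space M. \<forall>\<epsilon>>0. \<exists>\<phi>\<in>D. nrm (\<lambda>x. u x - \<phi> x) < ennreal \<epsilon>}"

text \<open>The second condition says that \<open>T\<close> is well defined and injective on classes modulo null sets.\<close>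

definition isometric_isomorphism_ae ::
  "'a measure \<Rightarrow> ('a \<Rightarrow> real) set \<Rightarrow> (('a \<Rightarrow> real) \<Rightarrow> ennreal) \<Rightarrow>
   'b measure \<Rightarrow> ('b \<Rightarrow> real) set \<Rightarrow> (('b \<Rightarrow> real) \<Rightarrow> ennreal) \<Rightarrow>
   (('a \<Rightarrow> real) \<Rightarrow> ('b \<Rightarrow> real)) \<Rightarrow> bool" where
  "isometric_isomorphism_ae M V nV M' W nW T \<longleftrightarrow>
     (\<forall>u\<in>V. T u \<in> W) \<and>
     (\<forall>u\<in>V. \<forall>v\<in>V. (AE x in M. u x = v x) \<longleftrightarrow> (AE y in M'. T u y = T v y)) \<and>
     (\<forall>w\<in>W. \<exists>u\<in>V. AE y in M'. T u y = w y) \<and>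
     (\<forall>u\<in>V. \<forall>v\<in>V. \<forall>a b. AE y in M'. T (\<lambda>x. a * u x + b * v x) y = a * T u y + b * T v y) \<and>
     (\<forall>u\<in>V. nV u < \<infinity> \<and> nW (T u) = nV u)"


section \<open>Smooth functions\<close>

primrec Ck_on :: "nat \<Rightarrow> 'a::euclidean_space set \<Rightarrow> ('a \<Rightarrow> real) \<Rightarrow> bool" where
  "Ck_on 0 U F \<longleftrightarrow> continuous_on U F"
| "Ck_on (Suc k) U F \<longleftrightarrow>
     (\<forall>x\<in>U. F differentiable (at x)) \<and> (\<forall>v. Ck_on k U (\<lambda>x. frechet_derivative F (at x) v))"

text \<open>Smooth functions on a subset \<open>S\<close> of a Euclidean space: those which near each point of \<open>S\<close>
  extend to a smooth function on an open set. For the unit sphere this is smoothness on an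
  embedded submanifold, for \<open>[-1,1]\<close> it is smoothness up to the boundary.\<close>

definition C_infinity :: "'a::euclidean_space set \<Rightarrow> ('a \<Rightarrow> real) set" where
  "C_infinity S = {u. \<forall>x\<in>S. \<exists>U F. open U \<and> x \<in> U \<and> (\<forall>k. Ck_on k U F) \<and> (\<forall>z\<in>S \<inter> U. u z = F z)}"


section \<open>The sphere\<close>

text \<open>The Riemannian volume measure of the round unit sphere: the measure of \<open>A\<close> is \<open>d\<close> times the
  Lebesgue measure of the cone \<open>{r x | 0 < r < 1, x \<in> A}\<close>, \<open>d\<close> being the dimension of the
  ambient space. The Euclidean space \<open>\<real>\<^sup>m \<times> \<real>\<^sup>n\<close> is the product type, whose norm is the Euclidean one.\<close>

definition sphere_measure :: "'a::euclidean_space measure" where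
  "sphere_measure =
     scale_measure (of_nat DIM('a))
       (distr (restrict_space lborel (ball 0 1 - {0})) (restrict_space borel (sphere 0 1))
          (\<lambda>x. x /\<^sub>R norm x))"

lemma space_sphere_measure [simp]: "space (sphere_measure :: 'a::euclidean_space measure) = sphere 0 1"
  by (simp add: sphere_measure_def space_scale_measure space_restrict_space)

lemma sets_sphere_measure:
  "sets (sphere_measure :: 'a::euclidean_space measure) = sets (restrict_space borel (sphere 0 1))"
  by (simp add: sphere_measure_def)

lemma emeasure_sphere_measure:
  assumes "A \<in> sets borel" "A \<subseteq> sphere (0::'a::euclidean_space) 1"
  shows "emeasure sphere_measure A =
           of_nat DIM('a) * emeasure lborel {x::'a. 0 < norm x \<and> norm x < 1 \<and> x /\<^sub>R norm x \<in> A}"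
proof -
  have 1: "(\<lambda>x::'a. x /\<^sub>R norm x) \<in> restrict_space lborel (ball 0 1 - {0}) \<rightarrow>\<^sub>M restrict_space borel (sphere 0 1)"
    by (rule measurable_restrict_space2)
       (auto simp: space_restrict_space intro!: measurable_restrict_space1)
  have 2: "A \<in> sets (restrict_space borel (sphere (0::'a) 1))"
    using assms by (subst sets_restrict_space_iff) auto
  have 3: "(\<lambda>x::'a. x /\<^sub>R norm x) -` A \<inter> (ball 0 1 - {0})
      = {x::'a. 0 < norm x \<and> norm x < 1 \<and> x /\<^sub>R norm x \<in> A}"
    by auto
  have "emeasure sphere_measure A =
      of_nat DIM('a) * emeasure lborel ((\<lambda>x::'a. x /\<^sub>R norm x) -` A \<inter> (ball 0 1 - {0}))"
    using 1 2 by (simp add: sphere_measure_def emeasure_distr space_restrict_space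
        emeasure_restrict_space)
  then show ?thesis
    unfolding 3 .
qed

text \<open>An element of \<open>O(m) \<times> O(n)\<close> is a pair of orthogonal matrices. As elements of \<open>L\<^sup>2\<close> are classes
  of functions, invariance is required almost everywhere for each group element.\<close>

definition G_invariant :: "((real^'m) \<times> (real^'n) \<Rightarrow> real) \<Rightarrow> bool" where
  "G_invariant u \<longleftrightarrow>
     (\<forall>(A::real^'m^'m) (B::real^'n^'n). orthogonal_matrix A \<longrightarrow> orthogonal_matrix B \<longrightarrow>
        (AE z in sphere_measure. u (A *v fst z, B *v snd z) = u z))"

definition f_map :: "(real^'m) \<times> (real^'n) \<Rightarrow> real" where
  "f_map z = (norm (fst z))\<^sup>2 - (norm (snd z))\<^sup>2"

definition j_map :: "((real^'m) \<times> (real^'n) \<Rightarrow> real) \<Rightarrow> real \<Rightarrow> real" where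
  "j_map u = (SOME w. w \<in> borel_measurable (restrict_space borel {-1..1}) \<and>
                      (AE z in sphere_measure. u z = w (f_map z)))"

definition c_const :: "nat \<Rightarrow> real \<Rightarrow> real" where
  "c_const N s = 4 powr s * pi powr (- (real N / 2)) * (Gamma (real N / 2 + s) / Gamma (2 - s)) * s * (1 - s)"

definition A_const :: "nat \<Rightarrow> real \<Rightarrow> real" where
  "A_const N s = Gamma (real N / 2 + s) / Gamma (real N / 2 - s)"

text \<open>The exponent \<open>N\<close> below is the dimension of the unit sphere of \<^typ>\<open>'a\<close>, i.e. \<open>N + 1 = DIM('a)\<close>.\<close>

definition Hs_sphere_norm :: "nat \<Rightarrow> real \<Rightarrow> ('a::euclidean_space \<Rightarrow> real) \<Rightarrow> ennreal" where
  "Hs_sphere_norm N s u = ennreal_sqrt (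
     ennreal (c_const N s / 2) *
       (\<integral>\<^sup>+ z. (\<integral>\<^sup>+ \<zeta>. ennreal (\<bar>u z - u \<zeta>\<bar>\<^sup>2 / norm (z - \<zeta>) powr (real N + 2 * s))
          \<partial>sphere_measure) \<partial>sphere_measure)
     + ennreal (A_const N s) * (\<integral>\<^sup>+ z. ennreal ((u z)\<^sup>2) \<partial>sphere_measure))"

definition Hs_sphere :: "nat \<Rightarrow> real \<Rightarrow> ('a::euclidean_space \<Rightarrow> real) set" where
  "Hs_sphere N s = closure_in_L2 sphere_measure (Hs_sphere_norm N s) (C_infinity (sphere 0 1))"

definition L2_sphere_G :: "((real^'m) \<times> (real^'n) \<Rightarrow> real) set" where
  "L2_sphere_G = {u \<in> L2_space sphere_measure. G_invariant u}"

definition Hs_sphere_G :: "nat \<Rightarrow> real \<Rightarrow> ((real^'m) \<times> (real^'n) \<Rightarrow> real) set" where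
  "Hs_sphere_G N s = {u \<in> Hs_sphere N s. G_invariant u}"


section \<open>The weighted interval\<close>

definition sphere_area :: "nat \<Rightarrow> real" where
  "sphere_area k = 2 * pi powr (real k / 2) / Gamma (real k / 2)"

definition alpha :: "nat \<Rightarrow> real" where "alpha n = real n / 2 - 1"
definition beta :: "nat \<Rightarrow> real" where "beta m = real m / 2 - 1"

text \<open>Here \<open>0 powr 0 = 0\<close>, so for \<open>n = 2\<close> or \<open>m = 2\<close> the value at an endpoint is not the
  usual one. This concerns a null set only.\<close>

definition h_weight :: "nat \<Rightarrow> nat \<Rightarrow> real \<Rightarrow> real" where
  "h_weight m n t = sphere_area m * sphere_area n / 2 powr (real (m + n) / 2)
     * (1 - t) powr alpha n * (1 + t) powr beta m"

definition h_measure :: "nat \<Rightarrow> nat \<Rightarrow> real measure" where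
  "h_measure m n = density (restrict_space lborel {-1..1}) (\<lambda>t. ennreal (h_weight m n t))"

definition jacobi_poly :: "real \<Rightarrow> real \<Rightarrow> nat \<Rightarrow> real poly" where
  "jacobi_poly a b i = (THE P. lead_coeff P = 1 \<and> degree P = i \<and>
     (\<forall>t. (1 - t\<^sup>2) * poly (pderiv (pderiv P)) t + (b - a - (a + b + 2) * t) * poly (pderiv P) t
          + real i * (real i + a + b + 1) * poly P t = 0))"

definition p_basis :: "nat \<Rightarrow> nat \<Rightarrow> nat \<Rightarrow> real \<Rightarrow> real" where
  "p_basis m n i t =
     poly (jacobi_poly (alpha n) (beta m) i) t
     / enn2real (L2_norm (h_measure m n) (poly (jacobi_poly (alpha n) (beta m) i)))"

definition phi_symbol :: "nat \<Rightarrow> real \<Rightarrow> real \<Rightarrow> real" where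
  "phi_symbol N s l =
     Gamma (1/2 + s + sqrt (l + ((real N - 1) / 2)\<^sup>2)) /
     Gamma (1/2 - s + sqrt (l + ((real N - 1) / 2)\<^sup>2))"

definition lambda_ev :: "nat \<Rightarrow> nat \<Rightarrow> real" where
  "lambda_ev N i = 2 * real i * (real N - 1 + 2 * real i)"

definition Hs_h_norm :: "nat \<Rightarrow> nat \<Rightarrow> nat \<Rightarrow> real \<Rightarrow> (real \<Rightarrow> real) \<Rightarrow> ennreal" where
  "Hs_h_norm N m n s w = ennreal_sqrt (
     \<Sum>i. ennreal ((L2_inner (h_measure m n) w (p_basis m n i))\<^sup>2 * phi_symbol N s (lambda_ev N i)))"

definition Hs_h :: "nat \<Rightarrow> nat \<Rightarrow> nat \<Rightarrow> real \<Rightarrow> (real \<Rightarrow> real) set" where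
  "Hs_h N m n s = closure_in_L2 (h_measure m n) (Hs_h_norm N m n s) (C_infinity {-1..1})"

end

theory Submission
  imports Defs "HOL-Probability.Probability" "HOL-Computational_Algebra.Computational_Algebra"
begin

text \<open>The map \<open>f\<close> pushes the volume of the sphere forward to \<open>h dt\<close>, and every invariant function factors through
  \<open>f\<close>; this settles the \<open>L\<^sup>2\<close> case. For \<open>H\<^sup>s\<close> the point is that the Gagliardo energy of \<open>w \<circ> f\<close> is diagonal in the
  Jacobi basis. Since \<open>w \<circ> f\<close> is even, only the even part of \<open>|z - \<zeta>|\<^sup>-\<^sup>N\<^sup>-\<^sup>2\<^sup>s\<close> matters, and it is a power series in
  \<open>(z \<bullet> \<zeta>)\<^sup>2\<close> with nonnegative coefficients. Each power defines, on functions of \<open>f\<close>, an operator that commutes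
  with the Jacobi operator, so its eigenvalue at \<open>p\<^sub>i\<close> can be computed explicitly. Summing over the powers gives the
  difference of \<open>\<phi>(\<lambda>\<^sub>i)\<close> and \<open>\<phi>(0) = A\<close>, by a telescoping recursion that lowers the exponent of the kernel by
  two, followed by Gauss's summation theorem.\<close>

section \<open>Density of polynomials and Parseval\<close>

text \<open>The obstacle is the exponent \<open>N + 2 s\<close>, larger than the dimension. For each
  single \<open>i\<close>, the Taylor coefficients of the even kernel times the eigenvalues of its
  powers form a divergent series. Only the differences between index 0 and index \<open>i\<close>
  are summable, and these are just what the square \<open>|u z - u y|^2\<close> produces. Hence the
  recursion is applied to differences, and the potential term with \<open>A_{N,s}\<close> restores
  the symbol at \<open>\<lambda>_0 = 0\<close>. The spaces pose a second difficulty. A smooth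
  function close to an invariant \<open>u\<close> need not be invariant, and averaging it over
  \<open>G\<close> would leave open whether the average is smooth in \<open>t\<close> up to the
  endpoints. This is bypassed: the norm of \<open>u\<close> is finite, the norm identity carries
  this over to \<open>w\<close>, and a function of finite norm on the interval is the limit of its
  truncated Jacobi expansions, which are polynomials. Finiteness rests on smooth functions having
  finite energy, by a Lipschitz bound and a bounded Riesz potential. The norm identity is proved in
  extended nonnegative numbers, so sums and integrals may be exchanged before anything is known to
  be finite.\<close>

lemma sq_le_2_sq:
  fixes a b :: real
  shows "(a - b)\<^sup>2 \<le> 2 * a\<^sup>2 + 2 * b\<^sup>2" "(a + b)\<^sup>2 \<le> 2 * a\<^sup>2 + 2 * b\<^sup>2"
  using zero_le_power2[of "a - b"] zero_le_power2[of "a + b"] by (simp_all add: power2_sum power2_diff)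

lemma integrable_sq_diff:
  fixes u v :: "'a \<Rightarrow> real"
  assumes [measurable]: "u \<in> borel_measurable M" "v \<in> borel_measurable M"
    and "integrable M (\<lambda>x. (u x)\<^sup>2)" "integrable M (\<lambda>x. (v x)\<^sup>2)"
  shows "integrable M (\<lambda>x. (u x - v x)\<^sup>2)" "integrable M (\<lambda>x. u x * v x)" "integrable M (\<lambda>x. (u x + v x)\<^sup>2)"
proof -
  have *: "integrable M (\<lambda>x. 2 * (u x)\<^sup>2 + 2 * (v x)\<^sup>2)" using assms by auto
  show "integrable M (\<lambda>x. (u x - v x)\<^sup>2)"
  proof (rule Bochner_Integration.integrable_bound[OF *])
    show "AE x in M. norm ((u x - v x)\<^sup>2) \<le> norm (2 * (u x)\<^sup>2 + 2 * (v x)\<^sup>2)"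
    proof (intro AE_I2)
      fix x show "norm ((u x - v x)\<^sup>2) \<le> norm (2 * (u x)\<^sup>2 + 2 * (v x)\<^sup>2)"
        using sq_le_2_sq(1)[of "u x" "v x"] by simp
    qed
  qed measurable
  show "integrable M (\<lambda>x. (u x + v x)\<^sup>2)"
  proof (rule Bochner_Integration.integrable_bound[OF *])
    show "AE x in M. norm ((u x + v x)\<^sup>2) \<le> norm (2 * (u x)\<^sup>2 + 2 * (v x)\<^sup>2)"
    proof (intro AE_I2)
      fix x show "norm ((u x + v x)\<^sup>2) \<le> norm (2 * (u x)\<^sup>2 + 2 * (v x)\<^sup>2)"
        using sq_le_2_sq(2)[of "u x" "v x"] by simp
    qed
  qed measurable
  show "integrable M (\<lambda>x. u x * v x)"
  proof (rule Bochner_Integration.integrable_bound[OF *])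
    show "AE x in M. norm (u x * v x) \<le> norm (2 * (u x)\<^sup>2 + 2 * (v x)\<^sup>2)"
    proof (intro AE_I2)
      fix x
      have "2 * \<bar>u x * v x\<bar> \<le> (u x)\<^sup>2 + (v x)\<^sup>2"
        using zero_le_power2[of "\<bar>u x\<bar> - \<bar>v x\<bar>"] by (simp add: power2_diff abs_mult)
      then have "\<bar>u x * v x\<bar> \<le> 2 * (u x)\<^sup>2 + 2 * (v x)\<^sup>2"
        using zero_le_power2[of "u x"] zero_le_power2[of "v x"] by linarith
      then show "norm (u x * v x) \<le> norm (2 * (u x)\<^sup>2 + 2 * (v x)\<^sup>2)" by simp
    qed
  qed measurable
qed

text \<open>A crude triangle inequality: the factor 2 on squared distances replaces Cauchy-Schwarz
  and is harmless where only arbitrarily small errors matter.\<close>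

lemma integral_sq_diff_triangle:
  fixes u v w :: "'a \<Rightarrow> real"
  assumes [measurable]: "u \<in> borel_measurable M" "v \<in> borel_measurable M" "w \<in> borel_measurable M"
    and "integrable M (\<lambda>x. (u x)\<^sup>2)" "integrable M (\<lambda>x. (v x)\<^sup>2)" "integrable M (\<lambda>x. (w x)\<^sup>2)"
  shows "(\<integral>x. (u x - w x)\<^sup>2 \<partial>M) \<le> 2 * (\<integral>x. (u x - v x)\<^sup>2 \<partial>M) + 2 * (\<integral>x. (v x - w x)\<^sup>2 \<partial>M)"
proof -
  have "(\<integral>x. (u x - w x)\<^sup>2 \<partial>M) \<le> (\<integral>x. 2 * (u x - v x)\<^sup>2 + 2 * (v x - w x)\<^sup>2 \<partial>M)"
  proof (rule integral_mono)
    show "(u x - w x)\<^sup>2 \<le> 2 * (u x - v x)\<^sup>2 + 2 * (v x - w x)\<^sup>2" for x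
      using sq_le_2_sq(2)[of "u x - v x" "v x - w x"] by simp
  qed (intro Bochner_Integration.integrable_add integrable_mult_right integrable_sq_diff(1) assms)+
  also have "\<dots> = 2 * (\<integral>x. (u x - v x)\<^sup>2 \<partial>M) + 2 * (\<integral>x. (v x - w x)\<^sup>2 \<partial>M)"
    using assms by (subst Bochner_Integration.integral_add) (auto intro!: integrable_sq_diff)
  finally show ?thesis .
qed

section \<open>Bounded continuous functions are dense in L2 of a finite Borel measure\<close>

context
  fixes M :: "'a::metric_space measure" and K :: "'a set"
  assumes fin: "finite_measure M" and sets_M: "sets M = sets (restrict_space borel K)"
begin

interpretation finite_measure M by (rule fin)

lemma borel_measurable_restricted:
  fixes g :: "'a \<Rightarrow> real"
  shows "g \<in> borel_measurable borel \<Longrightarrow> g \<in> borel_measurable M"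
  using measurable_restrict_space1[of g borel borel K] measurable_cong_sets[OF sets_M refl] by blast

text \<open>Membership in the L2-closure of the bounded continuous functions, as a predicate that
  can be carried through inductions over Borel sets and measurable functions. Boundedness makes each
  \<open>g\<close> square integrable, the measure being finite; for a non-integrable square the
  Bochner integral would be 0 and the condition would say nothing.\<close>

definition cont_approx :: "('a \<Rightarrow> real) \<Rightarrow> bool" where
  "cont_approx u \<longleftrightarrow> (\<forall>\<epsilon>>0. \<exists>g. continuous_on UNIV g \<and> bounded (range g) \<and> (\<integral>x. (u x - g x)\<^sup>2 \<partial>M) < \<epsilon>)"

lemma bounded_continuous_sq_integrable:
  fixes g :: "'a \<Rightarrow> real"
  assumes "continuous_on UNIV g" "bounded (range g)"
  shows "g \<in> borel_measurable M" "integrable M (\<lambda>x. (g x)\<^sup>2)"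
proof -
  show [measurable]: "g \<in> borel_measurable M"
    using assms by (intro borel_measurable_restricted borel_measurable_continuous_onI)
  obtain B where B: "\<And>x. \<bar>g x\<bar> \<le> B" using assms(2) by (auto simp: bounded_iff)
  have "\<bar>(g x)\<^sup>2\<bar> \<le> B\<^sup>2" for x using power_mono[OF B[of x], of 2] by simp
  then show "integrable M (\<lambda>x. (g x)\<^sup>2)"
    by (intro integrable_const_bound[of _ "B\<^sup>2"]) auto
qed

lemma cont_approx_close:
  assumes "u \<in> borel_measurable M" "integrable M (\<lambda>x. (u x)\<^sup>2)"
    and "\<And>\<epsilon>. \<epsilon> > 0 \<Longrightarrow> \<exists>v. v \<in> borel_measurable M \<and> integrable M (\<lambda>x. (v x)\<^sup>2) \<and> cont_approx v \<and> (\<integral>x. (u x - v x)\<^sup>2 \<partial>M) < \<epsilon>"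
  shows "cont_approx u"
  unfolding cont_approx_def
proof (intro allI impI)
  fix \<epsilon> :: real assume "\<epsilon> > 0"
  then obtain v where v: "v \<in> borel_measurable M" "integrable M (\<lambda>x. (v x)\<^sup>2)" "cont_approx v" "(\<integral>x. (u x - v x)\<^sup>2 \<partial>M) < \<epsilon>/4"
    using assms(3)[of "\<epsilon>/4"] by auto
  obtain g where g: "continuous_on UNIV g" "bounded (range g)" "(\<integral>x. (v x - g x)\<^sup>2 \<partial>M) < \<epsilon>/4"
    using v(3) \<open>\<epsilon> > 0\<close> unfolding cont_approx_def by (meson divide_pos_pos zero_less_numeral)
  have "(\<integral>x. (u x - g x)\<^sup>2 \<partial>M) \<le> 2 * (\<integral>x. (u x - v x)\<^sup>2 \<partial>M) + 2 * (\<integral>x. (v x - g x)\<^sup>2 \<partial>M)"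
    using assms v bounded_continuous_sq_integrable[OF g(1,2)] by (intro integral_sq_diff_triangle) auto
  then show "\<exists>g. continuous_on UNIV g \<and> bounded (range g) \<and> (\<integral>x. (u x - g x)\<^sup>2 \<partial>M) < \<epsilon>"
    using g v by (intro exI[of _ g]) auto
qed

text \<open>Dominated convergence: since \<open>\<bar>v i x\<bar> \<le> \<bar>u x\<bar>\<close>, the
  squared error is at most four times the square of \<open>u\<close>.\<close>

lemma cont_approx_lim:
  assumes u: "u \<in> borel_measurable M" "integrable M (\<lambda>x. (u x)\<^sup>2)"
    and v: "\<And>i. v i \<in> borel_measurable M" "\<And>i. cont_approx (v i)"
    and le: "\<And>i x. x \<in> space M \<Longrightarrow> \<bar>v i x\<bar> \<le> \<bar>u x\<bar>"
    and lim: "\<And>x. x \<in> space M \<Longrightarrow> (\<lambda>i. v i x) \<longlonglongrightarrow> u x"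
  shows "cont_approx u"
proof (rule cont_approx_close[OF u])
  fix \<epsilon> :: real assume "\<epsilon> > 0"
  note [measurable] = u(1) v(1)
  have "(\<lambda>i. \<integral>x. (u x - v i x)\<^sup>2 \<partial>M) \<longlonglongrightarrow> (\<integral>x. 0 \<partial>M)"
  proof (rule integral_dominated_convergence[where w = "\<lambda>x. 4 * (u x)\<^sup>2"])
    show "AE x in M. (\<lambda>i. (u x - v i x)\<^sup>2) \<longlonglongrightarrow> 0"
    proof (intro AE_I2)
      fix x assume "x \<in> space M"
      then have "(\<lambda>i. (u x - v i x)\<^sup>2) \<longlonglongrightarrow> (u x - u x)\<^sup>2" by (intro tendsto_intros lim)
      then show "(\<lambda>i. (u x - v i x)\<^sup>2) \<longlonglongrightarrow> 0" by simp
    qed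
    show "AE x in M. norm ((u x - v i x)\<^sup>2) \<le> 4 * (u x)\<^sup>2" for i
    proof (intro AE_I2)
      fix x assume "x \<in> space M"
      then have "\<bar>u x - v i x\<bar> \<le> 2 * \<bar>u x\<bar>" using le[of x i] by linarith
      then have "\<bar>u x - v i x\<bar>\<^sup>2 \<le> (2 * \<bar>u x\<bar>)\<^sup>2" by (intro power_mono) auto
      then show "norm ((u x - v i x)\<^sup>2) \<le> 4 * (u x)\<^sup>2" by (simp add: power_mult_distrib)
    qed
  qed (use u in auto)
  then have "\<forall>\<^sub>F i in sequentially. (\<integral>x. (u x - v i x)\<^sup>2 \<partial>M) < \<epsilon>"
    using \<open>\<epsilon> > 0\<close> by (intro order_tendstoD) auto
  then obtain i where i: "(\<integral>x. (u x - v i x)\<^sup>2 \<partial>M) < \<epsilon>" by (auto simp: eventually_sequentially)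
  have "integrable M (\<lambda>x. (v i x)\<^sup>2)"
  proof (rule Bochner_Integration.integrable_bound[OF u(2)])
    show "AE x in M. norm ((v i x)\<^sup>2) \<le> norm ((u x)\<^sup>2)"
      using le by (intro AE_I2) (simp add: abs_le_square_iff)
  qed auto
  then show "\<exists>v. v \<in> borel_measurable M \<and> integrable M (\<lambda>x. (v x)\<^sup>2) \<and> cont_approx v \<and> (\<integral>x. (u x - v x)\<^sup>2 \<partial>M) < \<epsilon>"
    using i v by (intro exI[of _ "v i"]) auto
qed

lemma cont_approx_lincomb:
  assumes u: "u \<in> borel_measurable M" "integrable M (\<lambda>x. (u x)\<^sup>2)" "cont_approx u"
    and v: "v \<in> borel_measurable M" "integrable M (\<lambda>x. (v x)\<^sup>2)" "cont_approx v"
  shows "cont_approx (\<lambda>x. c * u x + d * v x)"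
  unfolding cont_approx_def
proof (intro allI impI)
  fix \<epsilon> :: real assume "\<epsilon> > 0"
  \<comment> \<open>The error of the combination is at most \<open>2 (c^2 + d^2) \<delta>\<close>,
    which is below \<open>\<epsilon>\<close>; the summand 1 keeps the denominator positive when
    \<open>c = d = 0\<close>.\<close>
  define \<delta> where "\<delta> = \<epsilon> / (4 * (c\<^sup>2 + d\<^sup>2 + 1))"
  have p: "c\<^sup>2 + d\<^sup>2 + 1 > 0" by (simp add: add_nonneg_pos)
  have \<delta>: "\<delta> > 0" using \<open>\<epsilon> > 0\<close> p by (simp add: \<delta>_def)
  obtain g where g: "continuous_on UNIV g" "bounded (range g)" "(\<integral>x. (u x - g x)\<^sup>2 \<partial>M) < \<delta>"
    using u(3) \<delta> unfolding cont_approx_def by meson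
  obtain h where h: "continuous_on UNIV h" "bounded (range h)" "(\<integral>x. (v x - h x)\<^sup>2 \<partial>M) < \<delta>"
    using v(3) \<delta> unfolding cont_approx_def by meson
  note gm = bounded_continuous_sq_integrable[OF g(1,2)] and hm = bounded_continuous_sq_integrable[OF h(1,2)]
  have "(\<integral>x. (c * u x + d * v x - (c * g x + d * h x))\<^sup>2 \<partial>M) \<le> (\<integral>x. 2 * c\<^sup>2 * (u x - g x)\<^sup>2 + 2 * d\<^sup>2 * (v x - h x)\<^sup>2 \<partial>M)"
  proof (rule integral_mono)
    have "integrable M (\<lambda>x. (c * (u x - g x) + d * (v x - h x))\<^sup>2)"
      using u v gm hm by (intro integrable_sq_diff) (auto simp: power_mult_distrib intro!: integrable_sq_diff)
    then show "integrable M (\<lambda>x. (c * u x + d * v x - (c * g x + d * h x))\<^sup>2)" by (simp add: algebra_simps)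
    show "integrable M (\<lambda>x. 2 * c\<^sup>2 * (u x - g x)\<^sup>2 + 2 * d\<^sup>2 * (v x - h x)\<^sup>2)"
      using u v gm hm by (auto intro!: integrable_sq_diff(1))
    fix x
    have "(c * u x + d * v x - (c * g x + d * h x)) = c * (u x - g x) + d * (v x - h x)" by (simp add: algebra_simps)
    then show "(c * u x + d * v x - (c * g x + d * h x))\<^sup>2 \<le> 2 * c\<^sup>2 * (u x - g x)\<^sup>2 + 2 * d\<^sup>2 * (v x - h x)\<^sup>2"
      using zero_le_power2[of "c * (u x - g x) - d * (v x - h x)"]
      by (simp only: power2_sum power2_diff power_mult_distrib)
  qed
  also have "\<dots> = 2 * c\<^sup>2 * (\<integral>x. (u x - g x)\<^sup>2 \<partial>M) + 2 * d\<^sup>2 * (\<integral>x. (v x - h x)\<^sup>2 \<partial>M)"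
    using u v gm hm by (subst Bochner_Integration.integral_add) (auto intro!: integrable_sq_diff)
  also have "\<dots> \<le> 2 * c\<^sup>2 * \<delta> + 2 * d\<^sup>2 * \<delta>"
    using g h by (intro add_mono mult_left_mono) auto
  also have "\<dots> < \<epsilon>"
  proof -
    have "\<epsilon> = 4 * (c\<^sup>2 + d\<^sup>2 + 1) * \<delta>" using p by (simp add: \<delta>_def)
    then have "\<epsilon> - (2 * c\<^sup>2 * \<delta> + 2 * d\<^sup>2 * \<delta>) = (2 * c\<^sup>2 + 2 * d\<^sup>2 + 4) * \<delta>" by (simp add: algebra_simps)
    moreover have "(2 * c\<^sup>2 + 2 * d\<^sup>2 + 4) * \<delta> > 0" using \<delta> by (intro mult_pos_pos add_nonneg_pos) auto
    ultimately show ?thesis by linarith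
  qed
  finally have "(\<integral>x. (c * u x + d * v x - (c * g x + d * h x))\<^sup>2 \<partial>M) < \<epsilon>" .
  moreover have "continuous_on UNIV (\<lambda>x. c * g x + d * h x)" using g h by (intro continuous_intros)
  moreover have "bounded (range (\<lambda>x. c * g x + d * h x))"
  proof -
    obtain B where B: "\<And>x. \<bar>g x\<bar> \<le> B" using g(2) by (auto simp: bounded_iff)
    obtain B' where B': "\<And>x. \<bar>h x\<bar> \<le> B'" using h(2) by (auto simp: bounded_iff)
    have "\<bar>c * g x + d * h x\<bar> \<le> \<bar>c\<bar> * B + \<bar>d\<bar> * B'" for x
      using mult_left_mono[OF B[of x], of "\<bar>c\<bar>"] mult_left_mono[OF B'[of x], of "\<bar>d\<bar>"] by (simp add: abs_mult[symmetric])
    then show ?thesis by (auto simp: bounded_iff)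
  qed
  ultimately show "\<exists>g. continuous_on UNIV g \<and> bounded (range g) \<and> (\<integral>x. (c * u x + d * v x - g x)\<^sup>2 \<partial>M) < \<epsilon>"
    by blast
qed

lemma cont_approx_const: "cont_approx (\<lambda>x. c)"
  unfolding cont_approx_def by (intro allI impI exI[of _ "\<lambda>x. c"]) auto

text \<open>The cut-offs \<open>max 0 (1 - i * infdist x B)\<close> are continuous and equal 1 on
  \<open>B\<close>. Off a closed \<open>B\<close> the distance is positive, so there they are
  eventually 0, and dominated convergence applies.\<close>

lemma cont_approx_closed:
  assumes "closed B"
  shows "cont_approx (indicator B)"
\<comment> \<open>The distance \<open>infdist\<close> to the empty set is 0, so for it the cut-offs
  would be constantly 1.\<close>
proof (cases "B = {}")
  case True
  then show ?thesis using cont_approx_const[of 0] by (simp add: indicator_def[abs_def])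
next
  case False
  define g where "g i x = max 0 (1 - real i * infdist x B)" for i x
  have g: "continuous_on UNIV (g i)" for i unfolding g_def by (intro continuous_intros)
  have g1: "\<bar>g i x\<bar> \<le> 1" for i x using infdist_nonneg[of x B] by (auto simp: g_def)
  have gb: "bounded (range (g i))" for i using g1 by (auto simp: bounded_iff)
  note [measurable] = bounded_continuous_sq_integrable(1)[OF g gb]
  have [measurable]: "(indicator B :: 'a \<Rightarrow> real) \<in> borel_measurable M"
    using assms by (intro borel_measurable_restricted) auto
  have "(\<lambda>i. \<integral>x. (indicator B x - g i x)\<^sup>2 \<partial>M) \<longlonglongrightarrow> (\<integral>x. 0 \<partial>M)"
  proof (rule integral_dominated_convergence[where w = "\<lambda>x. 4"])
    show "AE x in M. (\<lambda>i. (indicator B x - g i x)\<^sup>2) \<longlonglongrightarrow> 0"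
    proof (intro AE_I2)
      fix x
      show "(\<lambda>i. (indicator B x - g i x)\<^sup>2) \<longlonglongrightarrow> 0"
      proof (cases "x \<in> B")
        case True
        then show ?thesis by (simp add: g_def)
      next
        case xB: False
        then have "infdist x B > 0"
          using assms False in_closed_iff_infdist_zero[of B x] infdist_nonneg[of x B] by (simp add: less_le)
        then obtain n where n: "real n * infdist x B > 1" using reals_Archimedean3 by blast
        have "\<forall>\<^sub>F i in sequentially. (indicator B x - g i x)\<^sup>2 = 0"
          using eventually_ge_at_top[of n]
        proof eventually_elim
          case (elim i)
          then have "real n * infdist x B \<le> real i * infdist x B" by (intro mult_right_mono) (auto simp: infdist_nonneg)
          then show ?case using n xB infdist_nonneg[of x B] by (simp add: g_def)
        qed
        then show ?thesis by (rule tendsto_eventually)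
      qed
    qed
    show "AE x in M. norm ((indicator B x - g i x)\<^sup>2) \<le> 4" for i
    proof (intro AE_I2)
      fix x
      have "\<bar>indicator B x - g i x\<bar> \<le> 2" using g1[of i x] by (auto simp: indicator_def)
      then have "\<bar>indicator B x - g i x\<bar>\<^sup>2 \<le> 2\<^sup>2" by (intro power_mono) auto
      then show "norm ((indicator B x - g i x)\<^sup>2) \<le> 4" by simp
    qed
  qed auto
  then have lim: "(\<lambda>i. \<integral>x. (indicator B x - g i x)\<^sup>2 \<partial>M) \<longlonglongrightarrow> 0" by simp
  show ?thesis
    unfolding cont_approx_def
  proof (intro allI impI)
    fix \<epsilon> :: real assume "\<epsilon> > 0"
    then obtain i where "(\<integral>x. (indicator B x - g i x)\<^sup>2 \<partial>M) < \<epsilon>"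
      using order_tendstoD(2)[OF lim] by (auto simp: eventually_sequentially)
    then show "\<exists>g. continuous_on UNIV g \<and> bounded (range g) \<and> (\<integral>x. (indicator B x - g x)\<^sup>2 \<partial>M) < \<epsilon>"
      using g gb by blast
  qed
qed

text \<open>Dynkin's argument: the closed sets are stable under intersection and generate the Borel
  sets, and approximability passes to complements and to countable disjoint unions.\<close>

lemma cont_approx_borel:
  assumes "B \<in> sets borel"
  shows "cont_approx (indicator B)"
proof -
  have m: "(indicator A :: 'a \<Rightarrow> real) \<in> borel_measurable M" "integrable M (\<lambda>x. (indicator A x :: real)\<^sup>2)" if "A \<in> sets borel" for A
  proof -
    show 1: "(indicator A :: 'a \<Rightarrow> real) \<in> borel_measurable M" using that by (intro borel_measurable_restricted) auto
    show "integrable M (\<lambda>x. (indicator A x :: real)\<^sup>2)"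
      using 1 by (intro integrable_const_bound[of _ 1]) (auto intro!: AE_I2 power_le_one simp: indicator_le_1)
  qed
  have "sets borel = sigma_sets UNIV {S :: 'a set. closed S}"
    by (simp add: borel_eq_closed)
  moreover have "Int_stable {S :: 'a set. closed S}" by (auto simp: Int_stable_def)
  ultimately have "{S :: 'a set. closed S} \<subseteq> Pow UNIV" "B \<in> sigma_sets UNIV {S. closed S}" using assms by auto
  with \<open>Int_stable _\<close> show ?thesis
  proof (induction rule: sigma_sets_induct_disjoint)
    case (basic A)
    then show ?case by (intro cont_approx_closed) auto
  next
    case empty
    then show ?case by (intro cont_approx_closed) auto
  next
    case (compl A)
    then have A: "A \<in> sets borel" by (simp add: borel_eq_closed)
    have "cont_approx (\<lambda>x. 1 * 1 + (-1) * indicator A x)"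
      using m[OF A] compl by (intro cont_approx_lincomb cont_approx_const) auto
    then show ?case by (simp add: indicator_compl Compl_eq_Diff_UNIV[symmetric])
  next
    case (union A)
    then have A: "A i \<in> sets borel" for i by (auto simp: borel_eq_closed)
    have fin: "cont_approx (indicator (\<Union>i<n. A i))" for n
    proof (induction n)
      case 0
      then show ?case using cont_approx_const[of 0] by simp
    next
      case (Suc n)
      have "cont_approx (\<lambda>x. 1 * indicator (\<Union>i<n. A i) x + 1 * indicator (A n) x)"
        using A union Suc by (intro cont_approx_lincomb m) auto
      moreover have "(indicator (\<Union>i<Suc n. A i) x :: real) = indicator (\<Union>i<n. A i) x + indicator (A n) x" for x
      proof -
        have "(\<Union>i<n. A i) \<inter> A n = {}"
          using union(1) by (auto simp: disjoint_family_on_def) (metis IntI empty_iff less_irrefl)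
        then show ?thesis by (auto simp: indicator_def lessThan_Suc)
      qed
      ultimately show ?case by simp
    qed
    show ?case
    proof (rule cont_approx_lim[where v = "\<lambda>n. indicator (\<Union>i<n. A i)"])
      show "(\<lambda>i. indicator (\<Union>i<i. A i) x :: real) \<longlonglongrightarrow> indicator (\<Union>i. A i) x" for x
        by (rule LIMSEQ_indicator_UN)
      have U: "(\<Union>i. A i) \<in> sets borel" "(\<Union>i<n. A i) \<in> sets borel" for n using A by auto
      show "indicat_real (\<Union>i. A i) \<in> borel_measurable M" "integrable M (\<lambda>x. (indicat_real (\<Union>i. A i) x)\<^sup>2)"
        "indicat_real (\<Union>i<n. A i) \<in> borel_measurable M" for n
        using U by (auto intro: m simp del: indicator_simps)
      show "\<bar>indicat_real (\<Union>i<n. A i) x\<bar> \<le> \<bar>indicat_real (\<Union>i. A i) x\<bar>" for n x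
        by (auto simp: indicator_def)
    qed (rule fin)
  qed
qed

text \<open>Monotone induction settles nonnegative functions; the general case is the difference of
  the positive and the negative part.\<close>

lemma cont_approx_sq_integrable:
  assumes "u \<in> borel_measurable M" "integrable M (\<lambda>x. (u x)\<^sup>2)"
  shows "cont_approx u"
proof -
  have nn: "cont_approx u" if "u \<in> borel_measurable M" "\<And>x. 0 \<le> u x" "integrable M (\<lambda>x. (u x)\<^sup>2)" for u
    using that
  proof (induction rule: borel_measurable_induct_real)
    case (set A)
    \<comment> \<open>The measure lives on \<open>K\<close>, so its measurable sets are traces of
      Borel sets; on the space of \<open>M\<close> the indicators of the trace and of
      \<open>B\<close> agree.\<close>
    then obtain B where B: "B \<in> sets borel" "A = K \<inter> B" using sets_M by (auto simp: sets_restrict_space)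
    have "space M = K" using sets_eq_imp_space_eq[OF sets_M] by (simp add: space_restrict_space)
    then have eq: "(\<integral>x. (indicator A x - g x)\<^sup>2 \<partial>M) = (\<integral>x. (indicator B x - g x)\<^sup>2 \<partial>M)" for g :: "'a \<Rightarrow> real"
      using B by (intro Bochner_Integration.integral_cong) (auto simp: indicator_def)
    then show ?case using cont_approx_borel[OF B(1)] unfolding cont_approx_def B(2)[symmetric] by (simp only: eq)
  next
    case (mult u c)
    show ?case
    proof (cases "c = 0")
      case False
      then have "integrable M (\<lambda>x. (u x)\<^sup>2)" using mult.prems by (simp add: power_mult_distrib)
      then have "cont_approx (\<lambda>x. c * u x + 0 * u x)" using mult by (intro cont_approx_lincomb)
      then show ?thesis by simp
    qed (simp add: cont_approx_const)
  next
    case (add u v)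
    have "integrable M (\<lambda>x. (u x)\<^sup>2)" "integrable M (\<lambda>x. (v x)\<^sup>2)"
      using add by (auto intro!: Bochner_Integration.integrable_bound[OF add.prems] power_mono AE_I2)
    then have "cont_approx (\<lambda>x. 1 * v x + 1 * u x)" using add by (intro cont_approx_lincomb)
    then show ?case by simp
  next
    case (seq U)
    have le: "U i x \<le> u x" if "x \<in> space M" for i x
      using seq.hyps(3) that by (intro incseq_le[OF _ seq.hyps(4)]) (auto simp: incseq_def le_fun_def)
    have um: "u \<in> borel_measurable M" by (rule borel_measurable_LIMSEQ_real[OF seq.hyps(4) seq.hyps(1)])
    show ?case
    proof (rule cont_approx_lim[where v = U, OF um seq.prems seq.hyps(1)])
      show "\<bar>U i x\<bar> \<le> \<bar>u x\<bar>" if "x \<in> space M" for i x using le[OF that, of i] seq.hyps(2)[of i x] by linarith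
      show "cont_approx (U i)" for i
      proof (rule seq.IH)
        show "integrable M (\<lambda>x. (U i x)\<^sup>2)"
          using seq.hyps(1) le seq.hyps(2) by (intro Bochner_Integration.integrable_bound[OF seq.prems] AE_I2) (auto intro!: power_mono)
      qed
    qed (use seq in auto)
  qed
  note [measurable] = assms(1)
  have "integrable M (\<lambda>x. (max 0 (u x))\<^sup>2)" "integrable M (\<lambda>x. (max 0 (- u x))\<^sup>2)"
    by (auto intro!: Bochner_Integration.integrable_bound[OF assms(2)] AE_I2 simp: max_def)
  then have "cont_approx (\<lambda>x. 1 * max 0 (u x) + (-1) * max 0 (- u x))"
    by (intro cont_approx_lincomb nn) auto
  moreover have "(\<lambda>x. 1 * max 0 (u x) + (-1) * max 0 (- u x)) = u" by (auto simp: max_def)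
  ultimately show ?thesis by simp
qed

end

section \<open>Polynomial approximation and Parseval's identity\<close>

lemma sq_integrable_approx_continuous:
  fixes u :: "'a::metric_space \<Rightarrow> real"
  assumes "finite_measure M" "sets M = sets (restrict_space borel K)"
    and "u \<in> borel_measurable M" "integrable M (\<lambda>x. (u x)\<^sup>2)" "\<epsilon> > 0"
  shows "\<exists>g. continuous_on UNIV g \<and> g \<in> borel_measurable M \<and> integrable M (\<lambda>x. (g x)\<^sup>2) \<and> (\<integral>x. (u x - g x)\<^sup>2 \<partial>M) < \<epsilon>"
  using cont_approx_sq_integrable[OF assms(1-4)] assms(5) bounded_continuous_sq_integrable[OF assms(1,2)]
  unfolding cont_approx_def[OF assms(1,2)] by meson

text \<open>Weierstrass approximation on the compact interval, applied to a continuous function that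
  is already close to \<open>u\<close>.\<close>

lemma sq_integrable_approx_poly:
  fixes u :: "real \<Rightarrow> real"
  assumes M: "finite_measure M" "sets M = sets (restrict_space borel {a..b})"
    and u: "u \<in> borel_measurable M" "integrable M (\<lambda>x. (u x)\<^sup>2)" and "\<epsilon> > 0"
  shows "\<exists>p. poly p \<in> borel_measurable M \<and> integrable M (\<lambda>x. (poly p x)\<^sup>2) \<and> (\<integral>x. (u x - poly p x)\<^sup>2 \<partial>M) < \<epsilon>"
proof -
  interpret finite_measure M by (rule M)
  have space: "space M = {a..b}" using sets_eq_imp_space_eq[OF M(2)] by (simp add: space_restrict_space)
  obtain g where g: "continuous_on UNIV g" "g \<in> borel_measurable M" "integrable M (\<lambda>x. (g x)\<^sup>2)" "(\<integral>x. (u x - g x)\<^sup>2 \<partial>M) < \<epsilon> / 4"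
    using sq_integrable_approx_continuous[OF M u, of "\<epsilon>/4"] \<open>\<epsilon> > 0\<close> by auto
  \<comment> \<open>A uniform error \<open>\<delta>\<close> costs \<open>\<delta>^2\<close> times
    the total mass, here less than \<open>\<epsilon>/4\<close>; adding 1 to the mass covers the zero
    measure.\<close>
  define \<delta> where "\<delta> = sqrt (\<epsilon> / (4 * (measure M (space M) + 1)))"
  have m: "measure M (space M) + 1 > 0" by (simp add: add_nonneg_pos)
  have \<delta>: "\<delta> > 0" "\<delta>\<^sup>2 = \<epsilon> / (4 * (measure M (space M) + 1))"
    using \<open>\<epsilon> > 0\<close> m by (auto simp: \<delta>_def)
  obtain q where q: "real_polynomial_function q" "\<And>x. x \<in> {a..b} \<Longrightarrow> \<bar>g x - q x\<bar> < \<delta>"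
    using Stone_Weierstrass_real_polynomial_function[of "{a..b}" g \<delta>] g(1) \<delta> continuous_on_subset by blast
  obtain c n where c: "q = (\<lambda>x. \<Sum>i\<le>n. c i * x ^ i)"
    using q(1) unfolding real_polynomial_function_iff_sum by auto
  define p where "p = (\<Sum>i\<le>n. monom (c i) i)"
  have p: "poly p = q" by (auto simp: p_def c poly_sum poly_monom)
  have pm: "poly p \<in> borel_measurable M"
    by (rule borel_measurable_restricted[OF M]) (intro borel_measurable_continuous_onI continuous_intros)
  have gp: "\<bar>(g x - poly p x)\<^sup>2\<bar> \<le> \<delta>\<^sup>2" if "x \<in> {a..b}" for x
    using power_mono[OF less_imp_le[OF q(2)[OF that]], of 2] by (simp add: p)
  have gpi: "integrable M (\<lambda>x. (g x - poly p x)\<^sup>2)"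
    using g(2) pm gp by (intro integrable_const_bound[of _ "\<delta>\<^sup>2"]) (auto intro!: AE_I2 simp: space)
  have "integrable M (\<lambda>x. (g x - (g x - poly p x))\<^sup>2)"
    by (rule integrable_sq_diff(1)[OF g(2) borel_measurable_diff[OF g(2) pm] g(3) gpi])
  moreover have "(\<lambda>x. (g x - (g x - poly p x))\<^sup>2) = (\<lambda>x. (poly p x)\<^sup>2)" by auto
  ultimately have pi: "integrable M (\<lambda>x. (poly p x)\<^sup>2)" by (simp only:)
  have "(\<integral>x. (g x - poly p x)\<^sup>2 \<partial>M) \<le> (\<integral>x. \<delta>\<^sup>2 \<partial>M)"
    using gp gpi by (intro integral_mono) (auto simp: space)
  also have "\<dots> = \<epsilon> / 4 * (measure M (space M) / (measure M (space M) + 1))" by (simp add: \<delta>)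
  also have "\<dots> < \<epsilon> / 4 * 1"
    using \<open>\<epsilon> > 0\<close> m by (intro mult_strict_left_mono) auto
  finally have 1: "(\<integral>x. (g x - poly p x)\<^sup>2 \<partial>M) < \<epsilon> / 4" by simp
  have "(\<integral>x. (u x - poly p x)\<^sup>2 \<partial>M) \<le> 2 * (\<integral>x. (u x - g x)\<^sup>2 \<partial>M) + 2 * (\<integral>x. (g x - poly p x)\<^sup>2 \<partial>M)"
    by (rule integral_sq_diff_triangle[OF u(1) g(2) pm u(2) g(3) pi])
  then show ?thesis using 1 g(4) pm pi by (intro exI[of _ p]) auto
qed

lemma poly_expansion_basis:
  fixes P :: "nat \<Rightarrow> real poly"
  assumes deg: "\<And>i. degree (P i) = i" "\<And>i. P i \<noteq> 0" and "degree q \<le> n"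
  shows "\<exists>c. q = (\<Sum>i\<le>n. smult (c i) (P i))"
  using assms(3)
proof (induction n arbitrary: q)
  case 0
  then obtain a where a: "q = [:a:]" by (metis degree_eq_zeroE le_zero_eq)
  obtain b where b: "P 0 = [:b:]" using deg(1)[of 0] by (metis degree_eq_zeroE)
  have "b \<noteq> 0" using deg(2)[of 0] b by auto
  then have "q = smult (a / b) (P 0)" using a b by simp
  then show ?case by (intro exI[of _ "\<lambda>_. a / b"]) simp
next
  case (Suc n)
  define d where "d = coeff q (Suc n) / lead_coeff (P (Suc n))"
  define r where "r = q - smult d (P (Suc n))"
  have lc: "lead_coeff (P (Suc n)) \<noteq> 0" using deg(2) by simp
  have "degree r \<le> Suc n" unfolding r_def using Suc.prems deg(1)[of "Suc n"] by (intro degree_diff_le) auto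
  moreover have "coeff r (Suc n) = 0" using lc deg(1)[of "Suc n"] by (simp add: r_def d_def)
  ultimately have "degree r \<le> n"
    by (metis Suc_leI degree_0 le_Suc_eq le_zero_eq leading_coeff_0_iff not_less_eq_eq zero_le)
  then obtain c where c: "r = (\<Sum>i\<le>n. smult (c i) (P i))" using Suc.IH by blast
  have "q = r + smult d (P (Suc n))" by (simp add: r_def)
  also have "\<dots> = (\<Sum>i\<le>Suc n. smult ((c(Suc n := d)) i) (P i))" by (simp add: c)
  finally show ?case by blast
qed

text \<open>Fourier coefficients give the best approximation, and since there is one polynomial of
  each degree, the span of the first ones contains every polynomial of that degree. Density of
  polynomials therefore makes the defect in Bessel's inequality tend to 0.\<close>

lemma Parseval_orthonormal_poly:
  fixes P :: "nat \<Rightarrow> real poly"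
  assumes M: "finite_measure M" "sets M = sets (restrict_space borel {a..b})"
    and P: "\<And>i. degree (P i) = i" "\<And>i. P i \<noteq> 0"
    and orth: "\<And>i j. (\<integral>x. poly (P i) x * poly (P j) x \<partial>M) = (if i = j then 1 else 0)"
    and w: "w \<in> borel_measurable M" "integrable M (\<lambda>x. (w x)\<^sup>2)"
  shows "(\<lambda>i. (\<integral>x. w x * poly (P i) x \<partial>M)\<^sup>2) sums (\<integral>x. (w x)\<^sup>2 \<partial>M)"
proof -
  interpret finite_measure M by (rule M)
  have space: "space M = {a..b}" using sets_eq_imp_space_eq[OF M(2)] by (simp add: space_restrict_space)
  have pm [measurable]: "poly p \<in> borel_measurable M" for p :: "real poly"
    by (rule borel_measurable_restricted[OF M]) (intro borel_measurable_continuous_onI continuous_intros)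
  have pi: "integrable M (poly p)" for p :: "real poly"
  proof -
    have "compact (poly p ` {a..b})" by (intro compact_continuous_image continuous_intros) auto
    then have "\<exists>B. \<forall>x\<in>{a..b}. \<bar>poly p x\<bar> \<le> B"
      using compact_imp_bounded[of "poly p ` {a..b}"] by (auto simp: bounded_iff)
    then obtain B where "\<And>x. x \<in> {a..b} \<Longrightarrow> \<bar>poly p x\<bar> \<le> B" by blast
    then show ?thesis by (intro integrable_const_bound[of _ B]) (auto intro!: AE_I2 simp: space)
  qed
  have ppi: "integrable M (\<lambda>x. poly p x * poly q x)" for p q :: "real poly"
  proof -
    have "poly (p * q) = (\<lambda>x. poly p x * poly q x)" by auto
    then show ?thesis using pi[of "p * q"] by simp
  qed
  have psi: "integrable M (\<lambda>x. (poly p x)\<^sup>2)" for p :: "real poly"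
    using ppi[of p p] by (simp add: power2_eq_square)
  have wpi: "integrable M (\<lambda>x. w x * poly p x)" for p :: "real poly"
    by (rule integrable_sq_diff(2)[OF w(1) pm w(2) psi])
  define e where "e i = (\<integral>x. w x * poly (P i) x \<partial>M)" for i
  \<comment> \<open>Pythagoras in the form that yields both halves: with \<open>c = e\<close> it is
    Bessel's inequality, and in general it shows that no other choice of \<open>c\<close> comes
    closer.\<close>
  have dist: "(\<integral>x. (w x - poly (\<Sum>i\<le>n. smult (c i) (P i)) x)\<^sup>2 \<partial>M)
      = (\<integral>x. (w x)\<^sup>2 \<partial>M) - (\<Sum>i\<le>n. (e i)\<^sup>2) + (\<Sum>i\<le>n. (e i - c i)\<^sup>2)" for c n
  proof -
    let ?q = "\<Sum>i\<le>n. smult (c i) (P i)"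
    have 1: "(\<integral>x. w x * poly ?q x \<partial>M) = (\<Sum>i\<le>n. c i * e i)"
    proof -
      have "(\<integral>x. w x * poly ?q x \<partial>M) = (\<integral>x. (\<Sum>i\<le>n. c i * (w x * poly (P i) x)) \<partial>M)"
        by (intro Bochner_Integration.integral_cong) (auto simp: poly_sum sum_distrib_left mult_ac)
      also have "\<dots> = (\<Sum>i\<le>n. \<integral>x. c i * (w x * poly (P i) x) \<partial>M)"
        by (rule Bochner_Integration.integral_sum) (intro integrable_mult_right wpi)
      finally show ?thesis by (simp add: e_def)
    qed
    have 2: "(\<integral>x. poly ?q x * poly ?q x \<partial>M) = (\<Sum>i\<le>n. (c i)\<^sup>2)"
    proof -
      have "(\<integral>x. poly ?q x * poly ?q x \<partial>M) = (\<integral>x. (\<Sum>i\<le>n. \<Sum>j\<le>n. c i * c j * (poly (P i) x * poly (P j) x)) \<partial>M)"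
        by (intro Bochner_Integration.integral_cong) (auto simp: poly_sum sum_product mult_ac)
      also have "\<dots> = (\<Sum>i\<le>n. \<integral>x. (\<Sum>j\<le>n. c i * c j * (poly (P i) x * poly (P j) x)) \<partial>M)"
        by (rule Bochner_Integration.integral_sum) (intro Bochner_Integration.integrable_sum integrable_mult_right ppi)
      also have "\<dots> = (\<Sum>i\<le>n. \<Sum>j\<le>n. \<integral>x. c i * c j * (poly (P i) x * poly (P j) x) \<partial>M)"
        by (intro sum.cong refl Bochner_Integration.integral_sum) (intro integrable_mult_right ppi)
      also have "\<dots> = (\<Sum>i\<le>n. \<Sum>j\<le>n. if j = i then c i * c j else 0)"
        by (intro sum.cong refl) (auto simp: orth)
      finally show ?thesis by (simp add: power2_eq_square)
    qed
    have "(\<integral>x. (w x - poly ?q x)\<^sup>2 \<partial>M) = (\<integral>x. ((w x)\<^sup>2 - 2 * (w x * poly ?q x)) + poly ?q x * poly ?q x \<partial>M)"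
      by (intro Bochner_Integration.integral_cong) (auto simp: power2_eq_square algebra_simps)
    also have "\<dots> = (\<integral>x. (w x)\<^sup>2 \<partial>M) - 2 * (\<integral>x. w x * poly ?q x \<partial>M) + (\<integral>x. poly ?q x * poly ?q x \<partial>M)"
      using w wpi[of ?q] ppi[of ?q ?q]
      by (subst Bochner_Integration.integral_add, simp, simp, subst Bochner_Integration.integral_diff) auto
    finally show ?thesis
      unfolding 1 2 by (simp add: power2_diff sum.distrib sum_subtractf sum_distrib_left mult_ac)
  qed
  have lim: "(\<lambda>n. \<Sum>i\<le>n. (e i)\<^sup>2) \<longlonglongrightarrow> (\<integral>x. (w x)\<^sup>2 \<partial>M)"
  proof (rule LIMSEQ_I)
    fix \<epsilon> :: real assume "\<epsilon> > 0"
    then obtain p where p: "(\<integral>x. (w x - poly p x)\<^sup>2 \<partial>M) < \<epsilon>"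
      using sq_integrable_approx_poly[OF M w] by blast
    show "\<exists>no. \<forall>n\<ge>no. norm ((\<Sum>i\<le>n. (e i)\<^sup>2) - (\<integral>x. (w x)\<^sup>2 \<partial>M)) < \<epsilon>"
    proof (intro exI allI impI)
      \<comment> \<open>The degree of \<open>p\<close> serves as threshold: from there on
        \<open>p\<close> lies in the span of \<open>P 0\<close>, ..., \<open>P n\<close>, so the
        partial sum inherits its error bound.\<close>
      fix n assume n: "n \<ge> degree p"
      obtain c where c: "p = (\<Sum>i\<le>n. smult (c i) (P i))" using poly_expansion_basis[OF P n] by blast
      have "(\<integral>x. (w x - poly (\<Sum>i\<le>n. smult (e i) (P i)) x)\<^sup>2 \<partial>M) \<ge> 0" by (rule Bochner_Integration.integral_nonneg) auto
      then have "(\<Sum>i\<le>n. (e i)\<^sup>2) \<le> (\<integral>x. (w x)\<^sup>2 \<partial>M)" unfolding dist[where n = n and c = e] by simp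
      moreover have "(\<Sum>i\<le>n. (e i - c i)\<^sup>2) \<ge> 0" by (rule sum_nonneg) auto
      moreover have "(\<integral>x. (w x)\<^sup>2 \<partial>M) - (\<Sum>i\<le>n. (e i)\<^sup>2) + (\<Sum>i\<le>n. (e i - c i)\<^sup>2) < \<epsilon>"
        using p unfolding c dist .
      ultimately show "norm ((\<Sum>i\<le>n. (e i)\<^sup>2) - (\<integral>x. (w x)\<^sup>2 \<partial>M)) < \<epsilon>" by simp
    qed
  qed
  then have "(\<lambda>n. \<Sum>i<Suc n. (e i)\<^sup>2) \<longlonglongrightarrow> (\<integral>x. (w x)\<^sup>2 \<partial>M)" by (simp add: lessThan_Suc_atMost)
  then show ?thesis unfolding sums_def e_def by (rule LIMSEQ_imp_Suc)
qed

section \<open>Summation of the zonal coefficients\<close>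

lemma pochhammer_powser_sums:
  fixes a x :: real
  assumes "\<bar>x\<bar> < 1"
  shows "(\<lambda>k. pochhammer a k / fact k * x ^ k) sums (1 - x) powr (- a)"
proof -
  have "(\<lambda>k. ((- a) gchoose k) * (- x) ^ k) sums (1 + (- x)) powr (- a)"
    using assms by (intro gen_binomial_real) simp
  moreover have "((- a) gchoose k) * (- x) ^ k = pochhammer a k / fact k * x ^ k" for k
  proof -
    have "(- x) ^ k = (- 1) ^ k * x ^ k" by (rule power_minus)
    moreover have "(- 1) ^ k * (- 1) ^ k = (1::real)" by (simp flip: power_mult_distrib)
    ultimately show ?thesis by (simp add: gbinomial_pochhammer)
  qed
  ultimately show ?thesis by simp
qed

lemma pos_not_nonpos_Ints: "(x::real) > 0 \<Longrightarrow> x \<notin> \<int>\<^sub>\<le>\<^sub>0"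
  by (auto elim!: nonpos_Ints_cases)

lemma Gamma_Suc_pos: "(x::real) > 0 \<Longrightarrow> Gamma (x + 1) = x * Gamma x"
  using Gamma_plus1[of x] pos_not_nonpos_Ints[of x] by simp

lemma nn_integral_Beta:
  fixes a b :: real
  assumes "a > 0" "b > 0"
  shows "(\<integral>\<^sup>+x. ennreal (x powr (a - 1) * (1 - x) powr (b - 1)) * indicator {0..1} x \<partial>lborel)
           = ennreal (Beta a b)"
proof -
  have "(\<integral>\<^sup>+x. ennreal (x powr (a - 1) * (1 - x) powr (b - 1)) * indicator {0..1} x \<partial>lborel)
      = (\<integral>\<^sup>+x. ennreal (indicator {0..1} x * (x powr (a - 1) * (1 - x) powr (b - 1))) \<partial>lborel)"
    by (intro nn_integral_cong) (auto simp: indicator_def)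
  then show ?thesis
    using nn_integral_has_integral_lebesgue[OF _ has_integral_Beta_real[OF assms]] by simp
qed

lemma sums_from_ennreal:
  fixes f :: "nat \<Rightarrow> real"
  assumes "\<And>k. 0 \<le> f k" "(\<Sum>k. ennreal (f k)) = ennreal c" "0 \<le> c"
  shows "f sums c"
proof -
  have "summable f"
    using assms(1) assms(2) by (intro summable_suminf_not_top) auto
  have "ennreal (suminf f) = ennreal c"
    using suminf_ennreal2[OF assms(1) \<open>summable f\<close>] assms(2) by (rule trans[OF sym])
  then have "suminf f = c"
    using assms(3) suminf_nonneg[OF \<open>summable f\<close> assms(1)] by simp
  with \<open>summable f\<close> show ?thesis by (simp add: sums_iff)
qed

lemma Gamma_legendre_duplication_real:
  fixes z :: real
  assumes "z > 0"
  shows "Gamma z * Gamma (z + 1/2) = 2 powr (1 - 2 * z) * sqrt pi * Gamma (2 * z)"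
proof -
  have A: "complex_of_real z + 1/2 = complex_of_real (z + 1/2)" "Gamma (2 * complex_of_real z) = Gamma (complex_of_real (2 * z))"
    "exp ((1 - 2 * complex_of_real z) * complex_of_real (ln 2)) = complex_of_real (exp ((1 - 2 * z) * ln 2))"
    by (simp_all flip: exp_of_real)
  have "z \<notin> \<int>\<^sub>\<le>\<^sub>0" "z + 1/2 \<notin> \<int>\<^sub>\<le>\<^sub>0"
    using assms by (auto intro!: pos_not_nonpos_Ints)
  then have "complex_of_real z \<notin> \<int>\<^sub>\<le>\<^sub>0" "complex_of_real z + 1/2 \<notin> \<int>\<^sub>\<le>\<^sub>0"
    unfolding A by (simp_all only: of_real_in_nonpos_Ints_iff not_False_eq_True)
  from Gamma_legendre_duplication[OF this]
  have "complex_of_real (Gamma z * Gamma (z + 1/2)) = complex_of_real (exp ((1 - 2 * z) * ln 2) * sqrt pi * Gamma (2 * z))"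
    unfolding A Gamma_complex_of_real of_real_mult[symmetric] .
  then show ?thesis
    unfolding of_real_eq_iff by (simp add: powr_def)
qed

text \<open>The series is the hypergeometric value \<open>2F1(a, b; c; 1)\<close> divided by
  \<open>Gamma c\<close>. By Euler's method, the factor \<open>Gamma b * Gamma (c - b)\<close> turns
  each term into a Beta integral, the binomial series is summed under the integral sign, and another
  Beta integral remains. All terms are nonnegative, so monotone convergence justifies the exchange
  and yields convergence of the series as well.\<close>

theorem Gauss_hypergeometric_sums:
  fixes a b c :: real
  assumes "a > 0" "b > 0" "c > a + b"
  shows "(\<lambda>k. pochhammer a k * pochhammer b k / (fact k * Gamma (c + real k))) sums
           (Gamma (c - a - b) / (Gamma (c - a) * Gamma (c - b)))"
proof (rule sums_from_ennreal)
  show "0 \<le> pochhammer a k * pochhammer b k / (fact k * Gamma (c + real k))" for k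
    using assms by (intro divide_nonneg_pos mult_nonneg_nonneg mult_pos_pos Gamma_real_pos)
      (auto simp: less_imp_le pochhammer_pos)
  show "0 \<le> Gamma (c - a - b) / (Gamma (c - a) * Gamma (c - b))"
    using assms by (intro divide_nonneg_pos mult_nonneg_nonneg mult_pos_pos Gamma_real_pos less_imp_le) auto
  define C where "C = Gamma b * Gamma (c - b)"
  have C: "C > 0" using assms by (auto simp: C_def)
  define W where "W = (\<lambda>x::real. x powr (b - 1) * (1 - x) powr (c - b - 1))"
  have [measurable]: "W \<in> borel_measurable borel" unfolding W_def by measurable
  have Wnn: "W x \<ge> 0" for x by (simp add: W_def)
  have eq: "C * (pochhammer a k * pochhammer b k / (fact k * Gamma (c + real k)))
        = pochhammer a k / fact k * Beta (b + k) (c - b)" for k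
  proof -
    have "b \<notin> \<int>\<^sub>\<le>\<^sub>0" using assms by (auto elim: nonpos_Ints_cases)
    then have "Gamma (b + k) = pochhammer b k * Gamma b"
      using assms by (simp add: pochhammer_Gamma Gamma_eq_zero_iff)
    then show ?thesis
      by (simp add: C_def Beta_def add_ac mult_ac)
  qed
  have "(\<Sum>k. ennreal (C * (pochhammer a k * pochhammer b k / (fact k * Gamma (c + real k)))))
      = (\<Sum>k. ennreal (pochhammer a k / fact k) * ennreal (Beta (b + k) (c - b)))"
    using assms by (intro suminf_cong, subst eq) (subst ennreal_mult', auto intro!: divide_nonneg_pos simp: less_imp_le pochhammer_pos)
  also have "\<dots> = (\<Sum>k. \<integral>\<^sup>+x. ennreal (pochhammer a k / fact k) * (ennreal (x powr (b + k - 1) * (1 - x) powr (c - b - 1)) * indicator {0..1} x) \<partial>lborel)"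
    using assms by (subst nn_integral_cmult) (auto simp: nn_integral_Beta)
  also have "\<dots> = (\<integral>\<^sup>+x. (\<Sum>k. ennreal (pochhammer a k / fact k) * (ennreal (x powr (b + k - 1) * (1 - x) powr (c - b - 1)) * indicator {0..1} x)) \<partial>lborel)"
    by (subst nn_integral_suminf) auto
  also have "\<dots> = (\<integral>\<^sup>+x. ennreal (x powr (b - 1) * (1 - x) powr (c - a - b - 1)) * indicator {0..1} x \<partial>lborel)"
  proof (rule nn_integral_cong_AE)
    \<comment> \<open>The endpoints are discarded because the binomial series needs
      \<open>\<bar>x\<bar> < 1\<close> and because \<open>0 powr\<close> any exponent is 0.\<close>
    have "AE x in lborel. x \<noteq> (0::real)" "AE x in lborel. x \<noteq> (1::real)"
      by (rule AE_lborel_singleton)+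
    then show "AE x in lborel. (\<Sum>k. ennreal (pochhammer a k / fact k) * (ennreal (x powr (b + k - 1) * (1 - x) powr (c - b - 1)) * indicator {0..1} x))
        = ennreal (x powr (b - 1) * (1 - x) powr (c - a - b - 1)) * indicator {0..1} x"
    proof eventually_elim
      case (elim x)
      show ?case
      proof (cases "x \<in> {0..1}")
        case True
        then have x: "0 < x" "x < 1" using elim by auto
        have "(\<lambda>k. pochhammer a k / fact k * x ^ k * W x) sums ((1 - x) powr (- a) * W x)"
          using x by (intro sums_mult2 pochhammer_powser_sums) auto
        moreover have "0 \<le> pochhammer a k / fact k * x ^ k * W x" for k
          using x assms Wnn by (intro mult_nonneg_nonneg divide_nonneg_pos) (auto simp: less_imp_le pochhammer_pos)
        ultimately have "(\<Sum>k. ennreal (pochhammer a k / fact k * x ^ k * W x)) = ennreal ((1 - x) powr (- a) * W x)"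
          by (subst suminf_ennreal2) (auto simp: sums_iff)
        also have "(1 - x) powr (- a) * W x = x powr (b - 1) * (1 - x) powr (c - a - b - 1)"
          by (simp add: W_def powr_add[symmetric] mult.left_commute)
             (metis (no_types, opaque_lifting) add_diff_eq diff_diff_eq2 minus_add_cancel uminus_add_conv_diff diff_diff_eq add.commute)
        also have "(\<lambda>k. ennreal (pochhammer a k / fact k * x ^ k * W x)) = (\<lambda>k. ennreal (pochhammer a k / fact k) * (ennreal (x powr (b + k - 1) * (1 - x) powr (c - b - 1)) * indicator {0..1} x))"
        proof
          fix k
          have "x powr (b + k - 1) = x ^ k * x powr (b - 1)"
            using x by (simp add: powr_add[symmetric] flip: powr_realpow) (simp add: algebra_simps)
          then show "ennreal (pochhammer a k / fact k * x ^ k * W x) = ennreal (pochhammer a k / fact k) * (ennreal (x powr (b + k - 1) * (1 - x) powr (c - b - 1)) * indicator {0..1} x)"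
            using True assms by (simp add: W_def mult_ac less_imp_le pochhammer_pos flip: ennreal_mult'')
        qed
        finally show ?thesis using True by simp
      qed auto
    qed
  qed
  also have "\<dots> = ennreal (Beta b (c - a - b))"
    using assms by (intro nn_integral_Beta) auto
  also have "Beta b (c - a - b) = C * (Gamma (c - a - b) / (Gamma (c - a) * Gamma (c - b)))"
  proof -
    have "Gamma (c - b) \<noteq> 0" using C_def C by auto
    then show ?thesis using assms by (simp add: Beta_def C_def diff_diff_eq add_ac)
  qed
  finally have "(\<Sum>k. ennreal (C * (pochhammer a k * pochhammer b k / (fact k * Gamma (c + real k)))))
      = ennreal (C * (Gamma (c - a - b) / (Gamma (c - a) * Gamma (c - b))))" .
  moreover have "ennreal (C * x) = ennreal C * ennreal x" for x
    using C by (intro ennreal_mult') auto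
  ultimately have "ennreal C * (\<Sum>k. ennreal (pochhammer a k * pochhammer b k / (fact k * Gamma (c + real k))))
      = ennreal C * ennreal (Gamma (c - a - b) / (Gamma (c - a) * Gamma (c - b)))"
    by (simp only: ennreal_suminf_cmult)
  then show "(\<Sum>k. ennreal (pochhammer a k * pochhammer b k / (fact k * Gamma (c + real k))))
      = ennreal (Gamma (c - a - b) / (Gamma (c - a) * Gamma (c - b)))"
    using C by (subst (asm) ennreal_mult_cancel_left) auto
qed

text \<open>Up to a factor independent of \<open>i\<close> and \<open>k\<close>, this is the \<open>k\<close>-th Taylor coefficient of the even part of
  \<open>(1 - t)\<^sup>-\<^sup>g\<close> times the eigenvalue, at spherical harmonics of degree \<open>2 i\<close>, of the operator with kernel
  \<open>(z \<bullet> \<zeta>)\<^sup>2\<^sup>k\<close> on the \<open>N\<close>-sphere.\<close>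

definition zonal_coeff :: "real \<Rightarrow> real \<Rightarrow> nat \<Rightarrow> nat \<Rightarrow> real" where
  "zonal_coeff g N i k = (if i \<le> k then pochhammer g (2 * k) / 4 ^ k / (fact (k - i) * Gamma (real k + real i + (N + 1) / 2)) else 0)"

text \<open>Replacing \<open>k\<close> by \<open>k + i\<close> and splitting
  \<open>pochhammer g (2 * k)\<close> by the duplication formula gives Gauss's series with
  \<open>a = g/2 + i\<close>, \<open>b = a + 1/2\<close> and \<open>c = (N + 1)/2 + 2 i\<close>.
  Here \<open>c - a - b = N/2 - g\<close>, so \<open>g < N/2\<close> is its condition of
  convergence. Legendre duplication merges the two Gamma factors of the denominator.\<close>

lemma zonal_coeff_sums:
  assumes "0 < g" "g < N / 2" 
  shows "zonal_coeff g N i sums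
    (Gamma (N / 2 - g) * 2 powr (N - g - 1) / (sqrt pi * Gamma g) * (Gamma (2 * i + g) / Gamma (2 * i + N - g)))"
proof -
  define a where "a = g / 2 + i"
  define c where "c = (N + 1) / 2 + 2 * i"
  have 1: "(\<lambda>k. pochhammer a k * pochhammer (a + 1/2) k / (fact k * Gamma (c + real k))) sums
           (Gamma (c - a - (a + 1/2)) / (Gamma (c - a) * Gamma (c - (a + 1/2))))"
    using assms by (intro Gauss_hypergeometric_sums) (auto simp: a_def c_def)
  have 2: "zonal_coeff g N i (k + i) = pochhammer g (2 * i) / 4 ^ i * (pochhammer a k * pochhammer (a + 1/2) k / (fact k * Gamma (c + real k)))" for k
  proof -
    have "pochhammer g (2 * (k + i)) = pochhammer g (2 * i) * pochhammer (g + 2 * i) (2 * k)"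
      using pochhammer_product'[of g "2 * i" "2 * k"] by (simp add: add.commute)
    also have "pochhammer (g + 2 * i) (2 * k) = 4 ^ k * pochhammer a k * pochhammer (a + 1/2) k"
    proof -
      have "2 * a = g + 2 * i" by (simp add: a_def)
      moreover have "(2::real) ^ (2 * k) = 4 ^ k" by (simp add: power_mult)
      ultimately show ?thesis using pochhammer_double[of a k] by simp
    qed
    finally show ?thesis
      by (simp add: zonal_coeff_def power_add c_def algebra_simps add_divide_distrib)
  qed
  have 3: "Gamma (c - a) * Gamma (c - (a + 1/2)) = 2 powr (1 - (2 * i + N - g)) * sqrt pi * Gamma (2 * i + N - g)"
  proof -
    define z where "z = c - (a + 1/2)"
    have "z > 0" using assms by (auto simp: z_def c_def a_def field_simps)
    moreover from this have "z \<notin> \<int>\<^sub>\<le>\<^sub>0" "z + 1/2 \<notin> \<int>\<^sub>\<le>\<^sub>0" by (auto elim!: nonpos_Ints_cases)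
    ultimately have "Gamma z * Gamma (z + 1/2) = 2 powr (1 - 2 * z) * sqrt pi * Gamma (2 * z)"
      by (intro Gamma_legendre_duplication_real)
    moreover have "2 * z = 2 * i + N - g" by (simp add: z_def c_def a_def field_simps)
    moreover have "c - a = z + 1/2" by (simp add: z_def)
    ultimately show ?thesis unfolding z_def[symmetric] by (simp only: mult.commute[of "Gamma (z + 1/2)"])
  qed
  have "(\<lambda>k. zonal_coeff g N i (k + i)) sums (pochhammer g (2 * i) / 4 ^ i * (Gamma (c - a - (a + 1/2)) / (Gamma (c - a) * Gamma (c - (a + 1/2)))))"
    unfolding 2 by (intro sums_mult 1)
  moreover have "(\<Sum>k<i. zonal_coeff g N i k) = 0"
    by (intro sum.neutral) (auto simp: zonal_coeff_def)
  ultimately have 4: "zonal_coeff g N i sums (pochhammer g (2 * i) / 4 ^ i * (Gamma (c - a - (a + 1/2)) / (Gamma (c - a) * Gamma (c - (a + 1/2)))))"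
    by (simp add: sums_iff_shift)
  have 5: "pochhammer g (2 * i) = Gamma (2 * i + g) / Gamma g"
  proof -
    have "g \<notin> \<int>\<^sub>\<le>\<^sub>0" using assms by (auto elim: nonpos_Ints_cases)
    then show ?thesis by (simp add: pochhammer_Gamma add.commute)
  qed
  have 6: "c - a - (a + 1/2) = N / 2 - g" by (simp add: a_def c_def field_simps)
  have 7: "4 ^ i = (2::real) powr (2 * i)" by (simp add: powr_realpow power_mult flip: powr_powr)
  show ?thesis
    using 4 unfolding 3 5 6 7 by (simp add: powr_diff powr_add field_simps)
qed

text \<open>The reciprocal of the limit formula for the Gamma function, read as the growth rate of
  rising factorials.\<close>

lemma pochhammer_asymp:
  fixes z :: real
  assumes "z > 0"
  shows "(\<lambda>n. pochhammer z (n + 1) / (fact n * real n powr z)) \<longlonglongrightarrow> 1 / Gamma z"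
proof -
  have "Gamma_series z \<longlonglongrightarrow> Gamma z" by (rule Gamma_series_LIMSEQ)
  then have "(\<lambda>n. 1 / Gamma_series z n) \<longlonglongrightarrow> 1 / Gamma z"
    using assms by (intro tendsto_divide) (auto simp: Gamma_eq_zero_iff elim!: nonpos_Ints_cases)
  then show ?thesis
  proof (rule Lim_transform_eventually)
    show "\<forall>\<^sub>F n in sequentially. 1 / Gamma_series z n = pochhammer z (n + 1) / (fact n * real n powr z)"
      using eventually_gt_at_top[of 0]
      by eventually_elim (simp add: Gamma_series_def powr_def)
  qed
qed

text \<open>The coefficients decay like \<open>k^(g - N/2 - 1)\<close>: after duplication they are a
  quotient of rising factorials whose growth is known. This is one half of the estimate for the
  boundary terms of the telescoping sum; the other half is the gain in
  \<open>zonal_coeff_diff_bounds\<close>.\<close>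

lemma zonal_coeff_tendsto_0:
  assumes "0 < g" "g < N / 2"
  shows "(\<lambda>k. real k * zonal_coeff g N 0 k) \<longlonglongrightarrow> 0"
proof -
  define r where "r z n = pochhammer z (n + 1) / (fact n * real n powr z)" for z :: real and n
  define q where "q = (N + 1) / 2"
  define L where "L = (1 / Gamma (g/2)) * (1 / Gamma (g/2+1/2)) / (1 / Gamma q) / Gamma q"
  have q: "q > 0" using assms by (simp add: q_def)
  have "(\<lambda>n. r (g/2) n * r (g/2+1/2) n / r q n / Gamma q) \<longlonglongrightarrow> L"
    unfolding L_def r_def using assms q
    by (intro tendsto_intros pochhammer_asymp) (auto simp: Gamma_eq_zero_iff elim!: nonpos_Ints_cases)
  moreover have "(\<lambda>n. real n powr (g + 1/2 - q)) \<longlonglongrightarrow> 0"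
    using assms by (intro tendsto_neg_powr) (auto simp: q_def filterlim_real_sequentially field_simps)
  ultimately have "(\<lambda>n. r (g/2) n * r (g/2+1/2) n / r q n / Gamma q * real n powr (g + 1/2 - q)) \<longlonglongrightarrow> L * 0"
    by (rule tendsto_mult)
  then have "(\<lambda>n. real (n+1) * zonal_coeff g N 0 (n+1)) \<longlonglongrightarrow> L * 0"
  proof (rule Lim_transform_eventually)
    show "\<forall>\<^sub>F n in sequentially. r (g/2) n * r (g/2+1/2) n / r q n / Gamma q * real n powr (g + 1/2 - q) = real (n+1) * zonal_coeff g N 0 (n+1)"
      using eventually_gt_at_top[of 0]
    proof eventually_elim
      case (elim n)
      have "q \<notin> \<int>\<^sub>\<le>\<^sub>0" using q by (auto elim!: nonpos_Ints_cases)
      then have G: "Gamma (real (n+1) + q) = pochhammer q (n+1) * Gamma q"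
        using q by (simp add: pochhammer_Gamma Gamma_eq_zero_iff add_ac)
      have p: "pochhammer g (2 * (n+1)) = 4 ^ (n+1) * pochhammer (g/2) (n+1) * pochhammer (g/2+1/2) (n+1)"
      proof -
        have "(2::real) ^ (2 * (n+1)) = 4 ^ (n+1)" by (subst power_mult) simp
        then show ?thesis using pochhammer_double[of "g/2" "n+1"] by simp
      qed
      have e: "real n powr (g + 1/2 - q) = real n powr (g/2) * real n powr (g/2+1/2) / real n powr q"
        by (simp add: powr_diff flip: powr_add)
      have "zonal_coeff g N 0 (n+1) = pochhammer (g/2) (n+1) * pochhammer (g/2+1/2) (n+1) / (fact (n+1) * (pochhammer q (n+1) * Gamma q))"
        unfolding zonal_coeff_def p G[symmetric] by (simp add: q_def del: pochhammer_Suc)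
      then have "real (n+1) * zonal_coeff g N 0 (n+1) = pochhammer (g/2) (n+1) * pochhammer (g/2+1/2) (n+1) / (fact n * (pochhammer q (n+1) * Gamma q))"
      proof -
        have "fact (n + 1) = real (n + 1) * fact n" by simp
        moreover have "c * (X / (c * F * Y)) = X / (F * Y)" if "c \<noteq> 0" for c X F Y :: real using that by simp
        ultimately show ?thesis
          using \<open>zonal_coeff g N 0 (n+1) = _\<close> by (metis of_nat_eq_0_iff add_is_0 one_neq_zero)
      qed
      also have "\<dots> = r (g/2) n * r (g/2+1/2) n / r q n / Gamma q * real n powr (g + 1/2 - q)"
        using elim q pochhammer_pos[OF q, of "n+1"]
        unfolding r_def e by (simp add: field_simps del: pochhammer_Suc)
      finally show ?case by simp
    qed
  qed
  then show ?thesis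
    using LIMSEQ_offset[of "\<lambda>n. real n * zonal_coeff g N 0 n" 1 0] by simp
qed

text \<open>Weierstrass's product inequality; the bounds on the product itself are carried along to
  make the induction work.\<close>

lemma Bernoulli_prod:
  fixes x :: "nat \<Rightarrow> real"
  assumes "\<And>j. j < i \<Longrightarrow> 0 \<le> x j \<and> x j \<le> 1"
  shows "1 - (\<Prod>j<i. 1 - x j) \<le> (\<Sum>j<i. x j) \<and> 0 \<le> (\<Prod>j<i. 1 - x j) \<and> (\<Prod>j<i. 1 - x j) \<le> 1"
  using assms
proof (induction i)
  case (Suc i)
  define P where "P = (\<Prod>j<i. 1 - x j)"
  have IH: "1 - P \<le> (\<Sum>j<i. x j)" "0 \<le> P" "P \<le> 1" using Suc unfolding P_def by auto
  have x: "0 \<le> x i" "x i \<le> 1" using Suc.prems[of i] by auto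
  have "P * (1 - x i) \<le> 1 * 1" using IH x by (intro mult_mono) auto
  moreover have "P * x i \<le> x i" using IH x by (intro mult_left_le_one_le) auto
  moreover have "0 \<le> P * (1 - x i)" using IH x by simp
  ultimately show ?case using IH by (simp add: P_def[symmetric] algebra_simps)
qed auto

text \<open>Passing from \<open>i\<close> to \<open>i + 1\<close> multiplies the coefficient by
  \<open>(k - i) / (k + i + (N + 1)/2)\<close>, one factor from the factorial and one from Gamma.
  Each quotient is written as one minus a quantity of order \<open>1/k\<close>.\<close>

lemma zonal_coeff_ratio:
  assumes "i \<le> k" "0 < N"
  shows "zonal_coeff g N i k = zonal_coeff g N 0 k * (\<Prod>j<i. 1 - (2 * real j + (N + 1) / 2) / (real k + real j + (N + 1) / 2))"
  using assms(1)
proof (induction i)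
  case (Suc i)
  define q where "q = (N + 1) / 2"
  have q: "q > 0" using assms by (simp add: q_def)
  have f: "fact (k - i) = (real k - real i) * fact (k - Suc i)"
    using Suc.prems by (subst fact_reduce) (auto simp: of_nat_diff)
  have G: "Gamma (real k + real (Suc i) + q) = (real k + real i + q) * Gamma (real k + real i + q)"
    using Gamma_Suc_pos[of "real k + real i + q"] q by (simp add: add_ac)
  have "zonal_coeff g N (Suc i) k = zonal_coeff g N i k * ((real k - real i) / (real k + real i + q))"
    using Suc.prems unfolding zonal_coeff_def f q_def[symmetric] G by simp
  also have "(real k - real i) / (real k + real i + q) = 1 - (2 * real i + q) / (real k + real i + q)"
    using q by (simp add: field_simps)
  finally show ?case using Suc by (simp add: q_def mult.assoc)
qed simp

lemma zonal_coeff_nonneg: "0 < g \<Longrightarrow> 0 < N \<Longrightarrow> 0 \<le> zonal_coeff g N i k"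
  unfolding zonal_coeff_def by (auto intro!: divide_nonneg_pos mult_pos_pos Gamma_real_pos add_nonneg_pos simp: less_imp_le pochhammer_pos)

text \<open>By the product formula the relative loss between index 0 and index \<open>i\<close> is
  at most a sum of \<open>i\<close> terms of order \<open>1/k\<close>. The difference thus gains a
  factor \<open>1/k\<close>, and this is what makes the singular exponent accessible.\<close>

lemma zonal_coeff_diff_bounds:
  assumes "0 < g" "0 < N"
  shows "0 \<le> zonal_coeff g N 0 k - zonal_coeff g N i k"
    and "i \<le> k \<Longrightarrow> real k * (zonal_coeff g N 0 k - zonal_coeff g N i k) \<le> zonal_coeff g N 0 k * (real i * (2 * real i + (N + 1) / 2))"
proof -
  define q where "q = (N + 1) / 2"
  have q: "q > 0" using assms by (simp add: q_def)
  define x where "x j = (2 * real j + q) / (real k + real j + q)" for j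
  have A: "0 \<le> zonal_coeff g N 0 k" using zonal_coeff_nonneg assms by auto
  have B: "0 \<le> zonal_coeff g N 0 k - zonal_coeff g N i k \<and> real k * (zonal_coeff g N 0 k - zonal_coeff g N i k) \<le> zonal_coeff g N 0 k * (real i * (2 * real i + q))" if "i \<le> k"
  proof -
    have x: "0 \<le> x j \<and> x j \<le> 1 \<and> real k * x j \<le> 2 * real i + q" if "j < i" for j
    proof -
      have "real j \<le> real k" "real j \<le> real i" using that \<open>i \<le> k\<close> by auto
      then have "x j \<le> 1" using q by (simp add: x_def)
      have "real k * (2 * real j + q) \<le> (real k + real j + q) * (2 * real i + q)"
        using q \<open>real j \<le> real i\<close> by (intro mult_mono) auto
      then have "real k * x j \<le> 2 * real i + q" using q by (simp add: x_def field_simps)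
      then show ?thesis using \<open>x j \<le> 1\<close> q by (simp add: x_def)
    qed
    define P where "P = (\<Prod>j<i. 1 - x j)"
    have P: "1 - P \<le> (\<Sum>j<i. x j)" "P \<le> 1"
      using Bernoulli_prod[of i x] x unfolding P_def by auto
    have eq: "zonal_coeff g N i k = zonal_coeff g N 0 k * P"
      using zonal_coeff_ratio[OF that assms(2)] unfolding P_def x_def q_def .
    have "real k * (1 - P) \<le> real k * (\<Sum>j<i. x j)" using P by (intro mult_left_mono) auto
    also have "\<dots> = (\<Sum>j<i. real k * x j)" by (rule sum_distrib_left)
    also have "\<dots> \<le> (\<Sum>j<i. 2 * real i + q)" using x by (intro sum_mono) auto
    finally have "real k * (1 - P) \<le> real i * (2 * real i + q)" by simp
    then have "zonal_coeff g N 0 k * (real k * (1 - P)) \<le> zonal_coeff g N 0 k * (real i * (2 * real i + q))"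
      using A by (intro mult_left_mono)
    moreover have "zonal_coeff g N 0 k * P \<le> zonal_coeff g N 0 k * 1" using A P by (intro mult_left_mono)
    ultimately show ?thesis unfolding eq by (simp add: algebra_simps)
  qed
  show "0 \<le> zonal_coeff g N 0 k - zonal_coeff g N i k"
    using A B by (cases "i \<le> k") (auto simp: zonal_coeff_def)
  show "i \<le> k \<Longrightarrow> real k * (zonal_coeff g N 0 k - zonal_coeff g N i k) \<le> zonal_coeff g N 0 k * (real i * (2 * real i + (N + 1) / 2))"
    using B by (simp add: q_def)
qed

text \<open>Raising the exponent by one costs a weight linear in \<open>k\<close>, because
  \<open>e * pochhammer (e + 1) (2 * k)\<close> is \<open>pochhammer e (2 * k)\<close> with one more
  factor.\<close>

lemma zonal_coeff_shift:
  assumes "e > 0"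
  shows "e * zonal_coeff (e + 1) N i k = (e + 2 * k) * zonal_coeff e N i k"
proof -
  have "e * pochhammer (e + 1) (2 * k) = pochhammer e (2 * k) * (e + 2 * k)"
    using pochhammer_rec[of e "2 * k"] pochhammer_Suc[of e "2 * k"] by simp
  then have "e * (pochhammer (e + 1) (2 * k) / c) = (e + 2 * k) * (pochhammer e (2 * k) / c)" for c
    by (simp add: mult.commute)
  from this[of "4 ^ k * (fact (k - i) * Gamma (real k + real i + (N + 1) / 2))"]
  show ?thesis by (simp add: zonal_coeff_def)
qed

lemma zonal_coeff_rec:
  assumes "0 < N"
  shows "4 * (real (Suc k) - real i) * (real k + real i + (N + 1) / 2) * zonal_coeff e N i (Suc k) = (e + 2 * k) * (e + 2 * k + 1) * zonal_coeff e N i k"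
proof -
  define q where "q = (N + 1) / 2"
  have q: "q > 0" using assms by (simp add: q_def)
  \<comment> \<open>For \<open>i = Suc k\<close> the factor \<open>Suc k - i\<close> on the left and
    the coefficient on the right vanish; for larger \<open>i\<close> both coefficients do.\<close>
  consider "i \<le> k" | "i = Suc k" | "i > Suc k" by linarith
  then show ?thesis
  proof cases
    case 1
    have p: "pochhammer e (2 * Suc k) = pochhammer e (2 * k) * (e + 2 * k) * (e + 2 * k + 1)"
      by (simp add: pochhammer_Suc add_ac)
    have f: "fact (Suc k - i) = (real (Suc k) - real i) * fact (k - i)"
      using 1 by (simp add: Suc_diff_le of_nat_diff)
    have G: "Gamma (real (Suc k) + real i + q) = (real k + real i + q) * Gamma (real k + real i + q)"
      using Gamma_Suc_pos[of "real k + real i + q"] q by (simp add: add_ac)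
    have 2: "real (Suc k) - real i > 0" "real k + real i + q > 0" using 1 q by auto
    have "zonal_coeff e N i (Suc k) = pochhammer e (2 * k) * (e + 2 * k) * (e + 2 * k + 1) / (4 * 4 ^ k) /
       ((real (Suc k) - real i) * fact (k - i) * ((real k + real i + q) * Gamma (real k + real i + q)))"
      using 1 unfolding zonal_coeff_def p f q_def[symmetric] G by simp
    also have "4 * (real (Suc k) - real i) * (real k + real i + q) * \<dots> = (e + 2 * k) * (e + 2 * k + 1) * (pochhammer e (2 * k) / 4 ^ k / (fact (k - i) * Gamma (real k + real i + q)))"
    proof -
      have "4 * a * b * (P * x * y / (4 * F) / ((a * f) * (b * G))) = x * y * (P / F / (f * G))"
        if "a > 0" "b > 0" for a b P x y F f G :: real using that by (simp add: field_simps)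
      from this[OF 2] show ?thesis .
    qed
    finally show ?thesis using 1 by (simp add: zonal_coeff_def q_def del: of_nat_Suc)
  qed (auto simp: zonal_coeff_def)
qed

text \<open>The coefficients for the singular exponent \<open>e + 1 > N / 2\<close> are reduced to those for \<open>e < N / 2\<close>, whose
  series converges to a quotient of Gamma values by Gauss's summation theorem. In the
  difference of the identities for \<open>0\<close> and \<open>i\<close> the boundary terms vanish as \<open>K \<rightarrow> \<infinity>\<close>.\<close>

lemma zonal_coeff_telescope:
  fixes e s N :: real and i :: nat
  assumes e: "e = N / 2 + s - 1" "0 < N" "e > 0"
  shows "2 * s * e * (\<Sum>k<Suc K. zonal_coeff (e + 1) N i k)
     + (2 * i * (2 * i + N - 1) + e * (N - 1 - e)) * (\<Sum>k<Suc K. zonal_coeff e N i k)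
     = (e + 2 * K) * (e + 2 * K + 1) * zonal_coeff e N i K"
proof (induction K)
  case 0
  have [simp]: "zonal_coeff f N (Suc j) 0 = 0" for j f by (simp add: zonal_coeff_def)
  show ?case
  proof (cases i)
    case [simp]: 0
    have "2 * s * (e * zonal_coeff (e + 1) N 0 0) = 2 * s * (e * zonal_coeff e N 0 0)"
      using zonal_coeff_shift[OF e(3), of N 0 0] by simp
    moreover have "2 * s = 2 * e - N + 2" using e by simp
    ultimately have "2 * s * e * zonal_coeff (e + 1) N 0 0 = (2 * e - N + 2) * (e * zonal_coeff e N 0 0)" by simp
    then show ?thesis by (simp add: algebra_simps)
  qed (auto simp: gr0_conv_Suc)
next
  case (Suc K)
  let ?A = "zonal_coeff e N i (Suc K)"
  have 1: "2 * s * e * zonal_coeff (e + 1) N i (Suc K) = 2 * s * ((e + 2 * Suc K) * ?A)"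
    using zonal_coeff_shift[OF e(3), of N i "Suc K"] by (metis mult.assoc)
  have 2: "2 * s = 2 * e - N + 2" using e by simp
  \<comment> \<open>Once \<open>2 s\<close> is replaced by \<open>2 e - N + 2\<close>, this
    polynomial identity carries the telescoping: the boundary factor at \<open>k\<close> splits into
    the two new summands and a third term, which \<open>zonal_coeff_rec\<close> identifies with the
    boundary term at \<open>k - 1\<close>.\<close>
  have id: "(2 * e - N + 2) * (e + 2 * k) + (2 * l * (2 * l + N - 1) + e * (N - 1 - e))
       + 2 * (k - l) * (2 * (k - 1) + 2 * l + N + 1) = (e + 2 * k) * (e + 2 * k + 1)" for k l :: real
    by (simp add: algebra_simps)
  have 3: "4 * (real (Suc K) - real i) * (real K + real i + (N + 1) / 2) = 2 * (real (Suc K) - real i) * (2 * (real (Suc K) - 1) + 2 * real i + N + 1)"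
  proof -
    have "real K + real i + (N + 1) / 2 = (2 * (real (Suc K) - 1) + 2 * real i + N + 1) / 2" by simp
    moreover have "4 * A * (Y / 2) = 2 * A * Y" for A Y :: real by simp
    ultimately show ?thesis by (simp only:)
  qed
  have 4: "2 * s * ((e + 2 * Suc K) * ?A) + (2 * i * (2 * i + N - 1) + e * (N - 1 - e)) * ?A
       + 4 * (real (Suc K) - real i) * (real K + real i + (N + 1) / 2) * ?A
     = (e + 2 * Suc K) * (e + 2 * Suc K + 1) * ?A"
    unfolding 2 3 mult.assoc[symmetric] distrib_right[symmetric]
    using id[of "real (Suc K)" "real i"] by (simp only: of_nat_mult of_nat_numeral)
  have split: "2 * s * e * (\<Sum>k<Suc (Suc K). zonal_coeff (e + 1) N i k)
     + c * (\<Sum>k<Suc (Suc K). zonal_coeff e N i k)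
     = (2 * s * e * (\<Sum>k<Suc K. zonal_coeff (e + 1) N i k) + c * (\<Sum>k<Suc K. zonal_coeff e N i k))
       + (2 * s * e * zonal_coeff (e + 1) N i (Suc K) + c * ?A)" for c
    by (simp only: sum.lessThan_Suc[of _ "Suc K"] distrib_left add_ac)
  show ?case
    unfolding split Suc.IH 1
    using 4 zonal_coeff_rec[OF e(2), of K i e] unfolding of_nat_mult of_nat_numeral by linarith
qed

text \<open>Taken alone, each of the two series has terms of order \<open>k^(s - 1)\<close> and
  diverges. Subtracting the telescoped identities for 0 and \<open>i\<close> expresses the partial
  sums of the difference by convergent series of exponent \<open>e\<close> and a boundary term that
  tends to 0.\<close>

theorem zonal_coeff_diff_sums:
  fixes N s :: real
  assumes s: "0 < s" "s < 1" and N: "N > 2"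
  shows "(\<lambda>k. zonal_coeff (N / 2 + s) N 0 k - zonal_coeff (N / 2 + s) N i k) sums
     (Gamma (1 - s) * 2 powr (N / 2 - s - 1) / (s * sqrt pi * Gamma (N / 2 + s))
       * (Gamma (2 * i + N / 2 + s) / Gamma (2 * i + N / 2 - s) - Gamma (N / 2 + s) / Gamma (N / 2 - s)))"
proof -
  define e where "e = N / 2 + s - 1"
  have e: "e > 0" "e < N / 2" using s N by (auto simp: e_def)
  have e1: "e + 1 = N / 2 + s" by (simp add: e_def)
  \<comment> \<open>This is \<open>(2 j + e) (2 j + N - 1 - e)\<close>, an eigenvalue
    \<open>2 j (2 j + N - 1)\<close> of the Laplacian plus a constant. One factor raises the upper
    Gamma argument of \<open>E j\<close> by one, the other lowers the lower argument, and the Gamma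
    quotient of the symbol appears.\<close>
  define c where "c j = 2 * real j * (2 * real j + N - 1) + e * (N - 1 - e)" for j
  define E where "E j = Gamma (N / 2 - e) * 2 powr (N - e - 1) / (sqrt pi * Gamma e) * (Gamma (2 * real j + e) / Gamma (2 * real j + N - e))" for j
  define X where "X K = (e + 2 * real K) * (e + 2 * real K + 1) * (zonal_coeff e N 0 K - zonal_coeff e N i K)" for K
  have E: "zonal_coeff e N j sums E j" for j
    unfolding E_def by (rule zonal_coeff_sums[OF e])
  \<comment> \<open>The weight is of order \<open>K^2\<close>. The coefficients are
    \<open>o(1/K)\<close> and their difference is smaller by a further factor \<open>1/K\<close>, so
    the product still tends to 0.\<close>
  have X: "X \<longlonglongrightarrow> 0"
  proof (rule tendsto_sandwich[OF _ _ tendsto_const])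
    define C where "C = (e + 2) * (e + 3) * (real i * (2 * real i + (N + 1) / 2))"
    show "\<forall>\<^sub>F K in sequentially. 0 \<le> X K"
      using zonal_coeff_diff_bounds(1)[of e N] e N by (intro always_eventually allI) (auto simp: X_def)
    show "\<forall>\<^sub>F K in sequentially. X K \<le> C * (real K * zonal_coeff e N 0 K)"
      using eventually_ge_at_top[of "max 1 i"]
    proof eventually_elim
      case (elim K)
      define D where "D = zonal_coeff e N 0 K - zonal_coeff e N i K"
      have D: "D \<ge> 0" "real K * D \<le> zonal_coeff e N 0 K * (real i * (2 * real i + (N + 1) / 2))"
        using zonal_coeff_diff_bounds[of e N] e N elim by (auto simp: D_def)
      have K: "real K \<ge> 1" using elim by simp
      have "e + 2 * real K \<le> (e + 2) * real K" "e + 2 * real K + 1 \<le> (e + 3) * real K"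
      proof -
        have eK: "e \<le> e * real K" using mult_left_mono[OF K, of e] e by simp
        show "e + 2 * real K \<le> (e + 2) * real K" unfolding distrib_right using K eK by linarith
        show "e + 2 * real K + 1 \<le> (e + 3) * real K" unfolding distrib_right using K eK by linarith
      qed
      then have "(e + 2 * real K) * (e + 2 * real K + 1) * D \<le> ((e + 2) * real K) * ((e + 3) * real K) * D"
        using e D by (intro mult_right_mono mult_mono) auto
      also have "\<dots> = (e + 2) * (e + 3) * real K * (real K * D)" by simp
      also have "\<dots> \<le> (e + 2) * (e + 3) * real K * (zonal_coeff e N 0 K * (real i * (2 * real i + (N + 1) / 2)))"
        using e D by (intro mult_left_mono) auto
      finally show ?case by (simp add: X_def D_def C_def mult_ac)
    qed
    show "(\<lambda>K. C * (real K * zonal_coeff e N 0 K)) \<longlonglongrightarrow> 0"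
      using tendsto_mult_right_zero[OF zonal_coeff_tendsto_0[OF e], of C] by simp
  qed
  have "(\<lambda>K. (X K + c i * (\<Sum>k<Suc K. zonal_coeff e N i k) - c 0 * (\<Sum>k<Suc K. zonal_coeff e N 0 k)) / (2 * s * e))
      \<longlonglongrightarrow> (0 + c i * E i - c 0 * E 0) / (2 * s * e)"
  proof -
    have "(\<lambda>K. \<Sum>k<Suc K. zonal_coeff e N j k) \<longlonglongrightarrow> E j" for j
      using E[of j, unfolded sums_def] by (rule LIMSEQ_Suc)
    then show ?thesis using X s e by (intro tendsto_intros) auto
  qed
  moreover have "(X K + c i * (\<Sum>k<Suc K. zonal_coeff e N i k) - c 0 * (\<Sum>k<Suc K. zonal_coeff e N 0 k)) / (2 * s * e)
      = (\<Sum>k<Suc K. zonal_coeff (N / 2 + s) N 0 k - zonal_coeff (N / 2 + s) N i k)" for K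
  proof -
    have T: "2 * s * e * (\<Sum>k<Suc K. zonal_coeff (e + 1) N j k) + c j * (\<Sum>k<Suc K. zonal_coeff e N j k)
     = (e + 2 * K) * (e + 2 * K + 1) * zonal_coeff e N j K" for j
      using zonal_coeff_telescope[of e N s j K] e N by (simp add: e_def c_def)
    have "X K = (e + 2 * K) * (e + 2 * K + 1) * zonal_coeff e N 0 K - (e + 2 * K) * (e + 2 * K + 1) * zonal_coeff e N i K"
      unfolding X_def of_nat_mult of_nat_numeral by (rule right_diff_distrib)
    then have "X K + c i * (\<Sum>k<Suc K. zonal_coeff e N i k) - c 0 * (\<Sum>k<Suc K. zonal_coeff e N 0 k)
      = 2 * s * e * (\<Sum>k<Suc K. zonal_coeff (e + 1) N 0 k) - 2 * s * e * (\<Sum>k<Suc K. zonal_coeff (e + 1) N i k)"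
      unfolding T[symmetric] by simp
    also have "\<dots> = (2 * s * e) * (\<Sum>k<Suc K. zonal_coeff (N / 2 + s) N 0 k - zonal_coeff (N / 2 + s) N i k)"
      unfolding e1 sum_subtractf right_diff_distrib ..
    finally show ?thesis using s e by simp
  qed
  ultimately have "(\<lambda>K. \<Sum>k<Suc K. zonal_coeff (N / 2 + s) N 0 k - zonal_coeff (N / 2 + s) N i k) \<longlonglongrightarrow> (c i * E i - c 0 * E 0) / (2 * s * e)"
    by simp
  then have *: "(\<lambda>k. zonal_coeff (N / 2 + s) N 0 k - zonal_coeff (N / 2 + s) N i k) sums ((c i * E i - c 0 * E 0) / (2 * s * e))"
    unfolding sums_def by (rule LIMSEQ_imp_Suc)
  define F where "F j = Gamma (2 * real j + N / 2 + s) / Gamma (2 * real j + N / 2 - s)" for j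
  have cE: "c j * E j / (2 * s * e) = Gamma (1 - s) * 2 powr (N / 2 - s - 1) / (s * sqrt pi * Gamma (N / 2 + s)) * F j" for j
  proof -
    define x where "x = 2 * real j + N / 2 + s - 1"
    define y where "y = 2 * real j + N / 2 - s"
    have xy: "x > 0" "y > 0" using s N by (auto simp: x_def y_def)
    have "c j = x * y" by (simp add: c_def x_def y_def e_def field_simps)
    moreover have E_eq: "E j = Gamma (1 - s) * 2 powr (N / 2 - s) / (sqrt pi * Gamma e) * (Gamma x / (y * Gamma y))"
    proof -
      have eqs: "2 * real j + e = x" "2 * real j + N - e = y + 1" "N / 2 - e = 1 - s" "N - e - 1 = N / 2 - s"
        by (auto simp: x_def y_def e_def)
      show ?thesis unfolding E_def eqs Gamma_Suc_pos[OF xy(2)] ..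
    qed
    ultimately have "c j * E j / (2 * s * e) = x * y * (Gamma (1 - s) * 2 powr (N / 2 - s) / (sqrt pi * Gamma e) * (Gamma x / (y * Gamma y))) / (2 * s * e)"
      by (simp only:)
    also have "\<dots> = Gamma (1 - s) * 2 powr (N / 2 - s) / (2 * s * sqrt pi * (e * Gamma e)) * ((x * Gamma x) / Gamma y)"
      using xy by (simp add: mult_ac)
    also have "e * Gamma e = Gamma (N / 2 + s)" using Gamma_Suc_pos[OF e(1)] by (simp add: e1)
    also have "x * Gamma x = Gamma (2 * real j + N / 2 + s)" using Gamma_Suc_pos[OF xy(1)] by (simp add: x_def)
    finally show ?thesis by (simp add: F_def y_def powr_diff)
  qed
  have "(c i * E i - c 0 * E 0) / (2 * s * e) = Gamma (1 - s) * 2 powr (N / 2 - s - 1) / (s * sqrt pi * Gamma (N / 2 + s)) * F i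
      - Gamma (1 - s) * 2 powr (N / 2 - s - 1) / (s * sqrt pi * Gamma (N / 2 + s)) * F 0"
    unfolding cE[symmetric] by (rule diff_divide_distrib)
  then show ?thesis
    using * unfolding right_diff_distrib[symmetric] by (simp add: F_def)
qed

section \<open>Smooth functions\<close>

lemma frechet_derivative_cong_open:
  assumes "open U" "x \<in> U" "\<And>y. y \<in> U \<Longrightarrow> F y = G y"
  shows "frechet_derivative F (at x) = frechet_derivative G (at x)"
proof -
  have "(F has_derivative D) (at x) \<longleftrightarrow> (G has_derivative D) (at x)" for D
    using assms by (metis has_derivative_transform_within_open)
  then show ?thesis by (simp add: frechet_derivative_def)
qed

lemma Ck_on_cong:
  assumes "open U" "\<And>x. x \<in> U \<Longrightarrow> F x = G x"
  shows "Ck_on k U F \<longleftrightarrow> Ck_on k U G"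
  using assms(2)
proof (induction k arbitrary: F G)
  case 0
  then show ?case by (simp cong: continuous_on_cong)
next
  case (Suc k)
  have d: "F differentiable (at x) \<longleftrightarrow> G differentiable (at x)" if "x \<in> U" for x
    unfolding differentiable_def using Suc.prems that assms(1) by (metis has_derivative_transform_within_open)
  have "Ck_on k U (\<lambda>x. frechet_derivative F (at x) v) \<longleftrightarrow> Ck_on k U (\<lambda>x. frechet_derivative G (at x) v)" for v
    by (rule Suc.IH) (use frechet_derivative_cong_open[OF assms(1), of _ F G] Suc.prems in auto)
  then show ?case using d by simp
qed

text \<open>Used for the product rule, whose result contains the undifferentiated factors next to
  their derivatives.\<close>

lemma Ck_on_Suc_imp: "open U \<Longrightarrow> Ck_on (Suc k) U F \<Longrightarrow> Ck_on k U F"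
proof (induction k arbitrary: F)
  case 0
  then show ?case by (auto intro!: continuous_at_imp_continuous_on differentiable_imp_continuous_within)
next
  case (Suc k)
  show ?case unfolding Ck_on.simps(2)[of k]
  proof (intro conjI allI ballI)
    show "F differentiable at x" if "x \<in> U" for x using Suc.prems that by simp
    show "Ck_on k U (\<lambda>x. frechet_derivative F (at x) v)" for v
      using Suc.prems by (intro Suc.IH) auto
  qed
qed

lemma Ck_on_const: "Ck_on k U (\<lambda>x. c)"
  by (induction k arbitrary: c) (auto simp: frechet_derivative_const)

lemma Ck_on_add:
  assumes "open U"
  shows "Ck_on k U F \<Longrightarrow> Ck_on k U G \<Longrightarrow> Ck_on k U (\<lambda>x. F x + G x)"
proof (induction k arbitrary: F G)
  case 0
  then show ?case by (auto intro: continuous_intros)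
next
  case (Suc k)
  have "Ck_on k U (\<lambda>x. frechet_derivative (\<lambda>x. F x + G x) (at x) v)" for v
  proof -
    have "Ck_on k U (\<lambda>x. frechet_derivative F (at x) v + frechet_derivative G (at x) v)"
      using Suc by auto
    moreover have eq: "frechet_derivative (\<lambda>x. F x + G x) (at x) v = frechet_derivative F (at x) v + frechet_derivative G (at x) v" if "x \<in> U" for x
    proof -
      have "((\<lambda>x. F x + G x) has_derivative (\<lambda>v. frechet_derivative F (at x) v + frechet_derivative G (at x) v)) (at x)"
        using Suc.prems that by (intro has_derivative_add) (auto simp: frechet_derivative_works[symmetric])
      from frechet_derivative_at[OF this] show ?thesis by metis
    qed
    ultimately show ?thesis using Ck_on_cong[OF assms eq] by simp
  qed
  then show ?case using Suc.prems by auto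
qed

lemma Ck_on_mult:
  assumes "open U"
  shows "Ck_on k U F \<Longrightarrow> Ck_on k U G \<Longrightarrow> Ck_on k U (\<lambda>x. F x * G x)"
proof (induction k arbitrary: F G)
  case 0
  then show ?case by (auto intro: continuous_intros)
next
  case (Suc k)
  have "Ck_on k U (\<lambda>x. frechet_derivative (\<lambda>x. F x * G x) (at x) v)" for v
  proof -
    have "Ck_on k U F" "Ck_on k U G" using Suc.prems Ck_on_Suc_imp[OF assms] by auto
    then have "Ck_on k U (\<lambda>x. F x * frechet_derivative G (at x) v + frechet_derivative F (at x) v * G x)"
      using Suc by (intro Ck_on_add[OF assms]) auto
    moreover have eq: "frechet_derivative (\<lambda>x. F x * G x) (at x) v = F x * frechet_derivative G (at x) v + frechet_derivative F (at x) v * G x" if "x \<in> U" for x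
    proof -
      have "((\<lambda>x. F x * G x) has_derivative (\<lambda>v. F x * frechet_derivative G (at x) v + frechet_derivative F (at x) v * G x)) (at x)"
        using Suc.prems that by (intro has_derivative_mult) (auto simp: frechet_derivative_works[symmetric])
      from frechet_derivative_at[OF this] show ?thesis by metis
    qed
    ultimately show ?thesis using Ck_on_cong[OF assms eq] by simp
  qed
  then show ?case using Suc.prems by (auto intro: differentiable_mult)
qed

lemma Ck_on_bounded_linear:
  assumes "bounded_linear F"
  shows "Ck_on k U F"
proof (cases k)
  case 0
  then show ?thesis using assms by (simp add: linear_continuous_on)
next
  case (Suc k')
  have "frechet_derivative F (at x) = F" for x
    using bounded_linear_imp_has_derivative[OF assms, of "at x"] frechet_derivative_at by metis
  then show ?thesis using Suc assms bounded_linear_imp_differentiable[OF assms] by (simp add: Ck_on_const)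
qed

lemma Ck_on_real_polynomial: "Ck_on k U (poly p)"
proof (induction k arbitrary: p)
  case 0
  then show ?case by (simp add: continuous_intros)
next
  case (Suc k)
  have d: "(poly p has_derivative (\<lambda>v. poly (pderiv p) x * v)) (at x)" for x
    using poly_DERIV[of p x] by (simp add: has_field_derivative_def)
  have "(\<lambda>x. frechet_derivative (poly p) (at x) v) = poly (smult v (pderiv p))" for v
    using frechet_derivative_at[OF d] by (auto simp: fun_eq_iff mult.commute)
  then show ?case using Suc d by (auto simp: differentiable_def)
qed

lemma C_infinity_poly: "poly p \<in> C_infinity S"
  unfolding C_infinity_def using Ck_on_real_polynomial by (auto intro!: exI[of _ UNIV] exI[of _ "poly p"])

text \<open>A linear functional on the reals is multiplication by its value at 1. So the derivative
  of the composition is a product of real functions, and the induction never has to handle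
  operator-valued derivatives.\<close>

lemma Ck_on_compose_real:
  fixes q :: "'a::euclidean_space \<Rightarrow> real" and F :: "real \<Rightarrow> real"
  assumes V: "open V" and q: "\<And>k. Ck_on k V q" and U: "open U" "q ` V \<subseteq> U"
  shows "Ck_on k U F \<Longrightarrow> Ck_on k V (\<lambda>x. F (q x))"
proof (induction k arbitrary: F)
  case 0
  have "continuous_on V q" using q[of 0] by simp
  then show ?case using 0 U continuous_on_compose2[of U F V q] by simp
next
  case (Suc k)
  have qd: "q differentiable (at x)" if "x \<in> V" for x using q[of 1] that by simp
  have Fd: "F differentiable (at (q x))" if "x \<in> V" for x using Suc.prems U that by auto
  have der: "((\<lambda>x. F (q x)) has_derivative (\<lambda>v. frechet_derivative F (at (q x)) (frechet_derivative q (at x) v))) (at x)" if "x \<in> V" for x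
    using qd[OF that] Fd[OF that] by (intro has_derivative_compose[of q _ x UNIV F, simplified]) (auto simp: frechet_derivative_works[symmetric])
  have lin: "frechet_derivative F (at (q x)) w = w * frechet_derivative F (at (q x)) 1" if "x \<in> V" for x w
    using linear_frechet_derivative[OF Fd[OF that]] linear_scale[of "frechet_derivative F (at (q x))" w 1] by simp
  have "Ck_on k V (\<lambda>x. frechet_derivative (\<lambda>x. F (q x)) (at x) v)" for v
  proof -
    have "Ck_on k V (\<lambda>x. frechet_derivative q (at x) v)" using q[of "Suc k"] by simp
    moreover have "Ck_on k V (\<lambda>x. frechet_derivative F (at (q x)) 1)"
      by (rule Suc.IH) (use Suc.prems in auto)
    ultimately have "Ck_on k V (\<lambda>x. frechet_derivative q (at x) v * frechet_derivative F (at (q x)) 1)"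
      by (rule Ck_on_mult[OF V])
    moreover have eq: "frechet_derivative (\<lambda>x. F (q x)) (at x) v = frechet_derivative q (at x) v * frechet_derivative F (at (q x)) 1" if "x \<in> V" for x
      using frechet_derivative_at[OF der[OF that]] lin[OF that] by metis
    ultimately show ?thesis using Ck_on_cong[OF V eq] by simp
  qed
  then show ?case using der by (auto simp: differentiable_def)
qed

lemma Ck_on_inner_self:
  fixes p :: "'a::euclidean_space \<Rightarrow> 'b::euclidean_space"
  assumes "open V" "bounded_linear p"
  shows "Ck_on k V (\<lambda>x. (norm (p x))\<^sup>2)"
proof -
  have "Ck_on k V (\<lambda>x. \<Sum>b\<in>B. (p x \<bullet> b) * (p x \<bullet> b))" if "finite B" for B
    using that
  proof (induction B rule: finite_induct)
    case (insert b B)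
    have "bounded_linear (\<lambda>x. p x \<bullet> b)" using bounded_linear_compose[OF bounded_linear_inner_left assms(2)] .
    then have "Ck_on k V (\<lambda>x. p x \<bullet> b)" by (rule Ck_on_bounded_linear)
    then show ?case using insert Ck_on_add[OF assms(1) Ck_on_mult[OF assms(1)]] by simp
  qed (simp add: Ck_on_const)
  from this[OF finite_Basis] show ?thesis by (simp add: power2_norm_eq_inner euclidean_inner[of "p _" "p _"])
qed

lemma C_infinityD:
  assumes "u \<in> C_infinity S" "x \<in> S"
  shows "\<exists>U F. open U \<and> x \<in> U \<and> (\<forall>k. Ck_on k U F) \<and> (\<forall>z\<in>S \<inter> U. u z = F z)"
  using assms by (simp add: C_infinity_def)

text \<open>Since \<open>f_map\<close> is a quadratic polynomial on the whole space, a local smooth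
  extension of \<open>\<phi>\<close> near \<open>f_map z\<close> pulls back to one near
  \<open>z\<close>. On the fibres over the endpoints this uses smoothness of \<open>\<phi>\<close>
  up to the boundary.\<close>

lemma C_infinity_f_map:
  assumes "\<phi> \<in> C_infinity {-1..1}" and r: "\<And>z. z \<in> S \<Longrightarrow> f_map z \<in> {-1..1}"
  shows "(\<lambda>z :: (real^'m) \<times> (real^'n). \<phi> (f_map z)) \<in> C_infinity S"
  unfolding C_infinity_def mem_Collect_eq
proof (intro ballI)
  fix z :: "(real^'m) \<times> (real^'n)" assume z: "z \<in> S"
  obtain U F where UF0: "open U \<and> f_map z \<in> U \<and> (\<forall>k. Ck_on k U F) \<and> (\<forall>t\<in>{-1..1} \<inter> U. \<phi> t = F t)"
    using C_infinityD[OF assms(1) r[OF z]] by (elim exE)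
  then have UF: "open U" "f_map z \<in> U" "\<And>k. Ck_on k U F" "\<And>t. t \<in> {-1..1} \<inter> U \<Longrightarrow> \<phi> t = F t" by auto
  define V where "V = (f_map :: (real^'m) \<times> (real^'n) \<Rightarrow> real) -` U"
  have "continuous_on UNIV (f_map :: (real^'m) \<times> (real^'n) \<Rightarrow> real)"
    unfolding f_map_def[abs_def] by (intro continuous_intros)
  then have V: "open V" unfolding V_def using UF(1) by (simp add: continuous_on_open_vimage)
  have q: "Ck_on k V (f_map :: (real^'m) \<times> (real^'n) \<Rightarrow> real)" for k
  proof -
    have "Ck_on k V (\<lambda>z :: (real^'m) \<times> (real^'n). (norm (fst z))\<^sup>2 + (- 1) * (norm (snd z))\<^sup>2)"
      by (intro Ck_on_add Ck_on_mult Ck_on_const Ck_on_inner_self V bounded_linear_fst bounded_linear_snd)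
    then show ?thesis by (simp add: f_map_def[abs_def])
  qed
  have "Ck_on k V (\<lambda>z. F (f_map z))" for k
    by (rule Ck_on_compose_real[OF V q UF(1) _ UF(3)]) (auto simp: V_def)
  then show "\<exists>U F. open U \<and> z \<in> U \<and> (\<forall>k. Ck_on k U F) \<and> (\<forall>z\<in>S \<inter> U. \<phi> (f_map z) = F z)"
    using V UF r by (intro exI[of _ V] exI[of _ "\<lambda>z. F (f_map z)"]) (auto simp: V_def)
qed

lemma C_infinity_continuous_on:
  assumes "u \<in> C_infinity S"
  shows "continuous_on S u"
  unfolding continuous_on_eq_continuous_within
proof
  fix x assume "x \<in> S"
  obtain U F where UF0: "open U \<and> x \<in> U \<and> (\<forall>k. Ck_on k U F) \<and> (\<forall>z\<in>S \<inter> U. u z = F z)"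
    using C_infinityD[OF assms \<open>x \<in> S\<close>] by (elim exE)
  then have UF: "open U" "x \<in> U" "\<And>k. Ck_on k U F" "\<And>z. z \<in> S \<inter> U \<Longrightarrow> u z = F z" by auto
  have "continuous_on (S \<inter> U) F" using UF(3)[of 0] by (auto intro: continuous_on_subset)
  then have "continuous_on (S \<inter> U) u" by (subst continuous_on_cong[OF refl UF(4)])
  then have "continuous (at x within (S \<inter> U)) u"
    using \<open>x \<in> S\<close> UF(2) by (simp add: continuous_on_eq_continuous_within)
  moreover have "at x within (S \<inter> U) = at x within S"
    by (rule at_within_nhd[of x U]) (use UF in auto)
  ultimately show "continuous (at x within S) u" by simp
qed

text \<open>Near each point the extension has bounded derivative on a ball; the mean value
  inequality is applied there because \<open>S\<close> itself need not be convex. If no global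
  constant existed, there would be pairs \<open>X n\<close>, \<open>Y n\<close> with difference
  quotients above \<open>n\<close>. As \<open>u\<close> is bounded on \<open>S\<close>, their
  distance tends to 0, so they accumulate at one point, against the local estimate.\<close>

lemma C_infinity_Lipschitz:
  fixes u :: "'a::euclidean_space \<Rightarrow> real"
  assumes u: "u \<in> C_infinity S" and S: "compact S"
  shows "\<exists>L. \<forall>x\<in>S. \<forall>y\<in>S. \<bar>u x - u y\<bar> \<le> L * norm (x - y)"
proof -
  have loc: "\<exists>r L. 0 < r \<and> (\<forall>y\<in>S \<inter> ball x r. \<forall>z\<in>S \<inter> ball x r. \<bar>u y - u z\<bar> \<le> L * norm (y - z))" if "x \<in> S" for x
  proof -
    obtain U F where UF0: "open U \<and> x \<in> U \<and> (\<forall>k. Ck_on k U F) \<and> (\<forall>z\<in>S \<inter> U. u z = F z)"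
    using C_infinityD[OF u \<open>x \<in> S\<close>] by (elim exE)
  then have UF: "open U" "x \<in> U" "\<And>k. Ck_on k U F" "\<And>z. z \<in> S \<inter> U \<Longrightarrow> u z = F z" by auto
    obtain r where r: "0 < r" "cball x r \<subseteq> U" using UF(1,2) open_contains_cball by blast
    have "\<exists>B. \<forall>y\<in>cball x r. \<bar>frechet_derivative F (at y) b\<bar> \<le> B" for b
    proof -
      have "continuous_on (cball x r) (\<lambda>y. frechet_derivative F (at y) b)"
        using UF(3)[of 1] r(2) by (auto intro: continuous_on_subset)
      then have "bounded ((\<lambda>y. frechet_derivative F (at y) b) ` cball x r)"
        by (intro compact_imp_bounded compact_continuous_image) auto
      then show ?thesis by (auto simp: bounded_iff)
    qed
    then have "\<forall>b. \<exists>B. \<forall>y\<in>cball x r. \<bar>frechet_derivative F (at y) b\<bar> \<le> B" by simp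
    from choice[OF this] obtain B where "\<forall>b. \<forall>y\<in>cball x r. \<bar>frechet_derivative F (at y) b\<bar> \<le> B b" by (elim exE)
    then have B: "\<bar>frechet_derivative F (at y) b\<bar> \<le> B b" if "y \<in> cball x r" for b y using that by blast
    define L where "L = (\<Sum>b\<in>Basis. \<bar>B b\<bar>)"
    have Fd: "(F has_derivative frechet_derivative F (at y)) (at y)" if "y \<in> cball x r" for y
      using UF(3)[of 1] r(2) that by (auto simp: frechet_derivative_works[symmetric])
    have on: "onorm (frechet_derivative F (at y)) \<le> L" if "y \<in> cball x r" for y
    proof (rule onorm_le)
      fix v :: 'a
      have lin: "linear (frechet_derivative F (at y))" using Fd[OF that] has_derivative_linear by blast
      have "frechet_derivative F (at y) v = (\<Sum>b\<in>Basis. (v \<bullet> b) * frechet_derivative F (at y) b)"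
        by (subst (1) euclidean_representation[of v, symmetric]) (simp add: linear_sum[OF lin] linear_scale[OF lin])
      then have "norm (frechet_derivative F (at y) v) \<le> (\<Sum>b\<in>Basis. norm ((v \<bullet> b) * frechet_derivative F (at y) b))"
        by (simp only: norm_sum)
      also have "\<dots> \<le> (\<Sum>b\<in>Basis. norm v * \<bar>B b\<bar>)"
      proof (intro sum_mono)
        fix b :: 'a assume "b \<in> Basis"
        moreover have "\<bar>frechet_derivative F (at y) b\<bar> \<le> \<bar>B b\<bar>" using B[OF that, of b] by linarith
        ultimately show "norm ((v \<bullet> b) * frechet_derivative F (at y) b) \<le> norm v * \<bar>B b\<bar>"
          unfolding real_norm_def abs_mult by (intro mult_mono Basis_le_norm) auto
      qed
      finally show "norm (frechet_derivative F (at y) v) \<le> L * norm v" by (simp add: L_def sum_distrib_left mult.commute)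
    qed
    have "\<bar>u y - u z\<bar> \<le> L * norm (y - z)" if "y \<in> S \<inter> ball x r" "z \<in> S \<inter> ball x r" for y z
    proof -
      have "norm (F y - F z) \<le> L * norm (y - z)"
        by (rule differentiable_bound[of "cball x r" F "\<lambda>y. frechet_derivative F (at y)"])
           (use that on Fd in \<open>auto intro: has_derivative_at_withinI\<close>)
      moreover have "y \<in> S \<inter> U" "z \<in> S \<inter> U" using r(2) that by (auto simp: subset_iff)
      ultimately show ?thesis using UF(4)[of y] UF(4)[of z] by simp
    qed
    then show ?thesis using r(1) by blast
  qed
  have cont: "continuous_on S u" by (rule C_infinity_continuous_on[OF u])
  show ?thesis
  proof (rule ccontr)
    assume "\<not> ?thesis"
    then have "\<forall>n::nat. \<exists>x y. x \<in> S \<and> y \<in> S \<and> \<bar>u x - u y\<bar> > real n * norm (x - y)" by (meson not_le)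
    then obtain X Y where XY: "\<And>n. X n \<in> S" "\<And>n. Y n \<in> S" "\<And>n. \<bar>u (X n) - u (Y n)\<bar> > real n * norm (X n - Y n)" by metis
    have "bounded (u ` S)" using cont S by (intro compact_imp_bounded compact_continuous_image)
    then obtain C where C: "\<And>x. x \<in> S \<Longrightarrow> \<bar>u x\<bar> \<le> C" by (auto simp: bounded_iff)
    obtain x r where xr: "x \<in> S" "strict_mono r" "(X \<circ> r) \<longlonglongrightarrow> x"
      using S XY(1) unfolding compact_def by blast
    have n0: "(\<lambda>n. X n - Y n) \<longlonglongrightarrow> 0"
    proof (rule tendsto_norm_zero_cancel, rule tendsto_sandwich[OF _ _ tendsto_const])
      show "\<forall>\<^sub>F n in sequentially. norm (X n - Y n) \<le> 2 * C / real n"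
        using eventually_gt_at_top[of 0]
      proof eventually_elim
        case (elim n)
        have "real n * norm (X n - Y n) \<le> 2 * C" using XY(3)[of n] C[OF XY(1), of n] C[OF XY(2), of n] by linarith
        then show ?case using elim by (simp add: field_simps)
      qed
      show "(\<lambda>n. 2 * C / real n) \<longlonglongrightarrow> 0" by (rule lim_const_over_n)
    qed auto
    have "(\<lambda>n. X (r n) - Y (r n)) \<longlonglongrightarrow> 0" using LIMSEQ_subseq_LIMSEQ[OF n0 xr(2)] by (simp add: o_def)
    then have "(\<lambda>n. X (r n) - (X (r n) - Y (r n))) \<longlonglongrightarrow> x - 0" using xr(3) by (intro tendsto_diff) (auto simp: o_def)
    then have Yx: "(\<lambda>n. Y (r n)) \<longlonglongrightarrow> x" by simp
    obtain \<rho> L where \<rho>: "0 < \<rho>" "\<And>y z. y \<in> S \<inter> ball x \<rho> \<Longrightarrow> z \<in> S \<inter> ball x \<rho> \<Longrightarrow> \<bar>u y - u z\<bar> \<le> L * norm (y - z)"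
      using loc[OF xr(1)] by blast
    have "\<forall>\<^sub>F n in sequentially. X (r n) \<in> ball x \<rho>" "\<forall>\<^sub>F n in sequentially. Y (r n) \<in> ball x \<rho>"
      using topological_tendstoD[OF xr(3), of "ball x \<rho>"] topological_tendstoD[OF Yx, of "ball x \<rho>"] \<rho>(1) by (auto simp: o_def)
    moreover have "\<forall>\<^sub>F n in sequentially. real n \<ge> L" using eventually_ge_at_top[of "nat \<lceil>L\<rceil>"] by eventually_elim linarith
    ultimately have "\<forall>\<^sub>F n in sequentially. False"
    proof eventually_elim
      case (elim n)
      have "\<bar>u (X (r n)) - u (Y (r n))\<bar> \<le> L * norm (X (r n) - Y (r n))" using elim XY by (intro \<rho>) auto
      also have "\<dots> \<le> real (r n) * norm (X (r n) - Y (r n))"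
        using elim seq_suble[OF xr(2), of n] by (intro mult_right_mono) auto
      finally show ?case using XY(3)[of "r n"] by simp
    qed
    then show False by simp
  qed
qed

section \<open>Jacobi polynomials\<close>

text \<open>At \<open>t = f(x, y)\<close> on the sphere this polynomial has the value \<open>|x|\<^sup>2\<^sup>j |y|\<^sup>2\<^sup>l\<close>.\<close>

definition YV :: "nat \<Rightarrow> nat \<Rightarrow> real poly" where
  "YV j l = [:1/2, 1/2:] ^ j * [:1/2, -1/2:] ^ l"

definition jacobi_op :: "real \<Rightarrow> real \<Rightarrow> real poly \<Rightarrow> real poly" where
  "jacobi_op a b p = [:1, 0, -1:] * pderiv (pderiv p) + [:b - a, -(a + b + 2):] * pderiv p"

lemma poly_YV: "poly (YV j l) t = ((1 + t) / 2) ^ j * ((1 - t) / 2) ^ l"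
  by (simp add: YV_def poly_power add_divide_distrib diff_divide_distrib)

lemma YV_split: "YV j l = YV (Suc j) l + YV j (Suc l)"
  by (rule poly_ext) (simp add: poly_YV field_simps)

lemma YV_mult: "YV j l * YV j' l' = YV (j + j') (l + l')"
  by (simp add: YV_def power_add mult_ac)

lemma YV_0_0 [simp]: "YV 0 0 = 1" by (simp add: YV_def)

lemma degree_YV: "degree (YV j l) = j + l"
  unfolding YV_def by (subst degree_mult_eq) (auto simp: degree_power_eq)

lemma YV_nonzero: "YV j l \<noteq> 0" by (simp add: YV_def)

lemma pderiv_YV: "pderiv (YV j l) = smult (real j / 2) (YV (j - 1) l) - smult (real l / 2) (YV j (l - 1))"
proof -
  have 1: "pderiv ([:1/2, 1/2:] ^ j :: real poly) = smult (real j / 2) ([:1/2, 1/2:] ^ (j - 1))" for j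
    by (simp add: pderiv_power pderiv_pCons)
  have 2: "pderiv ([:1/2, -1/2:] ^ j :: real poly) = - smult (real j / 2) ([:1/2, -1/2:] ^ (j - 1))" for j
    by (simp add: pderiv_power pderiv_pCons)
  show ?thesis unfolding YV_def pderiv_mult 1 2 by (simp add: mult_ac)
qed

lemma smult_sum_right: "smult c (sum f A) = (\<Sum>x\<in>A. smult c (f x :: real poly))"
  by (induction A rule: infinite_finite_induct) (auto simp: smult_add_right)

lemma jacobi_op_add: "jacobi_op a b (p + q) = jacobi_op a b p + jacobi_op a b q"
  unfolding jacobi_op_def pderiv_add distrib_left by (simp only: ac_simps)

lemma jacobi_op_smult: "jacobi_op a b (smult c p) = smult c (jacobi_op a b p)"
  by (simp add: jacobi_op_def pderiv_smult smult_add_right)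

lemma jacobi_op_0 [simp]: "jacobi_op a b 0 = 0"
  by (simp add: jacobi_op_def)

lemma jacobi_op_1 [simp]: "jacobi_op a b 1 = 0"
  by (simp add: jacobi_op_def)

lemma jacobi_op_sum: "jacobi_op a b (sum f A) = (\<Sum>x\<in>A. jacobi_op a b (f x))"
  by (induction A rule: infinite_finite_induct) (auto simp: jacobi_op_add)

text \<open>With \<open>y = (1 + t)/2\<close> and \<open>v = (1 - t)/2\<close> the operator sends
  the monomial \<open>y^j v^l\<close> to its neighbours of the same total degree
  \<open>j + l\<close>. Since \<open>y + v = 1\<close>, these monomials are not independent across
  degrees, but within a fixed degree the operator is tridiagonal, which is what the commutation
  argument uses.\<close>

lemma jacobi_op_YV:
  "jacobi_op a b (YV j l) = smult (real j * (real j + b)) (YV (j - 1) (Suc l)) + smult (real l * (real l + a)) (YV (Suc j) (l - 1))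
     - smult (2 * real j * real l + (a + 1) * real j + (b + 1) * real l) (YV j l)"
proof (rule poly_ext)
  fix t :: real
  define y v where "y = (1 + t) / 2" and "v = (1 - t) / 2"
  have t: "1 - t\<^sup>2 = 4 * y * v" "b - a - (a + b + 2) * t = 2 * ((b + 1) * v - (a + 1) * y)"
    by (simp_all add: y_def v_def field_simps power2_eq_square)
  have p1: "2 * poly (pderiv (YV j l)) t = real j * (y ^ (j - 1) * v ^ l) - real l * (y ^ j * v ^ (l - 1))" for j l
    by (simp add: pderiv_YV poly_YV y_def v_def)
  have p2: "4 * poly (pderiv (pderiv (YV j l))) t = real j * (real (j - 1) * (y ^ (j - 1 - 1) * v ^ l) - real l * (y ^ (j - 1) * v ^ (l - 1)))
      - real l * (real j * (y ^ (j - 1) * v ^ (l - 1)) - real (l - 1) * (y ^ j * v ^ (l - 1 - 1)))"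
  proof -
    have "4 * poly (pderiv (pderiv (YV j l))) t = real j * (2 * poly (pderiv (YV (j - 1) l)) t) - real l * (2 * poly (pderiv (YV j (l - 1))) t)"
      by (simp only: pderiv_YV[of j l] pderiv_diff pderiv_smult poly_diff poly_smult) simp
    then show ?thesis unfolding p1 .
  qed
  have "poly (jacobi_op a b (YV j l)) t = (1 - t\<^sup>2) * poly (pderiv (pderiv (YV j l))) t + (b - a - (a + b + 2) * t) * poly (pderiv (YV j l)) t"
    by (simp add: jacobi_op_def algebra_simps power2_eq_square)
  also have "\<dots> = y * v * (4 * poly (pderiv (pderiv (YV j l))) t) + ((b + 1) * v - (a + 1) * y) * (2 * poly (pderiv (YV j l)) t)"
    unfolding t by simp
  also have "\<dots> = poly (smult (real j * (real j + b)) (YV (j - 1) (Suc l)) + smult (real l * (real l + a)) (YV (Suc j) (l - 1))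
     - smult (2 * real j * real l + (a + 1) * real j + (b + 1) * real l) (YV j l)) t"
    unfolding p1 p2
    unfolding poly_add poly_diff poly_smult poly_YV y_def[symmetric] v_def[symmetric]
    by (cases j; cases "j - 1"; cases l; cases "l - 1") (simp_all add: algebra_simps)
  finally show "poly (jacobi_op a b (YV j l)) t = \<dots>" .
qed

lemma coeff_jacobi_op:
  "coeff (jacobi_op a b p) j = (real j + 2) * (real j + 1) * coeff p (j + 2) + (b - a) * (real j + 1) * coeff p (j + 1) - real j * (real j + a + b + 1) * coeff p j"
proof -
  have m: "coeff ([:c0, c1, c2:] * q) j = c0 * coeff q j + (if j \<ge> 1 then c1 * coeff q (j - 1) else 0) + (if j \<ge> 2 then c2 * coeff q (j - 2) else 0)" for c0 c1 c2 :: real and q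
    by (cases j; cases "j - 1") (auto simp: coeff_pCons)
  have m2: "coeff ([:c0, c1:] * q) j = c0 * coeff q j + (if j \<ge> 1 then c1 * coeff q (j - 1) else 0)" for c0 c1 :: real and q
    by (cases j) (auto simp: coeff_pCons)
  show ?thesis
  proof (cases j)
    case 0
    then show ?thesis by (simp add: jacobi_op_def m m2 coeff_pderiv)
  next
    case (Suc i)
    then show ?thesis by (cases i) (simp_all add: jacobi_op_def m m2 coeff_pderiv algebra_simps)
  qed
qed

text \<open>The Jacobi polynomial normalised by the value \<open>1\<close> at \<open>t = 1\<close>, in hypergeometric form.\<close>

definition jacobi_R :: "real \<Rightarrow> real \<Rightarrow> nat \<Rightarrow> real poly" where
  "jacobi_R a b i = (\<Sum>j\<le>i. smult (pochhammer (- real i) j * pochhammer (real i + a + b + 1) j / (fact j * pochhammer (a + 1) j)) (YV 0 j))"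

section \<open>Jacobi polynomials as the polynomial eigenvectors of the Jacobi operator\<close>

context
  fixes a b :: real
  assumes ab: "a \<ge> 0" "b \<ge> 0"
begin

text \<open>In powers of \<open>(1 - t)/2\<close> the operator produces only the same power and the
  next lower one, so the eigenvalue equation is a two-term recursion, solved by the hypergeometric
  coefficients.\<close>

lemma jacobi_R_eigen: "jacobi_op a b (jacobi_R a b i) = smult (- real i * (real i + a + b + 1)) (jacobi_R a b i)"
proof -
  define r where "r j = pochhammer (- real i) j * pochhammer (real i + a + b + 1) j / (fact j * pochhammer (a + 1) j)" for j
  have R: "jacobi_R a b i = (\<Sum>j\<le>i. smult (r j) (YV 0 j))" by (simp add: jacobi_R_def r_def)
  have rec: "r (Suc j) * (real (Suc j) * (real (Suc j) + a)) = r j * (real j * (real j + a + b + 1) - real i * (real i + a + b + 1))" for j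
  proof -
    have "a + 1 + real j \<noteq> 0" "pochhammer (a + 1) j \<noteq> 0" using ab pochhammer_pos[of "a + 1" j] by auto
    then show ?thesis
      unfolding r_def pochhammer_Suc fact_Suc
      by (simp add: divide_simps del: of_nat_Suc) (simp add: algebra_simps)
  qed
  \<comment> \<open>\<open>pochhammer (- i) (Suc i)\<close> contains the factor 0. The coefficient
    after the last one thus satisfies the recursion too, and the sum can be shifted by one
    index.\<close>
  have r0: "r (Suc i) = 0" by (simp add: r_def pochhammer_of_nat_eq_0_lemma)
  have V: "jacobi_op a b (YV 0 j) = smult (real j * (real j + a)) (YV 0 (j - 1)) - smult (real j * (real j + a + b + 1)) (YV 0 j)" for j
  proof (cases j)
    case (Suc i)
    have key: "smult c (YV (Suc 0) i) = smult c (YV 0 i) - smult c (YV 0 (Suc i))" for c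
      using YV_split[of 0 i] by (simp add: smult_diff_right[symmetric])
    have "real j * (real j + a + b + 1) = real j * (real j + a) + (b + 1) * real j" by (simp add: algebra_simps)
    then show ?thesis unfolding jacobi_op_YV by (simp add: Suc smult_add_left key)
  qed (simp add: jacobi_op_YV)
  have "jacobi_op a b (jacobi_R a b i) = (\<Sum>j\<le>i. smult (r j * (real j * (real j + a))) (YV 0 (j - 1))) - (\<Sum>j\<le>i. smult (r j * (real j * (real j + a + b + 1))) (YV 0 j))"
    by (simp add: R jacobi_op_sum jacobi_op_smult V smult_diff_right sum_subtractf)
  also have "(\<Sum>j\<le>i. smult (r j * (real j * (real j + a))) (YV 0 (j - 1))) = (\<Sum>j\<le>Suc i. smult (r j * (real j * (real j + a))) (YV 0 (j - 1)))"
    by (simp add: r0)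
  also have "\<dots> = (\<Sum>j\<le>i. smult (r (Suc j) * (real (Suc j) * (real (Suc j) + a))) (YV 0 j))"
    by (subst sum.atMost_Suc_shift) simp
  also have "\<dots> = (\<Sum>j\<le>i. smult (r j * (real j * (real j + a + b + 1) - real i * (real i + a + b + 1))) (YV 0 j))"
    by (simp only: rec)
  finally show ?thesis
    by (simp add: R sum_subtractf[symmetric] smult_diff_left[symmetric] right_diff_distrib smult_sum_right mult_ac flip: sum_negf)
qed

lemma degree_jacobi_R: "degree (jacobi_R a b i) = i" and jacobi_R_nonzero: "jacobi_R a b i \<noteq> 0"
proof -
  define r where "r j = pochhammer (- real i) j * pochhammer (real i + a + b + 1) j / (fact j * pochhammer (a + 1) j)" for j
  have "pochhammer (- real i) i \<noteq> 0" by (simp add: pochhammer_eq_0_iff)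
  moreover have "pochhammer (real i + a + b + 1) i > 0" "pochhammer (a + 1) i > 0" using ab by (auto intro!: pochhammer_pos)
  ultimately have ri: "r i \<noteq> 0" by (simp add: r_def)
  have c: "coeff (smult (r i) (YV 0 i)) i \<noteq> 0"
    using ri degree_YV[of 0 i] YV_nonzero[of 0 i] by (metis add_0 coeff_smult leading_coeff_0_iff mult_eq_0_iff)
  have "(\<Sum>j<i. coeff (smult (r j) (YV 0 j)) i) = 0"
    by (intro sum.neutral ballI) (simp add: coeff_eq_0 degree_YV)
  then have "coeff (jacobi_R a b i) i = coeff (smult (r i) (YV 0 i)) i"
    unfolding jacobi_R_def r_def[symmetric] coeff_sum lessThan_Suc_atMost[symmetric] by simp
  then have 1: "coeff (jacobi_R a b i) i \<noteq> 0" using c by simp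
  then show "jacobi_R a b i \<noteq> 0" by auto
  have "degree (jacobi_R a b i) \<le> i"
    unfolding jacobi_R_def by (intro degree_sum_le) (auto simp: degree_YV intro!: order.trans[OF degree_smult_le])
  then show "degree (jacobi_R a b i) = i" using 1 le_degree[of "jacobi_R a b i" i] by simp
qed

lemma poly_jacobi_R_1: "poly (jacobi_R a b i) 1 = 1"
proof -
  have "poly (jacobi_R a b i) 1 = (\<Sum>j\<le>i. pochhammer (- real i) j * pochhammer (real i + a + b + 1) j / (fact j * pochhammer (a + 1) j) * 0 ^ j)"
    by (simp add: jacobi_R_def poly_sum poly_YV)
  also have "\<dots> = 1" by (subst sum.atMost_shift) simp
  finally show ?thesis .
qed

text \<open>Comparing top coefficients gives \<open>j (j + a + b + 1) = i (i + a + b + 1)\<close>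
  for the degree \<open>j\<close>; the other root \<open>- (i + a + b + 1)\<close> is
  negative.\<close>

lemma jacobi_eigen_degree:
  assumes "jacobi_op a b q = smult (- real i * (real i + a + b + 1)) q" "q \<noteq> 0"
  shows "degree q = i"
proof -
  define j where "j = degree q"
  have "coeff (jacobi_op a b q) j = - real j * (real j + a + b + 1) * coeff q j"
    by (simp add: coeff_jacobi_op j_def coeff_eq_0)
  then have "(real j * (real j + a + b + 1) - real i * (real i + a + b + 1)) * lead_coeff q = 0"
    unfolding assms(1) by (simp add: j_def algebra_simps)
  then have "real j * (real j + a + b + 1) - real i * (real i + a + b + 1) = 0"
    using assms(2) by simp
  then have "(real j - real i) * (real j + real i + a + b + 1) = 0" by (simp add: algebra_simps)
  moreover have "real j + real i + a + b + 1 > 0" using ab by simp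
  ultimately show ?thesis by (simp add: j_def)
qed

text \<open>Subtracting the multiple that cancels the coefficient of degree \<open>i\<close> leaves
  an eigenvector which, if nonzero, would have degree \<open>i\<close> after all. The factor is
  identified at \<open>t = 1\<close>, where \<open>jacobi_R\<close> is 1.\<close>

lemma jacobi_eigen_unique:
  assumes "jacobi_op a b q = smult (- real i * (real i + a + b + 1)) q"
  shows "q = smult (poly q 1) (jacobi_R a b i)"
proof (cases "q = 0")
  case False
  define c where "c = lead_coeff q / lead_coeff (jacobi_R a b i)"
  define r where "r = q - smult c (jacobi_R a b i)"
  have d: "degree q = i" by (rule jacobi_eigen_degree[OF assms False])
  have c0: "coeff r i = 0" using d jacobi_R_nonzero[of i] by (simp add: r_def c_def degree_jacobi_R)
       (metis degree_jacobi_R leading_coeff_0_iff nonzero_eq_divide_eq)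
  have "jacobi_op a b r = jacobi_op a b (q + smult (- c) (jacobi_R a b i))" by (simp add: r_def)
  also have "\<dots> = smult (- real i * (real i + a + b + 1)) r"
    unfolding jacobi_op_add jacobi_op_smult assms jacobi_R_eigen r_def by (simp add: smult_diff_right mult_ac)
  finally have "r \<noteq> 0 \<Longrightarrow> degree r = i" by (rule jacobi_eigen_degree)
  then have "r = 0" using c0 by (metis leading_coeff_0_iff)
  then have q: "q = smult c (jacobi_R a b i)" by (simp add: r_def)
  then have "poly q 1 = c" by (simp add: poly_jacobi_R_1)
  then show ?thesis using q by metis
qed simp

text \<open>Existence and uniqueness behind the definite description: the differential equation says
  that \<open>P\<close> is an eigenvector, hence a multiple of \<open>jacobi_R\<close>, and the
  leading coefficient 1 fixes the multiple.\<close>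

lemma jacobi_poly_eq: "jacobi_poly a b i = smult (1 / lead_coeff (jacobi_R a b i)) (jacobi_R a b i)"
  unfolding jacobi_poly_def
proof (rule the_equality)
  let ?R = "jacobi_R a b i"
  have ode: "(\<forall>t. (1 - t\<^sup>2) * poly (pderiv (pderiv P)) t + (b - a - (a + b + 2) * t) * poly (pderiv P) t
          + real i * (real i + a + b + 1) * poly P t = 0) \<longleftrightarrow> jacobi_op a b P = smult (- real i * (real i + a + b + 1)) P" for P
  proof -
    have "poly (jacobi_op a b P) t = (1 - t\<^sup>2) * poly (pderiv (pderiv P)) t + (b - a - (a + b + 2) * t) * poly (pderiv P) t" for t
      by (simp add: jacobi_op_def algebra_simps power2_eq_square)
    then show ?thesis unfolding poly_eq_poly_eq_iff[symmetric] fun_eq_iff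
      by (simp add: algebra_simps add_eq_0_iff2) (smt (verit))
  qed
  have lc: "lead_coeff ?R \<noteq> 0" using jacobi_R_nonzero by simp
  show "lead_coeff (smult (1 / lead_coeff ?R) ?R) = 1 \<and> degree (smult (1 / lead_coeff ?R) ?R) = i \<and>
     (\<forall>t. (1 - t\<^sup>2) * poly (pderiv (pderiv (smult (1 / lead_coeff ?R) ?R))) t + (b - a - (a + b + 2) * t) * poly (pderiv (smult (1 / lead_coeff ?R) ?R)) t
          + real i * (real i + a + b + 1) * poly (smult (1 / lead_coeff ?R) ?R) t = 0)"
    unfolding ode jacobi_op_smult jacobi_R_eigen using lc by (simp add: degree_jacobi_R mult_ac)
  fix P assume P: "lead_coeff P = 1 \<and> degree P = i \<and> (\<forall>t. (1 - t\<^sup>2) * poly (pderiv (pderiv P)) t + (b - a - (a + b + 2) * t) * poly (pderiv P) t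
          + real i * (real i + a + b + 1) * poly P t = 0)"
  then have "P = smult (poly P 1) ?R" unfolding ode by (intro jacobi_eigen_unique) auto
  moreover from this P have "poly P 1 * lead_coeff ?R = 1" by (metis lead_coeff_smult)
  ultimately show "P = smult (1 / lead_coeff ?R) ?R" using lc by (metis nonzero_eq_divide_eq)
qed

end


text \<open>\<open>I\<close> abstracts integration against a multiple of \<open>(1 - t)\<^sup>a (1 + t)\<^sup>b\<close>; its values on the \<open>YV j l\<close> are Beta integrals.\<close>

locale jacobi_functional =
  fixes a b C0 :: real and I :: "real poly \<Rightarrow> real"
  assumes ab: "a \<ge> 0" "b \<ge> 0" and C0: "C0 > 0"
    and I_add: "I (p + q) = I p + I q"
    and I_smult: "I (smult c p) = c * I p"
    and I_YV: "I (YV j l) = C0 * (Gamma (real j + b + 1) * Gamma (real l + a + 1) / Gamma (real j + real l + a + b + 2))"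
begin

lemma I_0 [simp]: "I 0 = 0"
  using I_smult[of 0 0] by simp

lemma I_diff: "I (p - q) = I p - I q"
  using I_add[of p "smult (-1) q"] I_smult[of "-1" q] by simp

lemma I_sum: "I (sum f A) = (\<Sum>x\<in>A. I (f x))"
  by (induction A rule: infinite_finite_induct) (auto simp: I_add)

lemma poly_YV_expansion: "\<exists>c. q = (\<Sum>j\<le>degree q. smult (c j) (YV j 0))"
  by (rule poly_expansion_basis) (auto simp: degree_YV YV_nonzero)

text \<open>For the weight \<open>(1 - t)^a (1 + t)^b\<close>, the weight times the argument of
  \<open>I\<close> is the derivative of \<open>(1 - t)^(a + 1) (1 + t)^(b + 1) g\<close>, which
  vanishes at both ends. As \<open>I\<close> is given only by its values, the identity is checked on
  the basis \<open>YV j 0\<close>, where it is the functional equation of Gamma.\<close>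

lemma I_divergence: "I ([:1, 0, -1:] * pderiv g + [:b - a, -(a + b + 2):] * g) = 0"
proof -
  obtain c where c: "g = (\<Sum>j\<le>degree g. smult (c j) (YV j 0))" using poly_YV_expansion by blast
  define F where "F g = [:1, 0, -1:] * pderiv g + [:b - a, -(a + b + 2):] * g" for g :: "real poly"
  have F_sum: "F (\<Sum>j\<in>A. smult (c j) (YV j 0)) = (\<Sum>j\<in>A. smult (c j) (F (YV j 0)))" for A
  proof (induction A rule: infinite_finite_induct)
    case (insert x A)
    then show ?case unfolding F_def
      by (simp only: sum.insert insert pderiv_add pderiv_smult distrib_left mult_smult_right mult_smult_left smult_add_right ac_simps)
  qed (simp_all add: F_def)
  have "I (F (YV j 0)) = 0" for j
  proof -
    have "F (YV j 0) = smult (2 * (real j + b + 1)) (YV j 1) - smult (2 * (a + 1)) (YV (Suc j) 0)"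
    proof (rule poly_ext)
      fix t :: real
      define y v where "y = (1 + t) / 2" and "v = (1 - t) / 2"
      have t: "1 - t\<^sup>2 = 4 * y * v" "b - a - (a + b + 2) * t = 2 * ((b + 1) * v - (a + 1) * y)"
        by (simp_all add: y_def v_def field_simps power2_eq_square)
      have "poly (F (YV j 0)) t = (1 - t\<^sup>2) * poly (pderiv (YV j 0)) t + (b - a - (a + b + 2) * t) * poly (YV j 0) t"
        by (simp add: F_def algebra_simps power2_eq_square)
      also have "\<dots> = poly (smult (2 * (real j + b + 1)) (YV j 1) - smult (2 * (a + 1)) (YV (Suc j) 0)) t"
        unfolding t by (cases j) (simp_all add: pderiv_YV poly_YV flip: y_def v_def, simp_all add: algebra_simps)
      finally show "poly (F (YV j 0)) t = \<dots>" .
    qed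
    then have "I (F (YV j 0)) = 2 * (real j + b + 1) * I (YV j 1) - 2 * (a + 1) * I (YV (Suc j) 0)"
      by (simp only: I_diff I_smult)
    also have "I (YV j 1) = C0 * (Gamma (real j + b + 1) * Gamma (a + 1 + 1) / Gamma (real j + a + b + 3))"
      by (simp add: I_YV add_ac)
    also have "I (YV (Suc j) 0) = C0 * (Gamma (real j + b + 1 + 1) * Gamma (a + 1) / Gamma (real j + a + b + 3))"
      by (simp add: I_YV add_ac)
    also have "Gamma (a + 1 + 1) = (a + 1) * Gamma (a + 1)" using ab by (intro Gamma_plus1) (auto elim!: nonpos_Ints_cases)
    also have "Gamma (real j + b + 1 + 1) = (real j + b + 1) * Gamma (real j + b + 1)"
      using ab by (intro Gamma_plus1) (auto elim!: nonpos_Ints_cases)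
    also have "2 * (real j + b + 1) * (C0 * (Gamma (real j + b + 1) * ((a + 1) * Gamma (a + 1)) / Gamma (real j + a + b + 3))) -
        2 * (a + 1) * (C0 * ((real j + b + 1) * Gamma (real j + b + 1) * Gamma (a + 1) / Gamma (real j + a + b + 3))) = 0"
      by (simp only: mult_ac times_divide_eq_right diff_self)
    finally show ?thesis .
  qed
  then have "I (F g) = 0" by (subst c, subst F_sum) (simp add: I_sum I_smult)
  then show ?thesis by (simp add: F_def)
qed

text \<open>Lagrange's identity: the difference of the two integrands is the divergence expression
  for the Wronskian \<open>p' q - p q'\<close>.\<close>

lemma I_symmetric: "I (jacobi_op a b p * q) = I (p * jacobi_op a b q)"
proof -
  define g where "g = pderiv p * q - p * pderiv q"
  have "pderiv g = pderiv (pderiv p) * q - p * pderiv (pderiv q)"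
    by (simp add: g_def pderiv_diff pderiv_mult algebra_simps)
  then have "jacobi_op a b p * q - p * jacobi_op a b q = [:1, 0, -1:] * pderiv g + [:b - a, -(a + b + 2):] * g"
    unfolding jacobi_op_def g_def by (simp only: distrib_left distrib_right right_diff_distrib left_diff_distrib mult_ac)
      (simp only: add_ac diff_conv_add_uminus minus_add_distrib minus_minus mult_ac)?
  then have "I (jacobi_op a b p * q - p * jacobi_op a b q) = 0" by (simp only: I_divergence)
  then show ?thesis by (simp add: I_diff)
qed

text \<open>Inserting the hypergeometric form of \<open>jacobi_R\<close>, every integral is a Gamma
  quotient. The sum is a terminating hypergeometric series at 1, evaluated by the Chu-Vandermonde
  identity.\<close>

lemma I_YV_R: "I (YV k 0 * jacobi_R a b i) = C0 * Gamma (a + 1) * Gamma (real k + b + 1) / Gamma (real k + a + b + 2)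
    * (pochhammer (real k + 1 - real i) i / pochhammer (real k + a + b + 2) i)"
proof -
  define c where "c = real k + a + b + 2"
  have c: "c > 0" using ab by (simp add: c_def)
  have G: "Gamma (real j + a + 1) = pochhammer (a + 1) j * Gamma (a + 1)" "Gamma (real k + real j + a + b + 2) = pochhammer c j * Gamma c" for j
  proof -
    have "a + 1 \<notin> \<int>\<^sub>\<le>\<^sub>0" "c \<notin> \<int>\<^sub>\<le>\<^sub>0" using ab c by (auto elim!: nonpos_Ints_cases)
    then show "Gamma (real j + a + 1) = pochhammer (a + 1) j * Gamma (a + 1)" "Gamma (real k + real j + a + b + 2) = pochhammer c j * Gamma c"
      by (simp_all add: pochhammer_Gamma Gamma_eq_zero_iff add_ac c_def)
  qed
  have "I (YV k 0 * jacobi_R a b i) = (\<Sum>j\<le>i. pochhammer (- real i) j * pochhammer (real i + a + b + 1) j / (fact j * pochhammer (a + 1) j) *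
      (C0 * (Gamma (real k + b + 1) * Gamma (real j + a + 1) / Gamma (real k + real j + a + b + 2))))"
    by (simp add: jacobi_R_def sum_distrib_left I_sum I_smult YV_mult I_YV)
  also have "\<dots> = (\<Sum>j\<le>i. C0 * Gamma (a + 1) * Gamma (real k + b + 1) / Gamma c * (pochhammer (real i + a + b + 1) j * pochhammer (- real i) j / (fact j * pochhammer c j)))"
  proof (intro sum.cong refl)
    fix j
    have "pochhammer (a + 1) j > 0" "pochhammer c j > 0" using ab c by (auto intro!: pochhammer_pos)
    then show "pochhammer (- real i) j * pochhammer (real i + a + b + 1) j / (fact j * pochhammer (a + 1) j) *
      (C0 * (Gamma (real k + b + 1) * Gamma (real j + a + 1) / Gamma (real k + real j + a + b + 2))) =
      C0 * Gamma (a + 1) * Gamma (real k + b + 1) / Gamma c * (pochhammer (real i + a + b + 1) j * pochhammer (- real i) j / (fact j * pochhammer c j))"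
      unfolding G by (simp add: mult_ac)
  qed
  also have "\<dots> = C0 * Gamma (a + 1) * Gamma (real k + b + 1) / Gamma c * (\<Sum>j=0..i. pochhammer (real i + a + b + 1) j * pochhammer (- real i) j / (of_nat (fact j) * pochhammer c j))"
    by (simp add: sum_distrib_left atLeast0AtMost)
  also have "(\<Sum>j=0..i. pochhammer (real i + a + b + 1) j * pochhammer (- real i) j / (of_nat (fact j) * pochhammer c j)) = pochhammer (c - (real i + a + b + 1)) i / pochhammer c i"
    using c by (intro Vandermonde_pochhammer) auto
  finally show ?thesis by (simp add: c_def algebra_simps)
qed

text \<open>The rising factorial runs from \<open>k + 1 - i\<close>, which is at most 0, up to
  \<open>k\<close>, so it contains the factor 0.\<close>

lemma I_YV_R_eq_0: "k < i \<Longrightarrow> I (YV k 0 * jacobi_R a b i) = 0"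
proof -
  assume "k < i"
  then have "real k + 1 - real i = - real (i - k - 1)" by (simp add: of_nat_diff)
  then have "pochhammer (real k + 1 - real i) i = pochhammer (- real (i - k - 1)) i" by (simp only:)
  also have "\<dots> = 0" using \<open>k < i\<close> by (intro pochhammer_of_nat_eq_0_lemma) auto
  finally show ?thesis by (simp add: I_YV_R)
qed

lemma I_R_low_degree: "degree q < i \<Longrightarrow> I (q * jacobi_R a b i) = 0"
proof -
  assume d: "degree q < i"
  obtain c where c: "q = (\<Sum>j\<le>degree q. smult (c j) (YV j 0))" using poly_YV_expansion by blast
  have "I (q * jacobi_R a b i) = (\<Sum>j\<le>degree q. c j * I (YV j 0 * jacobi_R a b i))"
    by (subst c) (simp add: sum_distrib_right I_sum I_smult)
  also have "\<dots> = 0" using d by (intro sum.neutral) (auto simp: I_YV_R_eq_0)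
  finally show ?thesis .
qed

lemma I_R_orthogonal: "i \<noteq> j \<Longrightarrow> I (jacobi_R a b i * jacobi_R a b j) = 0"
  using I_R_low_degree[of "jacobi_R a b i" j] I_R_low_degree[of "jacobi_R a b j" i] degree_jacobi_R[OF ab]
  by (cases "i < j") (auto simp: mult.commute)

text \<open>\<open>I\<close> is known only as a linear functional with given values, so positivity
  cannot be quoted. Instead \<open>YV i 0\<close> is expanded in the \<open>jacobi_R j\<close>: by
  orthogonality only \<open>j = i\<close> contributes to its pairing with
  \<open>jacobi_R a b i\<close>, and this pairing is nonzero by the explicit formula.\<close>

lemma I_R_R_nonzero: "I (jacobi_R a b i * jacobi_R a b i) \<noteq> 0"
proof -
  have "\<exists>c. YV i 0 = (\<Sum>j\<le>i. smult (c j) (jacobi_R a b j))"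
    by (rule poly_expansion_basis) (auto simp: degree_YV degree_jacobi_R[OF ab] jacobi_R_nonzero[OF ab])
  then obtain c where c: "YV i 0 = (\<Sum>j\<le>i. smult (c j) (jacobi_R a b j))" by blast
  have "I (YV i 0 * jacobi_R a b i) = (\<Sum>j\<le>i. c j * I (jacobi_R a b j * jacobi_R a b i))"
    unfolding c by (simp add: sum_distrib_right I_sum I_smult)
  also have "\<dots> = (\<Sum>j\<le>i. if j = i then c i * I (jacobi_R a b i * jacobi_R a b i) else 0)"
    by (intro sum.cong) (auto simp: I_R_orthogonal)
  also have "\<dots> = c i * I (jacobi_R a b i * jacobi_R a b i)" by simp
  finally have 1: "I (YV i 0 * jacobi_R a b i) = c i * I (jacobi_R a b i * jacobi_R a b i)" .
  have "pochhammer (1::real) i > 0" "pochhammer (real i + a + b + 2) i > 0" using ab by (auto intro!: pochhammer_pos)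
  moreover have "Gamma (a + 1) > 0" "Gamma (real i + b + 1) > 0" "Gamma (real i + a + b + 2) > 0" using ab by (auto intro!: Gamma_real_pos)
  ultimately have "I (YV i 0 * jacobi_R a b i) \<noteq> 0" using C0 by (simp add: I_YV_R)
  then show ?thesis using 1 by auto
qed

text \<open>In terms of \<open>t = f(z)\<close>, \<open>zonal_op k\<close> is the operator with kernel \<open>(z \<bullet> \<zeta>)\<^sup>2\<^sup>k\<close> on the sphere. It commutes with the
  Jacobi operator, so the Jacobi polynomials are its eigenvectors; the eigenvalue \<open>mu k i\<close> is found by
  evaluation at \<open>t = 1\<close>, where a single summand survives.\<close>

definition kap :: "nat \<Rightarrow> nat \<Rightarrow> real" where
  "kap k j = fact (2 * k) / 4 ^ k / (fact j * fact (k - j) * pochhammer (b + 1) j * pochhammer (a + 1) (k - j))"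

definition mu :: "nat \<Rightarrow> nat \<Rightarrow> real" where
  "mu k i = (if i \<le> k then C0 * Gamma (a + 1) * Gamma (b + 1) * fact (2 * k) / 4 ^ k / (fact (k - i) * Gamma (real k + real i + a + b + 2)) else 0)"

definition zonal_op :: "nat \<Rightarrow> real poly \<Rightarrow> real poly" where
  "zonal_op k p = (\<Sum>j\<le>k. smult (kap k j * I (YV j (k - j) * p)) (YV j (k - j)))"

text \<open>Detailed balance: \<open>kap\<close> makes the tridiagonal matrix of the Jacobi operator
  on the \<open>YV j (k - j)\<close> symmetric, the raising coefficient at \<open>j\<close> matching
  the lowering coefficient at \<open>Suc j\<close>.\<close>

lemma kap_rec: "j < k \<Longrightarrow> kap k (Suc j) * (real (Suc j) * (real (Suc j) + b)) = kap k j * (real (k - j) * (real (k - j) + a))"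
proof -
  assume "j < k"
  then obtain l where l: "k - j = Suc l" "k - Suc j = l" by (metis Suc_diff_Suc)
  have "pochhammer (b + 1) j > 0" "pochhammer (a + 1) l > 0" using ab by (auto intro!: pochhammer_pos)
  moreover have "real (Suc j) + b > 0" "real (Suc l) + a > 0" using ab by auto
  moreover have p: "pochhammer (b + 1) (Suc j) = pochhammer (b + 1) j * (real (Suc j) + b)" "pochhammer (a + 1) (Suc l) = pochhammer (a + 1) l * (real (Suc l) + a)"
    by (simp_all add: pochhammer_Suc add_ac)
  ultimately show ?thesis unfolding kap_def l p fact_Suc by (simp del: of_nat_Suc)
qed

text \<open>The kernel is the sum of \<open>kap k j * B j x * B j y\<close>. By detailed balance and
  an index shift, the Jacobi operator may act on either variable with the same result, and
  \<open>I_symmetric\<close> moves it from the kernel to \<open>p\<close>.\<close>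

lemma zonal_op_commute: "jacobi_op a b (zonal_op k p) = zonal_op k (jacobi_op a b p)"
proof -
  define B where "B j = YV j (k - j)" for j
  define A where "A j = real j * (real j + b)" for j
  define C where "C j = real (k - j) * (real (k - j) + a)" for j
  define D where "D j = 2 * real j * real (k - j) + (a + 1) * real j + (b + 1) * real (k - j)" for j
  define U where "U j = I (B j * p)" for j
  have L: "jacobi_op a b (B j) = smult (A j) (B (j - 1)) + smult (C j) (B (Suc j)) - smult (D j) (B j)" if "j \<le> k" for j
  proof -
    have "smult (A j) (YV (j - 1) (Suc (k - j))) = smult (A j) (B (j - 1))"
      using that by (cases j) (auto simp: A_def B_def Suc_diff_Suc)
    moreover have "smult (C j) (YV (Suc j) (k - j - 1)) = smult (C j) (B (Suc j))"
      by (simp add: B_def)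
    ultimately show ?thesis unfolding B_def[of j] jacobi_op_YV A_def[symmetric] C_def[symmetric] D_def[symmetric] by simp
  qed
  have s1: "(\<Sum>j\<le>k. smult (kap k j * U j * A j) (B (j - 1))) = (\<Sum>j<k. smult (kap k j * C j * U (Suc j)) (B j))"
  proof -
    have "(\<Sum>j\<le>k. smult (kap k j * U j * A j) (B (j - 1))) = (\<Sum>j<k. smult (kap k (Suc j) * U (Suc j) * A (Suc j)) (B j))"
      by (subst sum.atMost_shift) (simp add: A_def)
    also have "\<dots> = (\<Sum>j<k. smult (kap k j * C j * U (Suc j)) (B j))"
    proof (intro sum.cong refl)
      fix j assume "j \<in> {..<k}"
      then have "kap k (Suc j) * A (Suc j) = kap k j * C j" unfolding A_def C_def by (intro kap_rec) auto
      then have "kap k (Suc j) * U (Suc j) * A (Suc j) = kap k j * C j * U (Suc j)" by (metis mult.assoc mult.commute)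
      then show "smult (kap k (Suc j) * U (Suc j) * A (Suc j)) (B j) = smult (kap k j * C j * U (Suc j)) (B j)" by (simp only:)
    qed
    finally show ?thesis .
  qed
  have Ck: "C k = 0" by (simp add: C_def)
  have s2: "(\<Sum>j\<le>k. smult (kap k j * U j * C j) (B (Suc j))) = (\<Sum>j\<le>k. smult (kap k j * A j * U (j - 1)) (B j))"
  proof -
    have "(\<Sum>j\<le>k. smult (kap k j * A j * U (j - 1)) (B j)) = (\<Sum>j<k. smult (kap k (Suc j) * A (Suc j) * U j) (B (Suc j)))"
      by (subst sum.atMost_shift) (simp add: A_def)
    also have "\<dots> = (\<Sum>j<k. smult (kap k j * U j * C j) (B (Suc j)))"
    proof (intro sum.cong refl)
      fix j assume "j \<in> {..<k}"
      then have "kap k (Suc j) * A (Suc j) = kap k j * C j" unfolding A_def C_def by (intro kap_rec) auto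
      then have "kap k (Suc j) * A (Suc j) * U j = kap k j * U j * C j" by (simp only: mult_ac)
      then show "smult (kap k (Suc j) * A (Suc j) * U j) (B (Suc j)) = smult (kap k j * U j * C j) (B (Suc j))" by (simp only:)
    qed
    also have "\<dots> = (\<Sum>j\<le>k. smult (kap k j * U j * C j) (B (Suc j)))"
      by (simp add: lessThan_Suc_atMost[symmetric] Ck)
    finally show ?thesis ..
  qed
  have "jacobi_op a b (zonal_op k p) = (\<Sum>j\<le>k. smult (kap k j * U j) (jacobi_op a b (B j)))"
    by (simp add: zonal_op_def jacobi_op_sum jacobi_op_smult B_def U_def)
  also have "\<dots> = (\<Sum>j\<le>k. smult (kap k j * U j * A j) (B (j - 1)) + smult (kap k j * U j * C j) (B (Suc j)) - smult (kap k j * U j * D j) (B j))"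
    by (intro sum.cong refl) (simp add: L smult_diff_right smult_add_right)
  also have "\<dots> = (\<Sum>j<k. smult (kap k j * C j * U (Suc j)) (B j)) + (\<Sum>j\<le>k. smult (kap k j * A j * U (j - 1)) (B j)) - (\<Sum>j\<le>k. smult (kap k j * U j * D j) (B j))"
    by (simp only: sum_subtractf sum.distrib s1 s2)
  also have "(\<Sum>j<k. smult (kap k j * C j * U (Suc j)) (B j)) = (\<Sum>j\<le>k. smult (kap k j * C j * U (Suc j)) (B j))"
    by (simp add: lessThan_Suc_atMost[symmetric] Ck)
  also have "(\<Sum>j\<le>k. smult (kap k j * C j * U (Suc j)) (B j)) + (\<Sum>j\<le>k. smult (kap k j * A j * U (j - 1)) (B j)) - (\<Sum>j\<le>k. smult (kap k j * U j * D j) (B j))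
      = (\<Sum>j\<le>k. smult (kap k j * (A j * U (j - 1) + C j * U (Suc j) - D j * U j)) (B j))"
    by (simp only: sum.distrib[symmetric] sum_subtractf[symmetric] smult_add_left[symmetric] smult_diff_left[symmetric] right_diff_distrib distrib_left mult_ac add_ac)
  also have "\<dots> = zonal_op k (jacobi_op a b p)"
    unfolding zonal_op_def B_def[symmetric]
  proof (intro sum.cong refl)
    fix j assume "j \<in> {..k}"
    then have "I (B j * jacobi_op a b p) = A j * U (j - 1) + C j * U (Suc j) - D j * U j"
      unfolding I_symmetric[symmetric] by (simp add: L U_def left_diff_distrib distrib_right I_diff I_add I_smult)
    then show "smult (kap k j * (A j * U (j - 1) + C j * U (Suc j) - D j * U j)) (B j) = smult (kap k j * I (B j * jacobi_op a b p)) (B j)" by simp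
  qed
  finally show ?thesis .
qed

lemma zonal_op_jacobi_R: "zonal_op k (jacobi_R a b i) = smult (mu k i) (jacobi_R a b i)"
proof -
  have I2: "zonal_op k (smult c p) = smult c (zonal_op k p)" for c p
    by (simp add: zonal_op_def I_smult smult_sum_right mult_ac)
  have "jacobi_op a b (zonal_op k (jacobi_R a b i)) = smult (- real i * (real i + a + b + 1)) (zonal_op k (jacobi_R a b i))"
    unfolding zonal_op_commute jacobi_R_eigen[OF ab] I2 ..
  then have 1: "zonal_op k (jacobi_R a b i) = smult (poly (zonal_op k (jacobi_R a b i)) 1) (jacobi_R a b i)"
    by (rule jacobi_eigen_unique[OF ab])
  have "poly (zonal_op k (jacobi_R a b i)) 1 = (\<Sum>j\<le>k. if j = k then kap k k * I (YV k 0 * jacobi_R a b i) else 0)"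
    unfolding zonal_op_def poly_sum by (intro sum.cong refl) (auto simp: poly_YV)
  also have "\<dots> = kap k k * I (YV k 0 * jacobi_R a b i)" by simp
  also have "\<dots> = mu k i"
  proof (cases "i \<le> k")
    case True
    define c where "c = real k + a + b + 2"
    have pos: "c > 0" "b + 1 > 0" using ab by (auto simp: c_def)
    then have "c \<notin> \<int>\<^sub>\<le>\<^sub>0" "b + 1 \<notin> \<int>\<^sub>\<le>\<^sub>0" by (auto elim!: nonpos_Ints_cases)
    then have G: "Gamma (real k + b + 1) = pochhammer (b + 1) k * Gamma (b + 1)" "Gamma (real k + real i + a + b + 2) = pochhammer c i * Gamma c"
      by (simp_all add: pochhammer_Gamma Gamma_eq_zero_iff add_ac c_def)
    have p: "pochhammer (real k + 1 - real i) i = fact k / fact (k - i)"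
    proof -
      have "pochhammer 1 k = (pochhammer 1 (k - i) * pochhammer (1 + real (k - i)) i :: real)"
        using pochhammer_product[of "k - i" k "1::real"] True by simp
      then show ?thesis using True by (simp add: pochhammer_fact[symmetric] of_nat_diff algebra_simps)
    qed
    have "pochhammer (b + 1) k > 0" "pochhammer c i > 0" using pos by (auto intro!: pochhammer_pos)
    then show ?thesis using True unfolding I_YV_R p mu_def kap_def c_def[symmetric] G by (simp add: mult_ac)
  next
    case False
    then show ?thesis by (simp add: mu_def I_YV_R_eq_0)
  qed
  finally show ?thesis using 1 by simp
qed

text \<open>One of the two factors \<open>W (YV j (k - j))\<close> is expanded in the orthogonal
  basis. After exchanging the sums, the inner sum is \<open>W\<close> of \<open>zonal_op k\<close>
  applied to a Jacobi polynomial. The abstract \<open>W\<close> stands for integration against a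
  square integrable function, to which \<open>zonal_op\<close> itself does not apply.\<close>

lemma kap_quadratic_form:
  fixes W :: "real poly \<Rightarrow> real"
  assumes W_add: "\<And>p q. W (p + q) = W p + W q" and W_smult: "\<And>c p. W (smult c p) = c * W p"
  shows "(\<Sum>j\<le>k. kap k j * (W (YV j (k - j)))\<^sup>2) = (\<Sum>i\<le>k. mu k i * ((W (jacobi_R a b i))\<^sup>2 / I (jacobi_R a b i * jacobi_R a b i)))"
proof -
  define n where "n i = I (jacobi_R a b i * jacobi_R a b i)" for i
  have n: "n i \<noteq> 0" for i by (simp add: n_def I_R_R_nonzero)
  have W_0: "W 0 = 0" using W_smult[of 0 0] by simp
  have W_sum: "W (sum f A) = (\<Sum>x\<in>A. W (f x))" for f :: "nat \<Rightarrow> real poly" and A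
    by (induction A rule: infinite_finite_induct) (auto simp: W_add W_0)
  have expand: "W (YV j (k - j)) = (\<Sum>i\<le>k. I (YV j (k - j) * jacobi_R a b i) / n i * W (jacobi_R a b i))" if "j \<le> k" for j
  proof -
    have "\<exists>c. YV j (k - j) = (\<Sum>i\<le>k. smult (c i) (jacobi_R a b i))"
      using that by (intro poly_expansion_basis) (auto simp: degree_YV degree_jacobi_R[OF ab] jacobi_R_nonzero[OF ab])
    then obtain c where c: "YV j (k - j) = (\<Sum>i\<le>k. smult (c i) (jacobi_R a b i))" by blast
    have "I (YV j (k - j) * jacobi_R a b i) = c i * n i" if "i \<le> k" for i
    proof -
      have "I (YV j (k - j) * jacobi_R a b i) = (\<Sum>l\<le>k. c l * I (jacobi_R a b l * jacobi_R a b i))"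
        unfolding c by (simp add: sum_distrib_right I_sum I_smult)
      also have "\<dots> = (\<Sum>l\<le>k. if l = i then c i * n i else 0)"
        by (intro sum.cong) (auto simp: I_R_orthogonal n_def)
      finally show ?thesis using that by simp
    qed
    then show ?thesis using n by (subst c) (simp add: W_sum W_smult)
  qed
  have "(\<Sum>j\<le>k. kap k j * (W (YV j (k - j)))\<^sup>2) = (\<Sum>j\<le>k. \<Sum>i\<le>k. kap k j * W (YV j (k - j)) * (I (YV j (k - j) * jacobi_R a b i) / n i * W (jacobi_R a b i)))"
  proof (intro sum.cong refl)
    fix j assume "j \<in> {..k}"
    then show "kap k j * (W (YV j (k - j)))\<^sup>2 = (\<Sum>i\<le>k. kap k j * W (YV j (k - j)) * (I (YV j (k - j) * jacobi_R a b i) / n i * W (jacobi_R a b i)))"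
      unfolding sum_distrib_left[symmetric] power2_eq_square mult.assoc using expand[of j] by simp
  qed
  also have "\<dots> = (\<Sum>i\<le>k. \<Sum>j\<le>k. kap k j * W (YV j (k - j)) * (I (YV j (k - j) * jacobi_R a b i) / n i * W (jacobi_R a b i)))"
    by (rule sum.swap)
  also have "\<dots> = (\<Sum>i\<le>k. W (jacobi_R a b i) / n i * W (zonal_op k (jacobi_R a b i)))"
    by (intro sum.cong refl) (simp add: zonal_op_def W_sum W_smult sum_distrib_left mult_ac)
  also have "\<dots> = (\<Sum>i\<le>k. mu k i * ((W (jacobi_R a b i))\<^sup>2 / n i))"
    by (simp add: zonal_op_jacobi_R W_smult power2_eq_square mult_ac)
  finally show ?thesis by (simp add: n_def)
qed

end

section \<open>The measure on the sphere and its image under \<open>f\<close>\<close>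

lemma nn_integral_lborel_translate:
  fixes f :: "'a::euclidean_space \<Rightarrow> ennreal"
  assumes [measurable]: "f \<in> borel_measurable borel"
  shows "(\<integral>\<^sup>+x. f (x + c) \<partial>lborel) = (\<integral>\<^sup>+x. f x \<partial>lborel)"
proof -
  have "(\<integral>\<^sup>+x. f x \<partial>lborel) = (\<integral>\<^sup>+x. f x \<partial>distr lborel borel ((+) c))"
    by (simp add: lborel_distr_plus)
  also have "\<dots> = (\<integral>\<^sup>+x. f (c + x) \<partial>lborel)" by (rule nn_integral_distr) auto
  finally show ?thesis by (simp add: add.commute)
qed

text \<open>The uniqueness proof for Haar measure, specialised: multiplied by the volume of the unit
  ball \<open>B\<close>, the measures of \<open>A\<close> and of its preimage under \<open>T\<close>
  are the same double integral, by Fubini and translation invariance. That \<open>T\<close>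
  preserves norms, and so the ball, fixes the factor as 1.\<close>

theorem lborel_distr_orthogonal:
  fixes T :: "'a::euclidean_space \<Rightarrow> 'a"
  assumes T: "orthogonal_transformation T"
  shows "distr lborel borel T = lborel"
proof -
  have lin: "linear T" using T by (rule orthogonal_transformation_linear)
  have [measurable]: "T \<in> borel_measurable borel"
    using linear_continuous_on[of T UNIV] lin by (intro borel_measurable_continuous_onI) (simp add: linear_conv_bounded_linear)
  have nT: "norm (T x) = norm x" for x using T by (simp add: orthogonal_transformation)
  have surj: "\<exists>d. T d = c" for c using orthogonal_transformation_surj[OF T] by (metis surjD)
  have key: "emeasure (distr lborel borel T) A = emeasure lborel A" if [measurable]: "A \<in> sets borel" for A
  proof -
  define B where "B = ball (0::'a) 1"
  have [measurable]: "B \<in> sets borel" by (simp add: B_def)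
  have B0: "emeasure lborel B \<noteq> 0" "emeasure lborel B \<noteq> top"
    by (auto simp: B_def emeasure_ball ennreal_eq_0_iff not_le)
  have "emeasure (distr lborel borel T) A * emeasure lborel B = (\<integral>\<^sup>+x. indicator A (T x) \<partial>lborel) * emeasure lborel B"
  proof -
    have "emeasure (distr lborel borel T) A = (\<integral>\<^sup>+x. indicator A x \<partial>distr lborel borel T)" by simp
    also have "\<dots> = (\<integral>\<^sup>+x. indicator A (T x) \<partial>lborel)" by (rule nn_integral_distr) measurable
    finally show ?thesis by simp
  qed
  also have "\<dots> = (\<integral>\<^sup>+y. indicator B y * (\<integral>\<^sup>+x. indicator A (T x) \<partial>lborel) \<partial>lborel)"
    by (simp add: nn_integral_multc mult.commute)
  also have "\<dots> = (\<integral>\<^sup>+y. \<integral>\<^sup>+x. indicator B y * indicator A (T x + y) \<partial>lborel \<partial>lborel)"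
  proof (rule nn_integral_cong)
    fix y :: 'a
    obtain d where d: "T d = y" using surj by blast
    have "(\<integral>\<^sup>+x. indicator A (T x) \<partial>lborel) = (\<integral>\<^sup>+x. indicator A (T (x + d)) \<partial>lborel)"
      by (rule nn_integral_lborel_translate[symmetric]) measurable
    also have "\<dots> = (\<integral>\<^sup>+x. indicator A (T x + y) \<partial>lborel)" by (simp add: linear_add[OF lin] d)
    finally show "indicator B y * (\<integral>\<^sup>+x. indicator A (T x) \<partial>lborel) = (\<integral>\<^sup>+x. indicator B y * indicator A (T x + y) \<partial>lborel)"
      by (simp add: nn_integral_cmult)
  qed
  also have "\<dots> = (\<integral>\<^sup>+x. \<integral>\<^sup>+y. indicator B y * indicator A (T x + y) \<partial>lborel \<partial>lborel)"
    by (rule lborel_pair.Fubini') measurable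
  also have "\<dots> = (\<integral>\<^sup>+x. \<integral>\<^sup>+y. indicator B (y - T x) * indicator A y \<partial>lborel \<partial>lborel)"
  proof (rule nn_integral_cong)
    fix x :: 'a
    have "(\<integral>\<^sup>+y. indicator B (y - T x) * indicator A y \<partial>lborel) = (\<integral>\<^sup>+y. indicator B (y + T x - T x) * indicator A (y + T x) \<partial>lborel)"
      by (rule nn_integral_lborel_translate[symmetric]) measurable
    then show "(\<integral>\<^sup>+y. indicator B y * indicator A (T x + y) \<partial>lborel) = (\<integral>\<^sup>+y. indicator B (y - T x) * indicator A y \<partial>lborel)"
      by (simp add: add.commute)
  qed
  also have "\<dots> = (\<integral>\<^sup>+y. \<integral>\<^sup>+x. indicator B (y - T x) * indicator A y \<partial>lborel \<partial>lborel)"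
    by (rule lborel_pair.Fubini') measurable
  also have "\<dots> = (\<integral>\<^sup>+y. emeasure lborel B * indicator A y \<partial>lborel)"
  proof (rule nn_integral_cong)
    fix y :: 'a
    \<comment> \<open>With this \<open>d\<close>,
      \<open>norm (y - T x) = norm (T (x + d)) = norm (x + d)\<close>, so the integral over
      \<open>x\<close> is the volume of a translate of \<open>B\<close>.\<close>
    obtain d where d: "T d = - y" using surj by blast
    have "(\<integral>\<^sup>+x. indicator B (y - T x) \<partial>lborel) = (\<integral>\<^sup>+x. indicator B (x + d) \<partial>lborel)"
    proof (rule nn_integral_cong)
      fix x
      have "norm (y - T x) = norm (T (x + d))" by (simp add: linear_add[OF lin] d norm_minus_commute)
      then show "(indicator B (y - T x) :: ennreal) = indicator B (x + d)" by (simp add: nT B_def indicator_def)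
    qed
    also have "\<dots> = emeasure lborel B" by (subst nn_integral_lborel_translate) auto
    finally show "(\<integral>\<^sup>+x. indicator B (y - T x) * indicator A y \<partial>lborel) = emeasure lborel B * indicator A y"
      by (simp add: nn_integral_multc)
  qed
  also have "\<dots> = emeasure lborel A * emeasure lborel B"
    by (subst nn_integral_cmult) (simp_all add: mult.commute)
  finally show ?thesis
    using B0 by (simp add: mult.commute[of _ "emeasure lborel B"] ennreal_mult_cancel_left)
  qed
  show ?thesis by (rule measure_eqI) (auto simp: key)
qed

lemma nn_integral_lborel_orthogonal:
  fixes T :: "'a::euclidean_space \<Rightarrow> 'a"
  assumes T: "orthogonal_transformation T" and [measurable]: "f \<in> borel_measurable borel"
  shows "(\<integral>\<^sup>+x. f (T x) \<partial>lborel) = (\<integral>\<^sup>+x. f x \<partial>lborel)"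
proof -
  have [measurable]: "T \<in> borel_measurable borel"
    using linear_continuous_on[of T UNIV] orthogonal_transformation_linear[OF T]
    by (intro borel_measurable_continuous_onI) (simp add: linear_conv_bounded_linear)
  have "(\<integral>\<^sup>+x. f x \<partial>lborel) = (\<integral>\<^sup>+x. f x \<partial>distr lborel borel T)"
    by (simp add: lborel_distr_orthogonal[OF T])
  also have "\<dots> = (\<integral>\<^sup>+x. f (T x) \<partial>lborel)" by (rule nn_integral_distr) auto
  finally show ?thesis ..
qed

lemmas sets_sphere_measure_cong [measurable_cong] = sets_sphere_measure

lemma borel_measurable_sphere [measurable (raw)]:
  "f \<in> measurable borel N \<Longrightarrow> f \<in> measurable (sphere_measure :: 'a::euclidean_space measure) N"
  using measurable_restrict_space1[of f borel N "sphere 0 1"] measurable_cong_sets[OF sets_sphere_measure refl] by blast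

lemma nn_integral_sphere_measure:
  fixes g :: "'a::euclidean_space \<Rightarrow> ennreal"
  assumes [measurable]: "g \<in> borel_measurable (sphere_measure :: 'a measure)"
  shows "(\<integral>\<^sup>+z. g z \<partial>sphere_measure) = of_nat DIM('a) * (\<integral>\<^sup>+x. g (x /\<^sub>R norm x) * indicator (ball 0 1 - {0}) x \<partial>lborel)"
proof -
  let ?N = "\<lambda>x::'a. x /\<^sub>R norm x"
  have 1: "?N \<in> restrict_space lborel (ball 0 1 - {0}) \<rightarrow>\<^sub>M restrict_space borel (sphere 0 1)"
    by (rule measurable_restrict_space2)
       (auto simp: space_restrict_space intro!: measurable_restrict_space1)
  have 2: "g \<in> borel_measurable (restrict_space borel (sphere 0 1))"
    using assms measurable_cong_sets[OF sets_sphere_measure refl] by blast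
  show ?thesis
    unfolding sphere_measure_def
    using 1 2 by (subst nn_integral_scale_measure, simp) (simp add: nn_integral_distr nn_integral_restrict_space)
qed

lemma finite_measure_sphere: "finite_measure (sphere_measure :: 'a::euclidean_space measure)"
proof
  have "emeasure sphere_measure (space (sphere_measure :: 'a measure)) = (\<integral>\<^sup>+z. 1 \<partial>(sphere_measure :: 'a measure))"
    by simp
  also have "\<dots> \<le> of_nat DIM('a) * emeasure lborel (ball (0::'a) 1)"
    by (subst nn_integral_sphere_measure) (auto intro!: mult_left_mono emeasure_mono)
  also have "\<dots> < \<infinity>" by (simp add: emeasure_ball ennreal_mult_less_top of_nat_less_top)
  finally show "emeasure sphere_measure (space (sphere_measure :: 'a measure)) \<noteq> \<infinity>" by simp
qed

lemma orthogonal_measurable_sphere: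
  fixes T :: "'a::euclidean_space \<Rightarrow> 'a"
  assumes T: "orthogonal_transformation T"
  shows "T \<in> sphere_measure \<rightarrow>\<^sub>M sphere_measure"
proof -
  have [measurable]: "T \<in> borel_measurable borel"
    using linear_continuous_on[of T UNIV] orthogonal_transformation_linear[OF T]
    by (intro borel_measurable_continuous_onI) (simp add: linear_conv_bounded_linear)
  have "T \<in> sphere_measure \<rightarrow>\<^sub>M restrict_space borel (sphere 0 1)"
    using T by (intro measurable_restrict_space2 borel_measurable_sphere) (auto simp: orthogonal_transformation)
  then show ?thesis using measurable_cong_sets[OF refl sets_sphere_measure] by blast
qed

text \<open>An orthogonal map commutes with the radial projection and preserves the punctured ball,
  so the invariance of Lebesgue measure descends to the sphere.\<close>

theorem distr_sphere_orthogonal: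
  fixes T :: "'a::euclidean_space \<Rightarrow> 'a"
  assumes T: "orthogonal_transformation T"
  shows "distr sphere_measure sphere_measure T = sphere_measure"
proof (rule measure_eqI)
  have lin: "linear T" using T by (rule orthogonal_transformation_linear)
  have [measurable]: "T \<in> borel_measurable borel"
    using linear_continuous_on[of T UNIV] lin by (intro borel_measurable_continuous_onI) (simp add: linear_conv_bounded_linear)
  have nT: "norm (T x) = norm x" for x using T by (simp add: orthogonal_transformation)
  fix A assume "A \<in> sets (distr sphere_measure (sphere_measure :: 'a measure) T)"
  then have As: "A \<in> sets (sphere_measure :: 'a measure)" by simp
  then have "A \<in> sets (restrict_space borel (sphere 0 1))" by (simp add: sets_sphere_measure)
  then have Ab [measurable]: "A \<in> sets borel" by (subst (asm) sets_restrict_space_iff) auto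
  have B [measurable]: "ball 0 1 - {0} \<in> sets (borel :: 'a measure)" by auto
  have "emeasure (distr sphere_measure sphere_measure T) A = (\<integral>\<^sup>+z. indicator A (T z) \<partial>sphere_measure)"
  proof -
    have "emeasure (distr sphere_measure sphere_measure T) A = (\<integral>\<^sup>+x. indicator A x \<partial>distr sphere_measure sphere_measure T)"
      using As by simp
    also have "\<dots> = (\<integral>\<^sup>+z. indicator A (T z) \<partial>sphere_measure)"
      using As orthogonal_measurable_sphere[OF T] by (intro nn_integral_distr) auto
    finally show ?thesis .
  qed
  also have "\<dots> = of_nat DIM('a) * (\<integral>\<^sup>+x. indicator A (T (x /\<^sub>R norm x)) * indicator (ball 0 1 - {0}) x \<partial>lborel)"
    by (rule nn_integral_sphere_measure) measurable
  also have "(\<integral>\<^sup>+x. indicator A (T (x /\<^sub>R norm x)) * indicator (ball 0 1 - {0}) x \<partial>lborel)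
      = (\<integral>\<^sup>+x. (\<lambda>y. indicator A (y /\<^sub>R norm y) * indicator (ball 0 1 - {0}) y) (T x) \<partial>lborel)"
  proof (rule nn_integral_cong)
    fix x :: 'a
    have "T x = 0 \<longleftrightarrow> x = 0" using nT[of x] by (metis norm_eq_zero)
    then show "indicator A (T (x /\<^sub>R norm x)) * (indicator (ball 0 1 - {0}) x :: ennreal) = indicator A (T x /\<^sub>R norm (T x)) * indicator (ball 0 1 - {0}) (T x)"
      by (simp add: nT linear_scale[OF lin] indicator_def)
  qed
  also have "\<dots> = (\<integral>\<^sup>+x. indicator A (x /\<^sub>R norm x) * indicator (ball 0 1 - {0}) x \<partial>lborel)"
    by (rule nn_integral_lborel_orthogonal[OF T]) measurable
  also have "of_nat DIM('a) * \<dots> = (\<integral>\<^sup>+z. indicator A z \<partial>(sphere_measure :: 'a measure))"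
    by (rule nn_integral_sphere_measure[symmetric]) measurable
  finally show "emeasure (distr sphere_measure sphere_measure T) A = emeasure sphere_measure A" using As by simp
qed simp

section \<open>Radial integration and the image of the sphere measure under
  \<open>f_map\<close>\<close>

definition radial_const :: "nat \<Rightarrow> real" where
  "radial_const d = pi powr (real d / 2) / Gamma (real d / 2)"

text \<open>The two measures are compared on half-lines, whose preimages are balls. Because the
  variable is the squared norm, \<open>radial_const\<close> is half the area of the unit sphere.
  Squared norms are chosen since \<open>f_map\<close> is linear in those of the two blocks.\<close>

lemma distr_lborel_norm_sq:
  "distr (lborel :: 'a::euclidean_space measure) borel (\<lambda>x. (norm x)\<^sup>2)
     = density lborel (\<lambda>r. ennreal (radial_const DIM('a) * r powr (real DIM('a) / 2 - 1)) * indicator {0<..} r)"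
  (is "?M = ?N")
proof (rule measure_eqI_generator_eq[where \<Omega> = UNIV and E = "range atMost" and A = "\<lambda>n. {..real n}"])
  define d where "d = real DIM('a)"
  have d: "d > 0" by (simp add: d_def)
  have G: "Gamma (d / 2 + 1) = d / 2 * Gamma (d / 2)"
    using d by (intro Gamma_plus1) (auto elim!: nonpos_Ints_cases)
  have Gpos: "Gamma (d / 2) > 0" using d by simp
  have k: "radial_const DIM('a) = pi powr (d / 2) / Gamma (d / 2)" by (simp add: radial_const_def d_def)
  have kpos: "radial_const DIM('a) > 0" using Gpos by (simp add: k)
  show "Int_stable (range (atMost :: real \<Rightarrow> _))"
    by (auto simp: Int_stable_def image_iff intro!: exI[of _ "min _ _"])
  show "sets ?M = sigma_sets UNIV (range atMost)" "sets ?N = sigma_sets UNIV (range atMost)"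
    by (simp_all add: borel_eq_atMost)
  show "(\<Union>n. {..real n}) = UNIV" using real_arch_simple by auto
  have M: "emeasure ?M {..r} = (if r < 0 then 0 else ennreal (unit_ball_vol d * r powr (d / 2)))" for r
  proof -
    have "emeasure ?M {..r} = emeasure lborel {x::'a. (norm x)\<^sup>2 \<le> r}"
      by (subst emeasure_distr) (auto intro!: arg_cong[where f = "emeasure lborel"])
    also have "\<dots> = (if r < 0 then 0 else ennreal (unit_ball_vol d * r powr (d / 2)))"
    proof (cases "r < 0")
      case True
      then have "{x::'a. (norm x)\<^sup>2 \<le> r} = {}" using zero_le_power2 by (auto simp: not_le intro: less_le_trans)
      then show ?thesis using True by simp
    next
      case False
      then have "{x::'a. (norm x)\<^sup>2 \<le> r} = cball 0 (sqrt r)"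
        by (auto simp: real_le_rsqrt) (metis norm_ge_zero not_less real_sqrt_le_iff real_sqrt_pow2 power_mono)
      moreover have "sqrt r ^ DIM('a) = r powr (d / 2)"
      proof (cases "r = 0")
        case r: False
        then have "r > 0" using False by simp
        then have "sqrt r ^ DIM('a) = sqrt r powr d" unfolding d_def by (subst powr_realpow) auto
        also have "\<dots> = (r powr (1/2)) powr d" using \<open>r > 0\<close> by (subst powr_half_sqrt) auto
        also have "\<dots> = r powr (d / 2)" by (simp only: powr_powr) simp
        finally show ?thesis .
      qed (simp add: power_0_left)
      ultimately show ?thesis using False by (simp add: emeasure_cball d_def)
    qed
    finally show ?thesis .
  qed
  have N: "emeasure ?N {..r} = (if r < 0 then 0 else ennreal (unit_ball_vol d * r powr (d / 2)))" for r
  proof -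
    have "emeasure ?N {..r} = (\<integral>\<^sup>+x. ennreal (indicator {0..r} x * (radial_const DIM('a) * x powr (d / 2 - 1))) \<partial>lborel)"
      by (subst emeasure_density) (auto simp: indicator_def d_def intro!: nn_integral_cong)
    also have "\<dots> = (if r < 0 then 0 else ennreal (unit_ball_vol d * r powr (d / 2)))"
    proof (cases "r < 0")
      case False
      have "((\<lambda>x. radial_const DIM('a) * x powr (d / 2 - 1)) has_integral (radial_const DIM('a) * (r powr (d / 2 - 1 + 1) / (d / 2 - 1 + 1)))) {0..r}"
        using False d by (intro has_integral_mult_right has_integral_powr_from_0) auto
      from nn_integral_has_integral_lebesgue[OF _ this]
      have "(\<integral>\<^sup>+x. ennreal (indicator {0..r} x * (radial_const DIM('a) * x powr (d / 2 - 1))) \<partial>lborel) = ennreal (radial_const DIM('a) * (r powr (d / 2) / (d / 2)))"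
        using kpos by simp
      also have "radial_const DIM('a) * (r powr (d / 2) / (d / 2)) = unit_ball_vol d * r powr (d / 2)"
        using d by (simp add: unit_ball_vol_def G k mult_ac)
      finally show ?thesis using False by simp
    qed simp
    finally show ?thesis .
  qed
  show "emeasure ?M X = emeasure ?N X" if "X \<in> range atMost" for X using that M N by auto
  show "emeasure ?M {..real n} \<noteq> \<infinity>" for n using M[of "real n"] by simp
qed auto

lemma nn_integral_norm_sq:
  assumes [measurable]: "g \<in> borel_measurable borel"
  shows "(\<integral>\<^sup>+x. g ((norm (x::'a::euclidean_space))\<^sup>2) \<partial>lborel) = (\<integral>\<^sup>+r. ennreal (radial_const DIM('a) * r powr (real DIM('a) / 2 - 1)) * indicator {0<..} r * g r \<partial>lborel)"
proof -
  have "(\<integral>\<^sup>+x. g ((norm (x::'a))\<^sup>2) \<partial>lborel) = (\<integral>\<^sup>+r. g r \<partial>distr (lborel :: 'a measure) borel (\<lambda>x. (norm x)\<^sup>2))"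
    by (subst nn_integral_distr) auto
  also have "\<dots> = (\<integral>\<^sup>+r. ennreal (radial_const DIM('a) * r powr (real DIM('a) / 2 - 1)) * indicator {0<..} r * g r \<partial>lborel)"
    unfolding distr_lborel_norm_sq by (subst nn_integral_density) auto
  finally show ?thesis .
qed

lemma nn_integral_norm_sq_pair:
  assumes G [measurable]: "(\<lambda>p. G (fst p) (snd p)) \<in> borel_measurable (borel :: (real \<times> real) measure)"
  shows "(\<integral>\<^sup>+z. G ((norm (fst z))\<^sup>2) ((norm (snd z))\<^sup>2) \<partial>(lborel :: ('a::euclidean_space \<times> 'b::euclidean_space) measure))
    = (\<integral>\<^sup>+r. \<integral>\<^sup>+q. ennreal (radial_const DIM('a) * r powr (real DIM('a) / 2 - 1)) * indicator {0<..} r *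
        (ennreal (radial_const DIM('b) * q powr (real DIM('b) / 2 - 1)) * indicator {0<..} q * G r q) \<partial>lborel \<partial>lborel)"
proof -
  have G' [measurable]: "case_prod G \<in> borel_measurable (borel \<Otimes>\<^sub>M borel)"
    using G by (simp add: borel_prod case_prod_beta')
  have "(\<integral>\<^sup>+z. G ((norm (fst z))\<^sup>2) ((norm (snd z))\<^sup>2) \<partial>(lborel :: ('a \<times> 'b) measure))
     = (\<integral>\<^sup>+z. G ((norm (fst z))\<^sup>2) ((norm (snd z))\<^sup>2) \<partial>(lborel \<Otimes>\<^sub>M lborel :: ('a \<times> 'b) measure))"
    by (simp only: lborel_prod)
  also have "\<dots> = (\<integral>\<^sup>+x. \<integral>\<^sup>+y. G ((norm (x::'a))\<^sup>2) ((norm (y::'b))\<^sup>2) \<partial>lborel \<partial>lborel)"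
    by (subst lborel.nn_integral_fst[symmetric]) auto
  also have "\<dots> = (\<integral>\<^sup>+x. (\<integral>\<^sup>+q. ennreal (radial_const DIM('b) * q powr (real DIM('b) / 2 - 1)) * indicator {0<..} q * G ((norm (x::'a))\<^sup>2) q \<partial>lborel) \<partial>lborel)"
    by (intro nn_integral_cong nn_integral_norm_sq) measurable
  also have "\<dots> = (\<integral>\<^sup>+r. ennreal (radial_const DIM('a) * r powr (real DIM('a) / 2 - 1)) * indicator {0<..} r * (\<integral>\<^sup>+q. ennreal (radial_const DIM('b) * q powr (real DIM('b) / 2 - 1)) * indicator {0<..} q * G r q \<partial>lborel) \<partial>lborel)"
    by (rule nn_integral_norm_sq) measurable
  also have "\<dots> = (\<integral>\<^sup>+r. \<integral>\<^sup>+q. ennreal (radial_const DIM('a) * r powr (real DIM('a) / 2 - 1)) * indicator {0<..} r *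
        (ennreal (radial_const DIM('b) * q powr (real DIM('b) / 2 - 1)) * indicator {0<..} q * G r q) \<partial>lborel \<partial>lborel)"
    by (intro nn_integral_cong nn_integral_cmult[symmetric]) measurable
  finally show ?thesis .
qed


text \<open>Distributing \<open>2 powr ((m + n)/2)\<close> over the two factors leaves a 4, which
  absorbs the two factors 2 by which \<open>sphere_area\<close> exceeds
  \<open>radial_const\<close>.\<close>

lemma h_weight_eq:
  assumes "-1 < t" "t < 1"
  shows "h_weight m n t = radial_const m * radial_const n * (((1 + t) / 2) powr beta m * ((1 - t) / 2) powr alpha n)"
proof -
  have "(2::real) powr (real (m + n) / 2) = 4 * (2 powr beta m * 2 powr alpha n)"
  proof -
    have "real (m + n) / 2 = 2 + beta m + alpha n" by (simp add: alpha_def beta_def add_divide_distrib)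
    then have "(2::real) powr (real (m + n) / 2) = 2 powr 2 * 2 powr beta m * 2 powr alpha n" by (simp only: powr_add)
    then show ?thesis by simp
  qed
  moreover have "sphere_area k = 2 * radial_const k" for k by (simp add: sphere_area_def radial_const_def)
  ultimately show ?thesis
    using assms by (simp add: h_weight_def powr_divide)
qed

lemma radial_const_pos: "k > 0 \<Longrightarrow> radial_const k > 0"
  by (simp add: radial_const_def)

lemma h_weight_measurable [measurable]: "h_weight m n \<in> borel_measurable borel"
  unfolding h_weight_def[abs_def] by measurable

lemma sets_h_measure [measurable_cong]: "sets (h_measure m n) = sets (restrict_space borel {-1..1})"
  by (simp add: h_measure_def cong: sets_restrict_space_cong)

lemma space_h_measure [simp]: "space (h_measure m n) = {-1..1}"
  by (simp add: h_measure_def space_restrict_space)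

lemma borel_measurable_h_measure [measurable (raw)]:
  "f \<in> measurable borel N \<Longrightarrow> f \<in> measurable (h_measure m n) N"
  using measurable_restrict_space1[of f borel N "{-1..1}"] measurable_cong_sets[OF sets_h_measure refl] by blast

lemma nn_integral_h_measure:
  assumes [measurable]: "g \<in> borel_measurable borel" and "m > 0" "n > 0"
  shows "(\<integral>\<^sup>+t. g t \<partial>h_measure m n) = ennreal (radial_const m * radial_const n) *
     (\<integral>\<^sup>+t. ennreal (((1 + t) / 2) powr beta m * ((1 - t) / 2) powr alpha n) * indicator {-1<..<1} t * g t \<partial>lborel)"
proof -
  have k: "radial_const m * radial_const n > 0" using assms by (simp add: radial_const_pos)
  have "(\<integral>\<^sup>+t. g t \<partial>h_measure m n) = (\<integral>\<^sup>+t. ennreal (h_weight m n t) * g t \<partial>restrict_space lborel {-1..1})"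
    unfolding h_measure_def by (subst nn_integral_density) (auto intro!: measurable_restrict_space1)
  also have "\<dots> = (\<integral>\<^sup>+t. ennreal (h_weight m n t) * g t * indicator {-1..1} t \<partial>lborel)"
    by (subst nn_integral_restrict_space) auto
  also have "\<dots> = (\<integral>\<^sup>+t. ennreal (radial_const m * radial_const n) * (ennreal (((1 + t) / 2) powr beta m * ((1 - t) / 2) powr alpha n) * indicator {-1<..<1} t * g t) \<partial>lborel)"
  proof (rule nn_integral_cong_AE)
    have "AE x in lborel. x \<noteq> (-1::real)" "AE x in lborel. x \<noteq> (1::real)" by (rule AE_lborel_singleton)+
    then show "AE t in lborel. ennreal (h_weight m n t) * g t * indicator {-1..1} t = ennreal (radial_const m * radial_const n) * (ennreal (((1 + t) / 2) powr beta m * ((1 - t) / 2) powr alpha n) * indicator {-1<..<1} t * g t)"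
    proof eventually_elim
      case (elim t)
      show ?case
      proof (cases "-1 < t \<and> t < 1")
        case True
        then have "ennreal (h_weight m n t) = ennreal (radial_const m * radial_const n) * ennreal (((1 + t) / 2) powr beta m * ((1 - t) / 2) powr alpha n)"
          using k by (subst h_weight_eq) (auto intro!: ennreal_mult')
        then show ?thesis using True by (simp add: mult.assoc)
      next
        case False
        then show ?thesis using elim by (auto simp: indicator_def)
      qed
    qed
  qed
  finally show ?thesis by (subst (asm) nn_integral_cmult) auto
qed

lemma nn_integral_powr_unit:
  assumes "c > 0"
  shows "(\<integral>\<^sup>+r. ennreal (r powr (c - 1)) * indicator {0<..<1} r \<partial>lborel) = ennreal (1 / c)"
proof -
  have "(\<integral>\<^sup>+r. ennreal (r powr (c - 1)) * indicator {0<..<1} r \<partial>lborel) = (\<integral>\<^sup>+r. ennreal (indicator {0..1} r * r powr (c - 1)) \<partial>lborel)"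
  proof (rule nn_integral_cong_AE)
    have "AE x in lborel. x \<noteq> (0::real)" "AE x in lborel. x \<noteq> (1::real)" by (rule AE_lborel_singleton)+
    then show "AE r in lborel. ennreal (r powr (c - 1)) * indicator {0<..<1} r = ennreal (indicator {0..1} r * r powr (c - 1))"
      by eventually_elim (auto simp: indicator_def)
  qed
  also have "\<dots> = ennreal (1 powr (c - 1 + 1) / (c - 1 + 1))"
    using assms by (intro nn_integral_has_integral_lebesgue has_integral_powr_from_0) auto
  finally show ?thesis by simp
qed

lemma f_map_normalized:
  fixes z :: "(real^'m) \<times> (real^'n)"
  shows "f_map (z /\<^sub>R norm z) = ((norm (fst z))\<^sup>2 - (norm (snd z))\<^sup>2) / ((norm (fst z))\<^sup>2 + (norm (snd z))\<^sup>2)"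
proof -
  have "(norm z)\<^sup>2 = (norm (fst z))\<^sup>2 + (norm (snd z))\<^sup>2" by (simp add: norm_prod_def)
  then show ?thesis
    by (simp add: f_map_def power_mult_distrib diff_divide_distrib power_inverse divide_inverse mult.commute left_diff_distrib)
qed

lemma f_map_measurable [measurable]: "f_map \<in> borel_measurable borel"
  unfolding f_map_def[abs_def] by (intro borel_measurable_continuous_onI continuous_intros)

text \<open>In the squared block norms \<open>r\<close> and \<open>q\<close> the cone integral is
  two-dimensional with a product density. The variables \<open>\<tau> = r + q\<close> and
  \<open>t = (r - q)/\<tau>\<close>, that is \<open>r = \<tau> (1 + t)/2\<close>, separate it. The
  power of \<open>\<tau>\<close> integrates to \<open>2/(m + n)\<close>; with the factor 1/2 from
  the substitution this cancels the dimension factor in \<open>sphere_measure\<close>, and the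
  weight of the interval remains.\<close>

theorem nn_integral_f_map:
  fixes g :: "real \<Rightarrow> ennreal"
  assumes g [measurable]: "g \<in> borel_measurable borel"
  shows "(\<integral>\<^sup>+z. g (f_map (z :: (real^'m) \<times> (real^'n))) \<partial>sphere_measure) = (\<integral>\<^sup>+t. g t \<partial>h_measure CARD('m) CARD('n))"
proof -
  define m n where "m = CARD('m)" and "n = CARD('n)"
  have mn: "m > 0" "n > 0" by (auto simp: m_def n_def)
  define k where "k = radial_const m * radial_const n"
  have k: "radial_const m > 0" "radial_const n > 0" "k > 0" using mn by (auto simp: k_def radial_const_pos)
  define wm where "wm r = ennreal (radial_const m * r powr beta m) * indicator {0<..} r" for r :: real
  define wn where "wn r = ennreal (radial_const n * r powr alpha n) * indicator {0<..} r" for r :: real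
  define G where "G r q = g ((r - q) / (r + q)) * indicator {0<..<1} (r + q)" for r q :: real
  define J where "J = (\<integral>\<^sup>+t. ennreal (((1 + t) / 2) powr beta m * ((1 - t) / 2) powr alpha n) * indicator {-1<..<1} t * g t \<partial>lborel)"
  have [measurable]: "wm \<in> borel_measurable borel" "wn \<in> borel_measurable borel"
    unfolding wm_def[abs_def] wn_def[abs_def] by measurable
  have [measurable]: "(\<lambda>p. G (fst p) (snd p)) \<in> borel_measurable (borel :: (real \<times> real) measure)"
    unfolding G_def borel_prod[symmetric] by measurable
  have [measurable]: "(\<lambda>x. G (a x) (b x)) \<in> borel_measurable M" if [measurable]: "a \<in> borel_measurable M" "b \<in> borel_measurable M" for a b and M :: "'x measure"
    unfolding G_def by measurable
  have dim: "DIM((real^'m) \<times> (real^'n)) = m + n" by (simp add: m_def n_def)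
  have inner: "(\<integral>\<^sup>+r. wm r * (wn (\<tau> - r) * G r (\<tau> - r)) \<partial>lborel) = ennreal (k / 2 * \<tau> powr (beta m + alpha n + 1)) * indicator {0<..<1} \<tau> * J" for \<tau>
  proof (cases "0 < \<tau> \<and> \<tau> < 1")
    case False
    have "(\<integral>\<^sup>+r. wm r * (wn (\<tau> - r) * G r (\<tau> - r)) \<partial>lborel) = (\<integral>\<^sup>+r. 0 \<partial>(lborel :: real measure))"
      using False by (intro nn_integral_cong) (auto simp: G_def indicator_def)
    then show ?thesis using False by (auto simp: indicator_def)
  next
    case True
    have "(\<integral>\<^sup>+r. wm r * (wn (\<tau> - r) * G r (\<tau> - r)) \<partial>lborel)
       = ennreal \<bar>\<tau> / 2\<bar> * (\<integral>\<^sup>+t. wm (\<tau> / 2 + \<tau> / 2 * t) * (wn (\<tau> - (\<tau> / 2 + \<tau> / 2 * t)) * G (\<tau> / 2 + \<tau> / 2 * t) (\<tau> - (\<tau> / 2 + \<tau> / 2 * t))) \<partial>lborel)"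
      using True by (intro nn_integral_real_affine) auto
    also have "\<dots> = ennreal (\<tau> / 2) * (\<integral>\<^sup>+t. ennreal (k * \<tau> powr (beta m + alpha n)) * (ennreal (((1 + t) / 2) powr beta m * ((1 - t) / 2) powr alpha n) * indicator {-1<..<1} t * g t) \<partial>lborel)"
    proof -
      have 1: "\<tau> / 2 + \<tau> / 2 * t = \<tau> * ((1 + t) / 2)" "\<tau> - \<tau> * ((1 + t) / 2) = \<tau> * ((1 - t) / 2)" for t by (simp_all add: field_simps)
      have eq: "wm (\<tau> / 2 + \<tau> / 2 * t) * (wn (\<tau> - (\<tau> / 2 + \<tau> / 2 * t)) * G (\<tau> / 2 + \<tau> / 2 * t) (\<tau> - (\<tau> / 2 + \<tau> / 2 * t)))
         = ennreal (k * \<tau> powr (beta m + alpha n)) * (ennreal (((1 + t) / 2) powr beta m * ((1 - t) / 2) powr alpha n) * indicator {-1<..<1} t * g t)" for t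
      proof (cases "-1 < t \<and> t < 1")
        case t: True
        have G1: "G (\<tau> * ((1 + t) / 2)) (\<tau> * ((1 - t) / 2)) = g t"
        proof -
          have "\<tau> * ((1 + t) / 2) + \<tau> * ((1 - t) / 2) = \<tau>" "\<tau> * ((1 + t) / 2) - \<tau> * ((1 - t) / 2) = \<tau> * t" by (simp_all add: field_simps)
          then show ?thesis using True by (simp add: G_def)
        qed
        have "wm (\<tau> * ((1 + t) / 2)) = ennreal (radial_const m * (\<tau> powr beta m * ((1 + t) / 2) powr beta m))"
          using True t by (simp add: wm_def powr_mult powr_divide)
        moreover have "wn (\<tau> * ((1 - t) / 2)) = ennreal (radial_const n * (\<tau> powr alpha n * ((1 - t) / 2) powr alpha n))"
          using True t by (simp add: wn_def powr_mult powr_divide)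
        ultimately show ?thesis
          unfolding 1 G1 using t k
          by (simp add: mult.assoc[symmetric] powr_add flip: ennreal_mult'') (simp add: k_def mult_ac)
      next
        case False
        have "\<tau> * ((1 + t) / 2) \<le> 0 \<or> \<tau> * ((1 - t) / 2) \<le> 0"
          using False True by (auto simp: mult_le_0_iff)
        then show ?thesis unfolding 1 using False by (auto simp: wm_def wn_def indicator_def)
      qed
      have "\<bar>\<tau> / 2\<bar> = \<tau> / 2" using True by simp
      then show ?thesis unfolding eq by (simp only:)
    qed
    also have "\<dots> = ennreal (\<tau> / 2) * (ennreal (k * \<tau> powr (beta m + alpha n)) * J)"
      unfolding J_def by (subst nn_integral_cmult) auto
    also have "\<dots> = ennreal (\<tau> / 2 * (k * \<tau> powr (beta m + alpha n))) * J"
      using True by (subst ennreal_mult'[of "\<tau> / 2"]) (auto simp only: mult.assoc)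
    also have "\<tau> / 2 * (k * \<tau> powr (beta m + alpha n)) = k / 2 * \<tau> powr (beta m + alpha n + 1)"
      using True by (simp add: powr_add)
    finally show ?thesis using True by simp
  qed
  have "(\<integral>\<^sup>+z. g (f_map (z :: (real^'m) \<times> (real^'n))) \<partial>sphere_measure) = of_nat (m + n) *
     (\<integral>\<^sup>+z. g (f_map ((z :: (real^'m) \<times> (real^'n)) /\<^sub>R norm z)) * indicator (ball 0 1 - {0}) z \<partial>lborel)"
    unfolding dim[symmetric] by (rule nn_integral_sphere_measure) measurable
  also have "(\<integral>\<^sup>+z. g (f_map ((z :: (real^'m) \<times> (real^'n)) /\<^sub>R norm z)) * indicator (ball 0 1 - {0}) z \<partial>lborel)
      = (\<integral>\<^sup>+z. G ((norm (fst (z :: (real^'m) \<times> (real^'n))))\<^sup>2) ((norm (snd z))\<^sup>2) \<partial>lborel)"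
  proof (rule nn_integral_cong)
    fix z :: "(real^'m) \<times> (real^'n)"
    have n: "(norm (fst z))\<^sup>2 + (norm (snd z))\<^sup>2 = (norm z)\<^sup>2" by (simp add: norm_prod_def)
    have "indicator (ball 0 1 - {0}) z = (indicator {0<..<1} ((norm z)\<^sup>2) :: ennreal)"
      by (simp add: indicator_def power_less_one_iff)
    then show "g (f_map (z /\<^sub>R norm z)) * indicator (ball 0 1 - {0}) z = G ((norm (fst z))\<^sup>2) ((norm (snd z))\<^sup>2)"
      unfolding G_def f_map_normalized n by simp
  qed
  also have "\<dots> = (\<integral>\<^sup>+r. \<integral>\<^sup>+q. wm r * (wn q * G r q) \<partial>lborel \<partial>lborel)"
    by (subst nn_integral_norm_sq_pair) (auto simp: wm_def wn_def m_def n_def alpha_def beta_def)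
  also have "\<dots> = (\<integral>\<^sup>+r. \<integral>\<^sup>+\<tau>. wm r * (wn (\<tau> - r) * G r (\<tau> - r)) \<partial>lborel \<partial>lborel)"
  proof (rule nn_integral_cong)
    fix r :: real
    show "(\<integral>\<^sup>+q. wm r * (wn q * G r q) \<partial>lborel) = (\<integral>\<^sup>+\<tau>. wm r * (wn (\<tau> - r) * G r (\<tau> - r)) \<partial>lborel)"
      using nn_integral_lborel_translate[of "\<lambda>q. wm r * (wn q * G r q)" "- r"] by simp
  qed
  also have "\<dots> = (\<integral>\<^sup>+\<tau>. \<integral>\<^sup>+r. wm r * (wn (\<tau> - r) * G r (\<tau> - r)) \<partial>lborel \<partial>lborel)"
    by (rule lborel_pair.Fubini') measurable
  also have "\<dots> = (\<integral>\<^sup>+\<tau>. ennreal (k / 2) * J * (ennreal (\<tau> powr (real (m + n) / 2 - 1)) * indicator {0<..<1} \<tau>) \<partial>lborel)"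
  proof (rule nn_integral_cong)
    fix \<tau> :: real
    have e: "beta m + alpha n + 1 = real (m + n) / 2 - 1" by (simp add: alpha_def beta_def add_divide_distrib)
    show "(\<integral>\<^sup>+r. wm r * (wn (\<tau> - r) * G r (\<tau> - r)) \<partial>lborel) = ennreal (k / 2) * J * (ennreal (\<tau> powr (real (m + n) / 2 - 1)) * indicator {0<..<1} \<tau>)"
      unfolding inner e using k by (subst ennreal_mult') (auto simp: mult_ac)
  qed
  also have "\<dots> = ennreal (k / 2) * J * ennreal (1 / (real (m + n) / 2))"
    using mn by (subst nn_integral_cmult, simp, subst nn_integral_powr_unit) auto
  also have "of_nat (m + n) * \<dots> = ennreal (real (m + n)) * (ennreal (k / 2) * ennreal (1 / (real (m + n) / 2))) * J"
    by (simp only: ennreal_of_nat_eq_real_of_nat mult_ac)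
  also have "ennreal (k / 2) * ennreal (1 / (real (m + n) / 2)) = ennreal (k / 2 * (1 / (real (m + n) / 2)))"
    using k by (intro ennreal_mult'[symmetric]) simp
  also have "ennreal (real (m + n)) * \<dots> = ennreal (real (m + n) * (k / 2 * (1 / (real (m + n) / 2))))"
    by (intro ennreal_mult'[symmetric]) simp
  also have "real (m + n) * (k / 2 * (1 / (real (m + n) / 2))) = k" using mn by (simp del: of_nat_add)
  also have "ennreal k * J = (\<integral>\<^sup>+t. g t \<partial>h_measure m n)"
    unfolding k_def J_def by (rule nn_integral_h_measure[symmetric]) (use mn in auto)
  finally show ?thesis by (simp add: m_def n_def)
qed

lemma f_map_range: "z \<in> sphere 0 1 \<Longrightarrow> f_map z \<in> {-1..1}"
proof -
  assume "z \<in> sphere 0 1"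
  then have "(norm (fst z))\<^sup>2 + (norm (snd z))\<^sup>2 = 1" by (simp add: norm_prod_def)
  moreover have "(norm (fst z))\<^sup>2 \<ge> 0" "(norm (snd z))\<^sup>2 \<ge> 0" by auto
  ultimately show ?thesis unfolding f_map_def atLeastAtMost_iff by linarith
qed

lemma f_map_measurable_sphere [measurable]: "f_map \<in> sphere_measure \<rightarrow>\<^sub>M h_measure m n"
proof -
  have "f_map \<in> sphere_measure \<rightarrow>\<^sub>M restrict_space borel {-1..1}"
    by (intro measurable_restrict_space2 borel_measurable_sphere f_map_measurable Pi_I f_map_range) simp
  then show ?thesis using measurable_cong_sets[OF refl sets_h_measure] by blast
qed

theorem distr_f_map:
  "distr (sphere_measure :: ((real^'m) \<times> (real^'n)) measure) (h_measure CARD('m) CARD('n)) f_map = h_measure CARD('m) CARD('n)"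
proof (rule measure_eqI)
  fix A assume "A \<in> sets (distr (sphere_measure :: ((real^'m) \<times> (real^'n)) measure) (h_measure CARD('m) CARD('n)) f_map)"
  then have As: "A \<in> sets (h_measure CARD('m) CARD('n))" by simp
  then have Ab: "A \<in> sets borel" by (simp add: sets_h_measure) (subst (asm) sets_restrict_space_iff, auto)
  have "emeasure (distr (sphere_measure :: ((real^'m) \<times> (real^'n)) measure) (h_measure CARD('m) CARD('n)) f_map) A
      = (\<integral>\<^sup>+t. indicator A t \<partial>distr (sphere_measure :: ((real^'m) \<times> (real^'n)) measure) (h_measure CARD('m) CARD('n)) f_map)"
    using As by simp
  also have "\<dots> = (\<integral>\<^sup>+z. indicator A (f_map z) \<partial>(sphere_measure :: ((real^'m) \<times> (real^'n)) measure))"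
    using As by (intro nn_integral_distr f_map_measurable_sphere) auto
  also have "\<dots> = (\<integral>\<^sup>+t. indicator A t \<partial>h_measure CARD('m) CARD('n))"
    using Ab by (intro nn_integral_f_map) auto
  finally show "emeasure (distr (sphere_measure :: ((real^'m) \<times> (real^'n)) measure) (h_measure CARD('m) CARD('n)) f_map) A
      = emeasure (h_measure CARD('m) CARD('n)) A" using As by simp
qed simp

section \<open>Moments\<close>

lemma orthogonal_transformation_measurable:
  fixes T :: "'a::euclidean_space \<Rightarrow> 'a"
  shows "orthogonal_transformation T \<Longrightarrow> T \<in> borel_measurable borel"
  using linear_continuous_on[of T UNIV] orthogonal_transformation_linear[of T]
  by (intro borel_measurable_continuous_onI) (simp add: linear_conv_bounded_linear)

lemma orthogonal_transformation_inner: "orthogonal_transformation T \<Longrightarrow> T x \<bullet> T y = x \<bullet> y"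
  by (simp add: orthogonal_transformation_def)

lemma borel_measurable_fst_snd [measurable (raw)]:
  fixes g :: "'x \<Rightarrow> 'a::{second_countable_topology,real_normed_vector} \<times> 'b::{second_countable_topology,real_normed_vector}"
  assumes "g \<in> borel_measurable M"
  shows "(\<lambda>x. fst (g x)) \<in> borel_measurable M" "(\<lambda>x. snd (g x)) \<in> borel_measurable M"
  using assms by (auto intro!: borel_measurable_continuous_on[of fst] borel_measurable_continuous_on[of snd] continuous_intros)

text \<open>The standard Gaussian density. It is both a product density and rotation invariant,
  which allows it to turn averages over directions into one-dimensional integrals.\<close>

definition gauss :: "'a::euclidean_space \<Rightarrow> real" where
  "gauss a = (1 / sqrt (2 * pi)) ^ DIM('a) * exp (- (norm a)\<^sup>2 / 2)"

lemma gauss_measurable [measurable]: "gauss \<in> borel_measurable borel"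
  unfolding gauss_def[abs_def] by measurable

lemma gauss_pos: "gauss a > 0" by (simp add: gauss_def)

lemma gauss_prod: "gauss a = (\<Prod>b\<in>Basis. std_normal_density (a \<bullet> b))"
proof -
  have "(norm a)\<^sup>2 = (\<Sum>b\<in>Basis. (a \<bullet> b)\<^sup>2)"
    by (subst power2_norm_eq_inner, subst euclidean_inner) (simp add: power2_eq_square)
  then have "exp (- (norm a)\<^sup>2 / 2) = (\<Prod>b\<in>Basis. exp (- (a \<bullet> b)\<^sup>2 / 2))"
    by (simp add: exp_sum[symmetric] sum_negf sum_divide_distrib)
  then show ?thesis unfolding gauss_def std_normal_density_def prod.distrib prod_constant by (simp only:)
qed

lemma nn_integral_std_normal_moment:
  "(\<integral>\<^sup>+x. ennreal (std_normal_density x * x ^ (2 * k)) \<partial>lborel) = ennreal (fact (2 * k) / (2 ^ k * fact k))"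
  using std_normal_moment_even[of k] by (intro nn_integral_eq_integral[THEN trans]) (auto simp: has_bochner_integral_iff normal_density_nonneg)

lemma gauss_moment_basis:
  fixes e :: "'a::euclidean_space"
  assumes e: "e \<in> Basis"
  shows "(\<integral>\<^sup>+a. ennreal (gauss a * (a \<bullet> e) ^ (2 * j)) \<partial>lborel) = ennreal (fact (2 * j) / (2 ^ j * fact j))"
proof -
  define f where "f b t = ennreal (std_normal_density t * t ^ (2 * (if b = e then j else 0)))" for b :: 'a and t
  have [measurable]: "f b \<in> borel_measurable borel" for b unfolding f_def[abs_def] by measurable
  have "(\<integral>\<^sup>+a. ennreal (gauss a * (a \<bullet> e) ^ (2 * j)) \<partial>lborel) = (\<integral>\<^sup>+a. (\<Prod>b\<in>Basis. f b (a \<bullet> b)) \<partial>lborel)"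
  proof (rule nn_integral_cong)
    fix a :: 'a
    have "(\<Prod>b\<in>Basis. (a \<bullet> b) ^ (2 * (if b = e then j else 0))) = (\<Prod>b\<in>Basis. if b = e then (a \<bullet> e) ^ (2 * j) else 1)"
      by (intro prod.cong) auto
    also have "\<dots> = (a \<bullet> e) ^ (2 * j)" using e by (simp add: prod.delta)
    finally have "gauss a * (a \<bullet> e) ^ (2 * j) = (\<Prod>b\<in>Basis. std_normal_density (a \<bullet> b) * (a \<bullet> b) ^ (2 * (if b = e then j else 0)))"
      by (simp add: gauss_prod prod.distrib)
    then show "ennreal (gauss a * (a \<bullet> e) ^ (2 * j)) = (\<Prod>b\<in>Basis. f b (a \<bullet> b))"
      unfolding f_def by (subst prod_ennreal) (auto simp: normal_density_nonneg)
  qed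
  also have "\<dots> = (\<Prod>b\<in>Basis. (\<integral>\<^sup>+x. f b x \<partial>lborel))" by (rule nn_integral_lborel_prod) auto
  also have "\<dots> = (\<Prod>b\<in>Basis. if b = e then ennreal (fact (2 * j) / (2 ^ j * fact j)) else 1)"
    unfolding f_def nn_integral_std_normal_moment by (intro prod.cong) auto
  also have "\<dots> = ennreal (fact (2 * j) / (2 ^ j * fact j))" using e by (simp add: prod.delta)
  finally show ?thesis .
qed

lemma axis_rotation:
  fixes x :: "real^'k"
  shows "\<exists>(e :: real^'k) T. e \<in> Basis \<and> orthogonal_transformation T \<and> T (norm x *\<^sub>R e) = x"
proof -
  obtain e :: "real^'k" where e: "e \<in> Basis" using nonempty_Basis by blast
  have "norm (norm x *\<^sub>R e) = norm x" using e by simp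
  then obtain T where "orthogonal_transformation T" "T (norm x *\<^sub>R e) = x"
    using orthogonal_transformation_exists by blast
  with e show ?thesis by blast
qed

text \<open>A rotation takes \<open>x\<close> to a multiple of a basis vector, for which the density
  factorises.\<close>

lemma gauss_moment:
  fixes x :: "real^'k"
  shows "(\<integral>\<^sup>+a. ennreal (gauss a * (x \<bullet> a) ^ (2 * j)) \<partial>lborel) = ennreal (fact (2 * j) / (2 ^ j * fact j) * norm x ^ (2 * j))"
proof -
  obtain e :: "real^'k" and T where e: "e \<in> Basis" and T: "orthogonal_transformation T" "T (norm x *\<^sub>R e) = x"
    using axis_rotation[of x] by blast
  have "(\<integral>\<^sup>+a. ennreal (gauss a * (x \<bullet> a) ^ (2 * j)) \<partial>lborel) = (\<integral>\<^sup>+a. ennreal (gauss (T a) * (x \<bullet> T a) ^ (2 * j)) \<partial>lborel)"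
    by (rule nn_integral_lborel_orthogonal[OF T(1), symmetric]) measurable
  also have "\<dots> = (\<integral>\<^sup>+a. ennreal (norm x ^ (2 * j)) * ennreal (gauss a * (a \<bullet> e) ^ (2 * j)) \<partial>lborel)"
  proof (rule nn_integral_cong)
    fix a
    have "x \<bullet> T a = norm x * (a \<bullet> e)"
      using orthogonal_transformation_inner[OF T(1), of "norm x *\<^sub>R e" a] unfolding T(2) by (simp add: inner_commute)
    moreover have "gauss (T a) = gauss a" using T(1) by (simp add: gauss_def orthogonal_transformation)
    ultimately show "ennreal (gauss (T a) * (x \<bullet> T a) ^ (2 * j)) = ennreal (norm x ^ (2 * j)) * ennreal (gauss a * (a \<bullet> e) ^ (2 * j))"
      by (subst ennreal_mult'[symmetric]) (simp_all add: power_mult_distrib mult_ac)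
  qed
  also have "\<dots> = ennreal (norm x ^ (2 * j)) * ennreal (fact (2 * j) / (2 ^ j * fact j))"
    using e by (subst nn_integral_cmult) (auto simp: gauss_moment_basis)
  finally show ?thesis by (simp add: ennreal_mult'[symmetric] mult.commute)
qed

text \<open>In the variable \<open>r = |a|^2\<close>, scaled by 2, this is a Gamma integral; the
  value is the \<open>j\<close>-th moment of the chi-squared distribution.\<close>

lemma gauss_norm_moment:
  "(\<integral>\<^sup>+a. ennreal (gauss a * norm (a::'a::euclidean_space) ^ (2 * j)) \<partial>lborel) = ennreal (2 ^ j * pochhammer (real DIM('a) / 2) j)"
proof -
  define d where "d = real DIM('a)"
  have d: "d > 0" by (simp add: d_def)
  define C where "C = (1 / sqrt (2 * pi)) ^ DIM('a)"
  have Cpos: "C > 0" by (simp add: C_def)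
  have C: "C = 1 / (2 powr (d / 2) * pi powr (d / 2))"
  proof -
    have "(1 / sqrt (2 * pi)) ^ DIM('a) = 1 / (sqrt (2 * pi) powr d)"
      unfolding d_def by (subst powr_realpow) (auto simp: power_divide)
    also have "sqrt (2 * pi) powr d = ((2 * pi) powr (1/2)) powr d" by (subst powr_half_sqrt) auto
    also have "\<dots> = (2 * pi) powr (d / 2)" by (simp add: powr_powr)
    also have "\<dots> = 2 powr (d / 2) * pi powr (d / 2)" by (rule powr_mult)
    finally show ?thesis by (simp add: C_def)
  qed
  define R where "R = radial_const DIM('a)"
  have R: "R = pi powr (d / 2) / Gamma (d / 2)" "R > 0" by (auto simp: R_def radial_const_def d_def)
  have "(\<integral>\<^sup>+a. ennreal (gauss a * norm (a::'a) ^ (2 * j)) \<partial>lborel) = (\<integral>\<^sup>+a. (\<lambda>r. ennreal (C * exp (- r / 2) * r ^ j)) ((norm (a::'a))\<^sup>2) \<partial>lborel)"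
    by (simp add: gauss_def C_def power_mult)
  also have "\<dots> = (\<integral>\<^sup>+r. ennreal (R * r powr (d / 2 - 1)) * indicator {0<..} r * ennreal (C * exp (- r / 2) * r ^ j) \<partial>lborel)"
    unfolding R_def d_def by (rule nn_integral_norm_sq) measurable
  also have "\<dots> = ennreal \<bar>2::real\<bar> * (\<integral>\<^sup>+t. ennreal (R * (0 + 2 * t) powr (d / 2 - 1)) * indicator {0<..} (0 + 2 * t) * ennreal (C * exp (- (0 + 2 * t) / 2) * (0 + 2 * t) ^ j) \<partial>lborel)"
    by (rule nn_integral_real_affine) auto
  also have "(\<integral>\<^sup>+t. ennreal (R * (0 + 2 * t) powr (d / 2 - 1)) * indicator {0<..} (0 + 2 * t) * ennreal (C * exp (- (0 + 2 * t) / 2) * (0 + 2 * t) ^ j) \<partial>lborel)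
     = (\<integral>\<^sup>+t. ennreal (R * C * 2 powr (d / 2 - 1 + j)) * ennreal (indicator {0..} t * t powr (d / 2 + j - 1) / exp t) \<partial>lborel)"
  proof (rule nn_integral_cong)
    fix t :: real
    show "ennreal (R * (0 + 2 * t) powr (d / 2 - 1)) * indicator {0<..} (0 + 2 * t) * ennreal (C * exp (- (0 + 2 * t) / 2) * (0 + 2 * t) ^ j)
      = ennreal (R * C * 2 powr (d / 2 - 1 + j)) * ennreal (indicator {0..} t * t powr (d / 2 + j - 1) / exp t)"
    proof (cases "t > 0")
      case True
      have "(2 * t) powr (d / 2 - 1) * (2 * t) ^ j = (2 * t) powr (d / 2 - 1 + j)"
        using True by (simp only: powr_add) (simp add: powr_realpow)
      also have "\<dots> = 2 powr (d / 2 - 1 + j) * t powr (d / 2 - 1 + j)" by (rule powr_mult)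
      finally have p: "(2 * t) powr (d / 2 - 1) * (2 * t) ^ j = 2 powr (d / 2 - 1 + j) * t powr (d / 2 - 1 + j)" .
      have "R * (2 * t) powr (d / 2 - 1) * (C * exp (- t) * (2 * t) ^ j) = R * C * exp (- t) * ((2 * t) powr (d / 2 - 1) * (2 * t) ^ j)"
        by (simp only: mult_ac)
      also have "\<dots> = R * C * 2 powr (d / 2 - 1 + j) * (t powr (d / 2 + j - 1) / exp t)"
      proof -
        have e: "d / 2 - 1 + real j = d / 2 + real j - 1" by simp
        show ?thesis unfolding p exp_minus e by (simp only: divide_inverse mult_ac)
      qed
      finally have eq: "R * (2 * t) powr (d / 2 - 1) * (C * exp (- t) * (2 * t) ^ j) = R * C * 2 powr (d / 2 - 1 + j) * (t powr (d / 2 + j - 1) / exp t)" .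
      have "ennreal (R * (2 * t) powr (d / 2 - 1)) * ennreal (C * exp (- t) * (2 * t) ^ j) = ennreal (R * (2 * t) powr (d / 2 - 1) * (C * exp (- t) * (2 * t) ^ j))"
        using R(2) by (intro ennreal_mult'[symmetric]) auto
      also have "\<dots> = ennreal (R * C * 2 powr (d / 2 - 1 + j)) * ennreal (t powr (d / 2 + j - 1) / exp t)"
        unfolding eq using R(2) Cpos by (intro ennreal_mult') auto
      finally show ?thesis using True by simp
    qed (auto simp: indicator_def not_less)
  qed
  also have "\<dots> = ennreal (R * C * 2 powr (d / 2 - 1 + j)) * ennreal (Gamma (d / 2 + j))"
    using d by (subst nn_integral_cmult) (auto simp: Gamma_conv_nn_integral_real)
  also have "ennreal \<bar>2::real\<bar> * \<dots> = ennreal (2 * (R * C * 2 powr (d / 2 - 1 + j) * Gamma (d / 2 + j)))"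
  proof -
    have "ennreal (R * C * 2 powr (d / 2 - 1 + j)) * ennreal (Gamma (d / 2 + j)) = ennreal (R * C * 2 powr (d / 2 - 1 + j) * Gamma (d / 2 + j))"
      using R(2) Cpos by (intro ennreal_mult'[symmetric]) auto
    then show ?thesis by (subst ennreal_mult') auto
  qed
  also have "2 * (R * C * 2 powr (d / 2 - 1 + j) * Gamma (d / 2 + j)) = 2 ^ j * pochhammer (d / 2) j"
  proof -
    have "d / 2 \<notin> \<int>\<^sub>\<le>\<^sub>0" using d by (auto elim!: nonpos_Ints_cases)
    then have "pochhammer (d / 2) j = Gamma (d / 2 + j) / Gamma (d / 2)" by (simp add: pochhammer_Gamma)
    moreover have "2 * 2 powr (d / 2 - 1 + j) = 2 powr (d / 2) * 2 ^ j"
      by (simp add: powr_add powr_diff powr_realpow)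
    moreover have "2 * (R * C * 2 powr (d / 2 - 1 + j) * Gamma (d / 2 + j)) = R * C * (2 * 2 powr (d / 2 - 1 + j)) * Gamma (d / 2 + j)"
      by (simp only: mult_ac)
    moreover have "pi powr (d / 2) > 0" "(2::real) powr (d / 2) > 0" by simp_all
    ultimately show ?thesis unfolding R(1) C by (simp only:) simp
  qed
  finally show ?thesis by (simp add: d_def)
qed

text \<open>The \<open>2 j\<close>-th moment of one coordinate of a uniformly distributed unit
  vector in dimension \<open>d\<close>.\<close>

definition dir_moment :: "nat \<Rightarrow> nat \<Rightarrow> real" where
  "dir_moment d j = fact (2 * j) / (4 ^ j * fact j * pochhammer (real d / 2) j)"

lemma dir_moment_nonneg: "0 \<le> dir_moment d j"
proof -
  have "0 \<le> pochhammer (real d / 2) j"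
    by (cases "d = 0") (auto simp: pochhammer_0_left less_imp_le pochhammer_pos)
  then show ?thesis by (simp add: dir_moment_def)
qed

text \<open>By invariance the moment is a multiple of \<open>|a|\<^sup>2\<^sup>j\<close>; averaging over a Gaussian vector \<open>a\<close> gives the factor.\<close>

lemma rotation_invariant_moment:
  fixes \<nu> :: "(real^'k) measure"
  assumes fin: "finite_measure \<nu>" and sets_\<nu> [measurable_cong]: "sets \<nu> = sets borel"
    and inv: "\<And>T g. orthogonal_transformation T \<Longrightarrow> g \<in> borel_measurable borel \<Longrightarrow> (\<integral>\<^sup>+x. g (T x) \<partial>\<nu>) = (\<integral>\<^sup>+x. g x \<partial>\<nu>)"
  shows "(\<integral>\<^sup>+x. ennreal ((x \<bullet> a) ^ (2 * j)) \<partial>\<nu>) = ennreal (dir_moment CARD('k) j * norm a ^ (2 * j)) * (\<integral>\<^sup>+x. ennreal (norm x ^ (2 * j)) \<partial>\<nu>)"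
proof -
  interpret finite_measure \<nu> by fact
  interpret P: pair_sigma_finite lborel \<nu> ..
  define \<Phi> where "\<Phi> a = (\<integral>\<^sup>+x. ennreal ((x \<bullet> a) ^ (2 * j)) \<partial>\<nu>)" for a
  define S where "S = (\<integral>\<^sup>+x. ennreal (norm x ^ (2 * j)) \<partial>\<nu>)"
  obtain e :: "real^'k" where e: "e \<in> Basis" using nonempty_Basis by blast
  have \<Phi>: "\<Phi> a = ennreal (norm a ^ (2 * j)) * \<Phi> e" for a
  proof -
    have "norm (norm a *\<^sub>R e) = norm a" using e by simp
    then obtain T where T: "orthogonal_transformation T" "T (norm a *\<^sub>R e) = a"
      using orthogonal_transformation_exists by blast
    have "\<Phi> a = (\<integral>\<^sup>+x. ennreal ((T x \<bullet> a) ^ (2 * j)) \<partial>\<nu>)"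
      unfolding \<Phi>_def by (rule inv[OF T(1), symmetric]) measurable
    also have "\<dots> = (\<integral>\<^sup>+x. ennreal (norm a ^ (2 * j)) * ennreal ((x \<bullet> e) ^ (2 * j)) \<partial>\<nu>)"
    proof (rule nn_integral_cong)
      fix x
      have "T x \<bullet> a = norm a * (x \<bullet> e)"
        using orthogonal_transformation_inner[OF T(1), of x "norm a *\<^sub>R e"] unfolding T(2) by simp
      then show "ennreal ((T x \<bullet> a) ^ (2 * j)) = ennreal (norm a ^ (2 * j)) * ennreal ((x \<bullet> e) ^ (2 * j))"
        by (subst ennreal_mult'[symmetric]) (simp_all add: power_mult_distrib)
    qed
    also have "\<dots> = ennreal (norm a ^ (2 * j)) * \<Phi> e"
      unfolding \<Phi>_def by (rule nn_integral_cmult) measurable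
    finally show ?thesis .
  qed
  \<comment> \<open>\<open>R\<close> is the Gaussian mean of \<open>|a|^(2j)\<close> and
    \<open>N\<close> that of \<open>(x . a)^(2j)\<close> for a unit vector \<open>x\<close>; their
    quotient \<open>N / R\<close> is \<open>dir_moment\<close>.\<close>
  define R where "R = 2 ^ j * pochhammer (real CARD('k) / 2) j"
  define N where "N = fact (2 * j) / (2 ^ j * fact j :: real)"
  have R: "R > 0" by (simp add: R_def pochhammer_pos)
  have N: "N \<ge> 0" by (simp add: N_def)
  have "\<Phi> e * ennreal R = (\<integral>\<^sup>+a. ennreal (gauss a * norm (a::real^'k) ^ (2 * j)) * \<Phi> e \<partial>lborel)"
    by (subst nn_integral_multc) (auto simp: gauss_norm_moment R_def mult.commute[of "\<Phi> e"])
  also have "\<dots> = (\<integral>\<^sup>+a. \<integral>\<^sup>+x. ennreal (gauss a * (x \<bullet> a) ^ (2 * j)) \<partial>\<nu> \<partial>lborel)"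
  proof (rule nn_integral_cong)
    fix a :: "real^'k"
    have "ennreal (gauss a * norm a ^ (2 * j)) * \<Phi> e = ennreal (gauss a) * \<Phi> a"
      unfolding \<Phi>[of a] using gauss_pos[of a] by (subst ennreal_mult') (auto simp: mult_ac)
    also have "\<dots> = (\<integral>\<^sup>+x. ennreal (gauss a) * ennreal ((x \<bullet> a) ^ (2 * j)) \<partial>\<nu>)"
      unfolding \<Phi>_def by (rule nn_integral_cmult[symmetric]) measurable
    also have "\<dots> = (\<integral>\<^sup>+x. ennreal (gauss a * (x \<bullet> a) ^ (2 * j)) \<partial>\<nu>)"
      using gauss_pos[of a] by (intro nn_integral_cong ennreal_mult'[symmetric]) auto
    finally show "ennreal (gauss a * norm a ^ (2 * j)) * \<Phi> e = (\<integral>\<^sup>+x. ennreal (gauss a * (x \<bullet> a) ^ (2 * j)) \<partial>\<nu>)" .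
  qed
  also have "\<dots> = (\<integral>\<^sup>+x. \<integral>\<^sup>+a. ennreal (gauss a * (x \<bullet> a) ^ (2 * j)) \<partial>lborel \<partial>\<nu>)"
    by (rule P.Fubini'[symmetric]) measurable
  also have "\<dots> = (\<integral>\<^sup>+x. ennreal N * ennreal (norm x ^ (2 * j)) \<partial>\<nu>)"
    unfolding gauss_moment N_def by (intro nn_integral_cong ennreal_mult') auto
  also have "\<dots> = ennreal N * S" unfolding S_def by (rule nn_integral_cmult) measurable
  finally have "\<Phi> e * ennreal R = ennreal N * S" .
  then have "\<Phi> e * (ennreal R * ennreal (1 / R)) = ennreal N * ennreal (1 / R) * S" by (metis mult.assoc mult.commute)
  moreover have "ennreal R * ennreal (1 / R) = 1" using R by (simp add: ennreal_mult'[symmetric])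
  moreover have "ennreal N * ennreal (1 / R) = ennreal (dir_moment CARD('k) j)"
  proof -
    have "(4::real) ^ j = 2 ^ j * 2 ^ j" by (simp flip: power_mult_distrib)
    then have "N * (1 / R) = dir_moment CARD('k) j" by (simp add: N_def R_def dir_moment_def mult_ac)
    then show ?thesis using N by (simp add: ennreal_mult'[symmetric])
  qed
  ultimately have "\<Phi> e = ennreal (dir_moment CARD('k) j) * S" by simp
  then have "\<Phi> a = ennreal (norm a ^ (2 * j)) * (ennreal (dir_moment CARD('k) j) * S)" using \<Phi>[of a] by simp
  also have "\<dots> = ennreal (dir_moment CARD('k) j * norm a ^ (2 * j)) * S"
    by (subst ennreal_mult') (auto simp: dir_moment_nonneg mult_ac)
  finally show ?thesis by (simp add: \<Phi>_def S_def)
qed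

section \<open>Joint moments of the two blocks on the sphere\<close>

lemma orthogonal_transformation_fst:
  "orthogonal_transformation T \<Longrightarrow> orthogonal_transformation (\<lambda>z. (T (fst z), snd z))"
  by (auto simp: orthogonal_transformation_def linear_iff inner_prod_def)

lemma orthogonal_transformation_snd:
  "orthogonal_transformation T \<Longrightarrow> orthogonal_transformation (\<lambda>z. (fst z, T (snd z)))"
  by (auto simp: orthogonal_transformation_def linear_iff inner_prod_def)

lemma nn_integral_sphere_orthogonal:
  fixes T :: "'a::euclidean_space \<Rightarrow> 'a"
  assumes T: "orthogonal_transformation T" and [measurable]: "g \<in> borel_measurable sphere_measure"
  shows "(\<integral>\<^sup>+z. g (T z) \<partial>sphere_measure) = (\<integral>\<^sup>+z. g z \<partial>(sphere_measure :: 'a::euclidean_space measure))"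
proof -
  have "(\<integral>\<^sup>+z. g z \<partial>(sphere_measure :: 'a measure)) = (\<integral>\<^sup>+z. g z \<partial>distr sphere_measure sphere_measure T)"
    by (simp add: distr_sphere_orthogonal[OF T])
  also have "\<dots> = (\<integral>\<^sup>+z. g (T z) \<partial>sphere_measure)"
    by (rule nn_integral_distr[OF orthogonal_measurable_sphere[OF T]]) simp
  finally show ?thesis ..
qed

text \<open>\<open>F\<close> collects the factors that rotations of the block \<open>p\<close> leave
  unchanged, as the lifting hypothesis says. The image under \<open>p\<close> of the measure
  weighted by \<open>F\<close> is then finite and rotation invariant.\<close>

lemma sphere_projection_moment:
  fixes p :: "'a::euclidean_space \<Rightarrow> real^'k" and F :: "'a \<Rightarrow> ennreal"
  assumes p [measurable]: "p \<in> borel_measurable borel" and F [measurable]: "F \<in> borel_measurable sphere_measure"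
    and fin: "(\<integral>\<^sup>+z. F z \<partial>sphere_measure) < \<infinity>"
    and lift: "\<And>T. orthogonal_transformation T \<Longrightarrow> \<exists>S. orthogonal_transformation S \<and> (\<forall>z. p (S z) = T (p z)) \<and> (\<forall>z. F (S z) = F z)"
  shows "(\<integral>\<^sup>+z. F z * ennreal ((p z \<bullet> a) ^ (2 * j)) \<partial>sphere_measure)
     = ennreal (dir_moment CARD('k) j * norm a ^ (2 * j)) * (\<integral>\<^sup>+z. F z * ennreal (norm (p z) ^ (2 * j)) \<partial>sphere_measure)"
proof -
  define \<nu> where "\<nu> = distr (density sphere_measure F) borel p"
  have [measurable]: "p \<in> borel_measurable (sphere_measure :: 'a measure)" by (rule borel_measurable_sphere[OF p])
  have nu: "(\<integral>\<^sup>+x. g x \<partial>\<nu>) = (\<integral>\<^sup>+z. F z * g (p z) \<partial>sphere_measure)" if [measurable]: "g \<in> borel_measurable borel" for g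
    unfolding \<nu>_def by (subst nn_integral_distr, simp, simp) (subst nn_integral_density, auto)
  have sets: "sets \<nu> = sets borel" by (simp add: \<nu>_def)
  have "finite_measure \<nu>"
  proof
    have "emeasure \<nu> (space \<nu>) = (\<integral>\<^sup>+x. 1 \<partial>\<nu>)" by simp
    also have "\<dots> = (\<integral>\<^sup>+z. F z \<partial>sphere_measure)" by (subst nu) auto
    finally show "emeasure \<nu> (space \<nu>) \<noteq> \<infinity>" using fin by simp
  qed
  moreover have "(\<integral>\<^sup>+x. g (T x) \<partial>\<nu>) = (\<integral>\<^sup>+x. g x \<partial>\<nu>)" if T: "orthogonal_transformation T" and g [measurable]: "g \<in> borel_measurable borel" for T g
  proof -
    note [measurable] = orthogonal_transformation_measurable[OF T]
    obtain S where S: "orthogonal_transformation S" "\<And>z. p (S z) = T (p z)" "\<And>z. F (S z) = F z" using lift[OF T] by blast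
    have "(\<integral>\<^sup>+x. g (T x) \<partial>\<nu>) = (\<integral>\<^sup>+z. F z * g (T (p z)) \<partial>sphere_measure)" by (rule nu) measurable
    also have "\<dots> = (\<integral>\<^sup>+z. (\<lambda>z. F z * g (p z)) (S z) \<partial>sphere_measure)" by (simp add: S)
    also have "\<dots> = (\<integral>\<^sup>+z. F z * g (p z) \<partial>sphere_measure)" by (rule nn_integral_sphere_orthogonal[OF S(1)]) measurable
    finally show ?thesis by (simp add: nu)
  qed
  ultimately have "(\<integral>\<^sup>+x. ennreal ((x \<bullet> a) ^ (2 * j)) \<partial>\<nu>) = ennreal (dir_moment CARD('k) j * norm a ^ (2 * j)) * (\<integral>\<^sup>+x. ennreal (norm x ^ (2 * j)) \<partial>\<nu>)"
    using sets by (intro rotation_invariant_moment)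
  then show ?thesis by (simp add: nu)
qed

lemma sphere_coords:
  fixes z :: "(real^'m) \<times> (real^'n)"
  assumes "z \<in> sphere 0 1"
  shows "(norm (fst z))\<^sup>2 = (1 + f_map z) / 2" "(norm (snd z))\<^sup>2 = (1 - f_map z) / 2"
proof -
  have "(norm (fst z))\<^sup>2 + (norm (snd z))\<^sup>2 = 1" using assms by (simp add: norm_prod_def)
  then show "(norm (fst z))\<^sup>2 = (1 + f_map z) / 2" "(norm (snd z))\<^sup>2 = (1 - f_map z) / 2"
    unfolding f_map_def by (simp_all add: field_simps)
qed

lemma sphere_norm_le:
  fixes z :: "(real^'m) \<times> (real^'n)"
  assumes "z \<in> sphere 0 1"
  shows "norm (fst z) \<le> 1" "norm (snd z) \<le> 1"
  using assms norm_fst_le[of "fst z" "snd z"] norm_snd_le[of "snd z" "fst z"] by auto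

text \<open>While one block is averaged over directions, the factor of the other block belongs to
  the invariant weight. What finally remains is a product of even powers of the block norms, a
  function of \<open>f_map\<close>. As an identity of measures the result applies to integrands
  \<open>w\<close> of any sign.\<close>

theorem distr_f_map_moment:
  fixes a :: "real^'m" and b :: "real^'n"
  shows "distr (density sphere_measure (\<lambda>z. ennreal ((fst z \<bullet> a) ^ (2 * j) * (snd z \<bullet> b) ^ (2 * l)))) (h_measure CARD('m) CARD('n)) f_map
    = density (h_measure CARD('m) CARD('n)) (\<lambda>t. ennreal (dir_moment CARD('m) j * dir_moment CARD('n) l * norm a ^ (2 * j) * norm b ^ (2 * l) * (((1 + t) / 2) ^ j * ((1 - t) / 2) ^ l)))"
    (is "?L = ?R")
proof (rule measure_eqI)
  interpret S: finite_measure "sphere_measure :: ((real^'m) \<times> (real^'n)) measure" by (rule finite_measure_sphere)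
  have Sf: "emeasure sphere_measure (sphere (0 :: (real^'m) \<times> (real^'n)) 1) \<noteq> \<top>"
    using S.emeasure_finite by simp
  fix A assume "A \<in> sets ?L"
  then have As: "A \<in> sets (h_measure CARD('m) CARD('n))" by simp
  then have Ab [measurable]: "A \<in> sets borel" by (simp add: sets_h_measure) (subst (asm) sets_restrict_space_iff, auto)
  have dens [measurable]: "(\<lambda>z. ennreal ((fst z \<bullet> a) ^ (2 * j) * (snd z \<bullet> b) ^ (2 * l))) \<in> borel_measurable (sphere_measure :: ((real^'m) \<times> (real^'n)) measure)"
    by (intro borel_measurable_sphere) measurable
  have fA [measurable]: "(\<lambda>z. indicator A (f_map z) :: ennreal) \<in> borel_measurable (sphere_measure :: ((real^'m) \<times> (real^'n)) measure)"
    by (intro borel_measurable_sphere) measurable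
  have "emeasure ?L A = (\<integral>\<^sup>+t. indicator A t \<partial>?L)" using As by simp
  also have "\<dots> = (\<integral>\<^sup>+z. indicator A (f_map z) \<partial>density sphere_measure (\<lambda>z. ennreal ((fst z \<bullet> a) ^ (2 * j) * (snd z \<bullet> b) ^ (2 * l))))"
    using As by (intro nn_integral_distr) auto
  also have "\<dots> = (\<integral>\<^sup>+z. ennreal ((fst z \<bullet> a) ^ (2 * j) * (snd z \<bullet> b) ^ (2 * l)) * indicator A (f_map z) \<partial>sphere_measure)"
    by (rule nn_integral_density) measurable
  also have "\<dots> = (\<integral>\<^sup>+z. (indicator A (f_map z) * ennreal ((snd z \<bullet> b) ^ (2 * l))) * ennreal ((fst z \<bullet> a) ^ (2 * j)) \<partial>sphere_measure)"
    by (intro nn_integral_cong, subst ennreal_mult') (simp, simp only: mult_ac)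
  also have "\<dots> = ennreal (dir_moment CARD('m) j * norm a ^ (2 * j)) * (\<integral>\<^sup>+z. (indicator A (f_map z) * ennreal ((snd z \<bullet> b) ^ (2 * l))) * ennreal (norm (fst z) ^ (2 * j)) \<partial>(sphere_measure :: ((real^'m) \<times> (real^'n)) measure))"
  proof (rule sphere_projection_moment[where p = fst and F = "\<lambda>z. indicator A (f_map z) * ennreal ((snd z \<bullet> b) ^ (2 * l))"])
    show "(\<lambda>z. indicator A (f_map z) * ennreal ((snd z \<bullet> b) ^ (2 * l))) \<in> borel_measurable (sphere_measure :: ((real^'m) \<times> (real^'n)) measure)"
      by (intro borel_measurable_times_ennreal fA borel_measurable_sphere) measurable
    have "(\<integral>\<^sup>+z. indicator A (f_map z) * ennreal ((snd z \<bullet> b) ^ (2 * l)) \<partial>(sphere_measure :: ((real^'m) \<times> (real^'n)) measure))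
       \<le> (\<integral>\<^sup>+z. ennreal (norm b ^ (2 * l)) \<partial>(sphere_measure :: ((real^'m) \<times> (real^'n)) measure))"
    proof (rule nn_integral_mono)
      fix z :: "(real^'m) \<times> (real^'n)" assume "z \<in> space sphere_measure"
      then have "\<bar>snd z \<bullet> b\<bar> \<le> norm b"
        using Cauchy_Schwarz_ineq2[of "snd z" b] mult_right_mono[OF sphere_norm_le(2), of z "norm b"] by simp
      then have "\<bar>snd z \<bullet> b\<bar> ^ (2 * l) \<le> norm b ^ (2 * l)" by (intro power_mono) auto
      then have "(snd z \<bullet> b) ^ (2 * l) \<le> norm b ^ (2 * l)" by (simp only: power_even_abs[OF dvd_triv_left])
      then show "indicator A (f_map z) * ennreal ((snd z \<bullet> b) ^ (2 * l)) \<le> ennreal (norm b ^ (2 * l))"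
        by (auto simp: indicator_def intro!: ennreal_leI)
    qed
    also have "\<dots> < \<infinity>" using Sf by (simp add: ennreal_mult_eq_top_iff less_top[symmetric])
    finally show "(\<integral>\<^sup>+z. indicator A (f_map z) * ennreal ((snd z \<bullet> b) ^ (2 * l)) \<partial>(sphere_measure :: ((real^'m) \<times> (real^'n)) measure)) < \<infinity>" .
    fix T :: "real^'m \<Rightarrow> real^'m" assume T: "orthogonal_transformation T"
    then have nT: "norm (T x) = norm x" for x by (simp add: orthogonal_transformation)
    from T show "\<exists>S :: (real^'m) \<times> (real^'n) \<Rightarrow> (real^'m) \<times> (real^'n). orthogonal_transformation S \<and> (\<forall>z::(real^'m) \<times> (real^'n). fst (S z) = T (fst z)) \<and> (\<forall>z. indicator A (f_map (S z)) * ennreal ((snd (S z) \<bullet> b) ^ (2 * l)) = indicator A (f_map z) * ennreal ((snd z \<bullet> b) ^ (2 * l)))"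
      by (intro exI[of _ "\<lambda>z. (T (fst z), snd z)"]) (auto intro!: orthogonal_transformation_fst simp: f_map_def nT)
  qed measurable
  also have "(\<integral>\<^sup>+z. (indicator A (f_map z) * ennreal ((snd z \<bullet> b) ^ (2 * l))) * ennreal (norm (fst z) ^ (2 * j)) \<partial>(sphere_measure :: ((real^'m) \<times> (real^'n)) measure))
    = (\<integral>\<^sup>+z. (indicator A (f_map z) * ennreal (norm (fst z) ^ (2 * j))) * ennreal ((snd z \<bullet> b) ^ (2 * l)) \<partial>(sphere_measure :: ((real^'m) \<times> (real^'n)) measure))"
    by (intro nn_integral_cong) (simp add: mult_ac)
  also have "\<dots> = ennreal (dir_moment CARD('n) l * norm b ^ (2 * l)) * (\<integral>\<^sup>+z. (indicator A (f_map z) * ennreal (norm (fst z) ^ (2 * j))) * ennreal (norm (snd z) ^ (2 * l)) \<partial>(sphere_measure :: ((real^'m) \<times> (real^'n)) measure))"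
  proof (rule sphere_projection_moment[where p = snd and F = "\<lambda>z. indicator A (f_map z) * ennreal (norm (fst z) ^ (2 * j))"])
    show "(\<lambda>z. indicator A (f_map z) * ennreal (norm (fst z) ^ (2 * j))) \<in> borel_measurable (sphere_measure :: ((real^'m) \<times> (real^'n)) measure)"
      by (intro borel_measurable_times_ennreal fA borel_measurable_sphere) measurable
    have "(\<integral>\<^sup>+z. indicator A (f_map z) * ennreal (norm (fst z) ^ (2 * j)) \<partial>(sphere_measure :: ((real^'m) \<times> (real^'n)) measure))
       \<le> (\<integral>\<^sup>+z. ennreal 1 \<partial>(sphere_measure :: ((real^'m) \<times> (real^'n)) measure))"
    proof (rule nn_integral_mono)
      fix z :: "(real^'m) \<times> (real^'n)" assume "z \<in> space sphere_measure"
      then have "norm (fst z) ^ (2 * j) \<le> 1" using sphere_norm_le(1)[of z] by (intro power_le_one) auto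
      then show "indicator A (f_map z) * ennreal (norm (fst z) ^ (2 * j)) \<le> ennreal 1"
        by (auto simp: indicator_def intro!: ennreal_leI simp del: ennreal_1)
    qed
    also have "\<dots> < \<infinity>" using Sf by (simp add: ennreal_mult_eq_top_iff less_top[symmetric])
    finally show "(\<integral>\<^sup>+z. indicator A (f_map z) * ennreal (norm (fst z) ^ (2 * j)) \<partial>(sphere_measure :: ((real^'m) \<times> (real^'n)) measure)) < \<infinity>" .
    fix T :: "real^'n \<Rightarrow> real^'n" assume T: "orthogonal_transformation T"
    then have nT: "norm (T x) = norm x" for x by (simp add: orthogonal_transformation)
    from T show "\<exists>S :: (real^'m) \<times> (real^'n) \<Rightarrow> (real^'m) \<times> (real^'n). orthogonal_transformation S \<and> (\<forall>z::(real^'m) \<times> (real^'n). snd (S z) = T (snd z)) \<and> (\<forall>z. indicator A (f_map (S z)) * ennreal (norm (fst (S z)) ^ (2 * j)) = indicator A (f_map z) * ennreal (norm (fst z) ^ (2 * j)))"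
      by (intro exI[of _ "\<lambda>z. (fst z, T (snd z))"]) (auto intro!: orthogonal_transformation_snd simp: f_map_def nT)
  qed measurable
  also have "(\<integral>\<^sup>+z. (indicator A (f_map z) * ennreal (norm (fst z) ^ (2 * j))) * ennreal (norm (snd z) ^ (2 * l)) \<partial>(sphere_measure :: ((real^'m) \<times> (real^'n)) measure))
     = (\<integral>\<^sup>+z. (\<lambda>t. ennreal (((1 + t) / 2) ^ j * ((1 - t) / 2) ^ l) * indicator A t) (f_map z) \<partial>(sphere_measure :: ((real^'m) \<times> (real^'n)) measure))"
  proof (rule nn_integral_cong)
    fix z :: "(real^'m) \<times> (real^'n)" assume "z \<in> space sphere_measure"
    then have z: "z \<in> sphere 0 1" by simp
    have "norm (fst z) ^ (2 * j) * norm (snd z) ^ (2 * l) = ((1 + f_map z) / 2) ^ j * ((1 - f_map z) / 2) ^ l"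
      unfolding power_mult sphere_coords[OF z] ..
    then have "ennreal (norm (fst z) ^ (2 * j)) * ennreal (norm (snd z) ^ (2 * l)) = ennreal (((1 + f_map z) / 2) ^ j * ((1 - f_map z) / 2) ^ l)"
      by (subst ennreal_mult'[symmetric]) auto
    then show "(indicator A (f_map z) * ennreal (norm (fst z) ^ (2 * j))) * ennreal (norm (snd z) ^ (2 * l)) = (\<lambda>t. ennreal (((1 + t) / 2) ^ j * ((1 - t) / 2) ^ l) * indicator A t) (f_map z)"
      by (simp add: mult_ac)
  qed
  also have "\<dots> = (\<integral>\<^sup>+t. ennreal (((1 + t) / 2) ^ j * ((1 - t) / 2) ^ l) * indicator A t \<partial>h_measure CARD('m) CARD('n))"
    by (rule nn_integral_f_map) measurable
  also have "ennreal (dir_moment CARD('m) j * norm a ^ (2 * j)) * (ennreal (dir_moment CARD('n) l * norm b ^ (2 * l)) * \<dots>)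
    = (\<integral>\<^sup>+t. ennreal (dir_moment CARD('m) j * norm a ^ (2 * j)) * (ennreal (dir_moment CARD('n) l * norm b ^ (2 * l)) * (ennreal (((1 + t) / 2) ^ j * ((1 - t) / 2) ^ l) * indicator A t)) \<partial>h_measure CARD('m) CARD('n))"
  proof -
    define W where "W t = ennreal (((1 + t) / 2) ^ j * ((1 - t) / 2) ^ l) * indicator A t" for t :: real
    have [measurable]: "W \<in> borel_measurable borel" unfolding W_def[abs_def] by measurable
    have Wh: "W \<in> borel_measurable (h_measure CARD('m) CARD('n))" by (rule borel_measurable_h_measure) measurable
    have Wh': "(\<lambda>t. c * W t) \<in> borel_measurable (h_measure CARD('m) CARD('n))" for c by (rule borel_measurable_h_measure) measurable
    show ?thesis unfolding W_def[symmetric] nn_integral_cmult[OF Wh'] nn_integral_cmult[OF Wh] ..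
  qed
  also have "\<dots> = (\<integral>\<^sup>+t. ennreal (dir_moment CARD('m) j * dir_moment CARD('n) l * norm a ^ (2 * j) * norm b ^ (2 * l) * (((1 + t) / 2) ^ j * ((1 - t) / 2) ^ l)) * indicator A t \<partial>h_measure CARD('m) CARD('n))"
  proof (rule nn_integral_cong)
    fix t :: real
    define x y w where "x = dir_moment CARD('m) j * norm a ^ (2 * j)" and "y = dir_moment CARD('n) l * norm b ^ (2 * l)" and "w = ((1 + t) / 2) ^ j * ((1 - t) / 2) ^ l"
    have xy: "x \<ge> 0" "y \<ge> 0" by (auto simp: x_def y_def dir_moment_nonneg)
    have "dir_moment CARD('m) j * dir_moment CARD('n) l * norm a ^ (2 * j) * norm b ^ (2 * l) * w = x * (y * w)" by (simp add: x_def y_def)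
    then have "ennreal (dir_moment CARD('m) j * dir_moment CARD('n) l * norm a ^ (2 * j) * norm b ^ (2 * l) * w) = ennreal x * (ennreal y * ennreal w)"
      using xy by (simp only: ennreal_mult')
    then show "ennreal (dir_moment CARD('m) j * norm a ^ (2 * j)) * (ennreal (dir_moment CARD('n) l * norm b ^ (2 * l)) * (ennreal (((1 + t) / 2) ^ j * ((1 - t) / 2) ^ l) * indicator A t))
       = ennreal (dir_moment CARD('m) j * dir_moment CARD('n) l * norm a ^ (2 * j) * norm b ^ (2 * l) * (((1 + t) / 2) ^ j * ((1 - t) / 2) ^ l)) * indicator A t"
      unfolding x_def[symmetric] y_def[symmetric] w_def[symmetric] by (simp add: mult.assoc)
  qed
  also have "\<dots> = emeasure ?R A"
    using As by (subst emeasure_density) auto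
  finally show "emeasure ?L A = emeasure ?R A" .
qed simp


lemma finite_measure_h: "finite_measure (h_measure CARD('m::finite) CARD('n::finite))"
proof -
  interpret S: finite_measure "sphere_measure :: ((real^'m) \<times> (real^'n)) measure" by (rule finite_measure_sphere)
  have "finite_measure (distr (sphere_measure :: ((real^'m) \<times> (real^'n)) measure) (h_measure CARD('m) CARD('n)) f_map)"
    by (rule S.finite_measure_distr) measurable
  then show ?thesis by (simp add: distr_f_map)
qed

lemma integral_f_map_moment:
  fixes w :: "real \<Rightarrow> real" and a :: "real^'m" and b :: "real^'n"
  assumes [measurable]: "w \<in> borel_measurable (h_measure CARD('m) CARD('n))"
  shows "(\<integral>z. w (f_map z) * ((fst z \<bullet> a) ^ (2 * j) * (snd z \<bullet> b) ^ (2 * l)) \<partial>sphere_measure)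
    = dir_moment CARD('m) j * dir_moment CARD('n) l * norm a ^ (2 * j) * norm b ^ (2 * l) * (\<integral>t. w t * (((1 + t) / 2) ^ j * ((1 - t) / 2) ^ l) \<partial>h_measure CARD('m) CARD('n))"
proof -
  define D where "D z = (fst z \<bullet> a) ^ (2 * j) * (snd z \<bullet> b) ^ (2 * l)" for z
  define K where "K = dir_moment CARD('m) j * dir_moment CARD('n) l * norm a ^ (2 * j) * norm b ^ (2 * l)"
  have [measurable]: "D \<in> borel_measurable sphere_measure"
    unfolding D_def[abs_def] by (intro borel_measurable_sphere) measurable
  have D: "D z \<ge> 0" for z by (simp add: D_def)
  have K: "K \<ge> 0" by (simp add: K_def dir_moment_nonneg)
  have "(\<integral>z. w (f_map z) * D z \<partial>sphere_measure) = (\<integral>z. D z *\<^sub>R w (f_map z) \<partial>sphere_measure)"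
    by (simp add: mult.commute)
  also have "\<dots> = (\<integral>z. w (f_map z) \<partial>density sphere_measure (\<lambda>z. ennreal (D z)))"
    by (rule integral_density[symmetric]) (auto simp: D)
  also have "\<dots> = (\<integral>t. w t \<partial>distr (density sphere_measure (\<lambda>z. ennreal (D z))) (h_measure CARD('m) CARD('n)) f_map)"
    by (rule integral_distr[symmetric]) auto
  also have "distr (density sphere_measure (\<lambda>z. ennreal (D z))) (h_measure CARD('m) CARD('n)) f_map
      = density (h_measure CARD('m) CARD('n)) (\<lambda>t. ennreal (K * (((1 + t) / 2) ^ j * ((1 - t) / 2) ^ l)))"
    unfolding D_def K_def by (rule distr_f_map_moment)
  also have "(\<integral>t. w t \<partial>density (h_measure CARD('m) CARD('n)) (\<lambda>t. ennreal (K * (((1 + t) / 2) ^ j * ((1 - t) / 2) ^ l))))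
      = (\<integral>t. (K * (((1 + t) / 2) ^ j * ((1 - t) / 2) ^ l)) *\<^sub>R w t \<partial>h_measure CARD('m) CARD('n))"
    by (rule integral_density) (auto simp: K intro!: AE_I2 mult_nonneg_nonneg)
  also have "\<dots> = (\<integral>t. K * (w t * (((1 + t) / 2) ^ j * ((1 - t) / 2) ^ l)) \<partial>h_measure CARD('m) CARD('n))"
    by (simp add: mult_ac)
  finally show ?thesis by (simp add: D_def K_def)
qed

lemma integral_sphere_orthogonal:
  fixes T :: "'a::euclidean_space \<Rightarrow> 'a" and g :: "'a \<Rightarrow> real"
  assumes T: "orthogonal_transformation T" and [measurable]: "g \<in> borel_measurable sphere_measure"
  shows "(\<integral>z. g (T z) \<partial>sphere_measure) = (\<integral>z. g z \<partial>(sphere_measure :: 'a measure))"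
proof -
  have "(\<integral>z. g z \<partial>(sphere_measure :: 'a measure)) = (\<integral>z. g z \<partial>distr sphere_measure sphere_measure T)"
    by (simp add: distr_sphere_orthogonal[OF T])
  also have "\<dots> = (\<integral>z. g (T z) \<partial>sphere_measure)"
    by (rule integral_distr[OF orthogonal_measurable_sphere[OF T]]) simp
  finally show ?thesis ..
qed

lemma measurable_comp_f_map [measurable (raw)]:
  assumes "w \<in> borel_measurable (h_measure m n)"
  shows "(\<lambda>z. w (f_map z)) \<in> borel_measurable sphere_measure"
  using measurable_compose[OF f_map_measurable_sphere assms] .

text \<open>Reflecting the first block preserves \<open>f_map\<close> and the measure but changes
  the sign of the integrand.\<close>

lemma integral_f_map_odd:
  fixes w :: "real \<Rightarrow> real" and a :: "real^'m" and b :: "real^'n"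
  assumes [measurable]: "w \<in> borel_measurable (h_measure CARD('m) CARD('n))" and "odd r"
  shows "(\<integral>z. w (f_map z) * ((fst z \<bullet> a) ^ r * (snd z \<bullet> b) ^ q) \<partial>sphere_measure) = 0"
proof -
  define g where "g z = w (f_map z) * ((fst z \<bullet> a) ^ r * (snd z \<bullet> b) ^ q)" for z
  have g: "g \<in> borel_measurable sphere_measure"
    unfolding g_def[abs_def] by (intro borel_measurable_times measurable_comp_f_map borel_measurable_sphere assms(1)) measurable
  have "orthogonal_transformation (uminus :: real^'m \<Rightarrow> real^'m)"
    by (simp add: orthogonal_transformation linear_iff)
  then have T: "orthogonal_transformation (\<lambda>z :: (real^'m) \<times> (real^'n). (- fst z, snd z))"
    by (rule orthogonal_transformation_fst)
  have "g (- fst z, snd z) = - g z" for z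
    using assms(2) by (simp add: g_def f_map_def)
  then have "(\<integral>z. g z \<partial>sphere_measure) = (\<integral>z. - g z \<partial>sphere_measure)"
    using integral_sphere_orthogonal[OF T g] by simp
  then show ?thesis by (simp add: g_def)
qed

lemma sum_odd_zero:
  fixes g :: "nat \<Rightarrow> real"
  assumes "\<And>r. odd r \<Longrightarrow> g r = 0"
  shows "(\<Sum>r\<le>2 * k. g r) = (\<Sum>j\<le>k. g (2 * j))"
  by (induction k) (auto simp: assms)

lemma integrable_comp_f_map:
  fixes w :: "real \<Rightarrow> real"
  assumes "integrable (h_measure CARD('m) CARD('n)) w"
  shows "integrable (sphere_measure :: ((real^'m) \<times> (real^'n)) measure) (\<lambda>z. w (f_map z))"
  using assms integrable_distr_eq[of f_map "sphere_measure :: ((real^'m) \<times> (real^'n)) measure" "h_measure CARD('m) CARD('n)" w]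
  by (simp add: distr_f_map borel_measurable_integrable)

lemma inner_prod_bound:
  fixes z \<zeta> :: "(real^'m) \<times> (real^'n)"
  assumes "z \<in> sphere 0 1" "\<zeta> \<in> sphere 0 1"
  shows "\<bar>fst z \<bullet> fst \<zeta>\<bar> \<le> 1" "\<bar>snd z \<bullet> snd \<zeta>\<bar> \<le> 1" "\<bar>z \<bullet> \<zeta>\<bar> \<le> 1"
proof -
  show "\<bar>fst z \<bullet> fst \<zeta>\<bar> \<le> 1" "\<bar>snd z \<bullet> snd \<zeta>\<bar> \<le> 1"
    using Cauchy_Schwarz_ineq2[of "fst z" "fst \<zeta>"] Cauchy_Schwarz_ineq2[of "snd z" "snd \<zeta>"]
      mult_le_one[OF sphere_norm_le(1)[OF assms(1)] _ sphere_norm_le(1)[OF assms(2)]]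
      mult_le_one[OF sphere_norm_le(2)[OF assms(1)] _ sphere_norm_le(2)[OF assms(2)]] by auto
  show "\<bar>z \<bullet> \<zeta>\<bar> \<le> 1" using Cauchy_Schwarz_ineq2[of z \<zeta>] assms by simp
qed

text \<open>This is \<open>kap\<close> with \<open>b + 1 = m/2\<close> and
  \<open>a + 1 = n/2\<close>, stated outside the locale.\<close>

definition zonal_kap :: "nat \<Rightarrow> nat \<Rightarrow> nat \<Rightarrow> nat \<Rightarrow> real" where
  "zonal_kap m n k j = fact (2 * k) / 4 ^ k / (fact j * fact (k - j) * pochhammer (real m / 2) j * pochhammer (real n / 2) (k - j))"

text \<open>The inner product is the sum of those of the two blocks, so the binomial theorem
  applies. Odd powers integrate to 0 and even ones to products of \<open>dir_moment\<close>; the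
  binomial coefficient cancels the factorials \<open>(2j)!\<close> and \<open>(2(k-j))!\<close> in
  them and leaves \<open>zonal_kap\<close>.\<close>

theorem integral_zonal_power:
  fixes w :: "real \<Rightarrow> real" and \<zeta> :: "(real^'m) \<times> (real^'n)"
  assumes w: "integrable (h_measure CARD('m) CARD('n)) w" and \<zeta>: "\<zeta> \<in> sphere 0 1"
  shows "(\<integral>z. w (f_map z) * (z \<bullet> \<zeta>) ^ (2 * k) \<partial>sphere_measure)
    = (\<Sum>j\<le>k. zonal_kap CARD('m) CARD('n) k j * (\<integral>t. w t * poly (YV j (k - j)) t \<partial>h_measure CARD('m) CARD('n)) * poly (YV j (k - j)) (f_map \<zeta>))"
proof -
  have [measurable]: "w \<in> borel_measurable (h_measure CARD('m) CARD('n))" using w by (rule borel_measurable_integrable)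
  define g where "g r z = w (f_map z) * ((fst z \<bullet> fst \<zeta>) ^ r * (snd z \<bullet> snd \<zeta>) ^ (2 * k - r))" for r z
  have "w (f_map z) * (z \<bullet> \<zeta>) ^ (2 * k) = (\<Sum>r\<le>2 * k. real ((2 * k) choose r) * g r z)" for z
    by (simp add: inner_prod_def binomial_ring sum_distrib_left g_def mult_ac)
  then have "(\<integral>z. w (f_map z) * (z \<bullet> \<zeta>) ^ (2 * k) \<partial>sphere_measure) = (\<integral>z. (\<Sum>r\<le>2 * k. real ((2 * k) choose r) * g r z) \<partial>sphere_measure)"
    by simp
  also have "\<dots> = (\<Sum>r\<le>2 * k. \<integral>z. real ((2 * k) choose r) * g r z \<partial>sphere_measure)"
  proof (rule Bochner_Integration.integral_sum, rule integrable_mult_right)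
    fix r
    show "integrable sphere_measure (g r)"
    proof (rule Bochner_Integration.integrable_bound[OF integrable_comp_f_map[OF w]])
      show "g r \<in> borel_measurable sphere_measure"
        unfolding g_def[abs_def] by (intro borel_measurable_times measurable_comp_f_map borel_measurable_sphere) measurable
      show "AE z in sphere_measure. norm (g r z) \<le> norm (w (f_map z))"
      proof (rule AE_I2)
        fix z :: "(real^'m) \<times> (real^'n)" assume "z \<in> space sphere_measure"
        then have z: "z \<in> sphere 0 1" by simp
        have "\<bar>(fst z \<bullet> fst \<zeta>) ^ r * (snd z \<bullet> snd \<zeta>) ^ (2 * k - r)\<bar> \<le> 1"
          unfolding abs_mult power_abs using inner_prod_bound[OF z \<zeta>]
          by (intro mult_le_one power_le_one) auto
        then show "norm (g r z) \<le> norm (w (f_map z))"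
          unfolding g_def real_norm_def abs_mult[of "w _"] by (intro mult_left_le) auto
      qed
    qed
  qed
  also have "\<dots> = (\<Sum>r\<le>2 * k. real ((2 * k) choose r) * (\<integral>z. g r z \<partial>sphere_measure))" by simp
  also have "\<dots> = (\<Sum>j\<le>k. real ((2 * k) choose (2 * j)) * (\<integral>z. g (2 * j) z \<partial>sphere_measure))"
    by (rule sum_odd_zero) (simp add: g_def integral_f_map_odd)
  also have "\<dots> = (\<Sum>j\<le>k. zonal_kap CARD('m) CARD('n) k j * (\<integral>t. w t * poly (YV j (k - j)) t \<partial>h_measure CARD('m) CARD('n)) * poly (YV j (k - j)) (f_map \<zeta>))"
  proof (intro sum.cong refl)
    fix j assume "j \<in> {..k}"
    then have j: "j \<le> k" by simp
    then have e: "2 * k - 2 * j = 2 * (k - j)" by simp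
    define Q where "Q = (\<integral>t. w t * poly (YV j (k - j)) t \<partial>h_measure CARD('m) CARD('n))"
    have "(\<integral>z. g (2 * j) z \<partial>sphere_measure) = dir_moment CARD('m) j * dir_moment CARD('n) (k - j) * norm (fst \<zeta>) ^ (2 * j) * norm (snd \<zeta>) ^ (2 * (k - j)) * Q"
      unfolding g_def e Q_def poly_YV by (rule integral_f_map_moment) measurable
    also have "\<dots> = dir_moment CARD('m) j * dir_moment CARD('n) (k - j) * poly (YV j (k - j)) (f_map \<zeta>) * Q"
      unfolding power_mult sphere_coords[OF \<zeta>] poly_YV by simp
    finally have 1: "(\<integral>z. g (2 * j) z \<partial>sphere_measure) = dir_moment CARD('m) j * dir_moment CARD('n) (k - j) * poly (YV j (k - j)) (f_map \<zeta>) * Q" .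
    have 2: "real ((2 * k) choose (2 * j)) * (dir_moment CARD('m) j * dir_moment CARD('n) (k - j)) = zonal_kap CARD('m) CARD('n) k j"
    proof -
      have "real ((2 * k) choose (2 * j)) = fact (2 * k) / (fact (2 * j) * fact (2 * (k - j)))"
        using j e by (simp add: binomial_fact)
      moreover have "(4::real) ^ k = 4 ^ j * 4 ^ (k - j)" using j by (simp flip: power_add)
      ultimately show ?thesis by (simp add: dir_moment_def zonal_kap_def)
    qed
    show "real ((2 * k) choose (2 * j)) * (\<integral>z. g (2 * j) z \<partial>sphere_measure) = zonal_kap CARD('m) CARD('n) k j * Q * poly (YV j (k - j)) (f_map \<zeta>)"
      unfolding 1 2[symmetric] by simp
  qed
  finally show ?thesis .
qed

section \<open>Invariant functions factor through \<open>f\<close>\<close>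

text \<open>The linear span of the exponentials, built one term at a time. Exponents add under
  multiplication, so it is an algebra and Stone-Weierstrass applies.\<close>

inductive_set exp_span :: "('a::euclidean_space \<Rightarrow> real) set" where
  zero: "(\<lambda>z. 0) \<in> exp_span"
| step: "g \<in> exp_span \<Longrightarrow> (\<lambda>z. k * exp (z \<bullet> c) + g z) \<in> exp_span"

lemma exp_span_add: "g \<in> exp_span \<Longrightarrow> h \<in> exp_span \<Longrightarrow> (\<lambda>z. g z + h z) \<in> exp_span"
proof (induction rule: exp_span.induct)
  case (step g k c)
  then have "(\<lambda>z. k * exp (z \<bullet> c) + (g z + h z)) \<in> exp_span" by (intro exp_span.step)
  then show ?case by (simp add: add.assoc)
qed simp

lemma exp_span_mult_exp: "g \<in> exp_span \<Longrightarrow> (\<lambda>z. k * exp (z \<bullet> c) * g z) \<in> exp_span"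
proof (induction rule: exp_span.induct)
  case (step g k' c')
  then have "(\<lambda>z. (k * k') * exp (z \<bullet> (c + c')) + k * exp (z \<bullet> c) * g z) \<in> exp_span" by (intro exp_span.step)
  then show ?case by (simp add: inner_add_right exp_add algebra_simps)
qed (simp add: exp_span.zero)

lemma exp_span_mult: "g \<in> exp_span \<Longrightarrow> h \<in> exp_span \<Longrightarrow> (\<lambda>z. g z * h z) \<in> exp_span"
proof (induction rule: exp_span.induct)
  case (step g k c)
  then have "(\<lambda>z. k * exp (z \<bullet> c) * h z + g z * h z) \<in> exp_span" by (intro exp_span_add exp_span_mult_exp)
  then show ?case by (simp add: distrib_right)
qed (simp add: exp_span.zero)

lemma exp_span_exp: "(\<lambda>z. k * exp (z \<bullet> c)) \<in> exp_span"
  using exp_span.step[OF exp_span.zero, of k c] by simp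

lemma exp_span_continuous: "g \<in> exp_span \<Longrightarrow> continuous_on S g"
  by (induction rule: exp_span.induct) (auto intro!: continuous_intros)

lemma exp_span_dense:
  fixes S :: "'a::euclidean_space set"
  assumes "compact S" "continuous_on S g" "e > 0"
  shows "\<exists>h \<in> exp_span. \<forall>x\<in>S. \<bar>g x - h x\<bar> < e"
proof -
  interpret function_ring_on exp_span S
  proof
    show "(\<lambda>_::'a. c) \<in> exp_span" for c
      using exp_span_exp[of c "0::'a"] by simp
    fix x y :: 'a assume "x \<noteq> y"
    have "x \<bullet> (x - y) \<noteq> y \<bullet> (x - y)"
      using \<open>x \<noteq> y\<close> by (metis eq_iff_diff_eq_0 inner_diff_left inner_eq_zero_iff)
    then show "\<exists>f\<in>exp_span. f x \<noteq> f y"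
      using exp_span_exp[of 1 "x - y"] by (intro bexI[of _ "\<lambda>z. 1 * exp (z \<bullet> (x - y))"]) auto
  qed (use assms(1) in \<open>auto intro: exp_span_continuous exp_span_add exp_span_mult\<close>)
  show ?thesis by (rule Stone_Weierstrass_basic[OF assms(2,3)])
qed

text \<open>Injectivity of the Laplace transform on the sphere: orthogonality to exponentials
  extends to all continuous functions by uniform approximation, and \<open>U\<close> itself is an
  L2-limit of continuous functions.\<close>

lemma integral_sphere_exp_eq_0_imp_AE:
  fixes U :: "'a::euclidean_space \<Rightarrow> real"
  assumes U [measurable]: "U \<in> borel_measurable sphere_measure" and bound: "\<And>z. \<bar>U z\<bar> \<le> K"
    and zero: "\<And>c. (\<integral>z. U z * exp (z \<bullet> c) \<partial>sphere_measure) = 0"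
  shows "AE z in sphere_measure. U z = 0"
proof -
  interpret finite_measure "sphere_measure :: 'a measure" by (rule finite_measure_sphere)
  have K: "K \<ge> 0" using bound[of 0] by linarith
  have int: "integrable sphere_measure (\<lambda>z. U z * g z)" if g: "continuous_on UNIV g" for g
  proof -
    have "bounded (g ` sphere (0::'a) 1)"
      using g by (intro compact_imp_bounded compact_continuous_image) (auto intro: continuous_on_subset)
    then obtain B where "\<forall>y\<in>g ` sphere 0 1. norm y \<le> B" unfolding bounded_iff by blast
    then have B: "\<bar>g z\<bar> \<le> B" if "norm z = 1" for z using that by auto
    have [measurable]: "g \<in> borel_measurable sphere_measure"
      using g by (intro borel_measurable_sphere borel_measurable_continuous_onI)
    show ?thesis
      using B bound K by (intro integrable_const_bound[of _ "K * B"]) (auto intro!: AE_I2 mult_mono simp: abs_mult)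
  qed
  have int1: "integrable sphere_measure U" using int[of "\<lambda>_. 1"] by simp
  have span: "(\<integral>z. U z * g z \<partial>sphere_measure) = 0" if "g \<in> exp_span" for g
    using that
  proof (induction rule: exp_span.induct)
    case (step g k c)
    have "(\<integral>z. U z * (k * exp (z \<bullet> c) + g z) \<partial>sphere_measure) = (\<integral>z. k * (U z * exp (z \<bullet> c)) + U z * g z \<partial>sphere_measure)"
      by (simp add: algebra_simps)
    also have "\<dots> = (\<integral>z. k * (U z * exp (z \<bullet> c)) \<partial>sphere_measure) + (\<integral>z. U z * g z \<partial>sphere_measure)"
    proof (rule Bochner_Integration.integral_add)
      show "integrable sphere_measure (\<lambda>z. k * (U z * exp (z \<bullet> c)))"
        by (rule integrable_mult_right, rule int) (intro continuous_intros)
      show "integrable sphere_measure (\<lambda>z. U z * g z)" by (rule int[OF exp_span_continuous[OF step(1)]])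
    qed
    finally show ?case using step zero by simp
  qed simp
  have cont: "(\<integral>z. U z * g z \<partial>sphere_measure) = 0" if g: "continuous_on UNIV g" for g
  proof -
    have "\<bar>\<integral>z. U z * g z \<partial>sphere_measure\<bar> \<le> e * (\<integral>z. \<bar>U z\<bar> \<partial>sphere_measure)" if "e > 0" for e
    proof -
      have "continuous_on (sphere 0 1) g" by (rule continuous_on_subset[OF g subset_UNIV])
      from exp_span_dense[OF compact_sphere this \<open>e > 0\<close>]
      obtain h where h: "h \<in> exp_span" "\<forall>z\<in>sphere 0 1. \<bar>g z - h z\<bar> < e" by (elim bexE)
      have "(\<integral>z. U z * g z \<partial>sphere_measure) = (\<integral>z. U z * g z - U z * h z \<partial>sphere_measure)"
        using span[OF h(1)] int[OF g] int[OF exp_span_continuous[OF h(1)]] by simp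
      also have "\<bar>\<dots>\<bar> \<le> (\<integral>z. \<bar>U z * g z - U z * h z\<bar> \<partial>sphere_measure)" by (rule integral_abs_bound)
      also have "\<dots> \<le> (\<integral>z. e * \<bar>U z\<bar> \<partial>sphere_measure)"
      proof (rule integral_mono)
        show "integrable sphere_measure (\<lambda>z. \<bar>U z * g z - U z * h z\<bar>)"
          using int[OF g] int[OF exp_span_continuous[OF h(1)]] by auto
        show "integrable sphere_measure (\<lambda>z. e * \<bar>U z\<bar>)" using int1 by auto
        fix z assume "z \<in> space (sphere_measure :: 'a measure)"
        then have "\<bar>U z\<bar> * \<bar>g z - h z\<bar> \<le> \<bar>U z\<bar> * e" using h(2) by (intro mult_left_mono) (auto intro: less_imp_le)
        then show "\<bar>U z * g z - U z * h z\<bar> \<le> e * \<bar>U z\<bar>"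
          by (simp add: right_diff_distrib[symmetric] abs_mult mult.commute)
      qed
      finally show ?thesis by simp
    qed
    note small = this
    have "\<bar>\<integral>z. U z * g z \<partial>sphere_measure\<bar> \<le> 0"
    proof (rule field_le_epsilon)
      fix e :: real assume "0 < e"
      define J where "J = (\<integral>z. \<bar>U z\<bar> \<partial>(sphere_measure :: 'a measure))"
      have J: "J \<ge> 0" by (simp add: J_def)
      have "e / (J + 1) > 0" using J \<open>0 < e\<close> by simp
      from small[OF this] have "\<bar>\<integral>z. U z * g z \<partial>sphere_measure\<bar> \<le> e / (J + 1) * J" by (simp add: J_def)
      also have "\<dots> \<le> e" using J \<open>0 < e\<close> by (simp add: field_simps)
      finally show "\<bar>\<integral>z. U z * g z \<partial>sphere_measure\<bar> \<le> 0 + e" by simp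
    qed
    then show ?thesis by simp
  qed
  have U2: "integrable sphere_measure (\<lambda>z. (U z)\<^sup>2)"
  proof (rule integrable_const_bound[of _ "K\<^sup>2"])
    show "AE z in sphere_measure. norm ((U z)\<^sup>2) \<le> K\<^sup>2"
      using power_mono[OF bound abs_ge_zero, where n = 2] by (intro AE_I2) auto
  qed simp
  have small: "(\<integral>z. (U z)\<^sup>2 \<partial>sphere_measure) \<le> e" if "e > 0" for e
  proof -
    obtain g where g: "continuous_on UNIV g" "g \<in> borel_measurable sphere_measure" "integrable sphere_measure (\<lambda>z. (g z)\<^sup>2)" "(\<integral>z. (U z - g z)\<^sup>2 \<partial>sphere_measure) < e"
      using sq_integrable_approx_continuous[OF finite_measure_sphere sets_sphere_measure U U2 \<open>e > 0\<close>] by blast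
    \<comment> \<open>Subtracting the vanishing term \<open>2 * (U z * g z)\<close> brings the
      integrand below the square of \<open>U - g\<close>, whose integral is small.\<close>
    have "(\<integral>z. (U z)\<^sup>2 \<partial>sphere_measure) = (\<integral>z. (U z)\<^sup>2 - 2 * (U z * g z) \<partial>sphere_measure)"
      using cont[OF g(1)] U2 int[OF g(1)] by simp
    also have "\<dots> \<le> (\<integral>z. (U z - g z)\<^sup>2 \<partial>sphere_measure)"
    proof (rule integral_mono)
      show "integrable sphere_measure (\<lambda>z. (U z)\<^sup>2 - 2 * (U z * g z))" using U2 int[OF g(1)] by auto
      show "integrable sphere_measure (\<lambda>z. (U z - g z)\<^sup>2)" by (rule integrable_sq_diff(1)[OF U g(2) U2 g(3)])
    qed (simp add: power2_diff)
    finally show ?thesis using g(4) by simp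
  qed
  have "(\<integral>z. (U z)\<^sup>2 \<partial>sphere_measure) \<le> 0"
    by (rule field_le_epsilon) (simp add: small)
  then have "(\<integral>z. (U z)\<^sup>2 \<partial>sphere_measure) = 0" by (simp add: order.antisym)
  then show ?thesis using integral_nonneg_eq_0_iff_AE[OF U2] by simp
qed

lemma integral_lborel_orthogonal:
  fixes T :: "'a::euclidean_space \<Rightarrow> 'a" and g :: "'a \<Rightarrow> real"
  assumes T: "orthogonal_transformation T" and [measurable]: "g \<in> borel_measurable borel"
  shows "(\<integral>x. g (T x) \<partial>lborel) = (\<integral>x. g x \<partial>lborel)"
proof -
  note [measurable] = orthogonal_transformation_measurable[OF T]
  have "(\<integral>x. g x \<partial>lborel) = (\<integral>x. g x \<partial>distr lborel borel T)"
    by (simp add: lborel_distr_orthogonal[OF T])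
  also have "\<dots> = (\<integral>x. g (T x) \<partial>lborel)" by (rule integral_distr) auto
  finally show ?thesis ..
qed

text \<open>The set where a continuous function is nonzero is open, and a nonempty open set is not
  null.\<close>

lemma AE_lborel_eq_0_continuous:
  fixes \<Phi> :: "'a::euclidean_space \<Rightarrow> real"
  assumes "AE x in lborel. \<Phi> x = 0" "continuous_on UNIV \<Phi>"
  shows "\<Phi> x = 0"
proof (rule ccontr)
  assume "\<Phi> x \<noteq> 0"
  define V where "V = \<Phi> -` (- {0})"
  have "open V" unfolding V_def using assms(2) by (intro open_vimage) auto
  moreover have "V \<noteq> {}" using \<open>\<Phi> x \<noteq> 0\<close> by (auto simp: V_def)
  ultimately have "\<not> negligible V" by (rule open_not_negligible)
  moreover have "V \<in> null_sets lborel"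
  proof (subst AE_iff_null_sets)
    show "AE x in lborel. x \<notin> V" using assms(1) by eventually_elim (simp add: V_def)
  qed (use \<open>open V\<close> in auto)
  ultimately show False
    using negligible_iff_null_sets null_sets_completionI by blast
qed

section \<open>Block rotations, their orbits and a section of \<open>f_map\<close>\<close>

lemma orthogonal_matrix_transformation:
  fixes A :: "real^'k^'k"
  shows "orthogonal_matrix A \<Longrightarrow> orthogonal_transformation ((*v) A)"
  by (simp add: orthogonal_transformation_matrix matrix_vector_mul_linear)

text \<open>For unit vectors \<open>e\<close> and \<open>e'\<close> this is a continuous section of
  \<open>f_map\<close> over the interval: the point lies on the sphere and has \<open>f_map\<close>
  value \<open>t\<close>.\<close>

definition sphere_point :: "real^'m \<Rightarrow> real^'n \<Rightarrow> real \<Rightarrow> (real^'m) \<times> (real^'n)" where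
  "sphere_point e e' t = (sqrt ((1 + t) / 2) *\<^sub>R e, sqrt ((1 - t) / 2) *\<^sub>R e')"

lemma block_rotation_exists:
  fixes z z' :: "(real^'m) \<times> (real^'n)"
  assumes "norm (fst z) = norm (fst z')" "norm (snd z) = norm (snd z')"
  shows "\<exists>(A::real^'m^'m) (B::real^'n^'n). orthogonal_matrix A \<and> orthogonal_matrix B \<and> (A *v fst z, B *v snd z) = z'"
proof -
  obtain S where S: "orthogonal_transformation S" "S (fst z) = fst z'" using orthogonal_transformation_exists[OF assms(1)] by blast
  obtain T where T: "orthogonal_transformation T" "T (snd z) = snd z'" using orthogonal_transformation_exists[OF assms(2)] by blast
  have "orthogonal_matrix (matrix S)" "orthogonal_matrix (matrix T)"
    using S T by (auto simp: orthogonal_transformation_matrix)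
  moreover have "matrix S *v fst z = fst z'" "matrix T *v snd z = snd z'"
    using S T by (auto simp: orthogonal_transformation_def matrix_works linear_matrix_vector_mul_eq)
  ultimately show ?thesis by (intro exI[of _ "matrix S"] exI[of _ "matrix T"]) auto
qed

lemma block_orthogonal:
  fixes A :: "real^'m^'m" and B :: "real^'n^'n"
  assumes "orthogonal_matrix A" "orthogonal_matrix B"
  shows "orthogonal_transformation (\<lambda>z. (A *v fst z, B *v snd z))"
proof -
  have A: "orthogonal_transformation ((*v) A)" and B: "orthogonal_transformation ((*v) B)"
    using assms by (auto simp: orthogonal_matrix_transformation)
  have "orthogonal_transformation (\<lambda>z. (A *v fst z, snd z :: real^'n))" "orthogonal_transformation (\<lambda>z. (fst z :: real^'m, B *v snd z))"
    by (rule orthogonal_transformation_fst[OF A], rule orthogonal_transformation_snd[OF B])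
  from orthogonal_transformation_compose[OF this] show ?thesis by (simp add: o_def)
qed

lemma f_map_block:
  fixes A :: "real^'m^'m" and B :: "real^'n^'n"
  assumes "orthogonal_matrix A" "orthogonal_matrix B"
  shows "f_map (A *v fst z, B *v snd z) = f_map z"
proof -
  have "orthogonal_transformation ((*v) A)" "orthogonal_transformation ((*v) B)"
    using assms by (auto simp: orthogonal_matrix_transformation)
  then show ?thesis by (simp add: f_map_def orthogonal_transformation)
qed

text \<open>Block rotations act transitively on the fibres of \<open>f_map\<close>. Invariance holds
  here at every point, unlike in \<open>G_invariant\<close>, so composing with a section already
  gives the factor.\<close>

lemma sphere_rotation_invariant_factor:
  fixes \<Theta> :: "(real^'m) \<times> (real^'n) \<Rightarrow> real"
  assumes [measurable]: "\<Theta> \<in> borel_measurable borel"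
    and inv: "\<And>(A::real^'m^'m) (B::real^'n^'n) z. orthogonal_matrix A \<Longrightarrow> orthogonal_matrix B \<Longrightarrow> \<Theta> (A *v fst z, B *v snd z) = \<Theta> z"
  shows "\<exists>\<theta> \<in> borel_measurable borel. \<forall>z\<in>sphere 0 1. \<Theta> z = \<theta> (f_map z)"
proof -
  obtain e :: "real^'m" where e: "e \<in> Basis" using nonempty_Basis by blast
  obtain e' :: "real^'n" where e': "e' \<in> Basis" using nonempty_Basis by blast
  have [measurable]: "sphere_point e e' \<in> borel_measurable borel"
    unfolding sphere_point_def[abs_def] by (intro borel_measurable_continuous_onI continuous_intros) auto
  have "\<Theta> z = \<Theta> (sphere_point e e' (f_map z))" if "z \<in> sphere 0 1" for z
  proof -
    have "norm (fst z) = norm (fst (sphere_point e e' (f_map z)))" "norm (snd z) = norm (snd (sphere_point e e' (f_map z)))"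
      using e e' by (simp_all add: sphere_point_def sphere_coords[OF that, symmetric])
    then obtain A :: "real^'m^'m" and B :: "real^'n^'n" where "orthogonal_matrix A" "orthogonal_matrix B" "(A *v fst z, B *v snd z) = sphere_point e e' (f_map z)"
      using block_rotation_exists by blast
    then show ?thesis using inv[of A B z] by simp
  qed
  then show ?thesis by (intro bexI[of _ "\<lambda>t. \<Theta> (sphere_point e e' t)"]) auto
qed

text \<open>Since \<open>2 |c| \<le> 2 + |c|^2/2\<close>, the weight absorbs two exponentials and an
  integrable Gaussian is left.\<close>

lemma exp_weight_bound:
  fixes c z z' :: "'a::euclidean_space"
  assumes "norm z \<le> 1" "norm z' \<le> 1"
  shows "exp (z \<bullet> c) * exp (z' \<bullet> c) * exp (- (norm c)\<^sup>2) \<le> exp 2 * exp (- (norm c)\<^sup>2 / 2)"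
proof -
  have "z \<bullet> c \<le> norm c" "z' \<bullet> c \<le> norm c"
    using norm_cauchy_schwarz[of z c] norm_cauchy_schwarz[of z' c] mult_right_mono[OF assms(1), of "norm c"] mult_right_mono[OF assms(2), of "norm c"] by auto
  moreover have "2 * norm c \<le> 2 + (norm c)\<^sup>2 / 2"
    using zero_le_power2[of "norm c - 2"] by (simp add: power2_diff)
  ultimately have "z \<bullet> c + z' \<bullet> c - (norm c)\<^sup>2 \<le> 2 - (norm c)\<^sup>2 / 2" by simp
  then show ?thesis by (simp flip: exp_add)
qed

lemma integrable_gauss_weight: "integrable lborel (\<lambda>c::'a::euclidean_space. exp (- (norm c)\<^sup>2 / 2))"
proof -
  have "(\<integral>\<^sup>+a. ennreal (gauss (a::'a) * norm a ^ (2 * 0)) \<partial>lborel) < \<infinity>" unfolding gauss_norm_moment by simp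
  then have "integrable lborel (gauss :: 'a \<Rightarrow> real)"
    by (intro integrableI_nonneg) (auto simp: less_imp_le gauss_pos)
  then have "integrable lborel (\<lambda>a::'a. inverse ((1 / sqrt (2 * pi)) ^ DIM('a)) * gauss a)" by (rule integrable_mult_right)
  then show ?thesis by (simp add: gauss_def mult.assoc[symmetric])
qed

text \<open>The Laplace transform \<open>\<Phi>\<close> of \<open>U\<close> is again invariant. Integrating \<open>\<Phi>\<^sup>2\<close> against a Gaussian weight, one
  integral can be traded for \<open>\<integral> U \<Theta>\<close> with \<open>\<Theta>\<close> continuous and invariant, hence a function of \<open>f\<close> and orthogonal
  to \<open>U\<close>. So \<open>\<Phi> = 0\<close>. This avoids a Haar measure on the group.\<close>

theorem G_invariant_orthogonal_eq_0:
  fixes U :: "(real^'m) \<times> (real^'n) \<Rightarrow> real"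
  assumes U [measurable]: "U \<in> borel_measurable sphere_measure" and bound: "\<And>z. \<bar>U z\<bar> \<le> K"
    and G: "G_invariant U"
    and orth: "\<And>\<theta>. \<theta> \<in> borel_measurable borel \<Longrightarrow> bounded ((\<lambda>z. \<theta> (f_map z)) ` sphere (0 :: (real^'m) \<times> (real^'n)) 1) \<Longrightarrow> (\<integral>z. U z * \<theta> (f_map z) \<partial>sphere_measure) = 0"
  shows "AE z in sphere_measure. U z = 0"
proof -
  let ?S = "sphere_measure :: ((real^'m) \<times> (real^'n)) measure"
  interpret S: finite_measure ?S by (rule finite_measure_sphere)
  interpret P: pair_sigma_finite lborel ?S ..
  have K: "K \<ge> 0" using bound[of 0] by linarith
  define \<Phi> where "\<Phi> c = (\<integral>z. U z * exp (z \<bullet> c) \<partial>?S)" for c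
  have expm [measurable]: "(\<lambda>z. exp (z \<bullet> c)) \<in> borel_measurable ?S" for c
    by (rule borel_measurable_sphere) measurable
  have idm [measurable]: "(\<lambda>z. z) \<in> borel_measurable ?S" by (rule borel_measurable_sphere) measurable
  have ein: "exp (z \<bullet> c) \<le> exp (norm c)" if "z \<in> space ?S" for z c
    using that norm_cauchy_schwarz[of z c] by simp
  have cont: "continuous_on UNIV \<Phi>"
    unfolding continuous_on_eq_continuous_at[OF open_UNIV] continuous_at_sequentially
  proof (intro ballI allI impI)
    fix c and X :: "nat \<Rightarrow> (real^'m) \<times> (real^'n)" assume X: "X \<longlonglongrightarrow> c"
    then have "Bseq X" by (intro convergent_imp_Bseq convergentI)
    then obtain B where B: "\<And>n. norm (X n) \<le> B" by (auto simp: Bseq_def)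
    have "(\<lambda>n. \<integral>z. U z * exp (z \<bullet> X n) \<partial>?S) \<longlonglongrightarrow> (\<integral>z. U z * exp (z \<bullet> c) \<partial>?S)"
    proof (rule integral_dominated_convergence[where w = "\<lambda>_. K * exp B"])
      show "AE z in ?S. (\<lambda>n. U z * exp (z \<bullet> X n)) \<longlonglongrightarrow> U z * exp (z \<bullet> c)"
        using X by (intro AE_I2 tendsto_intros)
      show "AE z in ?S. norm (U z * exp (z \<bullet> X n)) \<le> K * exp B" for n
      proof (rule AE_I2)
        fix z assume "z \<in> space ?S"
        then have "exp (z \<bullet> X n) \<le> exp B" using ein[of z "X n"] B[of n] by (meson exp_le_cancel_iff order.trans)
        then show "norm (U z * exp (z \<bullet> X n)) \<le> K * exp B" using bound[of z] K by (auto simp: abs_mult intro!: mult_mono)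
      qed
    qed auto
    then show "(\<Phi> \<circ> X) \<longlonglongrightarrow> \<Phi> c" by (simp add: \<Phi>_def o_def)
  qed
  then have [measurable]: "\<Phi> \<in> borel_measurable borel" by (rule borel_measurable_continuous_onI)
  have \<Phi>_inv: "\<Phi> (A *v fst c, B *v snd c) = \<Phi> c" if A: "orthogonal_matrix (A::real^'m^'m)" "orthogonal_matrix (B::real^'n^'n)" for A B c
  proof -
    define T where "T z = (A *v fst z, B *v snd z)" for z
    have T: "orthogonal_transformation T" unfolding T_def by (rule block_orthogonal[OF A])
    have "\<Phi> (T c) = (\<integral>z. (\<lambda>z. U z * exp (z \<bullet> T c)) (T z) \<partial>?S)"
      unfolding \<Phi>_def by (rule integral_sphere_orthogonal[OF T, symmetric]) measurable
    also have "\<dots> = (\<integral>z. U (T z) * exp (z \<bullet> c) \<partial>?S)"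
      by (simp add: orthogonal_transformation_inner[OF T])
    also have "\<dots> = \<Phi> c"
      unfolding \<Phi>_def
    proof (rule integral_cong_AE)
      show "(\<lambda>z. U (T z) * exp (z \<bullet> c)) \<in> borel_measurable ?S"
        using measurable_compose[OF orthogonal_measurable_sphere[OF T] U] by measurable
      \<comment> \<open>The hypothesis is used for a single group element, with a null set that may
        depend on it. For the integral \<open>\<Phi>\<close> it yields invariance at every
        point.\<close>
      have "AE z in ?S. U (T z) = U z" using G A unfolding G_invariant_def T_def by blast
      then show "AE z in ?S. U (T z) * exp (z \<bullet> c) = U z * exp (z \<bullet> c)" by eventually_elim simp
    qed measurable
    finally show ?thesis by (simp add: T_def)
  qed
  define M0 where "M0 = measure ?S (space ?S)"
  have \<Phi>_bound: "\<bar>\<Phi> c\<bar> \<le> K * exp (norm c) * M0" for c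
  proof -
    have "\<bar>\<Phi> c\<bar> \<le> (\<integral>z. \<bar>U z * exp (z \<bullet> c)\<bar> \<partial>?S)" unfolding \<Phi>_def by (rule integral_abs_bound)
    also have "\<dots> \<le> (\<integral>z. K * exp (norm c) \<partial>?S)"
    proof (rule integral_mono)
      have b: "\<bar>U z * exp (z \<bullet> c)\<bar> \<le> K * exp (norm c)" if "z \<in> space ?S" for z
        using bound[of z] K ein[OF that, of c] by (auto simp: abs_mult intro!: mult_mono)
      then show "\<bar>U z * exp (z \<bullet> c)\<bar> \<le> K * exp (norm c)" if "z \<in> space ?S" for z using that .
      show "integrable ?S (\<lambda>z. \<bar>U z * exp (z \<bullet> c)\<bar>)"
        using b by (intro S.integrable_const_bound[of _ "K * exp (norm c)"] AE_I2) auto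
    qed simp
    also have "\<dots> = K * exp (norm c) * M0" by (simp add: M0_def)
    finally show ?thesis .
  qed
  define W where "W c = exp (- (norm c)\<^sup>2)" for c :: "(real^'m) \<times> (real^'n)"
  have [measurable]: "W \<in> borel_measurable borel" unfolding W_def[abs_def] by measurable
  have M0: "M0 \<ge> 0" by (simp add: M0_def)
  define \<Theta> where "\<Theta> z = (\<integral>c. \<Phi> c * exp (z \<bullet> c) * W c \<partial>lborel)" for z
  have dom: "\<bar>\<Phi> c * exp (z \<bullet> c) * W c\<bar> \<le> K * M0 * exp 2 * exp (- (norm c)\<^sup>2 / 2)" if "norm z \<le> 1" for z c
  proof -
    \<comment> \<open>A vector of norm at most 1 with \<open>z' \<bullet> c = norm c\<close>; it
      brings the bound \<open>exp (norm c)\<close> for \<open>\<Phi>\<close> into the form required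
      by \<open>exp_weight_bound\<close>.\<close>
    define z' where "z' = (if c = 0 then 0 else c /\<^sub>R norm c)"
    have z': "norm z' \<le> 1" "z' \<bullet> c = norm c" by (auto simp: z'_def dot_square_norm power2_eq_square)
    have "\<bar>\<Phi> c * exp (z \<bullet> c) * W c\<bar> \<le> (K * exp (norm c) * M0) * exp (z \<bullet> c) * W c"
      using \<Phi>_bound[of c] by (auto simp: abs_mult W_def intro!: mult_right_mono)
    also have "\<dots> = K * M0 * (exp (z' \<bullet> c) * exp (z \<bullet> c) * exp (- (norm c)\<^sup>2))" by (simp add: z' W_def)
    also have "\<dots> \<le> K * M0 * (exp 2 * exp (- (norm c)\<^sup>2 / 2))"
      using K M0 exp_weight_bound[OF z'(1) that, of c] by (intro mult_left_mono) auto
    finally show ?thesis by simp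
  qed
  have [measurable]: "\<Theta> \<in> borel_measurable borel" unfolding \<Theta>_def by measurable
  have \<Theta>_inv: "\<Theta> (A *v fst z, B *v snd z) = \<Theta> z" if A: "orthogonal_matrix (A::real^'m^'m)" "orthogonal_matrix (B::real^'n^'n)" for A B z
  proof -
    define T where "T z = (A *v fst z, B *v snd z)" for z
    have T: "orthogonal_transformation T" unfolding T_def by (rule block_orthogonal[OF A])
    have \<Phi>T: "\<Phi> (T c) = \<Phi> c" for c using \<Phi>_inv[OF A] by (simp add: T_def)
    have "\<Theta> (T z) = (\<integral>c. (\<lambda>c. \<Phi> c * exp (T z \<bullet> c) * W c) (T c) \<partial>lborel)"
      unfolding \<Theta>_def by (rule integral_lborel_orthogonal[OF T, symmetric]) measurable
    also have "\<dots> = \<Theta> z"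
    proof -
      have "norm (T c) = norm c" for c using T unfolding orthogonal_transformation by blast
      then show ?thesis unfolding \<Theta>_def by (simp add: \<Phi>T W_def orthogonal_transformation_inner[OF T])
    qed
    finally show ?thesis by (simp add: T_def)
  qed
  obtain \<theta> where \<theta> [measurable]: "\<theta> \<in> borel_measurable borel" and \<theta>_eq: "\<And>z. z \<in> sphere 0 1 \<Longrightarrow> \<Theta> z = \<theta> (f_map z)"
    using sphere_rotation_invariant_factor[OF \<open>\<Theta> \<in> _\<close> \<Theta>_inv] by blast
  have gw: "integrable lborel (\<lambda>c. K * M0 * exp 2 * exp (- (norm (c :: (real^'m) \<times> (real^'n)))\<^sup>2 / 2))"
    by (intro integrable_mult_right integrable_gauss_weight)
  have "bounded ((\<lambda>z. \<theta> (f_map z)) ` sphere (0 :: (real^'m) \<times> (real^'n)) 1)"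
  proof -
    have "\<bar>\<theta> (f_map z)\<bar> \<le> (\<integral>c. K * M0 * exp 2 * exp (- (norm (c :: (real^'m) \<times> (real^'n)))\<^sup>2 / 2) \<partial>lborel)" if z: "z \<in> sphere (0 :: (real^'m) \<times> (real^'n)) 1" for z
    proof -
      have "\<bar>\<Theta> z\<bar> \<le> (\<integral>c. \<bar>\<Phi> c * exp (z \<bullet> c) * W c\<bar> \<partial>lborel)" unfolding \<Theta>_def by (rule integral_abs_bound)
      also have "\<dots> \<le> (\<integral>c. K * M0 * exp 2 * exp (- (norm (c :: (real^'m) \<times> (real^'n)))\<^sup>2 / 2) \<partial>lborel)"
      proof (rule integral_mono[OF _ gw])
        show "integrable lborel (\<lambda>c. \<bar>\<Phi> c * exp (z \<bullet> c) * W c\<bar>)"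
          using z K M0 dom[of z] by (intro Bochner_Integration.integrable_bound[OF gw] AE_I2) auto
        show "\<bar>\<Phi> c * exp (z \<bullet> c) * W c\<bar> \<le> K * M0 * exp 2 * exp (- (norm c)\<^sup>2 / 2)" for c using z dom[of z c] by simp
      qed
      finally show ?thesis using \<theta>_eq[OF z] by simp
    qed
    then show ?thesis unfolding bounded_iff real_norm_def by blast
  qed
  from orth[OF \<theta> this] have z0: "(\<integral>z. U z * \<Theta> z \<partial>?S) = 0"
    using \<theta>_eq by (subst (asm) Bochner_Integration.integral_cong[OF refl, of _ _ "\<lambda>z. U z * \<Theta> z"]) auto
  have "(\<integral>c. (\<Phi> c)\<^sup>2 * W c \<partial>lborel) = (\<integral>c. \<integral>z. \<Phi> c * W c * (U z * exp (z \<bullet> c)) \<partial>?S \<partial>lborel)"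
  proof (rule Bochner_Integration.integral_cong[OF refl])
    fix c
    have "(\<integral>z. \<Phi> c * W c * (U z * exp (z \<bullet> c)) \<partial>?S) = \<Phi> c * W c * \<Phi> c"
      by (simp add: \<Phi>_def[of c])
    moreover have "(\<Phi> c)\<^sup>2 * W c = \<Phi> c * W c * \<Phi> c" by (simp add: power2_eq_square)
    ultimately show "(\<Phi> c)\<^sup>2 * W c = (\<integral>z. \<Phi> c * W c * (U z * exp (z \<bullet> c)) \<partial>?S)" by (simp only:)
  qed
  also have "\<dots> = (\<integral>z. \<integral>c. \<Phi> c * W c * (U z * exp (z \<bullet> c)) \<partial>lborel \<partial>?S)"
  proof (rule P.Fubini_integral[symmetric])
    have "integrable (lborel \<Otimes>\<^sub>M ?S) (\<lambda>p :: ((real^'m) \<times> (real^'n)) \<times> ((real^'m) \<times> (real^'n)). K * (K * M0 * exp 2 * exp (- (norm (fst p))\<^sup>2 / 2)))"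
    proof (intro integrable_mult_right)
      show "integrable (lborel \<Otimes>\<^sub>M ?S) (\<lambda>p :: ((real^'m) \<times> (real^'n)) \<times> ((real^'m) \<times> (real^'n)). exp (- (norm (fst p))\<^sup>2 / 2))"
      proof (rule P.Fubini_integrable)
      qed (use integrable_mult_right[OF integrable_gauss_weight, of M0] in \<open>auto intro!: AE_I2 simp: M0_def mult.commute\<close>)
    qed
    then show "integrable (lborel \<Otimes>\<^sub>M ?S) (\<lambda>(c, z). \<Phi> c * W c * (U z * exp (z \<bullet> c)))"
    proof (rule Bochner_Integration.integrable_bound)
      show "AE p in lborel \<Otimes>\<^sub>M ?S. norm (case p of (c, z) \<Rightarrow> \<Phi> c * W c * (U z * exp (z \<bullet> c))) \<le> norm (K * (K * M0 * exp 2 * exp (- (norm (fst p))\<^sup>2 / 2)))"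
      proof (rule AE_I2)
        fix p :: "((real^'m) \<times> (real^'n)) \<times> ((real^'m) \<times> (real^'n))" assume "p \<in> space (lborel \<Otimes>\<^sub>M ?S)"
        then obtain c z where p: "p = (c, z)" "norm z = 1" by (auto simp: space_pair_measure)
        have "\<bar>\<Phi> c * W c * (U z * exp (z \<bullet> c))\<bar> = \<bar>U z\<bar> * \<bar>\<Phi> c * exp (z \<bullet> c) * W c\<bar>" by (simp add: abs_mult)
        also have "\<dots> \<le> K * (K * M0 * exp 2 * exp (- (norm c)\<^sup>2 / 2))"
          using bound[of z] dom[of z c] p K M0 by (intro mult_mono) auto
        finally show "norm (case p of (c, z) \<Rightarrow> \<Phi> c * W c * (U z * exp (z \<bullet> c))) \<le> norm (K * (K * M0 * exp 2 * exp (- (norm (fst p))\<^sup>2 / 2)))"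
          using p K M0 by simp
      qed
    qed measurable
  qed
  also have "\<dots> = (\<integral>z. U z * \<Theta> z \<partial>?S)"
  proof (rule Bochner_Integration.integral_cong[OF refl])
    fix z
    have "(\<integral>c. \<Phi> c * W c * (U z * exp (z \<bullet> c)) \<partial>lborel) = (\<integral>c. U z * (\<Phi> c * exp (z \<bullet> c) * W c) \<partial>lborel)"
      by (simp add: mult_ac)
    then show "(\<integral>c. \<Phi> c * W c * (U z * exp (z \<bullet> c)) \<partial>lborel) = U z * \<Theta> z" by (simp add: \<Theta>_def)
  qed
  finally have int0: "(\<integral>c. (\<Phi> c)\<^sup>2 * W c \<partial>lborel) = 0" using z0 by simp
  have "AE c in lborel. (\<Phi> c)\<^sup>2 * W c = 0"
  proof (subst integral_nonneg_eq_0_iff_AE[symmetric])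
    show "integrable lborel (\<lambda>c. (\<Phi> c)\<^sup>2 * W c)"
    proof (rule Bochner_Integration.integrable_bound)
      show "integrable lborel (\<lambda>c. (K * M0) * (K * M0 * exp 2 * exp (- (norm (c :: (real^'m) \<times> (real^'n)))\<^sup>2 / 2)))"
        by (intro integrable_mult_right gw)
      show "AE c in lborel. norm ((\<Phi> c)\<^sup>2 * W c) \<le> norm ((K * M0) * (K * M0 * exp 2 * exp (- (norm c)\<^sup>2 / 2)))"
      proof (rule AE_I2)
        fix c :: "(real^'m) \<times> (real^'n)"
        define z' where "z' = (if c = 0 then 0 else c /\<^sub>R norm c)"
        have z': "norm z' \<le> 1" "z' \<bullet> c = norm c" by (auto simp: z'_def dot_square_norm power2_eq_square)
        have "\<bar>(\<Phi> c)\<^sup>2 * W c\<bar> = \<bar>\<Phi> c\<bar> * \<bar>\<Phi> c * W c\<bar>" by (simp add: abs_mult power2_eq_square)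
        also have "\<dots> \<le> (K * exp (norm c) * M0) * \<bar>\<Phi> c * W c\<bar>" by (intro mult_right_mono \<Phi>_bound) auto
        also have "\<dots> = (K * M0) * \<bar>\<Phi> c * exp (z' \<bullet> c) * W c\<bar>" by (simp add: abs_mult z')
        also have "\<dots> \<le> (K * M0) * (K * M0 * exp 2 * exp (- (norm c)\<^sup>2 / 2))"
          using dom[OF z'(1), of c] K M0 by (intro mult_left_mono) auto
        finally show "norm ((\<Phi> c)\<^sup>2 * W c) \<le> norm ((K * M0) * (K * M0 * exp 2 * exp (- (norm c)\<^sup>2 / 2)))" using K M0 by simp
      qed
    qed simp
  qed (use int0 in \<open>auto simp: W_def\<close>)
  then have "AE c in lborel. \<Phi> c = 0" by eventually_elim (simp add: W_def)
  then have "\<Phi> c = 0" for c using cont by (rule AE_lborel_eq_0_continuous)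
  then show ?thesis using U bound unfolding \<Phi>_def by (intro integral_sphere_exp_eq_0_imp_AE) auto
qed


text \<open>\<open>w\<close> is the conditional expectation of \<open>u\<close> given
  \<open>f_map\<close>: the Radon-Nikodym density, relative to the weighted interval, of the image
  of the measure with density \<open>u\<close>. The difference between \<open>u\<close> and
  \<open>w\<close> composed with \<open>f_map\<close> is invariant and orthogonal to all bounded
  functions of \<open>f_map\<close>, so it vanishes.\<close>

lemma bounded_invariant_factor:
  fixes u :: "(real^'m) \<times> (real^'n) \<Rightarrow> real"
  assumes u [measurable]: "u \<in> borel_measurable sphere_measure" and bound: "\<And>z. 0 \<le> u z \<and> u z \<le> C"
    and G: "G_invariant u"
  shows "\<exists>w \<in> borel_measurable (h_measure CARD('m) CARD('n)). AE z in sphere_measure. u z = w (f_map z)"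
proof -
  let ?S = "sphere_measure :: ((real^'m) \<times> (real^'n)) measure"
  let ?H = "h_measure CARD('m) CARD('n)"
  interpret S: finite_measure ?S by (rule finite_measure_sphere)
  interpret H: finite_measure ?H by (rule finite_measure_h)
  have C: "C \<ge> 0" using bound[of 0] by linarith
  define \<nu> where "\<nu> = distr (density ?S (\<lambda>z. ennreal (u z))) ?H f_map"
  have nu: "(\<integral>\<^sup>+t. g t \<partial>\<nu>) = (\<integral>\<^sup>+z. ennreal (u z) * g (f_map z) \<partial>?S)" if g [measurable]: "g \<in> borel_measurable ?H" for g
    unfolding \<nu>_def using g measurable_compose[OF f_map_measurable_sphere g]
    by (subst nn_integral_distr, simp, simp) (subst nn_integral_density, auto)
  have push: "(\<integral>\<^sup>+z. g (f_map z) \<partial>?S) = (\<integral>\<^sup>+t. g t \<partial>?H)" if g [measurable]: "g \<in> borel_measurable ?H" for g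
  proof -
    have "(\<integral>\<^sup>+t. g t \<partial>?H) = (\<integral>\<^sup>+t. g t \<partial>distr ?S ?H f_map)" by (simp only: distr_f_map)
    also have "\<dots> = (\<integral>\<^sup>+z. g (f_map z) \<partial>?S)" by (rule nn_integral_distr) auto
    finally show ?thesis ..
  qed
  have sets_nu: "sets \<nu> = sets ?H" by (simp add: \<nu>_def)
  have le: "emeasure \<nu> A \<le> ennreal C * emeasure ?H A" if A: "A \<in> sets ?H" for A
  proof -
    have "emeasure \<nu> A = (\<integral>\<^sup>+t. indicator A t \<partial>\<nu>)" using A by (simp add: sets_nu)
    also have "\<dots> = (\<integral>\<^sup>+z. ennreal (u z) * indicator A (f_map z) \<partial>?S)" using A by (intro nu) auto
    also have "\<dots> \<le> (\<integral>\<^sup>+z. (\<lambda>t. ennreal C * indicator A t) (f_map z) \<partial>?S)"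
      using bound by (intro nn_integral_mono mult_right_mono ennreal_leI) auto
    also have "\<dots> = (\<integral>\<^sup>+t. ennreal C * indicator A t \<partial>?H)" using A by (intro push) auto
    also have "\<dots> = ennreal C * emeasure ?H A" using A by (simp add: nn_integral_cmult_indicator)
    finally show ?thesis .
  qed
  have "absolutely_continuous ?H \<nu>"
    unfolding absolutely_continuous_def null_sets_def using le by (auto simp: sets_nu) (metis le_zero_eq mult_zero_right)
  from H.Radon_Nikodym[OF this sets_nu] obtain w' where w' [measurable]: "w' \<in> borel_measurable ?H" and dens: "density ?H w' = \<nu>" by blast
  \<comment> \<open>On the set \<open>B\<close> where the density exceeds \<open>C\<close>, the
    image measure is at most \<open>C\<close> times \<open>?H\<close>, so the excess integrates to
    0. Finiteness of \<open>?H\<close> permits cancelling the common term.\<close>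
  have w'_le: "AE t in ?H. w' t \<le> ennreal C"
  proof -
    define B where "B = {t \<in> space ?H. w' t > ennreal C}"
    have B [measurable]: "B \<in> sets ?H" unfolding B_def by measurable
    have "(\<integral>\<^sup>+t. (w' t - ennreal C) * indicator B t \<partial>?H) + ennreal C * emeasure ?H B = (\<integral>\<^sup>+t. (w' t - ennreal C) * indicator B t + ennreal C * indicator B t \<partial>?H)"
      by (subst nn_integral_add) (auto simp: nn_integral_cmult_indicator)
    also have "\<dots> = (\<integral>\<^sup>+t. w' t * indicator B t \<partial>?H)"
      by (intro nn_integral_cong) (auto simp: B_def indicator_def diff_add_cancel_ennreal less_imp_le)
    also have "\<dots> = emeasure \<nu> B" unfolding dens[symmetric] by (subst emeasure_density) auto
    also have "\<dots> \<le> 0 + ennreal C * emeasure ?H B" using le[OF B] by simp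
    finally have "ennreal C * emeasure ?H B + (\<integral>\<^sup>+t. (w' t - ennreal C) * indicator B t \<partial>?H) \<le> ennreal C * emeasure ?H B + 0"
      by (simp only: add.commute)
    moreover have "ennreal C * emeasure ?H B \<noteq> \<infinity>"
      using H.emeasure_finite[of B] by (simp add: ennreal_mult_eq_top_iff)
    ultimately have "(\<integral>\<^sup>+t. (w' t - ennreal C) * indicator B t \<partial>?H) = 0"
      unfolding ennreal_add_left_cancel_le by simp
    then have "AE t in ?H. (w' t - ennreal C) * indicator B t = 0" by (subst (asm) nn_integral_0_iff_AE) auto
    then show ?thesis
    proof (rule AE_mp, intro AE_I2 impI)
      fix t assume "t \<in> space ?H" "(w' t - ennreal C) * indicator B t = 0"
      then show "w' t \<le> ennreal C"
        by (cases "t \<in> B") (auto simp: B_def not_less diff_eq_0_iff_ennreal)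
    qed
  qed
  \<comment> \<open>Truncation turns the almost everywhere bound into a pointwise one, in which form
    \<open>G_invariant_orthogonal_eq_0\<close> asks for it.\<close>
  define w where "w t = min C (enn2real (w' t))" for t
  have w [measurable]: "w \<in> borel_measurable ?H" unfolding w_def[abs_def] by measurable
  have w_bound: "0 \<le> w t \<and> w t \<le> C" for t using C by (auto simp: w_def)
  have ww': "AE t in ?H. ennreal (w t) = w' t"
    using w'_le
  proof eventually_elim
    case (elim t)
    then have "w' t < top" using ennreal_less_top[of C] by (rule le_less_trans)
    moreover from this have "enn2real (w' t) \<le> C" using elim C by (cases "w' t") (auto simp: ennreal_le_iff)
    ultimately show ?case by (simp add: w_def min_def)
  qed
  have key: "(\<integral>\<^sup>+z. ennreal (u z) * g (f_map z) \<partial>?S) = (\<integral>\<^sup>+z. ennreal (w (f_map z)) * g (f_map z) \<partial>?S)" if g [measurable]: "g \<in> borel_measurable ?H" for g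
  proof -
    have "(\<integral>\<^sup>+z. ennreal (u z) * g (f_map z) \<partial>?S) = (\<integral>\<^sup>+t. g t \<partial>density ?H w')" unfolding dens by (rule nu[OF g, symmetric])
    also have "\<dots> = (\<integral>\<^sup>+t. w' t * g t \<partial>?H)" by (rule nn_integral_density) auto
    also have "\<dots> = (\<integral>\<^sup>+t. ennreal (w t) * g t \<partial>?H)" using ww' by (intro nn_integral_cong_AE) (auto elim: eventually_mono)
    also have "\<dots> = (\<integral>\<^sup>+z. (\<lambda>t. ennreal (w t) * g t) (f_map z) \<partial>?S)" by (rule push[symmetric]) measurable
    finally show ?thesis .
  qed
  define U where "U z = u z - w (f_map z)" for z
  have wf [measurable]: "(\<lambda>z. w (f_map z)) \<in> borel_measurable ?S" by (rule measurable_comp_f_map[OF w])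
  have U [measurable]: "U \<in> borel_measurable ?S" unfolding U_def[abs_def] by measurable
  have "AE z in ?S. U z = 0"
  proof (rule G_invariant_orthogonal_eq_0[OF U])
    show "\<bar>U z\<bar> \<le> C" for z using bound[of z] w_bound[of "f_map z"] by (auto simp: U_def)
    show "G_invariant U"
      unfolding G_invariant_def
    proof (intro allI impI)
      fix A :: "real^'m^'m" and B :: "real^'n^'n" assume A: "orthogonal_matrix A" "orthogonal_matrix B"
      then have "AE z in sphere_measure. u (A *v fst z, B *v snd z) = u z" using G unfolding G_invariant_def by blast
      then show "AE z in sphere_measure. U (A *v fst z, B *v snd z) = U z"
        by eventually_elim (simp add: U_def f_map_block[OF A])
    qed
    fix \<theta> :: "real \<Rightarrow> real" assume \<theta> [measurable]: "\<theta> \<in> borel_measurable borel"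
      and "bounded ((\<lambda>z. \<theta> (f_map z)) ` sphere (0 :: (real^'m) \<times> (real^'n)) 1)"
    then obtain B where "\<forall>y\<in>(\<lambda>z. \<theta> (f_map z)) ` sphere (0 :: (real^'m) \<times> (real^'n)) 1. norm y \<le> B"
      unfolding bounded_iff by blast
    then have B: "\<bar>\<theta> (f_map z)\<bar> \<le> B" if "norm z = 1" for z :: "(real^'m) \<times> (real^'n)" using that by auto
    have th [measurable]: "(\<lambda>z. \<theta> (f_map z)) \<in> borel_measurable ?S"
      by (rule measurable_comp_f_map[of _ 1 1]) measurable
    have int: "integrable ?S (\<lambda>z. v z * q (f_map z))" "integrable ?S (\<lambda>z. q (f_map z) * v z)"
      if [measurable]: "v \<in> borel_measurable ?S" "q \<in> borel_measurable borel" and v: "\<And>z. 0 \<le> v z \<and> v z \<le> C" and q: "\<And>t. \<bar>q t\<bar> \<le> \<bar>\<theta> t\<bar>" for v q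
    proof -
      have qm [measurable]: "(\<lambda>z. q (f_map z)) \<in> borel_measurable ?S"
        by (rule measurable_comp_f_map[of _ 1 1]) measurable
      have "\<bar>v z * q (f_map z)\<bar> \<le> C * B" if "z \<in> space ?S" for z
      proof -
        have "\<bar>q (f_map z)\<bar> \<le> B" using q[of "f_map z"] B[of z] that by auto
        then show ?thesis using v[of z] C unfolding abs_mult by (intro mult_mono) auto
      qed
      then show "integrable ?S (\<lambda>z. v z * q (f_map z))"
        by (intro S.integrable_const_bound[of _ "C * B"] AE_I2) auto
      then show "integrable ?S (\<lambda>z. q (f_map z) * v z)" by (simp add: mult.commute)
    qed
    have pos: "(\<integral>z. u z * q (f_map z) \<partial>?S) = (\<integral>z. w (f_map z) * q (f_map z) \<partial>?S)"
      if [measurable]: "q \<in> borel_measurable borel" and q: "\<And>t. 0 \<le> q t" "\<And>t. q t \<le> \<bar>\<theta> t\<bar>" for q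
    proof -
      have qm [measurable]: "(\<lambda>z. q (f_map z)) \<in> borel_measurable ?S"
        by (rule measurable_comp_f_map[of _ 1 1]) measurable
      have "(\<integral>z. u z * q (f_map z) \<partial>?S) = enn2real (\<integral>\<^sup>+z. ennreal (u z * q (f_map z)) \<partial>?S)"
        using bound q by (intro integral_eq_nn_integral) auto
      also have "(\<integral>\<^sup>+z. ennreal (u z * q (f_map z)) \<partial>?S) = (\<integral>\<^sup>+z. ennreal (u z) * (\<lambda>t. ennreal (q t)) (f_map z) \<partial>?S)"
        using bound by (intro nn_integral_cong ennreal_mult') auto
      also have "\<dots> = (\<integral>\<^sup>+z. ennreal (w (f_map z)) * (\<lambda>t. ennreal (q t)) (f_map z) \<partial>?S)"
        by (rule key) measurable
      also have "\<dots> = (\<integral>\<^sup>+z. ennreal (w (f_map z) * q (f_map z)) \<partial>?S)"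
        using w_bound by (intro nn_integral_cong ennreal_mult'[symmetric]) auto
      also have "enn2real \<dots> = (\<integral>z. w (f_map z) * q (f_map z) \<partial>?S)"
        using w_bound q by (intro integral_eq_nn_integral[symmetric]) auto
      finally show ?thesis .
    qed
    \<comment> \<open>The identity \<open>key\<close> concerns nonnegative integrands, hence the
      splitting of the test function.\<close>
    define qp qn where "qp t = max 0 (\<theta> t)" and "qn t = max 0 (- \<theta> t)" for t
    have [measurable]: "qp \<in> borel_measurable borel" "qn \<in> borel_measurable borel" unfolding qp_def[abs_def] qn_def[abs_def] by measurable
    have th_eq: "\<theta> t = qp t - qn t" for t by (auto simp: qp_def qn_def)
    have ip: "integrable ?S (\<lambda>z. v z * qp (f_map z))" "integrable ?S (\<lambda>z. v z * qn (f_map z))" if "v = u \<or> v = (\<lambda>z. w (f_map z))" for v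
      using that bound w_bound by (auto intro!: int(1) simp: qp_def qn_def)
    have "(\<integral>z. U z * \<theta> (f_map z) \<partial>?S) = (\<integral>z. (u z * qp (f_map z) - u z * qn (f_map z)) - (w (f_map z) * qp (f_map z) - w (f_map z) * qn (f_map z)) \<partial>?S)"
      by (intro Bochner_Integration.integral_cong refl) (simp add: U_def th_eq algebra_simps)
    also have "\<dots> = ((\<integral>z. u z * qp (f_map z) \<partial>?S) - (\<integral>z. u z * qn (f_map z) \<partial>?S)) - ((\<integral>z. w (f_map z) * qp (f_map z) \<partial>?S) - (\<integral>z. w (f_map z) * qn (f_map z) \<partial>?S))"
      using ip[of u] ip[of "\<lambda>z. w (f_map z)"] by simp
    also have "\<dots> = 0" using pos[of qp] pos[of qn] by (simp add: qp_def qn_def)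
    finally show "(\<integral>z. U z * \<theta> (f_map z) \<partial>?S) = 0" .
  qed
  then have "AE z in ?S. u z = w (f_map z)" by eventually_elim (simp add: U_def)
  then show ?thesis using w by blast
qed

text \<open>The function \<open>arctan u + pi/2\<close> takes values between 0 and \<open>pi\<close>
  and is invariant together with \<open>u\<close>; its factor is transformed back by
  \<open>tan\<close>.\<close>

theorem invariant_factor:
  fixes u :: "(real^'m) \<times> (real^'n) \<Rightarrow> real"
  assumes u [measurable]: "u \<in> borel_measurable sphere_measure" and G: "G_invariant u"
  shows "\<exists>w \<in> borel_measurable (h_measure CARD('m) CARD('n)). AE z in sphere_measure. u z = w (f_map z)"
proof -
  define v where "v z = arctan (u z) + pi / 2" for z
  have tan_m [measurable]: "(tan :: real \<Rightarrow> real) \<in> borel_measurable borel"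
    unfolding tan_def[abs_def] by measurable
  have v: "v \<in> borel_measurable sphere_measure"
    unfolding v_def[abs_def] by (intro borel_measurable_add borel_measurable_const measurable_compose[OF u]) (intro borel_measurable_continuous_onI continuous_intros)
  have "\<exists>w \<in> borel_measurable (h_measure CARD('m) CARD('n)). AE z in sphere_measure. v z = w (f_map z)"
  proof (rule bounded_invariant_factor[OF v])
    show "0 \<le> v z \<and> v z \<le> pi" for z
      using arctan_lbound[of "u z"] arctan_ubound[of "u z"] by (auto simp: v_def)
    show "G_invariant v"
      unfolding G_invariant_def
    proof (intro allI impI)
      fix A :: "real^'m^'m" and B :: "real^'n^'n" assume A: "orthogonal_matrix A" "orthogonal_matrix B"
      then have "AE z in sphere_measure. u (A *v fst z, B *v snd z) = u z" using G unfolding G_invariant_def by blast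
      then show "AE z in sphere_measure. v (A *v fst z, B *v snd z) = v z" by eventually_elim (simp add: v_def)
    qed
  qed
  then obtain w where w [measurable]: "w \<in> borel_measurable (h_measure CARD('m) CARD('n))" and eq: "AE z in sphere_measure. v z = w (f_map z)" by blast
  have "(\<lambda>t. tan (w t - pi / 2)) \<in> borel_measurable (h_measure CARD('m) CARD('n))" by measurable
  moreover have "AE z in sphere_measure. u z = tan (w (f_map z) - pi / 2)"
    using eq
  proof eventually_elim
    case (elim z)
    then have "w (f_map z) - pi / 2 = arctan (u z)" by (simp add: v_def)
    then show ?case by (simp add: tan_arctan)
  qed
  ultimately show ?thesis by (intro bexI[of _ "\<lambda>t. tan (w t - pi / 2)"])
qed

lemma AE_f_map_iff:
  assumes [measurable]: "w \<in> borel_measurable (h_measure CARD('m) CARD('n))" "w' \<in> borel_measurable (h_measure CARD('m) CARD('n))"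
  shows "(AE z in (sphere_measure :: ((real^'m) \<times> (real^'n)) measure). (w (f_map z) :: real) = w' (f_map z)) \<longleftrightarrow> (AE t in h_measure CARD('m) CARD('n). w t = w' t)"
proof -
  have "(AE t in h_measure CARD('m) CARD('n). w t = w' t) \<longleftrightarrow> (AE t in distr (sphere_measure :: ((real^'m) \<times> (real^'n)) measure) (h_measure CARD('m) CARD('n)) f_map. w t = w' t)"
    by (simp only: distr_f_map)
  also have "\<dots> \<longleftrightarrow> (AE z in (sphere_measure :: ((real^'m) \<times> (real^'n)) measure). w (f_map z) = w' (f_map z))"
    by (rule AE_distr_iff) measurable
  finally show ?thesis ..
qed

section \<open>The zonal operators on the weighted interval\<close>

text \<open>The substitution \<open>t = 2 x - 1\<close> gives a Beta integral, and its derivative is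
  the factor 2 in the constant.\<close>

lemma nn_integral_h_YV:
  assumes "m > 0" "n > 0"
  shows "(\<integral>\<^sup>+t. ennreal (poly (YV j l) t) \<partial>h_measure m n) = ennreal (2 * radial_const m * radial_const n *
     (Gamma (real j + beta m + 1) * Gamma (real l + alpha n + 1) / Gamma (real j + real l + alpha n + beta m + 2)))"
proof -
  define a b where "a = alpha n" and "b = beta m"
  have ab: "a > -1" "b > -1" using assms by (auto simp: a_def b_def alpha_def beta_def)
  define F where "F t = ennreal (((1 + t) / 2) powr b * ((1 - t) / 2) powr a) * indicator {-1<..<1} t * ennreal (poly (YV j l) t)" for t :: real
  have [measurable]: "F \<in> borel_measurable borel" unfolding F_def[abs_def] poly_YV by measurable
  have k: "radial_const m > 0" "radial_const n > 0" using assms by (auto intro: radial_const_pos)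
  have "(\<integral>\<^sup>+t. ennreal (poly (YV j l) t) \<partial>h_measure m n) = ennreal (radial_const m * radial_const n) * (\<integral>\<^sup>+t. F t \<partial>lborel)"
    unfolding F_def a_def b_def by (rule nn_integral_h_measure) (use assms in \<open>auto simp: poly_YV\<close>)
  also have "(\<integral>\<^sup>+t. F t \<partial>lborel) = ennreal \<bar>2::real\<bar> * (\<integral>\<^sup>+x. F (-1 + 2 * x) \<partial>lborel)"
    by (rule nn_integral_real_affine) auto
  also have "(\<integral>\<^sup>+x. F (-1 + 2 * x) \<partial>lborel) = (\<integral>\<^sup>+x. ennreal (x powr ((b + j + 1) - 1) * (1 - x) powr ((a + l + 1) - 1)) * indicator {0..1} x \<partial>lborel)"
  proof (rule nn_integral_cong)
    fix x :: real
    have 1: "(1 + (-1 + 2 * x)) / 2 = x" "(1 - (-1 + 2 * x)) / 2 = 1 - x" by (simp_all add: field_simps)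
    show "F (-1 + 2 * x) = ennreal (x powr ((b + j + 1) - 1) * (1 - x) powr ((a + l + 1) - 1)) * indicator {0..1} x"
    proof (cases "0 < x \<and> x < 1")
      case True
      have "x powr ((b + j + 1) - 1) = x powr b * x ^ j" "(1 - x) powr ((a + l + 1) - 1) = (1 - x) powr a * (1 - x) ^ l"
        using True by (simp_all add: powr_add powr_realpow)
      then have "x powr ((b + j + 1) - 1) * (1 - x) powr ((a + l + 1) - 1) = (x powr b * (1 - x) powr a) * (x ^ j * (1 - x) ^ l)"
        by (simp only: mult_ac)
      moreover have "ennreal ((x powr b * (1 - x) powr a) * (x ^ j * (1 - x) ^ l)) = ennreal (x powr b * (1 - x) powr a) * ennreal (x ^ j * (1 - x) ^ l)"
        using True by (intro ennreal_mult') auto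
      ultimately show ?thesis unfolding F_def poly_YV 1 using True by simp
    next
      case False
      then show ?thesis unfolding F_def poly_YV 1 by (cases "x = 0 \<or> x = 1") (auto simp: indicator_def)
    qed
  qed
  also have "\<dots> = ennreal (Beta (b + j + 1) (a + l + 1))" using ab by (intro nn_integral_Beta) auto
  also have "ennreal (radial_const m * radial_const n) * (ennreal \<bar>2::real\<bar> * ennreal (Beta (b + j + 1) (a + l + 1)))
     = ennreal (radial_const m * radial_const n * (\<bar>2::real\<bar> * Beta (b + j + 1) (a + l + 1)))"
    using k by (simp add: ennreal_mult')
  also have "radial_const m * radial_const n * (\<bar>2::real\<bar> * Beta (b + j + 1) (a + l + 1)) = 2 * radial_const m * radial_const n *
     (Gamma (real j + b + 1) * Gamma (real l + a + 1) / Gamma (real j + real l + a + b + 2))"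
    by (simp add: Beta_def add_ac)
  finally show ?thesis by (simp add: a_def b_def)
qed

lemma finite_measure_h': "m > 0 \<Longrightarrow> n > 0 \<Longrightarrow> finite_measure (h_measure m n)"
proof
  assume mn: "m > 0" "n > 0"
  have "emeasure (h_measure m n) (space (h_measure m n)) = (\<integral>\<^sup>+t. ennreal (poly (YV 0 0) t) \<partial>h_measure m n)"
    by simp
  also have "\<dots> < \<infinity>" unfolding nn_integral_h_YV[OF mn] by simp
  finally show "emeasure (h_measure m n) (space (h_measure m n)) \<noteq> \<infinity>" by simp
qed

context
  fixes m n :: nat
  assumes mn: "m \<ge> 2" "n \<ge> 2"
begin

abbreviation (input) "H \<equiv> h_measure m n"
abbreviation (input) "R \<equiv> jacobi_R (alpha n) (beta m)"

interpretation H: finite_measure H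
  using mn by (intro finite_measure_h') auto

lemma ab_nonneg: "alpha n \<ge> 0" "beta m \<ge> 0"
  using mn by (auto simp: alpha_def beta_def)

lemma poly_measurable_H [measurable]: "poly p \<in> borel_measurable H"
  by (intro borel_measurable_h_measure borel_measurable_continuous_onI continuous_intros)

lemma poly_bounded_H: "\<exists>B. \<forall>t\<in>{-1..1}. \<bar>poly (p :: real poly) t\<bar> \<le> B"
proof -
  have "compact (poly p ` {-1..1})" by (intro compact_continuous_image continuous_intros) auto
  then show ?thesis using compact_imp_bounded[of "poly p ` {-1..1}"] by (auto simp: bounded_iff)
qed

lemma poly_integrable_H: "integrable H (poly p)"
proof -
  obtain B where "\<forall>t\<in>{-1..1}. \<bar>poly p t\<bar> \<le> B" using poly_bounded_H by blast
  then show ?thesis by (intro H.integrable_const_bound[of _ B] AE_I2) auto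
qed

lemma poly_sq_integrable_H: "integrable H (\<lambda>t. (poly p t)\<^sup>2)"
proof -
  have "poly (p * p) = (\<lambda>t. (poly p t)\<^sup>2)" by (auto simp: power2_eq_square)
  then show ?thesis using poly_integrable_H[of "p * p"] by simp
qed

lemma mult_poly_integrable_H:
  assumes "integrable H w"
  shows "integrable H (\<lambda>t. w t * poly p t)"
proof -
  obtain B where B: "\<forall>t\<in>{-1..1}. \<bar>poly p t\<bar> \<le> B" using poly_bounded_H by blast
  have [measurable]: "w \<in> borel_measurable H" using assms by (rule borel_measurable_integrable)
  have "integrable H (\<lambda>t. w t * B)" using assms by simp
  then show ?thesis
  proof (rule Bochner_Integration.integrable_bound)
    show "AE t in H. norm (w t * poly p t) \<le> norm (w t * B)"
    proof (rule AE_I2)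
      fix t assume "t \<in> space H"
      then have "\<bar>poly p t\<bar> \<le> \<bar>B\<bar>" using B by (auto intro: order.trans[OF _ abs_ge_self])
      then show "norm (w t * poly p t) \<le> norm (w t * B)"
        unfolding real_norm_def abs_mult by (intro mult_left_mono) auto
    qed
  qed measurable
qed

definition Ih :: "real poly \<Rightarrow> real" where "Ih p = (\<integral>t. poly p t \<partial>H)"

lemma jacobi_functional_h: "jacobi_functional (alpha n) (beta m) (2 * radial_const m * radial_const n) Ih"
proof
  show "alpha n \<ge> 0" "beta m \<ge> 0" by (rule ab_nonneg)+
  have k: "radial_const m > 0" "radial_const n > 0" using mn by (auto intro: radial_const_pos)
  then show "0 < 2 * radial_const m * radial_const n" by simp
  show "Ih (p + q) = Ih p + Ih q" for p q
    using poly_integrable_H[of p] poly_integrable_H[of q] by (simp add: Ih_def)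
  show "Ih (smult c p) = c * Ih p" for c p by (simp add: Ih_def)
  show "Ih (YV j l) = 2 * radial_const m * radial_const n *
     (Gamma (real j + beta m + 1) * Gamma (real l + alpha n + 1) / Gamma (real j + real l + alpha n + beta m + 2))" for j l
  proof -
    have "Ih (YV j l) = enn2real (\<integral>\<^sup>+t. ennreal (poly (YV j l) t) \<partial>H)"
      unfolding Ih_def by (intro integral_eq_nn_integral) (auto intro!: AE_I2 simp: poly_YV)
    moreover have "Gamma (real j + beta m + 1) > 0" "Gamma (real l + alpha n + 1) > 0" "Gamma (real j + real l + alpha n + beta m + 2) > 0"
      using ab_nonneg by (auto intro!: Gamma_real_pos)
    ultimately show ?thesis using k mn by (simp add: nn_integral_h_YV)
  qed
qed

interpretation J: jacobi_functional "alpha n" "beta m" "2 * radial_const m * radial_const n" Ih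
  by (rule jacobi_functional_h)

definition Rn :: "nat \<Rightarrow> real" where "Rn i = Ih (R i * R i)"

lemma Rn_pos: "Rn i > 0"
proof -
  have "Ih (R i * R i) \<ge> 0" by (simp add: Ih_def)
  then show ?thesis using J.I_R_R_nonzero[of i] by (simp add: Rn_def)
qed

definition coef :: "(real \<Rightarrow> real) \<Rightarrow> nat \<Rightarrow> real" where
  "coef w i = L2_inner H w (p_basis m n i)"

text \<open>\<open>p_basis\<close> divides the monic polynomial by its norm. Written through
  \<open>jacobi_R\<close>, whose squared norm is \<open>Rn i\<close>, only the sign of the leading
  coefficient survives the normalisation.\<close>

definition Pn :: "nat \<Rightarrow> real poly" where "Pn i = smult (sgn (lead_coeff (R i)) / sqrt (Rn i)) (R i)"

lemma p_basis_eq: "p_basis m n i = poly (Pn i)"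
proof
  fix t
  define c where "c = lead_coeff (R i)"
  have c: "c \<noteq> 0" using jacobi_R_nonzero[OF ab_nonneg] by (simp add: c_def)
  have J: "jacobi_poly (alpha n) (beta m) i = smult (1 / c) (R i)"
    unfolding c_def by (rule jacobi_poly_eq[OF ab_nonneg])
  have "(\<integral>\<^sup>+x. ennreal ((poly (smult (1 / c) (R i)) x)\<^sup>2) \<partial>H) = ennreal (\<integral>x. (poly (smult (1 / c) (R i)) x)\<^sup>2 \<partial>H)"
    by (intro nn_integral_eq_integral poly_sq_integrable_H) auto
  also have "(\<integral>x. (poly (smult (1 / c) (R i)) x)\<^sup>2 \<partial>H) = (\<integral>x. (1 / c)\<^sup>2 * poly (R i * R i) x \<partial>H)"
    by (intro Bochner_Integration.integral_cong) (auto simp: power2_eq_square)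
  also have "\<dots> = (1 / c)\<^sup>2 * Rn i" by (simp only: integral_mult_right_zero Rn_def Ih_def)
  finally have "L2_norm H (poly (smult (1 / c) (R i))) = ennreal (sqrt ((1 / c)\<^sup>2 * Rn i))"
    using Rn_pos[of i] by (simp add: L2_norm_def ennreal_sqrt_def)
  then have L: "enn2real (L2_norm H (poly (jacobi_poly (alpha n) (beta m) i))) = sqrt (Rn i) / \<bar>c\<bar>"
    unfolding J using Rn_pos[of i] by (simp add: real_sqrt_mult power_divide real_sqrt_divide)
  then show "p_basis m n i t = poly (Pn i) t"
    unfolding p_basis_def L unfolding Pn_def J c_def[symmetric] using c Rn_pos[of i] by (simp add: sgn_if field_simps)
qed

lemma coef_sq: "(coef w i)\<^sup>2 = (\<integral>t. w t * poly (R i) t \<partial>H)\<^sup>2 / Rn i"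
proof -
  have "coef w i = (\<integral>t. (sgn (lead_coeff (R i)) / sqrt (Rn i)) * (w t * poly (R i) t) \<partial>H)"
    unfolding coef_def L2_inner_def p_basis_eq Pn_def by (intro Bochner_Integration.integral_cong) auto
  also have "\<dots> = (sgn (lead_coeff (R i)) / sqrt (Rn i)) * (\<integral>t. w t * poly (R i) t \<partial>H)" by (rule integral_mult_right_zero)
  finally have e: "coef w i = (sgn (lead_coeff (R i)) / sqrt (Rn i)) * (\<integral>t. w t * poly (R i) t \<partial>H)" .
  have "(sgn (lead_coeff (R i)))\<^sup>2 = 1" using jacobi_R_nonzero[OF ab_nonneg, of i] by (simp add: sgn_if)
  then show ?thesis unfolding e using Rn_pos[of i] by (simp add: power_mult_distrib power_divide)
qed

lemma Pn_degree: "degree (Pn i) = i" "Pn i \<noteq> 0"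
proof -
  have "sgn (lead_coeff (R i)) / sqrt (Rn i) \<noteq> 0"
    using Rn_pos[of i] jacobi_R_nonzero[OF ab_nonneg, of i] by (simp add: sgn_zero_iff)
  then obtain y where "y \<noteq> 0" "Pn i = smult y (R i)" unfolding Pn_def by blast
  then show "degree (Pn i) = i" "Pn i \<noteq> 0"
    using jacobi_R_nonzero[OF ab_nonneg, of i] degree_jacobi_R[OF ab_nonneg, of i] by auto
qed

lemma Pn_orthonormal: "(\<integral>t. poly (Pn i) t * poly (Pn j) t \<partial>H) = (if i = j then 1 else 0)"
proof -
  define x where "x i = sgn (lead_coeff (R i)) / sqrt (Rn i)" for i
  have "(\<integral>t. poly (Pn i) t * poly (Pn j) t \<partial>H) = (\<integral>t. (x i * x j) * poly (R i * R j) t \<partial>H)"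
    by (intro Bochner_Integration.integral_cong) (auto simp: Pn_def x_def)
  also have "\<dots> = (x i * x j) * Ih (R i * R j)" unfolding Ih_def by (rule integral_mult_right_zero)
  finally have e: "(\<integral>t. poly (Pn i) t * poly (Pn j) t \<partial>H) = (x i * x j) * Ih (R i * R j)" .
  show ?thesis
  proof (cases "i = j")
    case True
    have "(sgn (lead_coeff (R j)))\<^sup>2 = 1" using jacobi_R_nonzero[OF ab_nonneg, of j] by (simp add: sgn_if)
    then have "x j * x j * Rn j = 1" using Rn_pos[of j] by (simp add: x_def power2_eq_square[symmetric] power_divide)
    then show ?thesis using True e by (simp add: Rn_def)
  qed (simp add: e J.I_R_orthogonal)
qed

lemma coef_Parseval:
  assumes "w \<in> borel_measurable H" "integrable H (\<lambda>t. (w t)\<^sup>2)"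
  shows "(\<lambda>i. (coef w i)\<^sup>2) sums (\<integral>t. (w t)\<^sup>2 \<partial>H)"
  using Parseval_orthonormal_poly[OF H.finite_measure_axioms sets_h_measure Pn_degree Pn_orthonormal assms]
  by (simp add: coef_def L2_inner_def p_basis_eq)

lemma L2_imp_integrable:
  fixes w :: "real \<Rightarrow> real"
  assumes [measurable]: "w \<in> borel_measurable H" and "integrable H (\<lambda>t. (w t)\<^sup>2)"
  shows "integrable H w"
  using integrable_sq_diff(2)[of w H "\<lambda>_. 1"] assms by simp

lemma zonal_kap_eq: "zonal_kap m n k j = J.kap k j"
  unfolding zonal_kap_def J.kap_def by (simp add: alpha_def beta_def)

text \<open>The right side is the double integral of
  \<open>(w (f y) - w (f z))^2 (y . z)^(2k)\<close> with the square multiplied out. The two pure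
  squares give \<open>mu k 0\<close> times the squared norm of \<open>w\<close>, because constants
  are the eigenvectors for index 0. The mixed term is \<open>kap_quadratic_form\<close>, and
  Parseval puts everything under one sum over \<open>i\<close>.\<close>

lemma mu_decreasing_sums:
  assumes w: "w \<in> borel_measurable H" "integrable H (\<lambda>t. (w t)\<^sup>2)"
  shows "(\<lambda>i. 2 * (J.mu k 0 - J.mu k i) * (coef w i)\<^sup>2) sums
    (2 * (\<Sum>j\<le>k. zonal_kap m n k j * (\<integral>t. (w t)\<^sup>2 * poly (YV j (k - j)) t \<partial>H) * Ih (YV j (k - j)))
      - 2 * (\<Sum>j\<le>k. zonal_kap m n k j * (\<integral>t. w t * poly (YV j (k - j)) t \<partial>H)\<^sup>2))"
proof -
  have R0: "R 0 = 1" by (simp add: jacobi_R_def)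
  have wi: "integrable H w" by (rule L2_imp_integrable[OF w])
  have 1: "(\<Sum>j\<le>k. zonal_kap m n k j * (\<integral>t. (w t)\<^sup>2 * poly (YV j (k - j)) t \<partial>H) * Ih (YV j (k - j))) = J.mu k 0 * (\<integral>t. (w t)\<^sup>2 \<partial>H)"
  proof -
    have T1: "poly (J.zonal_op k 1) t = J.mu k 0" for t
      using J.zonal_op_jacobi_R[of k 0] by (simp add: R0)
    have "(\<Sum>j\<le>k. zonal_kap m n k j * (\<integral>t. (w t)\<^sup>2 * poly (YV j (k - j)) t \<partial>H) * Ih (YV j (k - j)))
       = (\<Sum>j\<le>k. \<integral>t. (zonal_kap m n k j * Ih (YV j (k - j))) * ((w t)\<^sup>2 * poly (YV j (k - j)) t) \<partial>H)"
      unfolding integral_mult_right_zero by (simp only: mult_ac)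
    also have "\<dots> = (\<integral>t. (\<Sum>j\<le>k. (zonal_kap m n k j * Ih (YV j (k - j))) * ((w t)\<^sup>2 * poly (YV j (k - j)) t)) \<partial>H)"
      by (rule Bochner_Integration.integral_sum[symmetric]) (intro integrable_mult_right mult_poly_integrable_H w)
    also have "\<dots> = (\<integral>t. (w t)\<^sup>2 * poly (J.zonal_op k 1) t \<partial>H)"
      by (intro Bochner_Integration.integral_cong refl) (simp add: J.zonal_op_def poly_sum zonal_kap_eq sum_distrib_left mult_ac)
    finally show ?thesis unfolding T1 by simp
  qed
  have 2: "(\<Sum>j\<le>k. zonal_kap m n k j * (\<integral>t. w t * poly (YV j (k - j)) t \<partial>H)\<^sup>2) = (\<Sum>i\<le>k. J.mu k i * (coef w i)\<^sup>2)"
    unfolding zonal_kap_eq coef_sq Rn_def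
    by (rule J.kap_quadratic_form) (auto simp: distrib_left mult_poly_integrable_H[OF wi] mult.left_commute)
  have 3: "(\<lambda>i. J.mu k i * (coef w i)\<^sup>2) sums (\<Sum>i\<le>k. J.mu k i * (coef w i)\<^sup>2)"
    by (rule sums_finite) (auto simp: J.mu_def)
  have "(\<lambda>i. 2 * (J.mu k 0 * (coef w i)\<^sup>2) - 2 * (J.mu k i * (coef w i)\<^sup>2)) sums (2 * (J.mu k 0 * (\<integral>t. (w t)\<^sup>2 \<partial>H)) - 2 * (\<Sum>i\<le>k. J.mu k i * (coef w i)\<^sup>2))"
    by (intro sums_diff sums_mult coef_Parseval w 3)
  then show ?thesis unfolding 1 2 by (simp add: algebra_simps)
qed

text \<open>A name for the eigenvalue that stays available after the context, where the
  interpretation \<open>J\<close> ends.\<close>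

definition mu_h :: "nat \<Rightarrow> nat \<Rightarrow> real" where "mu_h = J.mu"

text \<open>The Gamma values in \<open>radial_const\<close> cancel those in \<open>mu\<close>, so
  \<open>m\<close> and \<open>n\<close> enter only through their sum. This is why the symbol depends
  on \<open>N\<close> but not on the splitting into blocks.\<close>

lemma mu_h_zonal_coeff:
  assumes "m + n = N + 1"
  shows "pochhammer g (2 * k) / fact (2 * k) * mu_h k i = 2 * pi powr ((real N + 1) / 2) * zonal_coeff g (real N) i k"
proof -
  have d: "real m + real n = real N + 1" using assms by (metis of_nat_1 of_nat_add)
  have c: "2 * radial_const m * radial_const n * Gamma (alpha n + 1) * Gamma (beta m + 1) = 2 * pi powr ((real N + 1) / 2)"
  proof -
    have "Gamma (real m / 2) > 0" "Gamma (real n / 2) > 0" using mn by auto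
    moreover have "pi powr ((real N + 1) / 2) = pi powr (real m / 2) * pi powr (real n / 2)"
      unfolding d[symmetric] by (simp add: powr_add add_divide_distrib)
    ultimately show ?thesis by (simp add: radial_const_def alpha_def beta_def)
  qed
  have "alpha n + beta m + 2 = (real N + 1) / 2" using d by (simp add: alpha_def beta_def field_simps)
  then have e: "real k + real i + alpha n + beta m + 2 = real k + real i + (real N + 1) / 2" by simp
  show ?thesis
  proof (cases "i \<le> k")
    case True
    have "mu_h k i = 2 * pi powr ((real N + 1) / 2) * fact (2 * k) / 4 ^ k / (fact (k - i) * Gamma (real k + real i + (real N + 1) / 2))"
      unfolding mu_h_def J.mu_def c e using True by simp
    then show ?thesis using True by (simp add: zonal_coeff_def)
  qed (simp add: mu_h_def J.mu_def zonal_coeff_def)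
qed

text \<open>For the exponent \<open>g = 1\<close> one has
  \<open>pochhammer 1 (2 * k) = fact (2 * k)\<close>, so \<open>mu_h\<close> itself is a positive
  multiple of a zonal coefficient and inherits its properties.\<close>

lemma mu_h_nonneg: "mu_h k i \<ge> 0"
proof -
  have "mu_h k i = 2 * pi powr ((real (m + n - 1) + 1) / 2) * zonal_coeff 1 (real (m + n - 1)) i k"
    using mu_h_zonal_coeff[of "m + n - 1" 1 k i] mn by (simp add: pochhammer_fact[symmetric])
  then show ?thesis using zonal_coeff_nonneg[of 1 "real (m + n - 1)" i k] mn by simp
qed

lemma mu_h_le: "mu_h k i \<le> mu_h k 0"
proof -
  have "mu_h k i = 2 * pi powr ((real (m + n - 1) + 1) / 2) * zonal_coeff 1 (real (m + n - 1)) i k" for i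
    using mu_h_zonal_coeff[of "m + n - 1" 1 k i] mn by (simp add: pochhammer_fact[symmetric])
  then show ?thesis using zonal_coeff_diff_bounds(1)[of 1 "real (m + n - 1)" k i] mn by simp
qed

lemmas mu_h_sums = mu_decreasing_sums[folded mu_h_def]

lemma Ih_kap_YV: "(\<Sum>j\<le>k. zonal_kap m n k j * Ih (YV j (k - j)) * poly (YV j (k - j)) t) = mu_h k 0"
proof -
  have R0: "R 0 = 1" by (simp add: jacobi_R_def)
  have "poly (J.zonal_op k 1) t = mu_h k 0" using J.zonal_op_jacobi_R[of k 0] by (simp add: R0 mu_h_def)
  then show ?thesis by (simp add: J.zonal_op_def poly_sum zonal_kap_eq)
qed

end

section \<open>The energy of a zonal function\<close>

lemma suminf_ennreal_swap:
  fixes f :: "nat \<Rightarrow> nat \<Rightarrow> ennreal"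
  shows "(\<Sum>k. \<Sum>i. f k i) = (\<Sum>i. \<Sum>k. f k i)"
proof -
  have "(\<Sum>k. \<Sum>i. f k i) = (\<Sum>k. \<integral>\<^sup>+i. f k i \<partial>count_space UNIV)" by (simp add: nn_integral_count_space_nat)
  also have "\<dots> = (\<integral>\<^sup>+i. (\<Sum>k. f k i) \<partial>count_space UNIV)" by (rule nn_integral_suminf[symmetric]) simp
  finally show ?thesis by (simp add: nn_integral_count_space_nat)
qed

lemma even_kernel_sums:
  fixes g t :: real
  assumes "\<bar>t\<bar> < 1"
  shows "(\<lambda>k. 2 * (pochhammer g (2 * k) / fact (2 * k)) * t ^ (2 * k)) sums ((1 - t) powr (- g) + (1 + t) powr (- g))"
proof -
  define f where "f k = pochhammer g k / fact k * t ^ k + pochhammer g k / fact k * (- t) ^ k" for k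
  have "f sums ((1 - t) powr (- g) + (1 - (- t)) powr (- g))"
    unfolding f_def using assms by (intro sums_add pochhammer_powser_sums) auto
  moreover have "f k = 0" if "k \<notin> range (\<lambda>k::nat. 2 * k)" for k
  proof -
    have "odd k" using that by (metis evenE rangeI)
    then show ?thesis by (simp add: f_def)
  qed
  moreover have "strict_mono (\<lambda>k::nat. 2 * k)" by (simp add: strict_mono_def)
  ultimately have "(\<lambda>k. f (2 * k)) sums ((1 - t) powr (- g) + (1 - (- t)) powr (- g))"
    by (subst sums_mono_reindex) auto
  moreover have "f (2 * k) = 2 * (pochhammer g (2 * k) / fact (2 * k)) * t ^ (2 * k)" for k
    by (simp add: f_def)
  ultimately show ?thesis by simp
qed

lemma norm_diff_sphere:
  fixes z y :: "'a::euclidean_space"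
  assumes "norm z = 1" "norm y = 1"
  shows "(norm (z - y))\<^sup>2 = 2 * (1 - z \<bullet> y)" "(norm (z + y))\<^sup>2 = 2 * (1 + z \<bullet> y)"
proof -
  have 1: "z \<bullet> z = 1" "y \<bullet> y = 1" using assms by (simp_all add: norm_eq_1)
  show "(norm (z - y))\<^sup>2 = 2 * (1 - z \<bullet> y)" "(norm (z + y))\<^sup>2 = 2 * (1 + z \<bullet> y)"
    by (simp_all add: power2_norm_eq_inner inner_diff_left inner_diff_right inner_add_left inner_add_right 1 inner_commute)
qed

lemma norm_powr_sq: "norm x powr (2 * g) = ((norm x)\<^sup>2) powr g"
proof (cases "norm x = 0")
  case False
  then have "(norm x)\<^sup>2 = norm x powr 2" by simp
  then show ?thesis by (simp only: powr_powr)
qed simp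

text \<open>At \<open>z = y\<close> and \<open>z = - y\<close> one of the quotients is \<open>D / 0 = 0\<close>, whence the condition on \<open>D\<close>.\<close>

lemma kernel_even_part:
  fixes z y :: "'a::euclidean_space"
  assumes z: "norm z = 1" "norm y = 1" and g: "g > 0" and D: "D \<ge> 0" "z = y \<or> z = - y \<Longrightarrow> D = 0"
  shows "ennreal (D / norm (z - y) powr (2 * g)) + ennreal (D / norm (z + y) powr (2 * g))
    = (\<Sum>k. ennreal (2 powr (1 - g) * (pochhammer g (2 * k) / fact (2 * k)) * (D * (z \<bullet> y) ^ (2 * k))))"
proof (cases "z = y \<or> z = - y")
  case True
  then show ?thesis using D by simp
next
  case False
  define t where "t = z \<bullet> y"
  have "norm (z - y) \<noteq> 0" "norm (z + y) \<noteq> 0" using False by (auto simp: eq_neg_iff_add_eq_0)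
  then have "(norm (z - y))\<^sup>2 > 0" "(norm (z + y))\<^sup>2 > 0" by auto
  then have t: "1 - t > 0" "1 + t > 0" unfolding norm_diff_sphere[OF z] by (auto simp: t_def)
  have "norm (z - y) powr (2 * g) = 2 powr g * (1 - t) powr g" "norm (z + y) powr (2 * g) = 2 powr g * (1 + t) powr g"
    unfolding norm_powr_sq norm_diff_sphere[OF z] t_def[symmetric] by (rule powr_mult)+
  then have e: "D / norm (z - y) powr (2 * g) + D / norm (z + y) powr (2 * g) = 2 powr (- g) * D * ((1 - t) powr (- g) + (1 + t) powr (- g))"
    using t unfolding powr_minus by (simp add: divide_inverse distrib_left mult_ac)
  have two: "(2::real) powr (1 - g) = 2 powr (- g) * 2" by (simp add: powr_diff powr_minus_divide)
  have "(\<lambda>k. 2 powr (- g) * D * (2 * (pochhammer g (2 * k) / fact (2 * k)) * t ^ (2 * k))) sums (2 powr (- g) * D * ((1 - t) powr (- g) + (1 + t) powr (- g)))"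
    using t by (intro sums_mult even_kernel_sums) auto
  moreover have "2 powr (- g) * D * (2 * (pochhammer g (2 * k) / fact (2 * k)) * t ^ (2 * k)) = 2 powr (1 - g) * (pochhammer g (2 * k) / fact (2 * k)) * (D * t ^ (2 * k))" for k
    unfolding two by (simp only: mult_ac)
  ultimately have s: "(\<lambda>k. 2 powr (1 - g) * (pochhammer g (2 * k) / fact (2 * k)) * (D * t ^ (2 * k))) sums (D / norm (z - y) powr (2 * g) + D / norm (z + y) powr (2 * g))"
    unfolding e by (simp only:)
  have nn: "0 \<le> 2 powr (1 - g) * (pochhammer g (2 * k) / fact (2 * k)) * (D * t ^ (2 * k))" for k
    using g D by (intro mult_nonneg_nonneg divide_nonneg_nonneg) (auto simp: less_imp_le pochhammer_pos)
  have "(\<Sum>k. ennreal (2 powr (1 - g) * (pochhammer g (2 * k) / fact (2 * k)) * (D * t ^ (2 * k)))) = ennreal (D / norm (z - y) powr (2 * g) + D / norm (z + y) powr (2 * g))"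
    using s nn by (subst suminf_ennreal2) (auto simp: sums_iff)
  also have "\<dots> = ennreal (D / norm (z - y) powr (2 * g)) + ennreal (D / norm (z + y) powr (2 * g))"
    using D by (intro ennreal_plus) auto
  finally show ?thesis by (simp add: t_def)
qed

text \<open>The exponent is written as \<open>2 * g\<close> because
  \<open>|z - y|^2 = 2 (1 - z . y)\<close> on the sphere, which makes the kernel a multiple of
  \<open>(1 - z . y)^(-g)\<close>. In the application \<open>g = N/2 + s\<close>.\<close>

definition energy :: "real \<Rightarrow> ('a::euclidean_space \<Rightarrow> real) \<Rightarrow> ennreal" where
  "energy g u = (\<integral>\<^sup>+ z. (\<integral>\<^sup>+ y. ennreal (\<bar>u z - u y\<bar>\<^sup>2 / norm (z - y) powr (2 * g)) \<partial>sphere_measure) \<partial>sphere_measure)"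

lemma sphere_pair_measurable:
  fixes F :: "'a::euclidean_space \<times> 'a \<Rightarrow> 'b::{second_countable_topology,real_normed_vector}"
  assumes "F \<in> borel_measurable borel"
  shows "F \<in> borel_measurable ((sphere_measure :: 'a measure) \<Otimes>\<^sub>M (sphere_measure :: 'a measure))"
proof -
  have i: "(\<lambda>z. z) \<in> measurable (sphere_measure :: 'a measure) borel" by (rule borel_measurable_sphere) simp
  have f: "fst \<in> measurable ((sphere_measure :: 'a measure) \<Otimes>\<^sub>M (sphere_measure :: 'a measure)) borel"
    by (rule measurable_compose[OF measurable_fst i])
  have s: "snd \<in> measurable ((sphere_measure :: 'a measure) \<Otimes>\<^sub>M (sphere_measure :: 'a measure)) borel"
    by (rule measurable_compose[OF measurable_snd i])
  have "(\<lambda>p. (fst p, snd p)) \<in> measurable ((sphere_measure :: 'a measure) \<Otimes>\<^sub>M (sphere_measure :: 'a measure)) (borel \<Otimes>\<^sub>M borel)"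
    by (rule measurable_Pair[OF f s])
  then have "(\<lambda>p. p) \<in> measurable ((sphere_measure :: 'a measure) \<Otimes>\<^sub>M (sphere_measure :: 'a measure)) borel"
    by (simp add: borel_prod)
  from measurable_compose[OF this assms] show ?thesis .
qed

lemma orthogonal_uminus: "orthogonal_transformation (uminus :: 'a::euclidean_space \<Rightarrow> 'a)"
  by (simp add: orthogonal_transformation linear_iff)

lemma energy_pair_measurable:
  fixes u :: "'a::euclidean_space \<Rightarrow> real"
  assumes u: "u \<in> borel_measurable sphere_measure" and P: "P \<in> borel_measurable (borel :: ('a \<times> 'a) measure)"
  shows "(\<lambda>p. ennreal (\<bar>u (fst p) - u (snd p)\<bar>\<^sup>2 * P p)) \<in> borel_measurable (sphere_measure \<Otimes>\<^sub>M (sphere_measure :: 'a measure))"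
proof -
  note [measurable] = measurable_compose[OF measurable_fst u] measurable_compose[OF measurable_snd u] sphere_pair_measurable[OF P]
  show ?thesis by measurable
qed

text \<open>For even \<open>u\<close>, the substitution of \<open>- y\<close> for \<open>y\<close>
  preserves the energy and replaces \<open>|z - y|\<close> by \<open>|z + y|\<close>. The sum of the
  two kernels has nonnegative series terms, so Tonelli's theorem exchanges the series with both
  integrals, also where the energy is infinite.\<close>

lemma double_energy:
  fixes u :: "'a::euclidean_space \<Rightarrow> real"
  assumes u: "u \<in> borel_measurable sphere_measure" and even: "\<And>z. u (- z) = u z" and g: "g > 0"
  shows "2 * energy g u = (\<Sum>k. ennreal (2 powr (1 - g) * (pochhammer g (2 * k) / fact (2 * k))) *
     (\<integral>\<^sup>+ z. (\<integral>\<^sup>+ y. ennreal (\<bar>u z - u y\<bar>\<^sup>2 * (z \<bullet> y) ^ (2 * k)) \<partial>sphere_measure) \<partial>sphere_measure))"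
proof -
  let ?S = "sphere_measure :: 'a measure"
  interpret S: finite_measure ?S by (rule finite_measure_sphere)
  define Fm where "Fm p = ennreal (\<bar>u (fst p) - u (snd p)\<bar>\<^sup>2 * inverse (norm (fst p - snd p) powr (2 * g)))" for p :: "'a \<times> 'a"
  define Fp where "Fp p = ennreal (\<bar>u (fst p) - u (snd p)\<bar>\<^sup>2 * inverse (norm (fst p + snd p) powr (2 * g)))" for p :: "'a \<times> 'a"
  define Fk where "Fk k p = ennreal (\<bar>u (fst p) - u (snd p)\<bar>\<^sup>2 * (fst p \<bullet> snd p) ^ (2 * k))" for k and p :: "'a \<times> 'a"
  define c where "c k = 2 powr (1 - g) * (pochhammer g (2 * k) / fact (2 * k))" for k
  have c: "c k \<ge> 0" for k using g by (auto simp: c_def less_imp_le pochhammer_pos)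
  have mFm [measurable]: "Fm \<in> borel_measurable (?S \<Otimes>\<^sub>M ?S)" unfolding Fm_def by (rule energy_pair_measurable[OF u]) measurable
  have mFp [measurable]: "Fp \<in> borel_measurable (?S \<Otimes>\<^sub>M ?S)" unfolding Fp_def by (rule energy_pair_measurable[OF u]) measurable
  have mFk [measurable]: "Fk k \<in> borel_measurable (?S \<Otimes>\<^sub>M ?S)" for k unfolding Fk_def by (rule energy_pair_measurable[OF u]) measurable
  have slice: "(\<lambda>y. F (z, y)) \<in> borel_measurable ?S" if "F \<in> borel_measurable (?S \<Otimes>\<^sub>M ?S)" "z \<in> space ?S" for F :: "'a \<times> 'a \<Rightarrow> ennreal" and z
    using that by (intro measurable_compose[OF measurable_Pair1']) auto
  have outer: "(\<lambda>z. \<integral>\<^sup>+y. F (z, y) \<partial>?S) \<in> borel_measurable ?S" if "F \<in> borel_measurable (?S \<Otimes>\<^sub>M ?S)" for F :: "'a \<times> 'a \<Rightarrow> ennreal"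
    using that by (rule S.borel_measurable_nn_integral_fst)
  have E: "energy g u = (\<integral>\<^sup>+z. \<integral>\<^sup>+y. Fm (z, y) \<partial>?S \<partial>?S)"
    by (simp add: energy_def Fm_def divide_inverse)
  have Ep: "(\<integral>\<^sup>+y. Fm (z, y) \<partial>?S) = (\<integral>\<^sup>+y. Fp (z, y) \<partial>?S)" if "z \<in> space ?S" for z
  proof -
    have "(\<integral>\<^sup>+y. Fp (z, y) \<partial>?S) = (\<integral>\<^sup>+y. Fp (z, - y) \<partial>?S)"
      using nn_integral_sphere_orthogonal[OF orthogonal_uminus slice[OF mFp that]] by simp
    then show ?thesis by (simp add: Fp_def Fm_def even)
  qed
  have "2 * energy g u = energy g u + energy g u" by (simp add: mult_2)
  also have "\<dots> = (\<integral>\<^sup>+z. \<integral>\<^sup>+y. Fm (z, y) \<partial>?S \<partial>?S) + (\<integral>\<^sup>+z. \<integral>\<^sup>+y. Fp (z, y) \<partial>?S \<partial>?S)"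
    unfolding E by (intro arg_cong2[where f = "(+)"] refl nn_integral_cong Ep)
  also have "\<dots> = (\<integral>\<^sup>+z. (\<integral>\<^sup>+y. Fm (z, y) \<partial>?S) + (\<integral>\<^sup>+y. Fp (z, y) \<partial>?S) \<partial>?S)"
    by (rule nn_integral_add[symmetric]) (intro outer mFm mFp)+
  also have "\<dots> = (\<integral>\<^sup>+z. (\<integral>\<^sup>+y. Fm (z, y) + Fp (z, y) \<partial>?S) \<partial>?S)"
    by (intro nn_integral_cong nn_integral_add[symmetric] slice mFm mFp)
  also have "\<dots> = (\<integral>\<^sup>+z. (\<integral>\<^sup>+y. (\<Sum>k. ennreal (c k) * Fk k (z, y)) \<partial>?S) \<partial>?S)"
  proof (rule nn_integral_cong, rule nn_integral_cong)
    fix z y assume "z \<in> space ?S" "y \<in> space ?S"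
    then have zy: "norm z = 1" "norm y = 1" by auto
    have "Fm (z, y) + Fp (z, y) = (\<Sum>k. ennreal (c k * (\<bar>u z - u y\<bar>\<^sup>2 * (z \<bullet> y) ^ (2 * k))))"
      unfolding Fm_def Fp_def fst_conv snd_conv divide_inverse[symmetric] c_def
      by (rule kernel_even_part[OF zy g]) (auto simp: even)
    also have "\<dots> = (\<Sum>k. ennreal (c k) * Fk k (z, y))"
      unfolding Fk_def fst_conv snd_conv by (intro suminf_cong ennreal_mult' c)
    finally show "Fm (z, y) + Fp (z, y) = (\<Sum>k. ennreal (c k) * Fk k (z, y))" .
  qed
  also have "\<dots> = (\<integral>\<^sup>+z. (\<Sum>k. \<integral>\<^sup>+y. ennreal (c k) * Fk k (z, y) \<partial>?S) \<partial>?S)"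
    by (intro nn_integral_cong nn_integral_suminf borel_measurable_times_ennreal borel_measurable_const slice mFk)
  also have "\<dots> = (\<integral>\<^sup>+z. (\<Sum>k. ennreal (c k) * (\<integral>\<^sup>+y. Fk k (z, y) \<partial>?S)) \<partial>?S)"
    by (rule nn_integral_cong) (intro suminf_cong nn_integral_cmult slice mFk)
  also have "\<dots> = (\<Sum>k. \<integral>\<^sup>+z. ennreal (c k) * (\<integral>\<^sup>+y. Fk k (z, y) \<partial>?S) \<partial>?S)"
    by (intro nn_integral_suminf borel_measurable_times_ennreal borel_measurable_const outer mFk)
  also have "\<dots> = (\<Sum>k. ennreal (c k) * (\<integral>\<^sup>+z. \<integral>\<^sup>+y. Fk k (z, y) \<partial>?S \<partial>?S))"
    by (intro suminf_cong nn_integral_cmult outer mFk)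
  finally show ?thesis by (simp add: Fk_def c_def)
qed

lemma zonal_integrable:
  fixes y :: "(real^'m) \<times> (real^'n)"
  assumes w: "integrable (h_measure CARD('m) CARD('n)) w" and y: "y \<in> sphere 0 1"
  shows "integrable sphere_measure (\<lambda>z. w (f_map z) * (z \<bullet> y) ^ (2 * k) :: real)"
proof (rule Bochner_Integration.integrable_bound[OF integrable_comp_f_map[OF w]])
  show "(\<lambda>z. w (f_map z) * (z \<bullet> y) ^ (2 * k)) \<in> borel_measurable sphere_measure"
    by (rule borel_measurable_times[OF measurable_comp_f_map[OF borel_measurable_integrable[OF w]] borel_measurable_sphere]) measurable
  show "AE z in sphere_measure. norm (w (f_map z) * (z \<bullet> y) ^ (2 * k)) \<le> norm (w (f_map z))"
  proof (rule AE_I2)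
    fix z :: "(real^'m) \<times> (real^'n)" assume "z \<in> space sphere_measure"
    then have "\<bar>z \<bullet> y\<bar> ^ (2 * k) \<le> 1" using inner_prod_bound(3)[of z y] y by (intro power_le_one) auto
    then show "norm (w (f_map z) * (z \<bullet> y) ^ (2 * k)) \<le> norm (w (f_map z))"
      unfolding real_norm_def abs_mult power_abs by (intro mult_left_le) auto
  qed
qed

lemma integral_comp_f_map:
  fixes w :: "real \<Rightarrow> real"
  assumes "w \<in> borel_measurable (h_measure CARD('m) CARD('n))"
  shows "(\<integral>z. w (f_map z) \<partial>(sphere_measure :: ((real^'m) \<times> (real^'n)) measure)) = (\<integral>t. w t \<partial>h_measure CARD('m) CARD('n))"
proof -
  have "(\<integral>t. w t \<partial>h_measure CARD('m) CARD('n)) = (\<integral>t. w t \<partial>distr (sphere_measure :: ((real^'m) \<times> (real^'n)) measure) (h_measure CARD('m) CARD('n)) f_map)"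
    by (simp only: distr_f_map)
  also have "\<dots> = (\<integral>z. w (f_map z) \<partial>(sphere_measure :: ((real^'m) \<times> (real^'n)) measure))"
    using assms by (intro integral_distr f_map_measurable_sphere)
  finally show ?thesis ..
qed

text \<open>For fixed \<open>k\<close> the kernel is bounded, so the square may be multiplied out
  into three integrable terms. With the singular kernel the separate terms would diverge; this is
  why the kernel is expanded before the square is.\<close>

lemma zonal_double_integral:
  fixes w :: "real \<Rightarrow> real"
  defines "Hm \<equiv> h_measure CARD('m) CARD('n)"
  assumes mn: "CARD('m) \<ge> 2" "CARD('n) \<ge> 2"
    and w: "w \<in> borel_measurable Hm" "integrable Hm (\<lambda>t. (w t)\<^sup>2)"
  shows "(\<integral>\<^sup>+ y. (\<integral>\<^sup>+ z. ennreal (\<bar>w (f_map y) - w (f_map z)\<bar>\<^sup>2 * (y \<bullet> z) ^ (2 * k)) \<partial>(sphere_measure :: ((real^'m) \<times> (real^'n)) measure)) \<partial>sphere_measure)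
    = (\<Sum>i. ennreal (2 * (mu_h CARD('m) CARD('n) k 0 - mu_h CARD('m) CARD('n) k i) * (coef CARD('m) CARD('n) w i)\<^sup>2))"
proof -
  let ?S = "sphere_measure :: ((real^'m) \<times> (real^'n)) measure"
  define \<kappa> where "\<kappa> j = zonal_kap CARD('m) CARD('n) k j" for j
  define B where "B j = YV j (k - j)" for j
  define A where "A j = (\<integral>t. (w t)\<^sup>2 * poly (B j) t \<partial>Hm)" for j
  define Wj where "Wj j = (\<integral>t. w t * poly (B j) t \<partial>Hm)" for j
  define Ij where "Ij j = (\<integral>t. 1 * poly (B j) t \<partial>Hm)" for j
  interpret Hm: finite_measure Hm unfolding Hm_def by (rule finite_measure_h)
  have w1: "integrable Hm w" unfolding Hm_def by (rule L2_imp_integrable[OF mn w[unfolded Hm_def]])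
  have one: "integrable Hm (\<lambda>t. 1 :: real)" by simp
  \<comment> \<open>The inner integral as a function of \<open>t = f_map y\<close>, obtained from
    \<open>integral_zonal_power\<close> for the square of \<open>w\<close>, for \<open>w\<close> and
    for the constant 1.\<close>
  define \<Psi> where "\<Psi> t = (\<Sum>j\<le>k. \<kappa> j * A j * poly (B j) t) - 2 * (\<Sum>j\<le>k. \<kappa> j * Wj j * (w t * poly (B j) t)) + (\<Sum>j\<le>k. \<kappa> j * Ij j * ((w t)\<^sup>2 * poly (B j) t))" for t
  have mp: "integrable Hm (\<lambda>t. v t * poly p t)" if "integrable Hm v" for v p
    unfolding Hm_def by (rule mult_poly_integrable_H[OF mn that[unfolded Hm_def]])
  have ip: "integrable Hm (poly p)" for p using mp[OF one] by simp
  have i\<Psi>: "integrable Hm \<Psi>" unfolding \<Psi>_def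
    by (intro Bochner_Integration.integrable_add Bochner_Integration.integrable_diff Bochner_Integration.integrable_sum integrable_mult_right ip mp w w1)
  have inner: "(\<integral>\<^sup>+ z. ennreal (\<bar>w (f_map y) - w (f_map z)\<bar>\<^sup>2 * (y \<bullet> z) ^ (2 * k)) \<partial>?S) = ennreal (\<Psi> (f_map y)) \<and> \<Psi> (f_map y) \<ge> 0"
    if "y \<in> space ?S" for y
  proof -
    have y: "y \<in> sphere 0 1" using that by simp
    define v where "v z = (w (f_map z))\<^sup>2 * (z \<bullet> y) ^ (2 * k) - 2 * w (f_map y) * (w (f_map z) * (z \<bullet> y) ^ (2 * k)) + (w (f_map y))\<^sup>2 * (1 * (z \<bullet> y) ^ (2 * k))" for z
    have eq: "\<bar>w (f_map y) - w (f_map z)\<bar>\<^sup>2 * (y \<bullet> z) ^ (2 * k) = v z" for z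
      by (simp add: v_def power2_diff inner_commute algebra_simps)
    have i1: "integrable ?S (\<lambda>z. (w (f_map z))\<^sup>2 * (z \<bullet> y) ^ (2 * k))" using zonal_integrable[OF w(2)[unfolded Hm_def] y] .
    have i2: "integrable ?S (\<lambda>z. w (f_map z) * (z \<bullet> y) ^ (2 * k))" using zonal_integrable[OF w1[unfolded Hm_def] y] .
    have i3: "integrable ?S (\<lambda>z. 1 * (z \<bullet> y) ^ (2 * k))" using zonal_integrable[OF one[unfolded Hm_def] y] .
    have iv: "integrable ?S v" unfolding v_def
      by (intro Bochner_Integration.integrable_add Bochner_Integration.integrable_diff integrable_mult_right i1 i2 i3)
    have nn: "v z \<ge> 0" for z unfolding eq[symmetric] by simp
    have "(\<integral>z. v z \<partial>?S) = (\<integral>z. (w (f_map z))\<^sup>2 * (z \<bullet> y) ^ (2 * k) \<partial>?S) - 2 * w (f_map y) * (\<integral>z. w (f_map z) * (z \<bullet> y) ^ (2 * k) \<partial>?S) + (w (f_map y))\<^sup>2 * (\<integral>z. 1 * (z \<bullet> y) ^ (2 * k) \<partial>?S)"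
      unfolding v_def using i1 i2 i3 by simp
    also have "(\<integral>z. (w (f_map z))\<^sup>2 * (z \<bullet> y) ^ (2 * k) \<partial>?S) = (\<Sum>j\<le>k. \<kappa> j * A j * poly (B j) (f_map y))"
      unfolding \<kappa>_def A_def B_def Hm_def by (rule integral_zonal_power[OF w(2)[unfolded Hm_def] y])
    also have "(\<integral>z. w (f_map z) * (z \<bullet> y) ^ (2 * k) \<partial>?S) = (\<Sum>j\<le>k. \<kappa> j * Wj j * poly (B j) (f_map y))"
      unfolding \<kappa>_def Wj_def B_def Hm_def by (rule integral_zonal_power[OF w1[unfolded Hm_def] y])
    also have "(\<integral>z. 1 * (z \<bullet> y) ^ (2 * k) \<partial>?S) = (\<Sum>j\<le>k. \<kappa> j * Ij j * poly (B j) (f_map y))"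
      unfolding \<kappa>_def Ij_def B_def Hm_def by (rule integral_zonal_power[OF one[unfolded Hm_def] y])
    finally have "(\<integral>z. v z \<partial>?S) = \<Psi> (f_map y)"
      by (simp add: \<Psi>_def sum_distrib_left mult_ac)
    moreover have "(\<integral>\<^sup>+ z. ennreal (v z) \<partial>?S) = ennreal (\<integral>z. v z \<partial>?S)"
      by (rule nn_integral_eq_integral[OF iv]) (simp add: nn)
    moreover have "(\<integral>z. v z \<partial>?S) \<ge> 0" by (rule Bochner_Integration.integral_nonneg) (rule nn)
    ultimately show ?thesis unfolding eq by simp
  qed
  have "(\<integral>\<^sup>+ y. (\<integral>\<^sup>+ z. ennreal (\<bar>w (f_map y) - w (f_map z)\<bar>\<^sup>2 * (y \<bullet> z) ^ (2 * k)) \<partial>?S) \<partial>?S) = (\<integral>\<^sup>+ y. ennreal (\<Psi> (f_map y)) \<partial>?S)"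
    using inner by (intro nn_integral_cong) blast
  also have "\<dots> = ennreal (\<integral>y. \<Psi> (f_map y) \<partial>?S)"
  proof (rule nn_integral_eq_integral)
    show "integrable ?S (\<lambda>y. \<Psi> (f_map y))" using integrable_comp_f_map i\<Psi> unfolding Hm_def by blast
    show "AE y in ?S. 0 \<le> \<Psi> (f_map y)" using inner by (intro AE_I2) blast
  qed
  also have "(\<integral>y. \<Psi> (f_map y) \<partial>?S) = (\<integral>t. \<Psi> t \<partial>Hm)"
    unfolding Hm_def by (rule integral_comp_f_map) (use i\<Psi> in \<open>auto simp: Hm_def\<close>)
  also have "(\<integral>t. \<Psi> t \<partial>Hm) = (\<integral>t. (\<Sum>j\<le>k. \<kappa> j * A j * poly (B j) t) \<partial>Hm) - 2 * (\<integral>t. (\<Sum>j\<le>k. \<kappa> j * Wj j * (w t * poly (B j) t)) \<partial>Hm) + (\<integral>t. (\<Sum>j\<le>k. \<kappa> j * Ij j * ((w t)\<^sup>2 * poly (B j) t)) \<partial>Hm)"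
  proof -
    have "integrable Hm (\<lambda>t. \<Sum>j\<le>k. \<kappa> j * A j * poly (B j) t)" "integrable Hm (\<lambda>t. \<Sum>j\<le>k. \<kappa> j * Wj j * (w t * poly (B j) t))"
      "integrable Hm (\<lambda>t. \<Sum>j\<le>k. \<kappa> j * Ij j * ((w t)\<^sup>2 * poly (B j) t))"
      by (intro Bochner_Integration.integrable_sum integrable_mult_right ip mp w w1)+
    then show ?thesis unfolding \<Psi>_def by simp
  qed
  also have "(\<integral>t. (\<Sum>j\<le>k. \<kappa> j * A j * poly (B j) t) \<partial>Hm) = (\<Sum>j\<le>k. \<kappa> j * A j * Ij j)"
    by (subst Bochner_Integration.integral_sum) (auto simp: Ij_def intro!: integrable_mult_right ip)
  also have "(\<integral>t. (\<Sum>j\<le>k. \<kappa> j * Wj j * (w t * poly (B j) t)) \<partial>Hm) = (\<Sum>j\<le>k. \<kappa> j * Wj j * Wj j)"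
    by (subst Bochner_Integration.integral_sum) (auto simp: Wj_def intro!: integrable_mult_right mp w1)
  also have "(\<integral>t. (\<Sum>j\<le>k. \<kappa> j * Ij j * ((w t)\<^sup>2 * poly (B j) t)) \<partial>Hm) = (\<Sum>j\<le>k. \<kappa> j * Ij j * A j)"
    by (subst Bochner_Integration.integral_sum) (auto simp: A_def intro!: integrable_mult_right mp w)
  also have "(\<Sum>j\<le>k. \<kappa> j * A j * Ij j) - 2 * (\<Sum>j\<le>k. \<kappa> j * Wj j * Wj j) + (\<Sum>j\<le>k. \<kappa> j * Ij j * A j)
     = 2 * (\<Sum>j\<le>k. \<kappa> j * A j * Ij j) - 2 * (\<Sum>j\<le>k. \<kappa> j * (Wj j)\<^sup>2)"
    by (simp add: power2_eq_square mult_ac)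
  finally have 1: "(\<integral>\<^sup>+ y. (\<integral>\<^sup>+ z. ennreal (\<bar>w (f_map y) - w (f_map z)\<bar>\<^sup>2 * (y \<bullet> z) ^ (2 * k)) \<partial>?S) \<partial>?S)
    = ennreal (2 * (\<Sum>j\<le>k. \<kappa> j * A j * Ij j) - 2 * (\<Sum>j\<le>k. \<kappa> j * (Wj j)\<^sup>2))" .
  have 2: "(\<lambda>i. 2 * (mu_h CARD('m) CARD('n) k 0 - mu_h CARD('m) CARD('n) k i) * (coef CARD('m) CARD('n) w i)\<^sup>2) sums
      (2 * (\<Sum>j\<le>k. \<kappa> j * A j * Ij j) - 2 * (\<Sum>j\<le>k. \<kappa> j * (Wj j)\<^sup>2))"
    using mu_h_sums[OF mn, of w k] w unfolding \<kappa>_def A_def Wj_def Ij_def B_def Hm_def Ih_def[OF mn] by simp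
  show ?thesis unfolding 1
    using 2 mu_h_le[OF mn, of k] by (subst suminf_ennreal2) (auto simp: sums_iff)
qed

section \<open>The symbol and the normalising constant\<close>

lemma A_phi_const: "A_const N s = phi_symbol N s (lambda_ev N 0) \<or> N = 0"
proof (cases "N = 0")
  case False
  \<comment> \<open>The root of a square is an absolute value; it is \<open>(N - 1)/2\<close>
    because \<open>N\<close> is at least 1 here.\<close>
  have "sqrt (((real N - 1) / 2)\<^sup>2) = (real N - 1) / 2" using False by (subst real_sqrt_abs) auto
  moreover have "1 / 2 + s + (real N - 1) / 2 = real N / 2 + s" "1 / 2 - s + (real N - 1) / 2 = real N / 2 - s"
    by (simp_all add: diff_divide_distrib)
  ultimately have "phi_symbol N s 0 = A_const N s" by (simp only: A_const_def phi_symbol_def add_0)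
  then show ?thesis by (simp add: lambda_ev_def)
qed simp

text \<open>Adding \<open>((N - 1)/2)^2\<close> to \<open>lambda_ev N i\<close> completes the
  square: the sum is the square of \<open>2 i + (N - 1)/2\<close>.\<close>

lemma phi_symbol_eq:
  assumes "N > 0"
  shows "phi_symbol N s (lambda_ev N i) = Gamma (2 * real i + real N / 2 + s) / Gamma (2 * real i + real N / 2 - s)"
proof -
  have "lambda_ev N i + ((real N - 1) / 2)\<^sup>2 = (2 * real i + (real N - 1) / 2)\<^sup>2"
    by (simp add: lambda_ev_def power2_eq_square field_simps)
  then have "sqrt (lambda_ev N i + ((real N - 1) / 2)\<^sup>2) = 2 * real i + (real N - 1) / 2"
    using assms by (simp add: real_sqrt_abs)
  moreover have "1 / 2 + s + (2 * real i + (real N - 1) / 2) = 2 * real i + real N / 2 + s" "1 / 2 - s + (2 * real i + (real N - 1) / 2) = 2 * real i + real N / 2 - s"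
    by (simp_all add: diff_divide_distrib)
  ultimately show ?thesis by (simp only: phi_symbol_def)
qed

text \<open>In the application \<open>X\<close> and \<open>Y\<close> are \<open>2 powr (N/2)\<close>
  and \<open>2 powr s\<close>, \<open>Z\<close> is \<open>pi powr (N/2)\<close>, \<open>p\<close> is
  \<open>sqrt pi\<close>, and \<open>g1\<close>, \<open>g2\<close> are
  \<open>Gamma (N/2 + s)\<close> and \<open>Gamma (1 - s)\<close>. As free positive variables they
  leave a rational identity.\<close>

lemma normalising_constant:
  fixes X Y Z p g1 g2 s :: real
  assumes "X > 0" "Y > 0" "Z > 0" "p > 0" "g1 > 0" "g2 > 0" "s > 0"
  shows "Y * Y * (1 / Z) * g1 / g2 * s / 4 * (2 * (2 / (X * Y)) * (2 * (Z * p)) * (g2 * (X / (Y * 2)) / (s * p * g1))) = 1"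
  using assms by (simp add: field_simps)

text \<open>The energy contributes \<open>\<phi> i - A\<close> to the weight of the
  \<open>i\<close>-th squared coefficient, for which only the differences of zonal coefficients are
  summed. The mass term contributes the missing \<open>A\<close> by Parseval. For \<open>w\<close>
  in L2 the identity holds also when both norms are infinite.\<close>

theorem Hs_norm_f_map:
  fixes w :: "real \<Rightarrow> real"
  assumes N: "N \<ge> 3" and mn: "CARD('m) \<ge> 2" "CARD('n) \<ge> 2" and mnN: "CARD('m) + CARD('n) = N + 1" and s: "0 < s" "s < 1"
    and w: "w \<in> borel_measurable (h_measure CARD('m) CARD('n))" "integrable (h_measure CARD('m) CARD('n)) (\<lambda>t. (w t)\<^sup>2)"
  shows "Hs_sphere_norm N s (\<lambda>z :: (real^'m) \<times> (real^'n). w (f_map z)) = Hs_h_norm N CARD('m) CARD('n) s w"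
proof -
  let ?S = "sphere_measure :: ((real^'m) \<times> (real^'n)) measure"
  define g where "g = real N / 2 + s"
  have g: "g > 0" using s by (simp add: g_def add_nonneg_pos)
  define co where "co i = (coef CARD('m) CARD('n) w i)\<^sup>2" for i
  have co: "co i \<ge> 0" for i by (simp add: co_def)
  define \<mu> where "\<mu> = mu_h CARD('m) CARD('n)"
  define c where "c k = 2 powr (1 - g) * (pochhammer g (2 * k) / fact (2 * k))" for k
  have c: "c k \<ge> 0" for k using g by (auto simp: c_def less_imp_le pochhammer_pos)
  define P where "P = 2 * pi powr ((real N + 1) / 2)"
  have P: "P > 0" by (simp add: P_def)
  define \<phi> where "\<phi> i = phi_symbol N s (lambda_ev N i)" for i
  define A where "A = A_const N s"
  define K where "K = Gamma (1 - s) * 2 powr (real N / 2 - s - 1) / (s * sqrt pi * Gamma (real N / 2 + s))"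
  have pos: "Gamma (real N / 2 + s) > 0" "Gamma (real N / 2 - s) > 0" "Gamma (1 - s) > 0" using s N by (auto intro!: Gamma_real_pos)
  have A: "A = \<phi> 0" using A_phi_const[of N s] N by (auto simp: A_def \<phi>_def)
  have A_pos: "A > 0" using pos by (simp add: A_def A_const_def)
  have K: "K > 0" using pos s by (simp add: K_def)
  have zs: "(\<lambda>k. zonal_coeff g (real N) 0 k - zonal_coeff g (real N) i k) sums (K * (\<phi> i - A))" for i
    using zonal_coeff_diff_sums[OF s, of "real N" i] N by (simp add: g_def K_def \<phi>_def phi_symbol_eq A_def A_const_def)
  have z0: "0 \<le> zonal_coeff g (real N) 0 k - zonal_coeff g (real N) i k" for i k
    using zonal_coeff_diff_bounds(1)[OF g] N by simp
  \<comment> \<open>The symbol is smallest at index 0: this is read off from the convergent series,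
    all of whose terms are nonnegative.\<close>
  have \<phi>A: "\<phi> i - A \<ge> 0" for i
  proof -
    have "0 \<le> K * (\<phi> i - A)" by (rule sums_le[OF _ sums_zero zs[of i]]) (rule z0)
    then show ?thesis using K by (simp add: zero_le_mult_iff)
  qed
  have cm: "c k * (2 * (\<mu> k 0 - \<mu> k i) * co i) = (2 * 2 powr (1 - g) * P * co i) * (zonal_coeff g (real N) 0 k - zonal_coeff g (real N) i k)" for k i
  proof -
    have z: "pochhammer g (2 * k) / fact (2 * k) * \<mu> k l = P * zonal_coeff g (real N) l k" for l
      unfolding \<mu>_def P_def by (rule mu_h_zonal_coeff[OF mn mnN])
    have "c k * (2 * (\<mu> k 0 - \<mu> k i) * co i) = 2 * 2 powr (1 - g) * co i * (pochhammer g (2 * k) / fact (2 * k) * \<mu> k 0 - pochhammer g (2 * k) / fact (2 * k) * \<mu> k i)"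
      by (simp only: c_def right_diff_distrib left_diff_distrib mult_ac)
    then show ?thesis unfolding z by (simp only: right_diff_distrib left_diff_distrib mult_ac)
  qed
  have wf: "(\<lambda>z. w (f_map z)) \<in> borel_measurable ?S" using w by (intro measurable_comp_f_map)
  have "2 * energy g (\<lambda>z :: (real^'m) \<times> (real^'n). w (f_map z)) = (\<Sum>k. ennreal (c k) * (\<Sum>i. ennreal (2 * (\<mu> k 0 - \<mu> k i) * co i)))"
  proof -
    have "2 * energy g (\<lambda>z :: (real^'m) \<times> (real^'n). w (f_map z)) = (\<Sum>k. ennreal (2 powr (1 - g) * (pochhammer g (2 * k) / fact (2 * k))) *
       (\<integral>\<^sup>+ z. (\<integral>\<^sup>+ y. ennreal (\<bar>w (f_map z) - w (f_map y)\<bar>\<^sup>2 * (z \<bullet> y) ^ (2 * k)) \<partial>?S) \<partial>?S))"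
      by (rule double_energy[OF wf _ g]) (simp add: f_map_def)
    then show ?thesis unfolding zonal_double_integral[OF mn w] c_def \<mu>_def co_def .
  qed
  also have "\<dots> = (\<Sum>k. \<Sum>i. ennreal ((2 * 2 powr (1 - g) * P * co i) * (zonal_coeff g (real N) 0 k - zonal_coeff g (real N) i k)))"
    unfolding cm[symmetric] by (intro suminf_cong) (simp add: ennreal_mult'[OF c] ennreal_suminf_cmult)
  also have "\<dots> = (\<Sum>i. \<Sum>k. ennreal ((2 * 2 powr (1 - g) * P * co i) * (zonal_coeff g (real N) 0 k - zonal_coeff g (real N) i k)))"
    by (rule suminf_ennreal_swap)
  also have "\<dots> = (\<Sum>i. ennreal ((2 * 2 powr (1 - g) * P * co i) * (K * (\<phi> i - A))))"
  proof (rule suminf_cong)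
    fix i
    have "(\<lambda>k. (2 * 2 powr (1 - g) * P * co i) * (zonal_coeff g (real N) 0 k - zonal_coeff g (real N) i k)) sums ((2 * 2 powr (1 - g) * P * co i) * (K * (\<phi> i - A)))"
      by (intro sums_mult zs)
    then show "(\<Sum>k. ennreal ((2 * 2 powr (1 - g) * P * co i) * (zonal_coeff g (real N) 0 k - zonal_coeff g (real N) i k))) = ennreal ((2 * 2 powr (1 - g) * P * co i) * (K * (\<phi> i - A)))"
      using z0 P co by (subst suminf_ennreal2) (auto simp: sums_iff)
  qed
  finally have E: "2 * energy g (\<lambda>z :: (real^'m) \<times> (real^'n). w (f_map z)) = (\<Sum>i. ennreal ((2 * 2 powr (1 - g) * P * co i) * (K * (\<phi> i - A))))" .
  define cN where "cN = c_const N s"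
  have "Gamma (2 - s) = (1 - s) * Gamma (1 - s)" using Gamma_Suc_pos[of "1 - s"] s by simp
  then have cN: "cN = 4 powr s * pi powr (- (real N / 2)) * Gamma g / Gamma (1 - s) * s"
    using s pos by (simp add: cN_def c_const_def g_def)
  have cNpos: "cN > 0" using s pos by (simp add: cN g_def)
  \<comment> \<open>Here the value of \<open>c_const\<close> is decisive. In \<open>cN / 4\<close>,
    one half comes from the norm and the other from doubling the energy to make the kernel
    even.\<close>
  have const: "cN / 4 * (2 * 2 powr (1 - g) * P * K) = 1"
  proof -
    have "pi powr ((real N + 1) / 2) = pi powr (real N / 2) * sqrt pi" by (simp add: powr_add add_divide_distrib powr_half_sqrt)
    moreover have "4 powr s = (2::real) powr s * 2 powr s" by (simp flip: powr_mult)
    moreover have "(2::real) powr (1 - g) = 2 / (2 powr (real N / 2) * 2 powr s)" by (simp add: g_def powr_diff powr_add)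
    moreover have "(2::real) powr (real N / 2 - s - 1) = 2 powr (real N / 2) / (2 powr s * 2)" by (simp add: powr_diff)
    moreover have "pi powr (- (real N / 2)) = 1 / pi powr (real N / 2)" by (rule powr_minus_divide)
    ultimately show ?thesis unfolding cN P_def K_def g_def[symmetric] using pos s
      by (simp only:) (rule normalising_constant, simp_all add: g_def)
  qed
  have "ennreal (cN / 2) * energy g (\<lambda>z :: (real^'m) \<times> (real^'n). w (f_map z)) = ennreal (cN / 4) * (2 * energy g (\<lambda>z :: (real^'m) \<times> (real^'n). w (f_map z)))"
  proof -
    have "ennreal (cN / 4) * ennreal 2 = ennreal (cN / 4 * 2)" using cNpos by (intro ennreal_mult'[symmetric]) simp
    then show ?thesis by (simp add: mult.assoc[symmetric])
  qed
  also have "\<dots> = (\<Sum>i. ennreal (cN / 4) * ennreal ((2 * 2 powr (1 - g) * P * co i) * (K * (\<phi> i - A))))"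
    unfolding E by (rule ennreal_suminf_cmult[symmetric])
  also have "\<dots> = (\<Sum>i. ennreal (co i * (\<phi> i - A)))"
  proof (rule suminf_cong)
    fix i
    have "cN / 4 * ((2 * 2 powr (1 - g) * P * co i) * (K * (\<phi> i - A))) = (cN / 4 * (2 * 2 powr (1 - g) * P * K)) * (co i * (\<phi> i - A))" by simp
    also have "\<dots> = co i * (\<phi> i - A)" unfolding const by simp
    finally have e: "cN / 4 * ((2 * 2 powr (1 - g) * P * co i) * (K * (\<phi> i - A))) = co i * (\<phi> i - A)" .
    have "ennreal (cN / 4) * ennreal ((2 * 2 powr (1 - g) * P * co i) * (K * (\<phi> i - A))) = ennreal (cN / 4 * ((2 * 2 powr (1 - g) * P * co i) * (K * (\<phi> i - A))))"
      using cNpos by (intro ennreal_mult'[symmetric]) simp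
    then show "ennreal (cN / 4) * ennreal ((2 * 2 powr (1 - g) * P * co i) * (K * (\<phi> i - A))) = ennreal (co i * (\<phi> i - A))"
      unfolding e .
  qed
  finally have part1: "ennreal (cN / 2) * energy g (\<lambda>z :: (real^'m) \<times> (real^'n). w (f_map z)) = (\<Sum>i. ennreal (co i * (\<phi> i - A)))" .
  have "(\<integral>\<^sup>+ z. ennreal ((w (f_map z))\<^sup>2) \<partial>?S) = ennreal (\<integral>z. (w (f_map z))\<^sup>2 \<partial>?S)"
    by (rule nn_integral_eq_integral[OF integrable_comp_f_map[OF w(2)]]) simp
  also have "(\<integral>z. (w (f_map z))\<^sup>2 \<partial>?S) = (\<integral>t. (w t)\<^sup>2 \<partial>h_measure CARD('m) CARD('n))"
    by (rule integral_comp_f_map) (use w in measurable)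
  also have "ennreal \<dots> = (\<Sum>i. ennreal (co i))"
    using coef_Parseval[OF mn w, folded co_def] by (subst suminf_ennreal2) (auto simp: sums_iff co)
  finally have "ennreal A * (\<integral>\<^sup>+ z. ennreal ((w (f_map z))\<^sup>2) \<partial>?S) = (\<Sum>i. ennreal A * ennreal (co i))"
    by (simp only: ennreal_suminf_cmult)
  also have "\<dots> = (\<Sum>i. ennreal (co i * A))"
    using A_pos by (intro suminf_cong) (simp add: ennreal_mult'[symmetric] mult.commute)
  finally have part2: "ennreal A * (\<integral>\<^sup>+ z. ennreal ((w (f_map z))\<^sup>2) \<partial>?S) = (\<Sum>i. ennreal (co i * A))" .
  have "(\<Sum>i. ennreal (co i * (\<phi> i - A))) + (\<Sum>i. ennreal (co i * A)) = (\<Sum>i. ennreal (co i * (\<phi> i - A)) + ennreal (co i * A))"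
    by (rule suminf_add) auto
  also have "\<dots> = (\<Sum>i. ennreal (co i * \<phi> i))"
  proof (rule suminf_cong)
    fix i
    have "ennreal (co i * (\<phi> i - A)) + ennreal (co i * A) = ennreal (co i * (\<phi> i - A) + co i * A)"
      using co \<phi>A A_pos by (intro ennreal_plus[symmetric]) auto
    then show "ennreal (co i * (\<phi> i - A)) + ennreal (co i * A) = ennreal (co i * \<phi> i)" by (simp add: algebra_simps)
  qed
  finally have "ennreal (cN / 2) * energy g (\<lambda>z :: (real^'m) \<times> (real^'n). w (f_map z)) + ennreal A * (\<integral>\<^sup>+ z. ennreal ((w (f_map z))\<^sup>2) \<partial>?S) = (\<Sum>i. ennreal (co i * \<phi> i))"
    unfolding part1 part2 .
  moreover have "real N + 2 * s = 2 * g" by (simp add: g_def)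
  ultimately show ?thesis
    unfolding Hs_sphere_norm_def Hs_h_norm_def energy_def cN_def A_def co_def \<phi>_def coef_def[OF mn] by simp
qed

section \<open>The isometries\<close>

lemma ennreal_sqrt_less_top: "ennreal_sqrt a < top \<longleftrightarrow> a < top"
  by (simp add: ennreal_sqrt_def less_top)

lemma ennreal_sqrt_less_iff:
  assumes "\<epsilon> > 0"
  shows "ennreal_sqrt a < ennreal \<epsilon> \<longleftrightarrow> a < ennreal (\<epsilon>\<^sup>2)"
proof (cases a)
  case (real r)
  have "sqrt r < \<epsilon> \<longleftrightarrow> r < \<epsilon>\<^sup>2"
    using real_sqrt_less_iff[of r "\<epsilon>\<^sup>2"] assms by simp
  then show ?thesis using real assms by (simp add: ennreal_sqrt_def ennreal_less_iff)
next
  case top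
  then show ?thesis by (simp add: ennreal_sqrt_def)
qed

text \<open>The kernel integrated against the constant 1 gives the eigenvalue of the constants,
  whatever the point \<open>z\<close>.\<close>

lemma integral_inner_power:
  fixes z :: "(real^'m) \<times> (real^'n)"
  assumes mn: "CARD('m) \<ge> 2" "CARD('n) \<ge> 2" and z: "z \<in> sphere 0 1"
  shows "(\<integral>\<^sup>+y. ennreal ((z \<bullet> y) ^ (2 * k)) \<partial>sphere_measure) = ennreal (mu_h CARD('m) CARD('n) k 0)"
proof -
  let ?H = "h_measure CARD('m) CARD('n)"
  interpret H: finite_measure ?H by (rule finite_measure_h)
  have one: "integrable ?H (\<lambda>t. 1 :: real)" by simp
  have i: "integrable sphere_measure (\<lambda>y. 1 * (y \<bullet> z) ^ (2 * k))" using zonal_integrable[OF one z] .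
  have "(\<integral>y. 1 * (y \<bullet> z) ^ (2 * k) \<partial>sphere_measure) = mu_h CARD('m) CARD('n) k 0"
    unfolding integral_zonal_power[OF one z] using Ih_kap_YV[OF mn, of k "f_map z"] by (simp add: Ih_def[OF mn])
  then have "(\<integral>\<^sup>+y. ennreal (1 * (y \<bullet> z) ^ (2 * k)) \<partial>sphere_measure) = ennreal (mu_h CARD('m) CARD('n) k 0)"
    using nn_integral_eq_integral[OF i] by simp
  then show ?thesis by (simp add: inner_commute)
qed

text \<open>Adding the potential at the antipode makes the kernel even, and the integral of each power
  \<open>(z \<bullet> y)\<^sup>2\<^sup>k\<close> is independent of \<open>z\<close>.\<close>

lemma riesz_potential_bounded:
  assumes mn: "CARD('m) \<ge> 2" "CARD('n) \<ge> 2" and N: "CARD('m) + CARD('n) = N + 1" and e: "0 < e" "e < real N / 2"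
  shows "\<exists>C. \<forall>z\<in>sphere 0 1. (\<integral>\<^sup>+y. ennreal (1 / norm (z - y) powr (2 * e)) \<partial>(sphere_measure :: ((real^'m) \<times> (real^'n)) measure)) \<le> ennreal C"
proof -
  let ?S = "sphere_measure :: ((real^'m) \<times> (real^'n)) measure"
  define c where "c k = 2 powr (1 - e) * (pochhammer e (2 * k) / fact (2 * k))" for k
  have c: "c k \<ge> 0" for k using e by (auto simp: c_def less_imp_le pochhammer_pos)
  define b where "b k = c k * mu_h CARD('m) CARD('n) k 0" for k
  have b: "b k = 2 powr (1 - e) * (2 * pi powr ((real N + 1) / 2) * zonal_coeff e (real N) 0 k)" for k
    unfolding b_def c_def using mu_h_zonal_coeff[OF mn N, of e k 0] by (simp only: mult.assoc)
  have "summable b" unfolding b using zonal_coeff_sums[OF e, of 0] by (intro summable_mult) (simp add: sums_iff)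
  have b0: "b k \<ge> 0" for k unfolding b_def using c mu_h_nonneg[OF mn] by simp
  have "(\<integral>\<^sup>+y. ennreal (1 / norm (z - y) powr (2 * e)) \<partial>?S) \<le> ennreal (suminf b)" if z: "z \<in> sphere 0 1" for z
  proof -
    define F where "F y = ennreal (1 / norm (z - y) powr (2 * e))" for y
    have mF [measurable]: "F \<in> borel_measurable ?S" unfolding F_def[abs_def] by (rule borel_measurable_sphere) measurable
    have mF' [measurable]: "(\<lambda>y. F (- y)) \<in> borel_measurable ?S" unfolding F_def by (rule borel_measurable_sphere) measurable
    have "(\<integral>\<^sup>+y. F y \<partial>?S) \<le> (\<integral>\<^sup>+y. F y \<partial>?S) + (\<integral>\<^sup>+y. F (- y) \<partial>?S)" by simp
    also have "\<dots> = (\<integral>\<^sup>+y. F y + F (- y) \<partial>?S)" by (rule nn_integral_add[symmetric]) measurable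
    also have "\<dots> \<le> (\<integral>\<^sup>+y. (\<Sum>k. ennreal (c k) * ennreal ((z \<bullet> y) ^ (2 * k))) \<partial>?S)"
    proof (rule nn_integral_mono)
      fix y assume "y \<in> space ?S"
      then have zy: "norm z = 1" "norm y = 1" using z by auto
      have e1: "ennreal (c k) * ennreal ((z \<bullet> y) ^ (2 * k)) = ennreal (c k * (1 * (z \<bullet> y) ^ (2 * k)))" for k
        using c[of k] by (simp add: ennreal_mult)
      show "F y + F (- y) \<le> (\<Sum>k. ennreal (c k) * ennreal ((z \<bullet> y) ^ (2 * k)))"
      proof (cases "z = y \<or> z = - y")
        case False
        have "F y + F (- y) = (\<Sum>k. ennreal (2 powr (1 - e) * (pochhammer e (2 * k) / fact (2 * k)) * (1 * (z \<bullet> y) ^ (2 * k))))"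
          using kernel_even_part[OF zy e(1), of 1] False by (simp add: F_def)
        then show ?thesis unfolding e1 by (simp add: c_def)
      next
        \<comment> \<open>At \<open>y = z\<close> and \<open>y = - z\<close> one of the two
          quotients is \<open>1 / 0 = 0\<close> and \<open>kernel_even_part\<close> does not apply.
          The other quotient is \<open>2 powr (- 2 e)\<close>, which is below the term for
          \<open>k = 0\<close>, so the inequality survives.\<close>
        case True
        have n2: "norm (z + z) = 2" using zy by (simp flip: scaleR_2)
        have "norm (z - y) = 0 \<and> norm (z + y) = 2 \<or> norm (z - y) = 2 \<and> norm (z + y) = 0"
          using True n2 by auto
        then have "F y + F (- y) = ennreal (1 / 2 powr (2 * e))" by (auto simp: F_def)
        also have "\<dots> \<le> ennreal (2 powr (1 - e))"
          using e by (intro ennreal_leI) (simp flip: powr_minus_divide)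
        also have "\<dots> = (\<Sum>k\<in>{0}. ennreal (c k) * ennreal ((z \<bullet> y) ^ (2 * k)))" by (simp add: c_def)
        also have "\<dots> \<le> (\<Sum>k. ennreal (c k) * ennreal ((z \<bullet> y) ^ (2 * k)))" by (rule sum_le_suminf) auto
        finally show ?thesis .
      qed
    qed
    also have "\<dots> = (\<Sum>k. \<integral>\<^sup>+y. ennreal (c k) * ennreal ((z \<bullet> y) ^ (2 * k)) \<partial>?S)"
      by (intro nn_integral_suminf borel_measurable_sphere) measurable
    also have "\<dots> = (\<Sum>k. ennreal (c k) * (\<integral>\<^sup>+y. ennreal ((z \<bullet> y) ^ (2 * k)) \<partial>?S))"
      by (intro suminf_cong nn_integral_cmult borel_measurable_sphere) measurable
    also have "\<dots> = (\<Sum>k. ennreal (b k))"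
      unfolding integral_inner_power[OF mn z] b_def by (intro suminf_cong ennreal_mult'[symmetric] c)
    also have "\<dots> = ennreal (suminf b)" using \<open>summable b\<close> b0 by (intro suminf_ennreal2)
    finally show ?thesis unfolding F_def .
  qed
  then show ?thesis by blast
qed

section \<open>Finiteness of the norm on the closure of the smooth functions\<close>

lemma Hs_sphere_norm_energy:
  "Hs_sphere_norm N s u = ennreal_sqrt (ennreal (c_const N s / 2) * energy (real N / 2 + s) u
     + ennreal (A_const N s) * (\<integral>\<^sup>+ z. ennreal ((u z)\<^sup>2) \<partial>sphere_measure))"
proof -
  have "2 * (real N / 2 + s) = real N + 2 * s" by simp
  then show ?thesis unfolding Hs_sphere_norm_def energy_def by (simp only:)
qed

lemma energy_cong_AE:
  assumes "AE z in sphere_measure. u z = v z"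
  shows "energy g u = energy g v"
  unfolding energy_def
proof (rule nn_integral_cong_AE, use assms in \<open>rule AE_mp\<close>, rule AE_I2, rule impI, rule nn_integral_cong_AE)
  fix z assume z: "u z = v z"
  show "AE y in sphere_measure. ennreal (\<bar>u z - u y\<bar>\<^sup>2 / norm (z - y) powr (2 * g)) = ennreal (\<bar>v z - v y\<bar>\<^sup>2 / norm (z - y) powr (2 * g))"
    using assms by (rule AE_mp) (rule AE_I2, simp add: z)
qed

lemma Hs_sphere_norm_cong_AE:
  assumes "AE z in sphere_measure. u z = v z"
  shows "Hs_sphere_norm N s u = Hs_sphere_norm N s v"
proof -
  have "(\<integral>\<^sup>+ z. ennreal ((u z)\<^sup>2) \<partial>sphere_measure) = (\<integral>\<^sup>+ z. ennreal ((v z)\<^sup>2) \<partial>sphere_measure)"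
    by (rule nn_integral_cong_AE) (use assms in \<open>auto elim: AE_mp\<close>)
  then show ?thesis unfolding Hs_sphere_norm_energy energy_cong_AE[OF assms] by simp
qed

lemma energy_eq_pair:
  fixes u :: "'a::euclidean_space \<Rightarrow> real"
  assumes "u \<in> borel_measurable sphere_measure"
  shows "energy g u = (\<integral>\<^sup>+ p. ennreal (\<bar>u (fst p) - u (snd p)\<bar>\<^sup>2 * inverse (norm (fst p - snd p) powr (2 * g)))
    \<partial>((sphere_measure :: 'a measure) \<Otimes>\<^sub>M (sphere_measure :: 'a measure)))"
proof -
  interpret S: finite_measure "sphere_measure :: 'a measure" by (rule finite_measure_sphere)
  have "(\<lambda>p. ennreal (\<bar>u (fst p) - u (snd p)\<bar>\<^sup>2 * inverse (norm (fst p - snd p) powr (2 * g)))) \<in> borel_measurable ((sphere_measure :: 'a measure) \<Otimes>\<^sub>M (sphere_measure :: 'a measure))"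
    by (rule energy_pair_measurable[OF assms]) measurable
  from S.nn_integral_fst[OF this] show ?thesis by (simp add: energy_def divide_inverse)
qed

lemma energy_triangle:
  fixes u v :: "'a::euclidean_space \<Rightarrow> real"
  assumes u: "u \<in> borel_measurable sphere_measure" and v: "v \<in> borel_measurable sphere_measure"
  shows "energy g u \<le> 2 * energy g (\<lambda>z. u z - v z) + 2 * energy g v"
proof -
  let ?S = "(sphere_measure :: 'a measure) \<Otimes>\<^sub>M (sphere_measure :: 'a measure)"
  define F where "F w p = ennreal (\<bar>w (fst p) - w (snd p)\<bar>\<^sup>2 * inverse (norm (fst p - snd p) powr (2 * g)))" for w and p :: "'a \<times> 'a"
  define d where "d z = u z - v z" for z
  have d: "d \<in> borel_measurable sphere_measure" unfolding d_def[abs_def] by (rule borel_measurable_diff[OF u v])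
  have m: "F w \<in> borel_measurable ?S" if "w \<in> borel_measurable sphere_measure" for w
    unfolding F_def by (rule energy_pair_measurable[OF that]) measurable
  have E: "energy g w = (\<integral>\<^sup>+p. F w p \<partial>?S)" if "w \<in> borel_measurable sphere_measure" for w
    unfolding F_def by (rule energy_eq_pair[OF that])
  have "energy g u \<le> (\<integral>\<^sup>+p. 2 * F d p + 2 * F v p \<partial>?S)"
    unfolding E[OF u]
  proof (rule nn_integral_mono)
    fix p :: "'a \<times> 'a"
    define k where "k = inverse (norm (fst p - snd p) powr (2 * g))"
    have k: "k \<ge> 0" by (simp add: k_def)
    have "\<bar>u (fst p) - u (snd p)\<bar>\<^sup>2 \<le> 2 * \<bar>d (fst p) - d (snd p)\<bar>\<^sup>2 + 2 * \<bar>v (fst p) - v (snd p)\<bar>\<^sup>2"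
      using sq_le_2_sq(2)[of "d (fst p) - d (snd p)" "v (fst p) - v (snd p)"] by (simp add: d_def)
    then have "\<bar>u (fst p) - u (snd p)\<bar>\<^sup>2 * k \<le> (2 * \<bar>d (fst p) - d (snd p)\<bar>\<^sup>2 + 2 * \<bar>v (fst p) - v (snd p)\<bar>\<^sup>2) * k"
      using k by (rule mult_right_mono)
    also have "\<dots> = 2 * (\<bar>d (fst p) - d (snd p)\<bar>\<^sup>2 * k) + 2 * (\<bar>v (fst p) - v (snd p)\<bar>\<^sup>2 * k)"
      by (simp only: distrib_right mult.assoc)
    finally have "F u p \<le> ennreal (2 * (\<bar>d (fst p) - d (snd p)\<bar>\<^sup>2 * k) + 2 * (\<bar>v (fst p) - v (snd p)\<bar>\<^sup>2 * k))"
      unfolding F_def k_def[symmetric] by (rule ennreal_leI)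
    also have "\<dots> = 2 * F d p + 2 * F v p"
      unfolding F_def k_def[symmetric] using k by (simp add: ennreal_plus ennreal_mult)
    finally show "F u p \<le> 2 * F d p + 2 * F v p" .
  qed
  also have "\<dots> = (\<integral>\<^sup>+p. 2 * F d p \<partial>?S) + (\<integral>\<^sup>+p. 2 * F v p \<partial>?S)"
    by (rule nn_integral_add) (intro borel_measurable_times_ennreal borel_measurable_const m d v)+
  also have "\<dots> = 2 * energy g d + 2 * energy g v"
    unfolding E[OF d] E[OF v] nn_integral_cmult[OF m[OF d]] nn_integral_cmult[OF m[OF v]] ..
  finally show ?thesis unfolding d_def .
qed

text \<open>Only finiteness is claimed, so it is enough that the squared norm of \<open>u\<close> is
  at most twice that of the difference plus twice that of \<open>v\<close>.\<close>

lemma Hs_sphere_norm_finite_triangle: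
  fixes u v :: "'a::euclidean_space \<Rightarrow> real"
  assumes u: "u \<in> borel_measurable sphere_measure" and v: "v \<in> borel_measurable sphere_measure"
    and fin: "Hs_sphere_norm N s (\<lambda>z. u z - v z) < \<infinity>" "Hs_sphere_norm N s v < \<infinity>"
  shows "Hs_sphere_norm N s u < \<infinity>"
proof -
  define I where "I w = (\<integral>\<^sup>+ z. ennreal ((w z)\<^sup>2) \<partial>(sphere_measure :: 'a measure))" for w
  define Q where "Q w = ennreal (c_const N s / 2) * energy (real N / 2 + s) w + ennreal (A_const N s) * I w" for w :: "'a \<Rightarrow> real"
  have n: "Hs_sphere_norm N s w = ennreal_sqrt (Q w)" for w :: "'a \<Rightarrow> real"
    unfolding Q_def I_def by (rule Hs_sphere_norm_energy)
  have I: "I u \<le> 2 * I (\<lambda>z. u z - v z) + 2 * I v"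
  proof -
    have "I u \<le> (\<integral>\<^sup>+z. 2 * ennreal ((u z - v z)\<^sup>2) + 2 * ennreal ((v z)\<^sup>2) \<partial>sphere_measure)"
      unfolding I_def
    proof (rule nn_integral_mono)
      fix z
      have "ennreal ((u z)\<^sup>2) \<le> ennreal (2 * (u z - v z)\<^sup>2 + 2 * (v z)\<^sup>2)"
        using sq_le_2_sq(2)[of "u z - v z" "v z"] by (intro ennreal_leI) simp
      also have "\<dots> = 2 * ennreal ((u z - v z)\<^sup>2) + 2 * ennreal ((v z)\<^sup>2)" by (simp add: ennreal_plus ennreal_mult)
      finally show "ennreal ((u z)\<^sup>2) \<le> 2 * ennreal ((u z - v z)\<^sup>2) + 2 * ennreal ((v z)\<^sup>2)" .
    qed
    also have "\<dots> = 2 * I (\<lambda>z. u z - v z) + 2 * I v"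
      unfolding I_def using u v by (subst nn_integral_add) (simp_all add: nn_integral_cmult)
    finally show ?thesis .
  qed
  have "Q u \<le> ennreal (c_const N s / 2) * (2 * energy (real N / 2 + s) (\<lambda>z. u z - v z) + 2 * energy (real N / 2 + s) v) + ennreal (A_const N s) * (2 * I (\<lambda>z. u z - v z) + 2 * I v)"
    unfolding Q_def by (intro add_mono mult_left_mono energy_triangle[OF u v] I) auto
  also have "\<dots> = 2 * Q (\<lambda>z. u z - v z) + 2 * Q v"
    unfolding Q_def by (simp only: distrib_left mult_ac add_ac)
  also have "\<dots> < \<infinity>" using fin unfolding n infinity_ennreal_def ennreal_sqrt_less_top by (simp add: ennreal_mult_less_top)
  finally show ?thesis unfolding n infinity_ennreal_def ennreal_sqrt_less_top .
qed

lemma C_infinity_sphere_measurable: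
  fixes u :: "'a::euclidean_space \<Rightarrow> real"
  assumes "u \<in> C_infinity (sphere 0 1)"
  shows "u \<in> borel_measurable sphere_measure"
  using borel_measurable_continuous_on_restrict[OF C_infinity_continuous_on[OF assms]]
    measurable_cong_sets[OF sets_sphere_measure refl] by blast

text \<open>The Lipschitz bound gains a factor \<open>|z - y|^2\<close>, which lowers the exponent
  of the kernel from \<open>N + 2 s\<close> to \<open>2 e = N + 2 s - 2\<close>. This is less than
  \<open>N\<close>, so the potential is bounded uniformly in \<open>z\<close>.\<close>

lemma Hs_sphere_norm_smooth:
  fixes u :: "(real^'m) \<times> (real^'n) \<Rightarrow> real"
  assumes mn: "CARD('m) \<ge> 2" "CARD('n) \<ge> 2" and N: "N \<ge> 3" "CARD('m) + CARD('n) = N + 1" and s: "0 < s" "s < 1"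
    and u: "u \<in> C_infinity (sphere 0 1)"
  shows "Hs_sphere_norm N s u < \<infinity>"
proof -
  let ?S = "sphere_measure :: ((real^'m) \<times> (real^'n)) measure"
  interpret S: finite_measure ?S by (rule finite_measure_sphere)
  have Sfin: "emeasure ?S (sphere 0 1) < top" using S.emeasure_finite[of "sphere 0 1"] by (simp only: less_top)
  define e where "e = real N / 2 + s - 1"
  have e: "0 < e" "e < real N / 2" using N s by (auto simp: e_def)
  obtain C where C: "\<forall>z\<in>sphere 0 1. (\<integral>\<^sup>+y. ennreal (1 / norm (z - y) powr (2 * e)) \<partial>?S) \<le> ennreal C"
    using riesz_potential_bounded[OF mn N(2) e] by blast
  obtain L where L: "\<forall>x\<in>sphere 0 1. \<forall>y\<in>sphere 0 1. \<bar>u x - u y\<bar> \<le> L * norm (x - y)"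
    using C_infinity_Lipschitz[OF u compact_sphere] by blast
  have "(\<integral>\<^sup>+ y. ennreal (\<bar>u z - u y\<bar>\<^sup>2 / norm (z - y) powr (2 * (real N / 2 + s))) \<partial>?S) \<le> ennreal (L\<^sup>2) * ennreal C" if z: "z \<in> space ?S" for z
  proof -
    have "(\<integral>\<^sup>+ y. ennreal (\<bar>u z - u y\<bar>\<^sup>2 / norm (z - y) powr (2 * (real N / 2 + s))) \<partial>?S) \<le> (\<integral>\<^sup>+ y. ennreal (L\<^sup>2) * ennreal (1 / norm (z - y) powr (2 * e)) \<partial>?S)"
    proof (rule nn_integral_mono)
      fix y assume y: "y \<in> space ?S"
      have "\<bar>u z - u y\<bar>\<^sup>2 / norm (z - y) powr (2 * (real N / 2 + s)) \<le> L\<^sup>2 * (1 / norm (z - y) powr (2 * e))"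
      proof (cases "z = y")
        case False
        then have p: "norm (z - y) > 0" by simp
        have "2 * (real N / 2 + s) = 2 + 2 * e" by (simp add: e_def)
        then have q: "norm (z - y) powr (2 * (real N / 2 + s)) = (norm (z - y))\<^sup>2 * norm (z - y) powr (2 * e)"
          using p by (simp only: powr_add) simp
        have "\<bar>u z - u y\<bar>\<^sup>2 \<le> (L * norm (z - y))\<^sup>2" using L z y by (intro power_mono) auto
        then have "\<bar>u z - u y\<bar>\<^sup>2 / norm (z - y) powr (2 * (real N / 2 + s)) \<le> (L * norm (z - y))\<^sup>2 / norm (z - y) powr (2 * (real N / 2 + s))"
          by (rule divide_right_mono) simp
        also have "\<dots> = L\<^sup>2 * (1 / norm (z - y) powr (2 * e))" unfolding q using p by (simp add: power_mult_distrib)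
        finally show ?thesis .
      qed simp
      then have "ennreal (\<bar>u z - u y\<bar>\<^sup>2 / norm (z - y) powr (2 * (real N / 2 + s))) \<le> ennreal (L\<^sup>2 * (1 / norm (z - y) powr (2 * e)))" by (rule ennreal_leI)
      also have "\<dots> = ennreal (L\<^sup>2) * ennreal (1 / norm (z - y) powr (2 * e))" by (rule ennreal_mult') simp
      finally show "ennreal (\<bar>u z - u y\<bar>\<^sup>2 / norm (z - y) powr (2 * (real N / 2 + s))) \<le> ennreal (L\<^sup>2) * ennreal (1 / norm (z - y) powr (2 * e))" .
    qed
    also have "\<dots> = ennreal (L\<^sup>2) * (\<integral>\<^sup>+ y. ennreal (1 / norm (z - y) powr (2 * e)) \<partial>?S)"
      by (intro nn_integral_cmult borel_measurable_sphere) measurable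
    also have "\<dots> \<le> ennreal (L\<^sup>2) * ennreal C" using C z by (intro mult_left_mono) auto
    finally show ?thesis .
  qed
  then have "energy (real N / 2 + s) u \<le> (\<integral>\<^sup>+z. ennreal (L\<^sup>2) * ennreal C \<partial>?S)"
    unfolding energy_def by (rule nn_integral_mono)
  also have "\<dots> < \<infinity>" using Sfin by (simp add: ennreal_mult_less_top)
  finally have E: "energy (real N / 2 + s) u < \<infinity>" .
  have "compact (u ` sphere 0 1)" by (intro compact_continuous_image C_infinity_continuous_on u compact_sphere)
  then obtain B where B: "\<forall>z\<in>sphere 0 1. \<bar>u z\<bar> \<le> B" using compact_imp_bounded[of "u ` sphere 0 1"] by (auto simp: bounded_iff)
  have "(\<integral>\<^sup>+ z. ennreal ((u z)\<^sup>2) \<partial>?S) \<le> (\<integral>\<^sup>+ z. ennreal (B\<^sup>2) \<partial>?S)"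
    using B by (intro nn_integral_mono ennreal_leI) (simp add: abs_le_square_iff[symmetric] order.trans[OF _ abs_ge_self])
  also have "\<dots> < \<infinity>" using Sfin by (simp add: ennreal_mult_less_top)
  finally show ?thesis using E unfolding Hs_sphere_norm_energy infinity_ennreal_def ennreal_sqrt_less_top
    by (simp add: ennreal_mult_less_top)
qed

text \<open>An element of the closure differs from some smooth function by a function of norm below
  1.\<close>

lemma Hs_sphere_norm_finite:
  fixes u :: "(real^'m) \<times> (real^'n) \<Rightarrow> real"
  assumes mn: "CARD('m) \<ge> 2" "CARD('n) \<ge> 2" and N: "N \<ge> 3" "CARD('m) + CARD('n) = N + 1" and s: "0 < s" "s < 1"
    and u: "u \<in> Hs_sphere N s"
  shows "Hs_sphere_norm N s u < \<infinity>"
proof -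
  have um: "u \<in> borel_measurable sphere_measure" using u by (simp add: Hs_sphere_def closure_in_L2_def L2_space_def)
  have "\<exists>\<phi>\<in>C_infinity (sphere 0 1). Hs_sphere_norm N s (\<lambda>x. u x - \<phi> x) < ennreal 1"
    using u zero_less_one unfolding Hs_sphere_def closure_in_L2_def by blast
  then obtain \<phi> where \<phi>: "\<phi> \<in> C_infinity (sphere 0 1)" and d: "Hs_sphere_norm N s (\<lambda>x. u x - \<phi> x) < ennreal 1" by blast
  have "Hs_sphere_norm N s (\<lambda>x. u x - \<phi> x) < \<infinity>" using d by (rule order.strict_trans) simp
  then show ?thesis
    using Hs_sphere_norm_finite_triangle[OF um C_infinity_sphere_measurable[OF \<phi>]] Hs_sphere_norm_smooth[OF mn N s \<phi>] by blast
qed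

section \<open>From functions and their factors to the isomorphisms\<close>

lemma nn_integral_sq_comp_f_map:
  assumes "w \<in> borel_measurable (h_measure CARD('m) CARD('n))"
  shows "(\<integral>\<^sup>+z. ennreal ((w (f_map z))\<^sup>2) \<partial>(sphere_measure :: ((real^'m) \<times> (real^'n)) measure)) = (\<integral>\<^sup>+t. ennreal ((w t)\<^sup>2) \<partial>h_measure CARD('m) CARD('n))"
proof -
  have "(\<integral>\<^sup>+t. ennreal ((w t)\<^sup>2) \<partial>h_measure CARD('m) CARD('n)) = (\<integral>\<^sup>+t. ennreal ((w t)\<^sup>2) \<partial>distr (sphere_measure :: ((real^'m) \<times> (real^'n)) measure) (h_measure CARD('m) CARD('n)) f_map)"
    by (simp only: distr_f_map)
  also have "\<dots> = (\<integral>\<^sup>+z. ennreal ((w (f_map z))\<^sup>2) \<partial>(sphere_measure :: ((real^'m) \<times> (real^'n)) measure))"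
    using assms by (intro nn_integral_distr f_map_measurable_sphere) simp
  finally show ?thesis ..
qed

lemma L2_norm_comp_f_map:
  fixes u :: "(real^'m) \<times> (real^'n) \<Rightarrow> real"
  assumes "w \<in> borel_measurable (h_measure CARD('m) CARD('n))" "AE z in sphere_measure. u z = w (f_map z)"
  shows "L2_norm sphere_measure u = L2_norm (h_measure CARD('m) CARD('n)) w"
proof -
  have "(\<integral>\<^sup>+z. ennreal ((u z)\<^sup>2) \<partial>sphere_measure) = (\<integral>\<^sup>+z. ennreal ((w (f_map z))\<^sup>2) \<partial>(sphere_measure :: ((real^'m) \<times> (real^'n)) measure))"
    by (rule nn_integral_cong_AE) (use assms(2) in \<open>auto elim: AE_mp\<close>)
  then show ?thesis unfolding L2_norm_def nn_integral_sq_comp_f_map[OF assms(1)] by simp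
qed

lemma L2_space_iff:
  "w \<in> L2_space M \<longleftrightarrow> w \<in> borel_measurable M \<and> integrable M (\<lambda>x. (w x)\<^sup>2)"
  by (auto simp: L2_space_def L2_norm_def ennreal_sqrt_less_top integrable_iff_bounded)

lemma G_invariant_comp_f_map: "G_invariant (\<lambda>z. w (f_map z))"
  unfolding G_invariant_def by (auto simp: f_map_block)

lemma measurable_restrict_h: "borel_measurable (restrict_space borel {-1..1}) = borel_measurable (h_measure m n)"
  by (rule measurable_cong_sets[OF sets_h_measure[symmetric] refl])

text \<open>One explicit factor \<open>w\<close> shows that the choice in \<open>j_map\<close>
  succeeds. Two factors agree almost everywhere on the interval because \<open>f_map\<close> carries
  the sphere measure to \<open>h_measure\<close>.\<close>

lemma j_map_eq:
  fixes u :: "(real^'m) \<times> (real^'n) \<Rightarrow> real"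
  assumes w: "w \<in> borel_measurable (h_measure CARD('m) CARD('n))" and AE: "AE z in sphere_measure. u z = w (f_map z)"
  shows "j_map u \<in> borel_measurable (h_measure CARD('m) CARD('n))"
    and "AE z in sphere_measure. u z = j_map u (f_map z)"
    and "AE t in h_measure CARD('m) CARD('n). j_map u t = w t"
proof -
  have "\<exists>w. w \<in> borel_measurable (restrict_space borel {-1..1}) \<and> (AE z in sphere_measure. u z = w (f_map z))"
    unfolding measurable_restrict_h[of "CARD('m)" "CARD('n)"] by (intro exI[of _ w] conjI w AE)
  from someI_ex[OF this]
  have j: "j_map u \<in> borel_measurable (h_measure CARD('m) CARD('n)) \<and> (AE z in sphere_measure. u z = j_map u (f_map z))"
    unfolding j_map_def measurable_restrict_h[of "CARD('m)" "CARD('n)"] .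
  from j show m: "j_map u \<in> borel_measurable (h_measure CARD('m) CARD('n))" by (rule conjunct1)
  from j show a: "AE z in sphere_measure. u z = j_map u (f_map z)" by (rule conjunct2)
  have "AE z in (sphere_measure :: ((real^'m) \<times> (real^'n)) measure). j_map u (f_map z) = w (f_map z)"
    using AE a by eventually_elim simp
  then show "AE t in h_measure CARD('m) CARD('n). j_map u t = w t"
    by (subst (asm) AE_f_map_iff[OF m w])
qed

text \<open>Shared by the two isomorphisms. The hypothesis on \<open>V\<close> and \<open>W\<close>
  speaks of every measurable factor of \<open>u\<close>, hence also of the one chosen by
  \<open>j_map\<close>; surjectivity comes from composing \<open>w\<close> with
  \<open>f_map\<close>.\<close>

lemma isometric_isomorphism_j_map:
  fixes V :: "((real^'m) \<times> (real^'n) \<Rightarrow> real) set"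
  assumes V: "\<And>u. u \<in> V \<Longrightarrow> u \<in> borel_measurable sphere_measure \<and> G_invariant u"
    and VW: "\<And>u w. u \<in> V \<Longrightarrow> w \<in> borel_measurable (h_measure CARD('m) CARD('n)) \<Longrightarrow> AE z in sphere_measure. u z = w (f_map z)
      \<Longrightarrow> w \<in> W \<and> nV u < \<infinity> \<and> nW w = nV u"
    and WV: "\<And>w. w \<in> W \<Longrightarrow> w \<in> borel_measurable (h_measure CARD('m) CARD('n)) \<and> (\<lambda>z. w (f_map z)) \<in> V"
  shows "isometric_isomorphism_ae sphere_measure V nV (h_measure CARD('m) CARD('n)) W nW j_map"
proof -
  let ?H = "h_measure CARD('m) CARD('n)"
  have spec: "j_map u \<in> borel_measurable ?H" "AE z in sphere_measure. u z = j_map u (f_map z)" if u: "u \<in> V" for u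
  proof -
    obtain w where w: "w \<in> borel_measurable ?H" "AE z in sphere_measure. u z = w (f_map z)"
      using invariant_factor[of u] V[OF u] by blast
    show "j_map u \<in> borel_measurable ?H" "AE z in sphere_measure. u z = j_map u (f_map z)"
      by (rule j_map_eq(1)[OF w], rule j_map_eq(2)[OF w])
  qed
  have iff: "(AE z in sphere_measure. u z = v z) \<longleftrightarrow> (AE t in ?H. j_map u t = j_map v t)" if u: "u \<in> V" and v: "v \<in> V" for u v
  proof -
    have "(AE z in sphere_measure. u z = v z) \<longleftrightarrow> (AE z in (sphere_measure :: ((real^'m) \<times> (real^'n)) measure). j_map u (f_map z) = j_map v (f_map z))"
    proof
      assume "AE z in sphere_measure. u z = v z"
      with spec(2)[OF u] spec(2)[OF v] show "AE z in (sphere_measure :: ((real^'m) \<times> (real^'n)) measure). j_map u (f_map z) = j_map v (f_map z)"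
        by eventually_elim simp
    next
      assume "AE z in (sphere_measure :: ((real^'m) \<times> (real^'n)) measure). j_map u (f_map z) = j_map v (f_map z)"
      with spec(2)[OF u] spec(2)[OF v] show "AE z in sphere_measure. u z = v z"
        by eventually_elim simp
    qed
    also have "\<dots> \<longleftrightarrow> (AE t in ?H. j_map u t = j_map v t)" by (rule AE_f_map_iff[OF spec(1)[OF u] spec(1)[OF v]])
    finally show ?thesis .
  qed
  have lin: "AE t in ?H. j_map (\<lambda>z. a * u z + b * v z) t = a * j_map u t + b * j_map v t" if u: "u \<in> V" and v: "v \<in> V" for u v a b
  proof (rule j_map_eq(3))
    show "(\<lambda>t. a * j_map u t + b * j_map v t) \<in> borel_measurable ?H"
      using spec(1)[OF u] spec(1)[OF v] by (intro borel_measurable_add borel_measurable_times borel_measurable_const)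
    show "AE z in sphere_measure. a * u z + b * v z = a * j_map u (f_map z) + b * j_map v (f_map z)"
      using spec(2)[OF u] spec(2)[OF v] by eventually_elim simp
  qed
  have surj: "\<exists>u\<in>V. AE t in ?H. j_map u t = w t" if "w \<in> W" for w
    using WV[OF that] j_map_eq(3)[of w "\<lambda>z :: (real^'m) \<times> (real^'n). w (f_map z)"] by (intro bexI[of _ "\<lambda>z. w (f_map z)"]) auto
  show ?thesis
    unfolding isometric_isomorphism_ae_def using iff lin surj VW[OF _ spec] by blast
qed

lemma C_infinity_interval_L2:
  fixes \<phi> :: "real \<Rightarrow> real"
  assumes "m > 0" "n > 0" and "\<phi> \<in> C_infinity {-1..1}"
  shows "\<phi> \<in> borel_measurable (h_measure m n) \<and> integrable (h_measure m n) (\<lambda>t. (\<phi> t)\<^sup>2)"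
proof -
  interpret H: finite_measure "h_measure m n" by (rule finite_measure_h'[OF assms(1,2)])
  have c: "continuous_on {-1..1} \<phi>" using assms(3) by (rule C_infinity_continuous_on)
  have m: "\<phi> \<in> borel_measurable (h_measure m n)"
    using borel_measurable_continuous_on_restrict[OF c] measurable_restrict_h by blast
  have "compact (\<phi> ` {-1..1})" by (intro compact_continuous_image c) simp
  then obtain B where B: "\<forall>z\<in>{-1..1}. \<bar>\<phi> z\<bar> \<le> B" using compact_imp_bounded[of "\<phi> ` {-1..1}"] by (auto simp: bounded_iff)
  have "integrable (h_measure m n) (\<lambda>t. (\<phi> t)\<^sup>2)"
  proof (rule H.integrable_const_bound[of _ "B\<^sup>2"])
    show "AE t in h_measure m n. norm ((\<phi> t)\<^sup>2) \<le> B\<^sup>2"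
      using B by (intro AE_I2) (simp add: abs_le_square_iff[symmetric] order.trans[OF _ abs_ge_self])
    show "(\<lambda>t. (\<phi> t)\<^sup>2) \<in> borel_measurable (h_measure m n)" using m by simp
  qed
  with m show ?thesis by blast
qed

lemma phi_symbol_pos:
  assumes "N \<ge> 3" "0 < s" "s < 1"
  shows "phi_symbol N s (lambda_ev N i) > 0"
  unfolding phi_symbol_eq[OF order.strict_trans2[OF _ assms(1)], simplified] using assms
  by (intro divide_pos_pos Gamma_real_pos) auto

text \<open>The norm is a weighted square sum of the Jacobi coefficients, so subtracting the
  truncated expansion leaves the tail of a convergent series. The truncation is a polynomial, hence
  smooth up to the endpoints.\<close>

lemma Hs_h_density:
  assumes mn: "m \<ge> 2" "n \<ge> 2" and N: "N \<ge> 3" and s: "0 < s" "s < 1"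
    and w: "w \<in> borel_measurable (h_measure m n)" "integrable (h_measure m n) (\<lambda>t. (w t)\<^sup>2)"
    and fin: "Hs_h_norm N m n s w < \<infinity>"
  shows "w \<in> Hs_h N m n s"
proof -
  let ?H = "h_measure m n"
  define \<phi> where "\<phi> i = phi_symbol N s (lambda_ev N i)" for i
  have \<phi>: "\<phi> i > 0" for i unfolding \<phi>_def by (rule phi_symbol_pos[OF N s])
  define a where "a i = (coef m n w i)\<^sup>2 * \<phi> i" for i
  have a: "a i \<ge> 0" for i unfolding a_def using \<phi>[of i] by simp
  have norm: "Hs_h_norm N m n s v = ennreal_sqrt (\<Sum>i. ennreal ((coef m n v i)\<^sup>2 * \<phi> i))" for v
    unfolding Hs_h_norm_def coef_def[OF mn] \<phi>_def ..
  have "(\<Sum>i. ennreal (a i)) < top" using fin unfolding norm a_def infinity_ennreal_def ennreal_sqrt_less_top .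
  then have sa: "summable a" using a by (intro summable_suminf_not_top) auto
  have wi: "integrable ?H w" by (rule L2_imp_integrable[OF mn w])
  have "\<exists>p\<in>C_infinity {-1..1}. Hs_h_norm N m n s (\<lambda>t. w t - p t) < ennreal \<epsilon>" if \<epsilon>: "\<epsilon> > 0" for \<epsilon>
  proof -
    \<comment> \<open>The norm is a square root, so the tail of the series is compared with the
      square of \<open>\<epsilon>\<close>.\<close>
    obtain K where "\<forall>k\<ge>K. norm (\<Sum>i. a (i + k)) < \<epsilon>\<^sup>2"
      using suminf_exist_split[OF _ sa, of "\<epsilon>\<^sup>2"] \<epsilon> by auto
    then have K: "(\<Sum>i. a (i + K)) < \<epsilon>\<^sup>2" by (auto dest: spec[of _ K])
    define p where "p = (\<Sum>j<K. smult (coef m n w j) (Pn m n j))"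
    have co: "coef m n (\<lambda>t. w t - poly p t) i = (if i < K then 0 else coef m n w i)" for i
    proof -
      have "coef m n (\<lambda>t. w t - poly p t) i = (\<integral>t. w t * poly (Pn m n i) t - (\<Sum>j<K. coef m n w j * poly (Pn m n j * Pn m n i) t) \<partial>?H)"
        unfolding coef_def[OF mn, of "\<lambda>t. w t - poly p t"] L2_inner_def p_basis_eq[OF mn]
        by (simp add: p_def poly_sum left_diff_distrib sum_distrib_right mult.assoc)
      also have "\<dots> = (\<integral>t. w t * poly (Pn m n i) t \<partial>?H) - (\<Sum>j<K. coef m n w j * (\<integral>t. poly (Pn m n j * Pn m n i) t \<partial>?H))"
        using mult_poly_integrable_H[OF mn wi] poly_integrable_H[OF mn]
        by (subst Bochner_Integration.integral_diff) (auto intro!: Bochner_Integration.integrable_sum integrable_mult_right simp: Bochner_Integration.integral_sum simp del: poly_mult)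
      also have "(\<integral>t. w t * poly (Pn m n i) t \<partial>?H) = coef m n w i"
        unfolding coef_def[OF mn] L2_inner_def p_basis_eq[OF mn] ..
      also have "(\<Sum>j<K. coef m n w j * (\<integral>t. poly (Pn m n j * Pn m n i) t \<partial>?H)) = (\<Sum>j<K. if j = i then coef m n w i else 0)"
        by (intro sum.cong refl) (simp add: Pn_orthonormal[OF mn])
      also have "\<dots> = (if i < K then coef m n w i else 0)" by simp
      finally show ?thesis by simp
    qed
    define b where "b i = (if i < K then 0 else a i)" for i
    have b: "(coef m n (\<lambda>t. w t - poly p t) i)\<^sup>2 * \<phi> i = b i" for i by (simp add: co b_def a_def)
    have sb: "summable b" using sa by (rule summable_comparison_test') (use a in \<open>auto simp: b_def\<close>)
    have "suminf b = (\<Sum>i. b (i + K)) + (\<Sum>i<K. b i)" by (rule suminf_split_initial_segment[OF sb])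
    also have "\<dots> = (\<Sum>i. a (i + K))" by (simp add: b_def)
    finally have "suminf b < \<epsilon>\<^sup>2" using K by simp
    moreover have "(\<Sum>i. ennreal (b i)) = ennreal (suminf b)" by (rule suminf_ennreal2[OF _ sb]) (simp add: b_def a)
    ultimately have "Hs_h_norm N m n s (\<lambda>t. w t - poly p t) < ennreal \<epsilon>"
      unfolding norm b ennreal_sqrt_less_iff[OF \<epsilon>] using \<epsilon> by (simp add: ennreal_lessI)
    then show ?thesis using C_infinity_poly by blast
  qed
  then show ?thesis using w unfolding Hs_h_def closure_in_L2_def by (auto simp: L2_space_iff)
qed

text \<open>The first conjunct gives \<open>j_map\<close> its meaning: a factor exists and is unique
  up to null sets of \<open>h_measure\<close>.\<close>

theorem proposition1p7:
  fixes N m n :: nat and s :: real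
  assumes "N \<ge> 3" and "m \<ge> 2" and "n \<ge> 2" and "m + n = N + 1"
    and "CARD('m::finite) = m" and "CARD('n::finite) = n"
    and "0 < s" and "s < 1"
  shows
    "(\<forall>u :: (real^'m) \<times> (real^'n) \<Rightarrow> real.
        u \<in> borel_measurable sphere_measure \<longrightarrow> G_invariant u \<longrightarrow>
          (\<exists>w \<in> borel_measurable (restrict_space borel {-1..1}).
             (AE z in sphere_measure. u z = w (f_map z)) \<and>
             (\<forall>w' \<in> borel_measurable (restrict_space borel {-1..1}).
                (AE z in sphere_measure. u z = w' (f_map z)) \<longrightarrow>
                (AE t in h_measure m n. w' t = w t)))) \<and>
     isometric_isomorphism_ae
       sphere_measure (Hs_sphere_G N s) (Hs_sphere_norm N s)
       (h_measure m n) (Hs_h N m n s) (Hs_h_norm N m n s)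
       (j_map :: ((real^'m) \<times> (real^'n) \<Rightarrow> real) \<Rightarrow> real \<Rightarrow> real) \<and>
     isometric_isomorphism_ae
       sphere_measure L2_sphere_G (L2_norm sphere_measure)
       (h_measure m n) (L2_space (h_measure m n)) (L2_norm (h_measure m n))
       (j_map :: ((real^'m) \<times> (real^'n) \<Rightarrow> real) \<Rightarrow> real \<Rightarrow> real)"
proof -
  note N = \<open>N \<ge> 3\<close> and s = \<open>0 < s\<close> \<open>s < 1\<close>
  have m: "m = CARD('m)" and n: "n = CARD('n)" using assms(5,6) by simp_all
  have mn: "CARD('m) \<ge> 2" "CARD('n) \<ge> 2" and mnN: "CARD('m) + CARD('n) = N + 1" using assms(2-4) m n by simp_all
  let ?S = "sphere_measure :: ((real^'m) \<times> (real^'n)) measure"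
  let ?H = "h_measure CARD('m) CARD('n)"
  have bm: "borel_measurable (restrict_space borel {-1..1}) = borel_measurable ?H" by (rule measurable_restrict_h)
  have comp_m: "(\<lambda>z :: (real^'m) \<times> (real^'n). w (f_map z)) \<in> borel_measurable ?S" if "w \<in> borel_measurable ?H" for w :: "real \<Rightarrow> real"
    using that by (rule measurable_comp_f_map)
  have comp_L2: "(\<lambda>z :: (real^'m) \<times> (real^'n). w (f_map z)) \<in> L2_space ?S" if "w \<in> L2_space ?H" for w
  proof -
    have w: "w \<in> borel_measurable ?H" "L2_norm ?H w < \<infinity>" using that by (auto simp: L2_space_def)
    then show ?thesis using L2_norm_comp_f_map[OF w(1), of "\<lambda>z :: (real^'m) \<times> (real^'n). w (f_map z)"] comp_m[OF w(1)] by (simp add: L2_space_def)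
  qed
  have factor: "\<exists>w \<in> borel_measurable (restrict_space borel {-1..1}). (AE z in sphere_measure. u z = w (f_map z)) \<and>
      (\<forall>w' \<in> borel_measurable (restrict_space borel {-1..1}). (AE z in sphere_measure. u z = w' (f_map z)) \<longrightarrow> (AE t in ?H. w' t = w t))"
    if u: "u \<in> borel_measurable ?S" "G_invariant u" for u
    unfolding bm
  proof -
    obtain w where w: "w \<in> borel_measurable ?H" "AE z in sphere_measure. u z = w (f_map z)" using invariant_factor[OF u] by blast
    have "AE t in ?H. w' t = w t" if w': "w' \<in> borel_measurable ?H" "AE z in sphere_measure. u z = w' (f_map z)" for w'
    proof -
      have "AE z in ?S. w' (f_map z) = w (f_map z)" using w(2) w'(2) by eventually_elim simp
      then show ?thesis by (subst (asm) AE_f_map_iff[OF w'(1) w(1)])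
    qed
    with w show "\<exists>w \<in> borel_measurable ?H. (AE z in sphere_measure. u z = w (f_map z)) \<and>
      (\<forall>w' \<in> borel_measurable ?H. (AE z in sphere_measure. u z = w' (f_map z)) \<longrightarrow> (AE t in ?H. w' t = w t))" by blast
  qed
  have L2: "isometric_isomorphism_ae ?S L2_sphere_G (L2_norm ?S) ?H (L2_space ?H) (L2_norm ?H) j_map"
  proof (rule isometric_isomorphism_j_map)
    show "u \<in> borel_measurable ?S \<and> G_invariant u" if "u \<in> L2_sphere_G" for u :: "(real^'m) \<times> (real^'n) \<Rightarrow> real"
      using that by (simp add: L2_sphere_G_def L2_space_def)
    show "w \<in> L2_space ?H \<and> L2_norm ?S u < \<infinity> \<and> L2_norm ?H w = L2_norm ?S u"
      if "u \<in> L2_sphere_G" "w \<in> borel_measurable ?H" "AE z in sphere_measure. u z = w (f_map z)" for u :: "(real^'m) \<times> (real^'n) \<Rightarrow> real" and w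
      using that L2_norm_comp_f_map[OF that(2,3)] by (simp add: L2_sphere_G_def L2_space_def)
    show "w \<in> borel_measurable ?H \<and> (\<lambda>z :: (real^'m) \<times> (real^'n). w (f_map z)) \<in> L2_sphere_G" if "w \<in> L2_space ?H" for w
      using comp_L2[OF that] that by (simp add: L2_sphere_G_def L2_space_def G_invariant_comp_f_map)
  qed
  have Hs: "isometric_isomorphism_ae ?S (Hs_sphere_G N s) (Hs_sphere_norm N s) ?H (Hs_h N CARD('m) CARD('n) s) (Hs_h_norm N CARD('m) CARD('n) s) j_map"
  proof (rule isometric_isomorphism_j_map)
    show "u \<in> borel_measurable ?S \<and> G_invariant u" if "u \<in> Hs_sphere_G N s" for u :: "(real^'m) \<times> (real^'n) \<Rightarrow> real"
      using that by (simp add: Hs_sphere_G_def Hs_sphere_def closure_in_L2_def L2_space_def)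
    show "w \<in> Hs_h N CARD('m) CARD('n) s \<and> Hs_sphere_norm N s u < \<infinity> \<and> Hs_h_norm N CARD('m) CARD('n) s w = Hs_sphere_norm N s u"
      if u: "u \<in> Hs_sphere_G N s" and w: "w \<in> borel_measurable ?H" and AE: "AE z in sphere_measure. u z = w (f_map z)" for u :: "(real^'m) \<times> (real^'n) \<Rightarrow> real" and w
    proof -
      have "u \<in> L2_space ?S" using u by (simp add: Hs_sphere_G_def Hs_sphere_def closure_in_L2_def)
      then have "w \<in> L2_space ?H" using L2_norm_comp_f_map[OF w AE] w by (simp add: L2_space_def)
      then have w2: "integrable ?H (\<lambda>t. (w t)\<^sup>2)" by (simp add: L2_space_iff)
      have fin: "Hs_sphere_norm N s u < \<infinity>"
        using u by (intro Hs_sphere_norm_finite[OF mn N mnN s]) (simp add: Hs_sphere_G_def)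
      have eq: "Hs_h_norm N CARD('m) CARD('n) s w = Hs_sphere_norm N s u"
        unfolding Hs_sphere_norm_cong_AE[OF AE] by (rule Hs_norm_f_map[OF N mn mnN s w w2, symmetric])
      \<comment> \<open>The smooth approximants of \<open>u\<close> need not be invariant and give
        none for \<open>w\<close>. Membership of \<open>w\<close> in the closure is derived from the
        finiteness of its norm instead.\<close>
      show ?thesis using fin eq Hs_h_density[OF mn N s w w2] by simp
    qed
    show "w \<in> borel_measurable ?H \<and> (\<lambda>z :: (real^'m) \<times> (real^'n). w (f_map z)) \<in> Hs_sphere_G N s" if w: "w \<in> Hs_h N CARD('m) CARD('n) s" for w
    proof -
      have wL: "w \<in> L2_space ?H" and w2: "w \<in> borel_measurable ?H" "integrable ?H (\<lambda>t. (w t)\<^sup>2)"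
        using w by (auto simp: Hs_h_def closure_in_L2_def L2_space_iff)
      have "\<exists>\<psi>\<in>C_infinity (sphere 0 1). Hs_sphere_norm N s (\<lambda>z :: (real^'m) \<times> (real^'n). w (f_map z) - \<psi> z) < ennreal \<epsilon>" if \<epsilon>: "\<epsilon> > 0" for \<epsilon>
      proof -
        \<comment> \<open>In this direction approximants do transfer: a smooth \<open>\<phi>\<close>
          on the interval composed with \<open>f_map\<close> is smooth on the sphere, and the norm
          identity applied to the difference \<open>w - \<phi>\<close> preserves the error.\<close>
        obtain \<phi> where \<phi>: "\<phi> \<in> C_infinity {-1..1}" and less: "Hs_h_norm N CARD('m) CARD('n) s (\<lambda>t. w t - \<phi> t) < ennreal \<epsilon>"
          using w \<epsilon> unfolding Hs_h_def closure_in_L2_def by blast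
        have \<phi>2: "\<phi> \<in> borel_measurable ?H" "integrable ?H (\<lambda>t. (\<phi> t)\<^sup>2)" using C_infinity_interval_L2[OF _ _ \<phi>, of "CARD('m)" "CARD('n)"] by auto
        have "Hs_sphere_norm N s (\<lambda>z :: (real^'m) \<times> (real^'n). w (f_map z) - \<phi> (f_map z)) = Hs_h_norm N CARD('m) CARD('n) s (\<lambda>t. w t - \<phi> t)"
          by (rule Hs_norm_f_map[OF N mn mnN s borel_measurable_diff[OF w2(1) \<phi>2(1)] integrable_sq_diff(1)[OF w2(1) \<phi>2(1) w2(2) \<phi>2(2)]])
        moreover have "(\<lambda>z :: (real^'m) \<times> (real^'n). \<phi> (f_map z)) \<in> C_infinity (sphere 0 1)"
          by (rule C_infinity_f_map[OF \<phi> f_map_range])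
        ultimately show ?thesis using less by (intro bexI[of _ "\<lambda>z. \<phi> (f_map z)"]) simp_all
      qed
      then have "(\<lambda>z :: (real^'m) \<times> (real^'n). w (f_map z)) \<in> Hs_sphere_G N s"
        using comp_L2[OF wL] by (simp add: Hs_sphere_G_def Hs_sphere_def closure_in_L2_def G_invariant_comp_f_map)
      with w2 show ?thesis by blast
    qed
  qed
  show ?thesis unfolding m n using factor Hs L2 by blast
qed

end
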